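(* The Zariski closed subset $\mathbb{G}_{2n}$ of $\mathbb{F}_{2n}$ has at least two disjoint irreducible components, and $\mathbb{G}_{12}$, $\mathbb{G}_{24}$ and $\mathbb{G}_{60}$ have at least three disjoint irreducible components.
   Context: Here $n$ is a positive integer. For a positive integer $d$, let $\mathbb{F}_d$ be the space of degree $d$ foliations on $\mathbb{P}^2$ (over $\mathbb{C}$): it is the Zariski open subset of $\mathbb{P}(U_d)$, where $U_d$ is the space of triples $(a,b,c)$ of homogeneous polynomials of degree $d+1$ in $x,y,z$ with $ax+by+cz=0$, consisting of the classes of triples without common factor; the triple defines the foliation given by the $1$-form $a\,dx+b\,dy+c\,dz$. The Gauss map $\mathcal{G}_{\mathcal{F}}:\mathbb{P}^2\dashrightarrow\check{\mathbb{P}}^2$, $[x,y,z]\mapsto[a,b,c]$, sends a non-singular point to the tangent line of $\mathcal{F}$ there; it is dominant of topological degree $d$. $\mathcal{F}$ is Galois if the induced field extension $\mathbb{C}(\check{\mathbb{P}}^2)\hookrightarrow\mathbb{C}(\mathbb{P}^2)$ is Galois, and $\mathbb{G}_d\subset\mathbb{F}_d$ is the set of degree $d$ Galois foliations, which is Zariski closed in $\mathbb{F}_d$.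
   Formalization: The claim on G_{2n} is stated for n ≥ 2 only: for n = 1 every degree 2 foliation is Galois, so G_2 = F_2 is irreducible and has just one irreducible component. *)

theory Defs
  imports
    "HOL-Analysis.Analysis"
    "HOL-Library.Poly_Mapping"
    "HOL-Computational_Algebra.Polynomial"
    "HOL-Computational_Algebra.Fraction_Field"
begin

section \<open>Multivariate polynomials\<close>

text \<open>
  Polynomials with coefficients in \<open>'k\<close> and variables indexed by \<open>'v\<close> are finitely supported
  functions from monomials (exponent vectors) to \<open>'k\<close>. With the convolution product of
  \<^theory>\<open>HOL-Library.Poly_Mapping\<close>, this is the usual polynomial ring.
\<close>

type_synonym ('v, 'k) mpol = "('v \<Rightarrow>\<^sub>0 nat) \<Rightarrow>\<^sub>0 'k"

definition mvar :: "'v \<Rightarrow> ('v, 'k::zero_neq_one) mpol" where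
  "mvar v = Poly_Mapping.single (Poly_Mapping.single v 1) 1"

definition mconst :: "'k \<Rightarrow> ('v, 'k::zero) mpol" where
  "mconst c = Poly_Mapping.single 0 c"

definition monom_degree :: "('v \<Rightarrow>\<^sub>0 nat) \<Rightarrow> nat" where
  "monom_degree t = (\<Sum>v\<in>Poly_Mapping.keys t. Poly_Mapping.lookup t v)"

text \<open>As usual, the zero polynomial is homogeneous of every degree.\<close>

definition homogeneous :: "nat \<Rightarrow> ('v, 'k::zero) mpol \<Rightarrow> bool" where
  "homogeneous m p \<longleftrightarrow> (\<forall>t\<in>Poly_Mapping.keys p. monom_degree t = m)"

definition monom_value :: "('v \<Rightarrow> 'r::comm_ring_1) \<Rightarrow> ('v \<Rightarrow>\<^sub>0 nat) \<Rightarrow> 'r" where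
  "monom_value x t = (\<Prod>v\<in>Poly_Mapping.keys t. x v ^ Poly_Mapping.lookup t v)"

text \<open>
  Value of a polynomial at \<open>x\<close> in a commutative ring \<open>'r\<close>, the coefficients being mapped
  to \<open>'r\<close> by \<open>\<phi>\<close>.
\<close>

definition mpol_eval :: "('k::zero \<Rightarrow> 'r::comm_ring_1) \<Rightarrow> ('v \<Rightarrow> 'r) \<Rightarrow> ('v, 'k) mpol \<Rightarrow> 'r" where
  "mpol_eval \<phi> x p = (\<Sum>t\<in>Poly_Mapping.keys p. \<phi> (Poly_Mapping.lookup p t) * monom_value x t)"


section \<open>Foliations on the complex projective plane\<close>

text \<open>The homogeneous coordinates \<open>x, y, z\<close> are \<open>mvar i\<close> for \<open>i\<close> in the three-element type \<open>3\<close>.\<close>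

type_synonym cpol = "(3, complex) mpol"

text \<open>A triple \<open>\<omega> = (a,b,c)\<close>, standing for the 1-form \<open>a dx + b dy + c dz\<close>.\<close>

type_synonym form = "cpol ^ 3"

definition forms :: "nat \<Rightarrow> form set" where
  "forms d = {\<omega>. (\<forall>i. homogeneous (d + 1) (\<omega> $ i)) \<and> (\<Sum>i\<in>UNIV. \<omega> $ i * mvar i) = 0}"

text \<open>The class of \<open>\<omega>\<close> in projective space: its punctured line.\<close>

definition proj_class :: "form \<Rightarrow> form set" where
  "proj_class \<omega> = {(\<chi> i. mconst c * \<omega> $ i) |c. c \<noteq> 0}"

definition proj_forms :: "nat \<Rightarrow> form set set" where
  "proj_forms d = proj_class ` (forms d - {0})"

definition no_common_factor :: "form \<Rightarrow> bool" where
  "no_common_factor \<omega> \<longleftrightarrow> (\<forall>p. (\<forall>i. p dvd \<omega> $ i) \<longrightarrow> p dvd 1)"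

definition foliations :: "nat \<Rightarrow> form set set" where
  "foliations d = {proj_class \<omega> |\<omega>. \<omega> \<in> forms d - {0} \<and> no_common_factor \<omega>}"


section \<open>The Zariski topology\<close>

text \<open>
  The coordinates of a triple are the coefficients of its three entries, so a polynomial function
  on the space of triples is given by a polynomial in variables indexed by pairs (entry, monomial).
  Only the finitely many coordinates belonging to monomials of degree \<open>d + 1\<close> are not identically
  zero on \<open>forms d\<close>. As \<open>forms d\<close> is a linear subspace, restricting these polynomials
  yields all homogeneous polynomial functions on it.
\<close>

type_synonym coord = "3 \<times> (3 \<Rightarrow>\<^sub>0 nat)"

definition coords :: "form \<Rightarrow> coord \<Rightarrow> complex" where
  "coords \<omega> = (\<lambda>(i, t). Poly_Mapping.lookup (\<omega> $ i) t)"

definition zero_locus :: "nat \<Rightarrow> (coord, complex) mpol set \<Rightarrow> form set set" where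
  "zero_locus d S = {P \<in> proj_forms d. \<forall>F\<in>S. \<forall>\<omega>\<in>P. mpol_eval id (coords \<omega>) F = 0}"

definition zariski_closed :: "nat \<Rightarrow> form set set \<Rightarrow> bool" where
  "zariski_closed d Z \<longleftrightarrow> (\<exists>S. (\<forall>F\<in>S. \<exists>m. homogeneous m F) \<and> Z = zero_locus d S)"

definition zariski :: "nat \<Rightarrow> form set topology" where
  "zariski d = topology (\<lambda>W. W \<subseteq> proj_forms d \<and> zariski_closed d (proj_forms d - W))"

definition foliation_space :: "nat \<Rightarrow> form set topology" where
  "foliation_space d = subtopology (zariski d) (foliations d)"

definition irreducible_in :: "'a topology \<Rightarrow> 'a set \<Rightarrow> bool" where
  "irreducible_in X Z \<longleftrightarrow> Z \<subseteq> topspace X \<and> Z \<noteq> {} \<and>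
     (\<forall>A B. closedin X A \<longrightarrow> closedin X B \<longrightarrow> Z \<subseteq> A \<union> B \<longrightarrow> Z \<subseteq> A \<or> Z \<subseteq> B)"

definition irreducible_components :: "'a topology \<Rightarrow> 'a set set" where
  "irreducible_components X =
     {Z. irreducible_in X Z \<and> (\<forall>Z'. irreducible_in X Z' \<longrightarrow> Z \<subseteq> Z' \<longrightarrow> Z' = Z)}"


section \<open>Galois foliations\<close>

definition field_automorphisms_over :: "'a::field set \<Rightarrow> 'a set \<Rightarrow> ('a \<Rightarrow> 'a) set" where
  "field_automorphisms_over K L = {\<sigma>. bij_betw \<sigma> L L \<and>
     (\<forall>x\<in>L. \<forall>y\<in>L. \<sigma> (x + y) = \<sigma> x + \<sigma> y \<and> \<sigma> (x * y) = \<sigma> x * \<sigma> y) \<and>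
     (\<forall>x\<in>K. \<sigma> x = x)}"

definition galois_extension :: "'a::field set \<Rightarrow> 'a set \<Rightarrow> bool" where
  "galois_extension K L \<longleftrightarrow> K \<subseteq> L \<and>
     (\<forall>x\<in>L. \<exists>p. p \<noteq> 0 \<and> (\<forall>j. coeff p j \<in> K) \<and> poly p x = 0) \<and>
     {x \<in> L. \<forall>\<sigma>\<in>field_automorphisms_over K L. \<sigma> x = x} = K"

text \<open>The function field of the projective plane, inside the field of fractions of \<open>\<complex>[x,y,z]\<close>.\<close>

definition plane_function_field :: "cpol fract set" where
  "plane_function_field =
     {Fract p q |p q m. homogeneous m p \<and> homogeneous m q \<and> q \<noteq> 0}"

definition compose_form :: "cpol \<Rightarrow> form \<Rightarrow> cpol" where
  "compose_form p \<omega> = mpol_eval mconst (\<lambda>i. \<omega> $ i) p"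

text \<open>
  The image of the function field of the dual plane under the pullback by the Gauss map
  \<open>[x,y,z] \<mapsto> [a,b,c]\<close>, which sends \<open>p/q\<close> to \<open>p(a,b,c)/q(a,b,c)\<close>. For a dominant Gauss map,
  \<open>q(a,b,c) \<noteq> 0\<close> is the same as \<open>q \<noteq> 0\<close>.
\<close>

definition gauss_subfield :: "form \<Rightarrow> cpol fract set" where
  "gauss_subfield \<omega> =
     {Fract (compose_form p \<omega>) (compose_form q \<omega>) |p q m.
        homogeneous m p \<and> homogeneous m q \<and> compose_form q \<omega> \<noteq> 0}"

text \<open>The subfield does not depend on the representative, as scaling \<open>\<omega>\<close> cancels in the quotient.\<close>

definition galois_foliations :: "nat \<Rightarrow> form set set" where
  "galois_foliations d = {P \<in> foliations d.
     \<forall>\<omega>\<in>P. galois_extension (gauss_subfield \<omega>) plane_function_field}"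

definition galois_foliation_space :: "nat \<Rightarrow> form set topology" where
  "galois_foliation_space d = subtopology (foliation_space d) (galois_foliations d)"


section \<open>The Zariski topology is a topology\<close>

lemma mpol_eval_superset:
  assumes "finite T" "Poly_Mapping.keys p \<subseteq> T" "\<phi> 0 = 0"
  shows "mpol_eval \<phi> x p = (\<Sum>t\<in>T. \<phi> (Poly_Mapping.lookup p t) * monom_value x t)"
  unfolding mpol_eval_def
  by (rule sum.mono_neutral_left) (use assms in \<open>auto simp: in_keys_iff\<close>)

lemma mpol_eval_add:
  fixes p q :: "('v, complex) mpol"
  shows "mpol_eval id x (p + q) = mpol_eval id x p + mpol_eval id x q"
proof -
  let ?T = "Poly_Mapping.keys p \<union> Poly_Mapping.keys q"
  have "Poly_Mapping.keys (p + q) \<subseteq> ?T"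
    by (rule Poly_Mapping.keys_add)
  then show ?thesis
    by (simp add: mpol_eval_superset[of ?T] lookup_add algebra_simps sum.distrib)
qed

lemma mpol_eval_sum:
  fixes p :: "'i \<Rightarrow> ('v, complex) mpol"
  shows "mpol_eval id x (\<Sum>i\<in>I. p i) = (\<Sum>i\<in>I. mpol_eval id x (p i))"
proof (induction I rule: infinite_finite_induct)
  case (insert i I)
  have "mpol_eval id x (sum p (insert i I)) = mpol_eval id x (p i) + mpol_eval id x (sum p I)"
    unfolding sum.insert[OF insert.hyps] by (rule mpol_eval_add)
  also have "\<dots> = (\<Sum>i\<in>insert i I. mpol_eval id x (p i))"
    unfolding sum.insert[OF insert.hyps] insert.IH ..
  finally show ?case .
qed (simp_all add: mpol_eval_def)

lemma mpol_eval_single: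
  "mpol_eval id x (Poly_Mapping.single t (c::complex)) = c * monom_value x t"
  by (simp add: mpol_eval_def)

lemma monom_value_superset:
  assumes "finite V" "Poly_Mapping.keys t \<subseteq> V"
  shows "monom_value x t = (\<Prod>v\<in>V. x v ^ Poly_Mapping.lookup t v)"
  unfolding monom_value_def
  by (rule prod.mono_neutral_left) (use assms in \<open>auto simp: in_keys_iff\<close>)

lemma monom_value_add: "monom_value x (s + t) = monom_value x s * monom_value x t"
proof -
  let ?V = "Poly_Mapping.keys s \<union> Poly_Mapping.keys t"
  have "Poly_Mapping.keys (s + t) \<subseteq> ?V"
    by (rule Poly_Mapping.keys_add)
  then show ?thesis
    by (simp add: monom_value_superset[of ?V] lookup_add power_add prod.distrib)
qed

lemma monom_degree_superset:
  assumes "finite V" "Poly_Mapping.keys t \<subseteq> V"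
  shows "monom_degree t = (\<Sum>v\<in>V. Poly_Mapping.lookup t v)"
  unfolding monom_degree_def
  by (rule sum.mono_neutral_left) (use assms in \<open>auto simp: in_keys_iff\<close>)

lemma monom_degree_add: "monom_degree (s + t) = monom_degree s + monom_degree t"
proof -
  let ?V = "Poly_Mapping.keys s \<union> Poly_Mapping.keys t"
  have "Poly_Mapping.keys (s + t) \<subseteq> ?V"
    by (rule Poly_Mapping.keys_add)
  then show ?thesis
    by (simp add: monom_degree_superset[of ?V] lookup_add sum.distrib)
qed

lemma mpol_expand: "p = (\<Sum>t\<in>Poly_Mapping.keys p. Poly_Mapping.single t (Poly_Mapping.lookup p t))"
proof (rule poly_mapping_eqI)
  fix k
  have "(\<Sum>t\<in>Poly_Mapping.keys p. Poly_Mapping.lookup p t when t = k) = (\<Sum>t\<in>Poly_Mapping.keys p. if k = t then Poly_Mapping.lookup p t else 0)"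
    by (rule sum.cong) (auto simp: when_def)
  also have "\<dots> = Poly_Mapping.lookup p k"
    by (simp add: in_keys_iff)
  finally show "Poly_Mapping.lookup p k = Poly_Mapping.lookup (\<Sum>t\<in>Poly_Mapping.keys p. Poly_Mapping.single t (Poly_Mapping.lookup p t)) k"
    by (simp add: lookup_sum lookup_single)
qed

lemma mpol_eval_mult:
  fixes p q :: "('v, complex) mpol"
  shows "mpol_eval id x (p * q) = mpol_eval id x p * mpol_eval id x q"
proof -
  have "p * q = (\<Sum>s\<in>Poly_Mapping.keys p. \<Sum>t\<in>Poly_Mapping.keys q. Poly_Mapping.single (s + t) (Poly_Mapping.lookup p s * Poly_Mapping.lookup q t))"
    by (subst mpol_expand[of p], subst mpol_expand[of q]) (simp add: sum_product mult_single)
  then have "mpol_eval id x (p * q) =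
      (\<Sum>s\<in>Poly_Mapping.keys p. \<Sum>t\<in>Poly_Mapping.keys q. (Poly_Mapping.lookup p s * monom_value x s) * (Poly_Mapping.lookup q t * monom_value x t))"
    by (simp add: mpol_eval_sum mpol_eval_single monom_value_add algebra_simps)
  then show ?thesis
    by (simp add: mpol_eval_def sum_product)
qed

lemma homogeneous_mult:
  assumes "homogeneous m p" "homogeneous n q"
  shows "homogeneous (m + n) (p * q)"
  using assms Poly_Mapping.keys_mult[of p q]
  by (fastforce simp: homogeneous_def monom_degree_add)

lemma mpol_eval_scale:
  assumes "homogeneous m F"
  shows "mpol_eval id (\<lambda>v. c * x v) F = c ^ m * mpol_eval id x (F :: ('v, complex) mpol)"
proof -
  have "monom_value (\<lambda>v. c * x v) t = c ^ monom_degree t * monom_value x t" for t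
    by (simp add: monom_value_def monom_degree_def power_mult_distrib prod.distrib power_sum)
  then show ?thesis
    using assms by (simp add: mpol_eval_def homogeneous_def sum_distrib_left algebra_simps)
qed

lemma lookup_mconst_mult: "Poly_Mapping.lookup (mconst c * p) t = c * Poly_Mapping.lookup (p :: ('v, complex) mpol) t"
proof -
  have "mconst c * p = (\<Sum>s\<in>Poly_Mapping.keys p. Poly_Mapping.single s (c * Poly_Mapping.lookup p s))"
    by (subst mpol_expand[of p]) (simp add: mconst_def sum_distrib_left mult_single)
  then have "Poly_Mapping.lookup (mconst c * p) t = (\<Sum>s\<in>Poly_Mapping.keys p. if t = s then c * Poly_Mapping.lookup p s else 0)"
    by (simp add: lookup_sum lookup_single when_def eq_commute)
  then show ?thesis
    by (simp add: in_keys_iff)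
qed

text \<open>A homogeneous polynomial vanishes at one representative iff it vanishes at all of them.\<close>

lemma proj_class_vanish_iff:
  assumes "homogeneous m F"
  shows "(\<forall>\<eta>\<in>proj_class \<omega>. mpol_eval id (coords \<eta>) F = 0) \<longleftrightarrow> mpol_eval id (coords \<omega>) F = 0"
proof -
  have "coords (\<chi> i. mconst c * \<omega> $ i) = (\<lambda>v. c * coords \<omega> v)" for c
    by (auto simp: coords_def lookup_mconst_mult)
  then have "(\<forall>\<eta>\<in>proj_class \<omega>. mpol_eval id (coords \<eta>) F = 0) \<longleftrightarrow>
      (\<forall>c. c \<noteq> 0 \<longrightarrow> c ^ m * mpol_eval id (coords \<omega>) F = 0)"
    using mpol_eval_scale[OF assms] by (auto simp: proj_class_def)
  then show ?thesis
    by (metis mult_zero_right mult_eq_0_iff power_not_zero zero_neq_one)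
qed

lemma zero_locus_proj_class_iff:
  assumes "\<forall>F\<in>S. \<exists>m. homogeneous m F"
  shows "proj_class \<omega> \<in> zero_locus d S \<longleftrightarrow>
    proj_class \<omega> \<in> proj_forms d \<and> (\<forall>F\<in>S. mpol_eval id (coords \<omega>) F = 0)"
  using assms proj_class_vanish_iff unfolding zero_locus_def by blast

lemma zariski_closed_Un:
  assumes "zariski_closed d Y" "zariski_closed d Z"
  shows "zariski_closed d (Y \<union> Z)"
proof -
  obtain S T where S: "\<forall>F\<in>S. \<exists>m. homogeneous m F" "Y = zero_locus d S"
    and T: "\<forall>F\<in>T. \<exists>m. homogeneous m F" "Z = zero_locus d T"
    using assms unfolding zariski_closed_def by blast
  define R where "R = {F * G |F G. F \<in> S \<and> G \<in> T}"
  have R: "\<forall>F\<in>R. \<exists>m. homogeneous m F"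
    using S(1) T(1) homogeneous_mult unfolding R_def by blast
  have "P \<in> Y \<union> Z \<longleftrightarrow> P \<in> zero_locus d R" if P: "P \<in> proj_forms d" for P
  proof -
    obtain \<omega> where "P = proj_class \<omega>"
      using P unfolding proj_forms_def by blast
    moreover have "(\<forall>F\<in>R. mpol_eval id (coords \<omega>) F = 0) \<longleftrightarrow>
        (\<forall>F\<in>S. mpol_eval id (coords \<omega>) F = 0) \<or> (\<forall>G\<in>T. mpol_eval id (coords \<omega>) G = 0)" for \<omega>
    proof -
      have "(\<forall>F\<in>R. mpol_eval id (coords \<omega>) F = 0) \<longleftrightarrow>
          (\<forall>F\<in>S. \<forall>G\<in>T. mpol_eval id (coords \<omega>) (F * G) = 0)"
        unfolding R_def by blast
      then show ?thesis
        unfolding mpol_eval_mult mult_eq_0_iff by blast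
    qed
    ultimately show ?thesis
      using P unfolding S(2) T(2) by (simp add: zero_locus_proj_class_iff S(1) T(1) R)
  qed
  moreover have "Y \<union> Z \<subseteq> proj_forms d" "zero_locus d R \<subseteq> proj_forms d"
    unfolding S(2) T(2) zero_locus_def by auto
  ultimately have "Y \<union> Z = zero_locus d R" by blast
  with R show ?thesis
    unfolding zariski_closed_def by blast
qed

lemma zariski_closed_Inter:
  assumes "\<forall>Z\<in>\<Z>. zariski_closed d Z"
  shows "zariski_closed d (proj_forms d \<inter> \<Inter>\<Z>)"
proof -
  have "\<forall>Z\<in>\<Z>. \<exists>S. (\<forall>F\<in>S. \<exists>m. homogeneous m F) \<and> Z = zero_locus d S"
    using assms unfolding zariski_closed_def by blast
  then obtain S where S: "\<forall>Z\<in>\<Z>. (\<forall>F\<in>S Z. \<exists>m. homogeneous m F) \<and> Z = zero_locus d (S Z)"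
    by metis
  have "proj_forms d \<inter> \<Inter>\<Z> = zero_locus d (\<Union>Z\<in>\<Z>. S Z)"
  proof -
    have "P \<in> Z \<longleftrightarrow> P \<in> zero_locus d (S Z)" if "Z \<in> \<Z>" for P Z
      using S that by blast
    then show ?thesis
      unfolding zero_locus_def by blast
  qed
  moreover have "\<forall>F\<in>(\<Union>Z\<in>\<Z>. S Z). \<exists>m. homogeneous m F"
    using S by blast
  ultimately show ?thesis
    unfolding zariski_closed_def by blast
qed

lemma istopology_zariski:
  "istopology (\<lambda>W. W \<subseteq> proj_forms d \<and> zariski_closed d (proj_forms d - W))"
proof -
  have "zariski_closed d (proj_forms d - \<Union>\<W>)"
    if "\<forall>W\<in>\<W>. zariski_closed d (proj_forms d - W)" for \<W>
  proof -
    have "proj_forms d - \<Union>\<W> = proj_forms d \<inter> \<Inter>((\<lambda>W. proj_forms d - W) ` \<W>)" by blast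
    with that zariski_closed_Inter[of "(\<lambda>W. proj_forms d - W) ` \<W>" d] show ?thesis by simp
  qed
  then show ?thesis
    unfolding istopology_def by (auto simp: Diff_Int zariski_closed_Un)
qed

lemma openin_zariski:
  "openin (zariski d) W \<longleftrightarrow> W \<subseteq> proj_forms d \<and> zariski_closed d (proj_forms d - W)"
  unfolding zariski_def using topology_inverse'[OF istopology_zariski[of d]] by simp

lemma topspace_zariski: "topspace (zariski d) = proj_forms d"
proof -
  have one: "homogeneous 0 (mconst 1 :: (coord, complex) mpol)"
    by (simp add: homogeneous_def mconst_def monom_degree_def)
  have "mpol_eval id x (mconst (1::complex)) = 1" for x :: "coord \<Rightarrow> complex"
    unfolding mconst_def mpol_eval_single by (simp add: monom_value_def)
  then have "proj_class \<omega> \<notin> zero_locus d {mconst 1}" for \<omega>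
    using one by (subst zero_locus_proj_class_iff) auto
  then have "zero_locus d {mconst 1} = {}"
    unfolding zero_locus_def proj_forms_def by blast
  with one have "zariski_closed d {}"
    unfolding zariski_closed_def by (metis singletonD)
  then have "openin (zariski d) (proj_forms d)"
    by (simp add: openin_zariski)
  then show ?thesis
    by (metis openin_zariski openin_subset openin_topspace subset_antisym)
qed

lemma closedin_zariski: "closedin (zariski d) Z \<longleftrightarrow> zariski_closed d Z"
proof -
  have "zariski_closed d Z \<Longrightarrow> Z \<subseteq> proj_forms d"
    by (auto simp: zariski_closed_def zero_locus_def)
  then show ?thesis
    by (auto simp: closedin_def topspace_zariski openin_zariski double_diff)
qed

end

theory Submission
  imports
    Defs
    "HOL-Computational_Algebra.Field_as_Ring"
    "HOL-Computational_Algebra.Polynomial_Factorial"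
    "HOL-Computational_Algebra.Fundamental_Theorem_Algebra"
begin

text \<open>
  The components are separated by an invariant: the number \<open>t\<close> of elements \<open>\<sigma>\<close> of the Galois group
  with \<open>\<sigma>\<^sup>2 = 1\<close>. The main point is that \<open>t\<close> is locally constant on the Galois foliations of degree
  \<open>d\<close> in the Zariski topology (\<open>involutions_locally_constant\<close>). It is therefore constant on irreducible
  sets, and irreducible components through foliations with different \<open>t\<close> are disjoint
  (\<open>separated_components\<close>).

  In affine coordinates the Gauss map sends a point to its tangent line \<open>y = p x + q\<close>, and the points
  of tangency of a line are the roots of a polynomial \<open>F\<close> of degree \<open>d\<close> in \<open>s = x\<close> with coefficients in
  \<open>\<complex>[p,q]\<close> (\<open>tangency\<close>). For a Galois foliation the function field is \<open>K(x)\<close>, where \<open>K\<close> is the field of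
  rational functions in \<open>p\<close> and \<open>q\<close>, and the roots of \<open>F\<close> are the conjugates of \<open>x\<close>
  (\<open>card_conjugates\<close>). Ordered pairs of roots fall into \<open>d\<close> orbits, one for each element of the group.
  Functions of pairs of roots that are locally constant in \<open>(p,q)\<close> are the functions on the set of
  orbits, so they form a space of dimension \<open>d\<close>. Exchanging the two roots acts on it as inversion acts
  on the group. If \<open>k\<close> and \<open>l\<close> are the dimensions of the symmetric and the antisymmetric functions,
  then \<open>k + l = d\<close> and \<open>k - l = t\<close>.

  Such a function can be written as \<open>H(s,t) / (F'(s) F'(t))\<close> with a polynomial \<open>H\<close> in \<open>s\<close> and \<open>t\<close>, whose
  coefficients are polynomials in \<open>p\<close> and \<open>q\<close> of degree bounded in terms of \<open>d\<close> alone
  (\<open>class_function_sol\<close>, by the growth estimate \<open>growth_divides2\<close>). Being locally constant is then a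
  finite system of linear equations (\<open>is_sol\<close>) with coefficients polynomial in the form, for any form.
  The dimension of the solution space can only drop in a Zariski neighbourhood of a form
  (\<open>free_variables_near\<close>). Hence neither \<open>k\<close> nor \<open>l\<close> increases near a given Galois foliation; as their
  sum is \<open>d\<close>, both are constant, and so is \<open>t\<close>.

  Foliations with different \<open>t\<close> come from finite groups \<open>\<Gamma>\<close> of Moebius transformations. If \<open>r\<close> is a
  rational function of degree \<open>d = |\<Gamma>|\<close> invariant under \<open>\<Gamma>\<close>, then the foliation \<open>dy = r(x) dx\<close> has
  degree \<open>d\<close> and Galois group \<open>\<Gamma>\<close>, since \<open>p = r(x)\<close> and \<open>q = y - x r(x)\<close> (\<open>moebius_group\<close>). Cyclic
  groups have \<open>t \<le> 2\<close> and dihedral groups of order \<open>2n\<close> have \<open>t \<ge> n + 1\<close>, which differ for \<open>n \<ge> 2\<close>. For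
  the tetrahedral, octahedral and icosahedral groups, of orders 12, 24 and 60, the number \<open>t\<close> lies
  strictly between these bounds.
\<close>

type_synonym cpoly2 = "complex poly poly"
type_synonym cpoly3 = "complex poly poly poly"

abbreviation "lookup \<equiv> Poly_Mapping.lookup"
abbreviation "keys \<equiv> Poly_Mapping.keys"

section \<open>Evaluation of polynomials\<close>

definition comm_ring_hom :: "('k::comm_ring_1 => 'r::comm_ring_1) => bool" where
 "comm_ring_hom \<phi> \<longleftrightarrow> \<phi> 0 = 0 & \<phi> 1 = 1 & (\<forall>x y. \<phi> (x + y) = \<phi> x + \<phi> y) &
   (\<forall>x y. \<phi> (x * y) = \<phi> x * \<phi> y)"

lemma comm_ring_homD:
 assumes "comm_ring_hom \<phi>"
 shows "\<phi> 0 = 0" "\<phi> 1 = 1" "\<phi> (x + y) = \<phi> x + \<phi> y" "\<phi> (x * y) = \<phi> x * \<phi> y"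
 using assms unfolding comm_ring_hom_def by auto

lemma comm_ring_hom_sum: "comm_ring_hom \<phi> ==> \<phi> (\<Sum>i\<in>I. f i) = (\<Sum>i\<in>I. \<phi> (f i))"
 by (induction I rule: infinite_finite_induct) (simp_all add: comm_ring_homD)

lemma comm_ring_hom_prod: "comm_ring_hom \<phi> ==> \<phi> (\<Prod>i\<in>I. f i) = (\<Prod>i\<in>I. \<phi> (f i))"
 by (induction I rule: infinite_finite_induct) (simp_all add: comm_ring_homD)

lemma comm_ring_hom_power: "comm_ring_hom \<phi> ==> \<phi> (x ^ n) = \<phi> x ^ n"
 by (induction n) (simp_all add: comm_ring_homD)

lemma comm_ring_hom_id: "comm_ring_hom id"
 by (simp add: comm_ring_hom_def)

lemma comm_ring_hom_mconst: "comm_ring_hom (mconst :: complex => ('v, complex) mpol)"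
 unfolding comm_ring_hom_def mconst_def by (auto simp: single_add mult_single)

lemma mpol_eval_hom_add:
 assumes "comm_ring_hom \<phi>"
 shows "mpol_eval \<phi> x (p + q) = mpol_eval \<phi> x p + mpol_eval \<phi> x q"
proof -
 let ?T = "keys p \<union> keys q"
 have "keys (p + q) \<subseteq> ?T"
  by (rule Poly_Mapping.keys_add)
 thus ?thesis
  by (simp add: mpol_eval_superset[of ?T] lookup_add algebra_simps sum.distrib comm_ring_homD[OF assms])
qed

lemma mpol_eval_hom_sum:
 assumes "comm_ring_hom \<phi>"
 shows "mpol_eval \<phi> x (\<Sum>i\<in>I. p i) = (\<Sum>i\<in>I. mpol_eval \<phi> x (p i))"
proof (induction I rule: infinite_finite_induct)
 case (insert i I)
 have "mpol_eval \<phi> x (sum p (insert i I)) = mpol_eval \<phi> x (p i) + mpol_eval \<phi> x (sum p I)"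
  unfolding sum.insert[OF insert.hyps] by (rule mpol_eval_hom_add[OF assms])
 also have "\<dots> = (\<Sum>i\<in>insert i I. mpol_eval \<phi> x (p i))"
  unfolding sum.insert[OF insert.hyps] insert.IH ..
 finally show ?case .
qed (simp_all add: mpol_eval_def)

lemma mpol_eval_hom_single:
 "comm_ring_hom \<phi> ==> mpol_eval \<phi> x (Poly_Mapping.single t c) = \<phi> c * monom_value x t"
 by (simp add: mpol_eval_def comm_ring_homD)

lemma mpol_eval_hom_mult:
 fixes p q :: "('v, complex) mpol"
 assumes "comm_ring_hom \<phi>"
 shows "mpol_eval \<phi> x (p * q) = mpol_eval \<phi> x p * mpol_eval \<phi> x q"
proof -
 have "p * q = (\<Sum>s\<in>keys p. \<Sum>t\<in>keys q. Poly_Mapping.single (s + t) (lookup p s * lookup q t))"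
  by (subst mpol_expand[of p], subst mpol_expand[of q]) (simp add: sum_product mult_single)
 hence "mpol_eval \<phi> x (p * q) =
   (\<Sum>s\<in>keys p. \<Sum>t\<in>keys q. (\<phi> (lookup p s) * monom_value x s) * (\<phi> (lookup q t) * monom_value x t))"
  by (simp add: mpol_eval_hom_sum[OF assms] mpol_eval_hom_single[OF assms] monom_value_add
    comm_ring_homD[OF assms] mult_ac)
 thus ?thesis
  by (simp add: mpol_eval_def sum_product)
qed

lemma mpol_eval_mconst: "comm_ring_hom \<phi> ==> mpol_eval \<phi> x (mconst c) = \<phi> c"
 unfolding mconst_def by (simp add: mpol_eval_hom_single monom_value_def)

lemma mpol_eval_mvar: "comm_ring_hom \<phi> ==> mpol_eval \<phi> x (mvar v) = x v"
 unfolding mvar_def by (simp add: mpol_eval_hom_single monom_value_def comm_ring_homD)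

lemma comm_ring_hom_mpol_eval:
 "comm_ring_hom \<phi> ==> comm_ring_hom (mpol_eval \<phi> x :: ('v, complex) mpol => 'r::comm_ring_1)"
 unfolding comm_ring_hom_def[of "mpol_eval \<phi> x"]
 using mpol_eval_mconst[of \<phi> x 1]
 by (auto simp: mpol_eval_hom_add mpol_eval_hom_mult comm_ring_homD mconst_def mpol_eval_def[of \<phi> x 0] simp flip: single_one)

lemma mpol_eval_commute:
 assumes "comm_ring_hom \<psi>"
 shows "\<psi> (mpol_eval \<phi> x p) = mpol_eval (\<psi> \<circ> \<phi>) (\<psi> \<circ> x) p"
 by (simp add: mpol_eval_def monom_value_def comm_ring_hom_sum[OF assms] comm_ring_homD[OF assms]
   comm_ring_hom_prod[OF assms] comm_ring_hom_power[OF assms])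

abbreviation ev :: "(3 => complex) => cpol => complex" where
 "ev v p \<equiv> mpol_eval id v p"

definition vec3 :: "'a => 'a => 'a => 3 => 'a" where
 "vec3 a b c = (%i. if i = 1 then a else if i = 2 then b else c)"

lemma vec3_simps [simp]: "vec3 a b c 1 = a" "vec3 a b c 2 = b" "vec3 a b c 3 = c"
 by (auto simp: vec3_def)

lemma vec3_eta: "vec3 (v 1) (v 2) (v 3) = v"
 by (rule ext) (metis exhaust_3 vec3_simps)

lemma comp_vec3: "f \<circ> vec3 a b c = vec3 (f a) (f b) (f c)"
 by (auto simp: vec3_def)

lemma ev_hom [simp]: "comm_ring_hom (mpol_eval id v :: ('v, complex) mpol => complex)"
 by (rule comm_ring_hom_mpol_eval[OF comm_ring_hom_id])

lemma ev_simps [simp]: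
 fixes p q :: "('v, complex) mpol"
 shows "mpol_eval id v (p + q) = mpol_eval id v p + mpol_eval id v q"
  "mpol_eval id v (p * q) = mpol_eval id v p * mpol_eval id v q"
  "mpol_eval id v (0 :: ('v, complex) mpol) = 0"
  "mpol_eval id v (1 :: ('v, complex) mpol) = 1"
  "mpol_eval id v (mconst c) = c" "mpol_eval id v (mvar i) = v i"
  "mpol_eval id v (p ^ n) = mpol_eval id v p ^ n"
  "mpol_eval id v (- p) = - mpol_eval id v p"
  "mpol_eval id v (p - q) = mpol_eval id v p - mpol_eval id v q"
proof -
 note h = comm_ring_homD[OF ev_hom[of v]]
 show "mpol_eval id v (p + q) = mpol_eval id v p + mpol_eval id v q"
  "mpol_eval id v (p * q) = mpol_eval id v p * mpol_eval id v q"
  "mpol_eval id v (0 :: ('v, complex) mpol) = 0"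
  "mpol_eval id v (1 :: ('v, complex) mpol) = 1"
  by (fact h)+
 show "mpol_eval id v (mconst c) = c" "mpol_eval id v (mvar i) = v i"
  by (simp_all add: mpol_eval_mconst mpol_eval_mvar comm_ring_hom_id)
 show "mpol_eval id v (p ^ n) = mpol_eval id v p ^ n"
  by (rule comm_ring_hom_power[OF ev_hom])
 show m: "mpol_eval id v (- p) = - mpol_eval id v p" for p :: "('v, complex) mpol"
  using h(3)[of p "- p"] h(1) by (simp add: eq_neg_iff_add_eq_0 add.commute)
 show "mpol_eval id v (p - q) = mpol_eval id v p - mpol_eval id v q"
  using h(3)[of p "- q"] m[of q] by simp
qed

lemma prod_UNIV_3: "prod f (UNIV :: 3 set) = f 1 * f 2 * f 3"
 unfolding UNIV_3 by (simp add: ac_simps)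

lemma monom_value_3:
 "monom_value v t = v 1 ^ lookup t 1 * v 2 ^ lookup t 2 * v (3::3) ^ lookup t 3"
 by (subst monom_value_superset[of UNIV]) (simp_all add: prod_UNIV_3 sum_3)

lemma monom_degree_3: "monom_degree t = lookup t 1 + lookup t 2 + lookup t (3::3)"
 by (subst monom_degree_superset[of UNIV]) (simp_all add: prod_UNIV_3 sum_3)

lemma lookup_3_eqI:
 "lookup s 1 = lookup t 1 ==> lookup s 2 = lookup t 2 ==> lookup s (3::3) = lookup t 3 ==> s = t"
 by (rule poly_mapping_eqI) (metis exhaust_3)

text \<open>
  Substituting \<open>(u, u\<^sup>N, u\<^sup>N\<^sup>N)\<close> for a large \<open>N\<close> keeps the monomials apart, which reduces the
 identity theorem in three variables to the one in a single variable.
\<close>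

lemma ev_zero_imp_zero:
 fixes p :: cpol
 assumes "!!v. ev v p = 0"
 shows "p = 0"
proof (rule ccontr)
 assume "p ~= 0"
 then obtain t0 where t0: "t0 \<in> keys p" by (metis all_not_in_conv keys_eq_empty)
 define N where "N = Suc (Max (monom_degree ` keys p))"
 have N: "lookup t i < N" if "t \<in> keys p" for t i
 proof -
  have "monom_degree t \<le> Max (monom_degree ` keys p)" using that by simp
  moreover have "lookup t i \<le> monom_degree t"
   using exhaust_3[of i] by (auto simp: monom_degree_3)
  ultimately show ?thesis by (simp add: N_def)
 qed
 define e where "e t = lookup t 1 + N * (lookup t 2 + N * lookup t (3::3))" for t
 have inj: "s = t" if "s \<in> keys p" "t \<in> keys p" "e s = e t" for s t
 proof -
  have digit: "a = a' & b = b'" if "a + N * b = a' + N * b'" "a < N" "a' < N" for a b a' b' :: nat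
   using arg_cong[OF that(1), of "%n. n mod N"] arg_cong[OF that(1), of "%n. n div N"] that(2,3) by simp
  have *: "lookup s 1 = lookup t 1 &
   lookup s 2 + N * lookup s 3 = lookup t 2 + N * lookup t (3::3)"
   using that(3) N[OF that(1)] N[OF that(2)] unfolding e_def by (intro digit)
  hence "lookup s 2 = lookup t 2 & lookup s 3 = lookup t (3::3)"
   using N[OF that(1)] N[OF that(2)] by (intro digit) auto
  with * show ?thesis by (auto intro: lookup_3_eqI)
 qed
 define r where "r = (\<Sum>t\<in>keys p. monom (lookup p t) (e t))"
 have "poly r u = ev (vec3 u (u ^ N) (u ^ (N * N))) p" for u
  unfolding r_def mpol_eval_def
  by (simp add: poly_sum poly_monom monom_value_3 e_def power_add power_mult distrib_left mult.assoc)
 hence "poly r u = 0" for u using assms by simp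
 hence "r = 0" using poly_all_0_iff_0 by blast
 moreover have "coeff r (e t0) = lookup p t0"
 proof -
  have "coeff r (e t0) = (\<Sum>t\<in>keys p. if t = t0 then lookup p t else 0)"
   unfolding r_def coeff_sum coeff_monom by (rule sum.cong) (use inj t0 in auto)
  thus ?thesis using t0 by simp
 qed
 ultimately show False using t0 by (simp add: in_keys_iff)
qed

lemma ev_eqI: "(!!v. ev v p = ev v q) ==> p = q"
 using ev_zero_imp_zero[of "p - q"] by simp

lemma ev_homogeneous:
 "homogeneous m p ==> ev (%i. c * v i) p = c ^ m * ev v p"
 by (rule mpol_eval_scale)

lemma mvar_neq_0: "mvar v ~= (0 :: ('v, complex) mpol)"
proof
 assume "mvar v = (0 :: ('v, complex) mpol)"
 hence "mpol_eval id (%_. 1) (mvar v :: ('v, complex) mpol) = 0" by simp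
 thus False by (simp del: One_nat_def)
qed

lemma homogeneous_eq_0I:
 assumes "homogeneous m p" "!!x y. ev (vec3 x y 1) p = 0"
 shows "p = 0"
proof -
 have "mvar 3 * p = 0"
 proof (rule ev_zero_imp_zero)
  fix v :: "3 => complex"
  have "ev v p = 0" if "v 3 ~= 0"
  proof -
   have "v = (%i. v 3 * vec3 (v 1 / v 3) (v 2 / v 3) 1 i)"
    by (rule ext) (use that in \<open>auto simp: vec3_def; metis exhaust_3\<close>)
   thus ?thesis using ev_homogeneous[OF assms(1)] assms(2) by (metis mult_zero_right)
  qed
  thus "ev v (mvar 3 * p) = 0" by auto
 qed
 moreover have "mvar 3 ~= (0 :: cpol)" by (rule mvar_neq_0)
 ultimately show ?thesis by simp
qed

lemma homogeneous_eqI: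
 assumes "homogeneous m p" "homogeneous m q" "!!x y. ev (vec3 x y 1) p = ev (vec3 x y 1) q"
 shows "p = q"
proof -
 have "homogeneous m (p - q)"
  using assms(1,2) keys_diff[of p q] by (auto simp: homogeneous_def)
 from homogeneous_eq_0I[OF this] assms(3) show ?thesis by simp
qed

lemma homogeneous_add: "homogeneous m p ==> homogeneous m q ==> homogeneous m (p + q)"
 using Poly_Mapping.keys_add[of p q] by (auto simp: homogeneous_def)

lemma homogeneous_uminus: "homogeneous m (p :: ('v, complex) mpol) ==> homogeneous m (- p)"
 by (auto simp: homogeneous_def)

lemma homogeneous_diff:
 "homogeneous m p ==> homogeneous m (q :: ('v, complex) mpol) ==> homogeneous m (p - q)"
 using homogeneous_add[of m p "- q"] homogeneous_uminus[of m q] by simp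

lemma homogeneous_0: "homogeneous m 0"
 by (simp add: homogeneous_def)

lemma homogeneous_mconst: "homogeneous 0 (mconst c)"
 by (simp add: homogeneous_def mconst_def monom_degree_def)

lemma homogeneous_1: "homogeneous 0 (1 :: ('v, complex) mpol)"
 by (simp add: homogeneous_def monom_degree_def)

lemma homogeneous_mvar: "homogeneous 1 (mvar v :: ('v, complex) mpol)"
 by (simp add: homogeneous_def mvar_def monom_degree_def)

lemma homogeneous_sum: "(!!i. i \<in> I ==> homogeneous m (p i)) ==> homogeneous m (\<Sum>i\<in>I. p i)"
 by (induction I rule: infinite_finite_induct) (auto simp: homogeneous_0 homogeneous_add)

lemma homogeneous_prod:
 fixes p :: "'i => ('v, complex) mpol"
 shows "(!!i. i \<in> I ==> homogeneous (m i) (p i)) ==> homogeneous (\<Sum>i\<in>I. m i) (\<Prod>i\<in>I. p i)"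
 by (induction I rule: infinite_finite_induct) (auto simp: homogeneous_1 homogeneous_mult)

lemma homogeneous_power:
 "homogeneous m (p :: ('v, complex) mpol) ==> homogeneous (n * m) (p ^ n)"
 by (induction n) (auto simp: homogeneous_1 homogeneous_mult)

lemma homogeneous_mconst_mult:
 "homogeneous m (p :: ('v, complex) mpol) ==> homogeneous m (mconst c * p)"
 using homogeneous_mult[OF homogeneous_mconst] by fastforce

lemma homogeneous_compose:
 fixes p :: "('v, complex) mpol" and g :: "'v => ('w, complex) mpol"
 assumes "homogeneous m p" "!!i. homogeneous e (g i)"
 shows "homogeneous (m * e) (mpol_eval mconst g p)"
 unfolding mpol_eval_def
proof (rule homogeneous_sum, rule homogeneous_mconst_mult)
 fix t assume t: "t \<in> keys p"
 have "homogeneous (\<Sum>v\<in>keys t. lookup t v * e) (monom_value g t)"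
  unfolding monom_value_def by (intro homogeneous_prod homogeneous_power assms)
 moreover have "(\<Sum>v\<in>keys t. lookup t v * e) = m * e"
  using assms(1) t by (simp add: homogeneous_def monom_degree_def flip: sum_distrib_right)
 ultimately show "homogeneous (m * e) (monom_value g t)" by simp
qed

lemma ev_compose: "ev v (mpol_eval mconst g p) = mpol_eval id (%i. ev v (g i)) p"
proof (subst mpol_eval_commute[OF ev_hom])
 have "ev v \<circ> mconst = id" by (simp add: fun_eq_iff)
 thus "mpol_eval (ev v \<circ> mconst) (ev v \<circ> g) p = mpol_eval id (%i. ev v (g i)) p"
  by (simp add: o_def)
qed


section \<open>Bivariate polynomials and generic points of the affine plane\<close>

definition ev2 :: "cpoly2 => complex => complex => complex" where
 "ev2 f x y = poly (poly f [:x:]) y"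

lemma ev2_simps [simp]:
 "ev2 0 x y = 0" "ev2 1 x y = 1" "ev2 (f + g) x y = ev2 f x y + ev2 g x y"
 "ev2 (f * g) x y = ev2 f x y * ev2 g x y" "ev2 (f - g) x y = ev2 f x y - ev2 g x y"
 "ev2 (- f) x y = - ev2 f x y" "ev2 (f ^ n) x y = ev2 f x y ^ n"
 "ev2 (pCons c f) x y = poly c y + x * ev2 f x y"
 by (simp_all add: ev2_def)

lemma comm_ring_hom_ev2: "comm_ring_hom (%f. ev2 f x y)"
 by (simp add: comm_ring_hom_def)

lemma ev2_sum: "ev2 (\<Sum>i\<in>I. f i) x y = (\<Sum>i\<in>I. ev2 (f i) x y)"
 by (rule comm_ring_hom_sum[OF comm_ring_hom_ev2])

lemma ev2_prod: "ev2 (\<Prod>i\<in>I. f i) x y = (\<Prod>i\<in>I. ev2 (f i) x y)"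
 by (rule comm_ring_hom_prod[OF comm_ring_hom_ev2])

lemma ev2_zero_imp_zero:
 assumes "!!x y. ev2 f x y = 0"
 shows "f = 0"
proof -
 have "poly f [:x:] = 0" for x
  using assms poly_all_0_iff_0[of "poly f [:x:]"] by (simp add: ev2_def)
 hence "range (%x::complex. [:x:]) \<subseteq> {z. poly f z = 0}" by auto
 moreover have "infinite (range (%x::complex. [:x:]))"
  using finite_imageD[of "%x::complex. [:x:]" UNIV] infinite_UNIV_char_0[where 'a = complex]
  by (auto simp: inj_on_def)
 ultimately show ?thesis using poly_roots_finite[of f] infinite_super by blast
qed

lemma ev2_eqI: "(!!x y. ev2 f x y = ev2 g x y) ==> f = g"
 using ev2_zero_imp_zero[of "f - g"] by simp

text \<open>The dehomogenization \<open>p(x,y,1)\<close>, with \<open>x\<close> as the outer variable.\<close>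

definition in_plane :: "cpol => cpoly2" where
 "in_plane p = mpol_eval (%c. [:[:c:]:]) (vec3 [:0, 1:] [:[:0, 1:]:] 1) p"

lemma ev2_in_plane: "ev2 (in_plane p) x y = ev (vec3 x y 1) p"
 unfolding in_plane_def
proof (subst mpol_eval_commute[OF comm_ring_hom_ev2])
 have "(%f. ev2 f x y) \<circ> (%c. [:[:c:]:]) = id" by (simp add: fun_eq_iff)
 moreover have "(%f. ev2 f x y) \<circ> vec3 [:0, 1:] [:[:0, 1:]:] 1 = vec3 x y 1"
  by (simp add: comp_vec3)
 ultimately show "mpol_eval ((%f. ev2 f x y) \<circ> (%c. [:[:c:]:])) ((%f. ev2 f x y) \<circ> vec3 [:0, 1:] [:[:0, 1:]:] 1) p =
   ev (vec3 x y 1) p" by simp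
qed

lemma in_plane_eq_0_iff: "homogeneous m p ==> in_plane p = 0 \<longleftrightarrow> p = 0"
 using homogeneous_eq_0I[of m p] ev2_in_plane[of p] by (metis ev2_simps(1) ev2_zero_imp_zero ev_simps(3))

text \<open>
  The filter of all sets that contain the complement of a plane curve. Statements about rational
  functions are checked at generic points, where no denominator vanishes.
\<close>

definition gen :: "(complex \<times> complex) filter" where
 "gen = (INF D\<in>{D. D ~= 0}. principal {X. ev2 D (fst X) (snd X) ~= 0})"

abbreviation generically :: "(complex \<times> complex => bool) => bool" (binder "GEN " 10) where
 "generically P \<equiv> eventually P gen"

lemma eventually_gen:
 "eventually P gen \<longleftrightarrow> (\<exists>D. D ~= 0 & (\<forall>x y. ev2 D x y ~= 0 --> P (x, y)))"
 unfolding gen_def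
proof (subst eventually_INF_base)
 show "{D :: cpoly2. D ~= 0} ~= {}" by (auto intro: exI[of _ 1])
 fix a b :: "cpoly2" assume "a \<in> {D. D ~= 0}" "b \<in> {D. D ~= 0}"
 thus "\<exists>x\<in>{D. D ~= 0}. principal {X. ev2 x (fst X) (snd X) ~= 0}
   \<le> inf (principal {X. ev2 a (fst X) (snd X) ~= 0}) (principal {X. ev2 b (fst X) (snd X) ~= 0})"
  by (intro bexI[of _ "a * b"]) auto
qed (auto simp: eventually_principal)

lemma eventually_genI: "D ~= 0 ==> \<forall>\<^sub>F X in gen. ev2 D (fst X) (snd X) ~= 0"
 unfolding eventually_gen by auto

lemma gen_not_bot [simp]: "gen ~= bot"
 unfolding trivial_limit_def eventually_gen using ev2_zero_imp_zero by blast

lemma ev2_along_line: "\<exists>r. \<forall>u. ev2 D (x + u * a) (y + u * b) = poly r u"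
proof (induction D)
 case 0
 thus ?case by (auto intro: exI[of _ 0])
next
 case (pCons c D)
 then obtain r where "\<forall>u. ev2 D (x + u * a) (y + u * b) = poly r u" by blast
 thus ?case
  by (intro exI[of _ "c \<circ>\<^sub>p [:y, b:] + [:x, a:] * r"]) (simp add: poly_pcompose algebra_simps)
qed

text \<open>Generic points are dense, because a nonzero polynomial has few zeros on a suitable line.\<close>

lemma gen_frequently_nhds:
 assumes "eventually P gen"
 shows "\<exists>\<^sub>F X in nhds X0. P X"
proof -
 obtain D where D: "D ~= 0" "!!x y. ev2 D x y ~= 0 ==> P (x, y)"
  using assms unfolding eventually_gen by blast
 obtain x1 y1 where nz: "ev2 D x1 y1 ~= 0" using D(1) ev2_zero_imp_zero by blast
 obtain x y where X0: "X0 = (x, y)" by (cases X0)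
 obtain r where r: "!!u. ev2 D (x + u * (x1 - x)) (y + u * (y1 - y)) = poly r u"
  using ev2_along_line by blast
 have "poly r 1 ~= 0" using nz r[of 1] by simp
 hence "finite {u. poly r u = 0}" by (intro poly_roots_finite) auto
 hence "\<not> (0::complex) islimpt {u. poly r u = 0}" by (rule islimpt_finite)
 hence "\<forall>\<^sub>F u in at 0. poly r u ~= 0"
  unfolding islimpt_iff_eventually by (simp add: eventually_mono)
 hence ev: "\<forall>\<^sub>F u in at (0::complex). P (x + u * (x1 - x), y + u * (y1 - y))"
  by eventually_elim (use D(2) r in auto)
 have lim: "filterlim (%u. (x + u * (x1 - x), y + u * (y1 - y))) (nhds X0) (at 0)"
  unfolding X0 by (auto intro!: tendsto_eq_intros)
 show ?thesis
 proof (rule ccontr)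
  assume "\<not> ?thesis"
  hence "\<forall>\<^sub>F X in nhds X0. \<not> P X" by (simp add: not_frequently)
  hence "\<forall>\<^sub>F u in at 0. \<not> P (x + u * (x1 - x), y + u * (y1 - y))"
   by (rule eventually_compose_filterlim[OF _ lim])
  with ev have "\<forall>\<^sub>F u in at (0::complex). False" by eventually_elim auto
  thus False by simp
 qed
qed

lemma gen_closed:
 assumes "closed S" "\<forall>\<^sub>F X in gen. X \<in> S"
 shows "X \<in> S"
proof (rule ccontr)
 assume "X \<notin> S"
 hence "\<forall>\<^sub>F Y in nhds X. Y \<notin> S"
  using assms(1) eventually_nhds_in_open[of "- S" X] by (simp add: open_Compl)
 with gen_frequently_nhds[OF assms(2), of X] show False
  by (simp add: frequently_def)
qed

lemma continuous_ev2:
 assumes "continuous_on S f" "continuous_on S g"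
 shows "continuous_on S (%z. ev2 D (f z) (g z))"
 by (induction D) (auto intro!: continuous_intros assms)

lemma gen_ev2_eq_imp_eq:
 assumes "\<forall>\<^sub>F X in gen. ev2 f (fst X) (snd X) = ev2 g (fst X) (snd X)"
 shows "f = g"
proof (rule ev2_eqI)
 fix x y
 have "closed {X. ev2 f (fst X) (snd X) = ev2 g (fst X) (snd X)}"
  by (intro closed_Collect_eq continuous_ev2 continuous_intros)
 from gen_closed[OF this, of "(x, y)"] assms show "ev2 f x y = ev2 g x y" by simp
qed

lemma DERIV_ev2:
 assumes "(P has_field_derivative P') (at z)" "(Q has_field_derivative Q') (at z)"
 shows "((%z. ev2 f (P z) (Q z)) has_field_derivative
   ev2 (pderiv f) (P z) (Q z) * P' + ev2 (map_poly pderiv f) (P z) (Q z) * Q') (at z)"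
proof (induction f)
 case 0
 thus ?case by simp
next
 case (pCons c f)
 have "((%z. poly c (Q z) + P z * ev2 f (P z) (Q z)) has_field_derivative
   poly (pderiv c) (Q z) * Q' + (P z * (ev2 (pderiv f) (P z) (Q z) * P' + ev2 (map_poly pderiv f) (P z) (Q z) * Q')
    + ev2 f (P z) (Q z) * P')) (at z)"
  by (rule derivative_eq_intros pCons.IH assms DERIV_chain2[OF poly_DERIV] refl | simp)+
 moreover have "map_poly pderiv (pCons c f) = pCons (pderiv c) (map_poly pderiv f)"
  by (rule poly_eqI) (auto simp: coeff_map_poly coeff_pCons split: nat.split)
 ultimately show ?case by (simp add: pderiv_pCons algebra_simps)
qed

lemma finite_slice_zeros:
 assumes "ev2 D a y ~= 0"
 shows "finite {u. ev2 D u y = 0}"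
proof -
 obtain r where r: "!!u. ev2 D (0 + u * 1) (y + u * 0) = poly r u"
  using ev2_along_line by blast
 hence "r ~= 0" using assms by fastforce
 thus ?thesis using poly_roots_finite[of r] r by simp
qed

lemma finite_slice_zeros':
 assumes "ev2 D x b ~= 0"
 shows "finite {u. ev2 D x u = 0}"
proof -
 obtain r where r: "!!u. ev2 D (x + u * 0) (0 + u * 1) = poly r u"
  using ev2_along_line by blast
 hence "r ~= 0" using assms by fastforce
 thus ?thesis using poly_roots_finite[of r] r by simp
qed

lemma connected_constant_off_finite:
 fixes g :: "complex => complex"
 assumes "finite S" "!!u. u \<notin> S ==> (g has_field_derivative 0) (at u)" "u \<notin> S" "v \<notin> S"
 shows "g u = g v"
proof -
 have "open (- S)" using assms(1) by (simp add: finite_imp_closed open_Compl)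
 moreover have "connected (- S)"
  using assms(1) connected_open_delete_finite[of "UNIV :: complex set" S] connected_UNIV[where 'a = complex] by (simp add: Compl_eq_Diff_UNIV)
 ultimately show ?thesis
  using DERIV_zero_connected_constant[of "- S" "{}" g] assms
  by (smt (verit) ComplD ComplI DERIV_isCont continuous_at_imp_continuous_on Diff_empty finite.emptyI)
qed

text \<open>The two partial derivatives, as a pair of one-variable derivatives.\<close>

definition has_partials ::
 "(complex \<times> complex => complex) => complex => complex => complex \<times> complex => bool" where
 "has_partials g g1 g2 X \<longleftrightarrow>
   ((%u. g (u, snd X)) has_field_derivative g1) (at (fst X)) &
   ((%v. g (fst X, v)) has_field_derivative g2) (at (snd X))"

text \<open>
  A generic horizontal and a generic vertical line remain connected after finitely many points are
  removed.
\<close>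

lemma gen_constant:
 assumes "\<forall>\<^sub>F X in gen. has_partials g 0 0 X"
 shows "\<exists>c. \<forall>\<^sub>F X in gen. g X = c"
proof -
 obtain D where D: "D ~= 0" "!!x y. ev2 D x y ~= 0 ==> has_partials g 0 0 (x, y)"
  using assms unfolding eventually_gen by blast
 obtain x0 y0 where nz: "ev2 D x0 y0 ~= 0" using D(1) ev2_zero_imp_zero by blast
 define D0 where "D0 = [:poly D [:x0:]:]"
 have D0: "ev2 D0 x y = ev2 D x0 y" for x y by (simp add: D0_def ev2_def)
 have "D0 ~= 0" using nz D0[of 0 y0] by auto
 have "g (x, y) = g (x0, y0)" if "ev2 (D * D0) x y ~= 0" for x y
 proof -
  have nz1: "ev2 D x y ~= 0" "ev2 D x0 y ~= 0" using that by (auto simp: D0)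
  have "g (x, y) = g (x0, y)"
   using connected_constant_off_finite[OF finite_slice_zeros[OF nz1(1)], of "%u. g (u, y)" x x0]
    D(2) nz1 by (auto simp: has_partials_def)
  also have "\<dots> = g (x0, y0)"
   using connected_constant_off_finite[OF finite_slice_zeros'[OF nz], of "%u. g (x0, u)" y y0]
    D(2) nz nz1 by (auto simp: has_partials_def)
  finally show ?thesis .
 qed
 thus ?thesis
  using D(1) \<open>D0 ~= 0\<close> unfolding eventually_gen by (intro exI[of _ "g (x0, y0)"] exI[of _ "D * D0"]) auto
qed

section \<open>Rational functions of polynomial growth\<close>

lemma degree_le_of_growth:
 fixes h :: "complex poly"
 assumes "!!z. norm (poly h z) \<le> C * (1 + norm z) ^ M"
 shows "degree h \<le> M"
proof (rule ccontr)
 assume "\<not> degree h \<le> M"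
 hence n: "M < degree h" by simp
 have bound: "norm (poly (reflect_poly h) w) \<le> C * (1 + norm w) ^ M * norm w ^ (degree h - M)" if "w ~= 0" for w
 proof -
  have "norm (poly (reflect_poly h) w) = norm w ^ degree h * norm (poly h (inverse w))"
   using that by (simp add: poly_reflect_poly_nz norm_mult norm_power)
  also have "\<dots> \<le> norm w ^ degree h * (C * (1 + norm (inverse w)) ^ M)"
   by (intro mult_left_mono assms) auto
  also have "\<dots> = C * (norm w * (1 + norm (inverse w))) ^ M * norm w ^ (degree h - M)"
   using n by (simp add: power_mult_distrib mult_ac flip: power_add)
  also have "norm w * (1 + norm (inverse w)) = 1 + norm w"
   using that by (simp add: distrib_left norm_inverse)
  finally show ?thesis .
 qed
 have "((%w::complex. C * (1 + norm w) ^ M * norm w ^ (degree h - M)) \<longlongrightarrow>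
   C * (1 + norm (0::complex)) ^ M * norm (0::complex) ^ (degree h - M)) (at 0)"
  by (intro tendsto_intros)
 hence lim: "((%w::complex. C * (1 + norm w) ^ M * norm w ^ (degree h - M)) \<longlongrightarrow> 0) (at 0)"
  using n by (simp add: power_0_left)
 have "((%w. poly (reflect_poly h) w) \<longlongrightarrow> 0) (at 0)"
  by (rule Lim_null_comparison[OF _ lim]) (auto simp: eventually_at_filter bound)
 moreover have "((%w. poly (reflect_poly h) w) \<longlongrightarrow> poly (reflect_poly h) 0) (at 0)"
  by (intro tendsto_intros)
 ultimately have "poly (reflect_poly h) 0 = 0"
  using tendsto_unique trivial_limit_at by blast
 thus False using n by (auto simp: poly_0_coeff_0)
qed

text \<open>
  Every root of \<open>D\<close> is a root of \<open>N\<close>, so it can be split off from both;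
 once \<open>D\<close> is constant, the growth bounds the degree.
\<close>

lemma growth_divides:
 fixes N D :: "complex poly"
 assumes "D ~= 0" "!!z. norm (poly N z) \<le> C * (1 + norm z) ^ M * norm (poly D z)"
 shows "\<exists>h. N = h * D & degree h \<le> M"
 using assms
proof (induction "degree D" arbitrary: N D)
 case 0
 then obtain c where D: "D = [:c:]" "c ~= 0" by (metis degree_0_id pCons_0_0)
 have "degree (smult (1 / c) N) \<le> M"
 proof (rule degree_le_of_growth)
  fix z show "norm (poly (smult (1 / c) N) z) \<le> C * (1 + norm z) ^ M"
   using 0(3)[of z] D by (simp add: norm_mult norm_divide field_simps)
 qed
 moreover have "N = smult (1 / c) N * D" using D by simp
 ultimately show ?case by blast
next
 case (Suc n)
 have "\<exists>z. poly D z = 0"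
  using Suc.hyps(2) by (intro fundamental_theorem_of_algebra) (simp add: constant_degree)
 then obtain z D' where D': "D = [:-z, 1:] * D'" by (auto simp: poly_eq_0_iff_dvd)
 have "poly N z = 0" using Suc.prems(2)[of z] D' by simp
 then obtain N' where N': "N = [:-z, 1:] * N'" by (auto simp: poly_eq_0_iff_dvd)
 have D'0: "D' ~= 0" using Suc.prems(1) D' by auto
 have "degree D = degree [:-z, 1:] + degree D'" unfolding D' using D'0 by (intro degree_mult_eq) auto
 hence "degree D' = n" using Suc.hyps(2) by simp
 moreover have "norm (poly N' w) \<le> C * (1 + norm w) ^ M * norm (poly D' w)" for w
 proof -
  have cl: "closed {w. norm (poly N' w) \<le> C * (1 + norm w) ^ M * norm (poly D' w)}"
   by (intro closed_Collect_le continuous_intros)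
  have off: "norm (poly N' w) \<le> C * (1 + norm w) ^ M * norm (poly D' w)" if "w ~= z" for w
  proof -
   have "norm (w - z) * norm (poly N' w) \<le> norm (w - z) * (C * (1 + norm w) ^ M * norm (poly D' w))"
    using Suc.prems(2)[of w] unfolding N' D' poly_mult norm_mult by (simp add: mult_ac)
   thus ?thesis using that by simp
  qed
  have "closure (- {z}) \<subseteq> {w. norm (poly N' w) \<le> C * (1 + norm w) ^ M * norm (poly D' w)}"
   using off by (intro closure_minimal cl) auto
  moreover have "closure (- {z}) = UNIV" by (simp add: closure_complement)
  ultimately show ?thesis by auto
 qed
 ultimately obtain h where "N' = h * D' & degree h \<le> M"
  using Suc.hyps(1)[of D' N'] D'0 by blast
 thus ?case unfolding N' D' by (intro exI[of _ h]) (simp only: mult_ac)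
qed

definition lagrange_basis :: "complex set => complex => complex poly" where
 "lagrange_basis S a = (\<Prod>b\<in>S - {a}. smult (inverse (a - b)) [:-b, 1:])"

lemma poly_lagrange_basis:
 assumes "finite S" "a \<in> S" "c \<in> S"
 shows "poly (lagrange_basis S a) c = (if c = a then 1 else 0)"
proof (cases "c = a")
 case True
 have "poly (smult (inverse (a - b)) [:-b, 1:]) a = 1" if "b \<in> S - {a}" for b
 proof -
  have "inverse (a - b) * (a - b) = 1" using that by (intro left_inverse) auto
  thus ?thesis by (simp add: algebra_simps)
 qed
 thus ?thesis unfolding lagrange_basis_def poly_prod True by simp
next
 case False
 thus ?thesis unfolding lagrange_basis_def poly_prod
  using assms by (auto intro!: bexI[of _ c])
qed

lemma degree_lagrange_basis:
 assumes "finite S" "a \<in> S"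
 shows "degree (lagrange_basis S a) \<le> card S - 1"
proof -
 have "degree (lagrange_basis S a) \<le> sum (degree \<circ> (%b. smult (inverse (a - b)) [:-b, 1:])) (S - {a})"
  unfolding lagrange_basis_def by (rule degree_prod_sum_le) (use assms in auto)
 also have "\<dots> \<le> (\<Sum>b\<in>S - {a}. 1)" by (intro sum_mono) auto
 finally show ?thesis using assms by simp
qed

lemma poly_eq_if_agree:
 fixes f g :: "complex poly"
 assumes "finite S" "degree f < card S" "degree g < card S" "!!c. c \<in> S ==> poly f c = poly g c"
 shows "f = g"
proof (rule ccontr)
 assume "f ~= g"
 hence "f - g ~= 0" by simp
 hence "card {x. poly (f - g) x = 0} \<le> degree (f - g)" by (rule card_poly_roots_bound)
 moreover have "S \<subseteq> {x. poly (f - g) x = 0}" using assms(4) by auto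
 moreover have "finite {x. poly (f - g) x = 0}" using \<open>f - g ~= 0\<close> by (rule poly_roots_finite)
 ultimately have "card S \<le> degree (f - g)" by (meson card_mono le_trans)
 also have "degree (f - g) < card S" using assms(2,3) by (meson degree_diff_less)
 finally show False by simp
qed

definition slice :: "cpoly2 => complex => complex poly" where
 "slice f y = map_poly (%c. poly c y) f"

lemma poly_slice: "poly (slice f y) x = ev2 f x y"
 by (induction f) (simp_all add: slice_def map_poly_pCons)

text \<open>
  A rational function of two variables whose growth is bounded by a polynomial is a polynomial of
  bounded degree: the one-variable case applies to every horizontal and to finitely many vertical
  lines, and interpolating between these vertical lines gives the quotient.
\<close>

lemma growth_divides2:
 fixes N D :: "cpoly2"
 assumes "D ~= 0"
  "!!x y. norm (ev2 N x y) \<le> C * (1 + norm x) ^ M * (1 + norm y) ^ M * norm (ev2 D x y)"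
 shows "\<exists>h. N = h * D & degree h \<le> M & (\<forall>i. degree (coeff h i) \<le> M)"
proof -
 obtain a b where ab: "ev2 D a b ~= 0" using assms(1) ev2_zero_imp_zero by blast
 have "infinite (- {u. ev2 D u b = 0})"
  using finite_slice_zeros[OF ab] infinite_UNIV_char_0[where 'a = complex] by (metis finite_compl)
 then obtain S where S: "finite S" "card S = Suc M" "S \<subseteq> - {u. ev2 D u b = 0}"
  using infinite_arbitrarily_large by metis
 have "\<exists>g. poly N [:c:] = g * poly D [:c:] & degree g \<le> M" if "c \<in> S" for c
 proof (rule growth_divides)
  show "poly D [:c:] ~= 0" using S(3) that by (auto simp: ev2_def)
  show "norm (poly (poly N [:c:]) z) \<le> C * (1 + norm c) ^ M * (1 + norm z) ^ M * norm (poly (poly D [:c:]) z)" for z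
   using assms(2)[of c z] by (simp add: ev2_def)
 qed
 then obtain g where g: "!!c. c \<in> S ==> poly N [:c:] = g c * poly D [:c:]" "!!c. c \<in> S ==> degree (g c) \<le> M"
  by metis
 define h where "h = (\<Sum>c\<in>S. smult (g c) (map_poly (%a. [:a:]) (lagrange_basis S c)))"
 have lift: "ev2 (map_poly (%a. [:a:]) l) x y = poly l x" for l x y
  by (induction l) (simp_all add: map_poly_pCons)
 have smul: "ev2 (smult u f) x y = poly u y * ev2 f x y" for u f x y by (simp add: ev2_def)
 have h_ev: "ev2 h x y = (\<Sum>c\<in>S. poly (g c) y * poly (lagrange_basis S c) x)" for x y
  unfolding h_def by (simp add: ev2_sum smul lift)
 have "degree h \<le> M"
  unfolding h_def
 proof (rule degree_sum_le)
  fix c assume "c \<in> S"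
  hence "degree (lagrange_basis S c) \<le> M" using degree_lagrange_basis[of S c] S by simp
  thus "degree (smult (g c) (map_poly (%a. [:a:]) (lagrange_basis S c))) \<le> M"
   by (simp add: degree_map_poly order_trans[OF degree_smult_le])
 qed (use S in auto)
 moreover have "degree (coeff h i) \<le> M" for i
  unfolding h_def coeff_sum
  by (rule degree_sum_le) (use S g(2) in \<open>auto simp: coeff_map_poly intro: order_trans[OF degree_smult_le]\<close>)
 moreover have "N = h * D"
 proof (rule gen_ev2_eq_imp_eq)
  define E where "E = (\<Prod>c\<in>S. [:poly D [:c:]:])"
  have "[:poly D [:c:]:] ~= 0" if "c \<in> S" for c using S(3) that by (auto simp: ev2_def)
  hence "E ~= 0" using S(1) by (auto simp: E_def)
  have "ev2 N x y = ev2 (h * D) x y" if E: "ev2 E x y ~= 0" for x y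
  proof -
   have nz: "ev2 D c y ~= 0" if "c \<in> S" for c
    using E that S(1) unfolding E_def ev2_prod by (simp add: ev2_def)
   obtain c0 where "c0 \<in> S" using S by (metis card.empty ex_in_conv nat.distinct(1))
   hence "slice D y ~= 0" using nz poly_slice by (metis poly_0)
   then obtain k where k: "slice N y = k * slice D y" "degree k \<le> M"
    using growth_divides[of "slice D y" "slice N y" "C * (1 + norm y) ^ M" M] assms(2)
    by (auto simp: poly_slice mult_ac)
   have "k = (\<Sum>c\<in>S. smult (poly (g c) y) (lagrange_basis S c))"
   proof (rule poly_eq_if_agree[OF S(1)])
    show "degree k < card S" using k S by simp
    have "degree (\<Sum>c\<in>S. smult (poly (g c) y) (lagrange_basis S c)) \<le> M"
    proof (rule degree_sum_le[OF S(1)])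
     fix c assume "c \<in> S"
     hence "degree (lagrange_basis S c) \<le> M" using degree_lagrange_basis[of S c] S by simp
     thus "degree (smult (poly (g c) y) (lagrange_basis S c)) \<le> M"
      by (meson degree_smult_le le_trans)
    qed
    thus "degree (\<Sum>c\<in>S. smult (poly (g c) y) (lagrange_basis S c)) < card S" using S by simp
    fix c assume c: "c \<in> S"
    have "poly k c * ev2 D c y = ev2 N c y"
     using arg_cong[OF k(1), of "%p. poly p c"] by (simp add: poly_slice)
    also have "\<dots> = poly (g c) y * ev2 D c y"
     using g(1)[OF c] by (simp add: ev2_def)
    finally have "poly k c = poly (g c) y" using nz[OF c] by simp
    also have "\<dots> = (\<Sum>b\<in>S. if b = c then poly (g b) y else 0)" using S(1) c by simp
    also have "\<dots> = poly (\<Sum>c\<in>S. smult (poly (g c) y) (lagrange_basis S c)) c"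
     unfolding poly_sum by (intro sum.cong) (use S(1) c in \<open>auto simp: poly_lagrange_basis\<close>)
    finally show "poly k c = poly (\<Sum>c\<in>S. smult (poly (g c) y) (lagrange_basis S c)) c" .
   qed
   hence "poly k x = ev2 h x y" by (simp add: h_ev poly_sum)
   thus ?thesis using arg_cong[OF k(1), of "%p. poly p x"] by (simp add: poly_slice)
  qed
  thus "\<forall>\<^sub>F X in gen. ev2 N (fst X) (snd X) = ev2 (h * D) (fst X) (snd X)"
   using \<open>E ~= 0\<close> unfolding eventually_gen by auto
 qed
 ultimately show ?thesis by blast
qed

lemma poly_growth: "\<exists>C\<ge>0. \<forall>n\<ge>degree f. \<forall>z. norm (poly f (z::complex)) \<le> C * (1 + norm z) ^ n"
proof (intro exI conjI allI impI)
 show "0 \<le> (\<Sum>i\<le>degree f. norm (coeff f i))" by (intro sum_nonneg) auto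
 fix n z assume n: "degree f \<le> n"
 have "norm (poly f z) \<le> (\<Sum>i\<le>degree f. norm (coeff f i * z ^ i))"
  unfolding poly_altdef by (rule norm_sum)
 also have "\<dots> \<le> (\<Sum>i\<le>degree f. norm (coeff f i) * (1 + norm z) ^ n)"
 proof (rule sum_mono)
  fix i assume "i \<in> {..degree f}"
  hence "norm z ^ i \<le> (1 + norm z) ^ i & (1 + norm z) ^ i \<le> (1 + norm z) ^ n"
   using n by (auto intro!: power_mono power_increasing)
  thus "norm (coeff f i * z ^ i) \<le> norm (coeff f i) * (1 + norm z) ^ n"
   unfolding norm_mult norm_power by (intro mult_left_mono) auto
 qed
 finally show "norm (poly f z) \<le> (\<Sum>i\<le>degree f. norm (coeff f i)) * (1 + norm z) ^ n"
  by (simp add: sum_distrib_right)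
qed

lemma ev2_growth:
 "\<exists>n0. \<forall>n\<ge>n0. \<exists>C\<ge>0. \<forall>x y. norm (ev2 f x y) \<le> C * ((1 + norm x) * (1 + norm y)) ^ n"
proof (induction f)
 case 0
 thus ?case by (auto intro!: exI[of _ "0::real"])
next
 case (pCons c f)
 then obtain n0 where n0: "!!n. n \<ge> n0 ==> \<exists>C\<ge>0. \<forall>x y. norm (ev2 f x y) \<le> C * ((1 + norm x) * (1 + norm y)) ^ n"
  by blast
 show ?case
 proof (rule exI[of _ "max (degree c) (Suc n0)"], intro allI impI)
  fix n assume n: "max (degree c) (Suc n0) \<le> n"
  obtain C1 where C1: "C1 \<ge> 0" "!!y. norm (poly c y) \<le> C1 * (1 + norm y) ^ n"
   using poly_growth[of c] n by auto
  obtain m where m: "n = Suc m" "m \<ge> n0" using n by (cases n) auto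
  obtain C2 where C2: "C2 \<ge> 0" "!!x y. norm (ev2 f x y) \<le> C2 * ((1 + norm x) * (1 + norm y)) ^ m"
   using n0[OF m(2)] by blast
  have "norm (ev2 (pCons c f) x y) \<le> (C1 + C2) * ((1 + norm x) * (1 + norm y)) ^ n" for x y
  proof -
   let ?w = "(1 + norm x) * (1 + norm y)"
   have "norm (poly c y) \<le> C1 * ?w ^ n"
   proof -
    have "(1 + norm y) ^ n \<le> ?w ^ n"
     by (intro power_mono) (auto simp: algebra_simps)
    thus ?thesis using C1 by (meson mult_left_mono order_trans)
   qed
   moreover have "norm (x * ev2 f x y) \<le> C2 * ?w ^ n"
   proof -
    have "norm x \<le> ?w" by (simp add: algebra_simps)
    hence "norm x * norm (ev2 f x y) \<le> ?w * (C2 * ?w ^ m)"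
     using C2 by (intro mult_mono) auto
    thus ?thesis by (simp add: norm_mult m mult_ac)
   qed
   ultimately have "norm (poly c y + x * ev2 f x y) \<le> C1 * ?w ^ n + C2 * ?w ^ n"
    by (meson add_mono norm_triangle_ineq order_trans)
   thus ?thesis by (simp add: algebra_simps)
  qed
  thus "\<exists>C\<ge>0. \<forall>x y. norm (ev2 (pCons c f) x y) \<le> C * ((1 + norm x) * (1 + norm y)) ^ n"
   using C1(1) C2(1) by (intro exI[of _ "C1 + C2"]) auto
 qed
qed


section \<open>Polynomial functions on the space of forms\<close>

definition polyfun :: "nat => (form => complex) => bool" where
 "polyfun d f \<longleftrightarrow> (\<exists>D. \<forall>\<omega>\<in>forms d. f \<omega> = mpol_eval id (coords \<omega>) D)"

lemma polyfun_const: "polyfun d (%\<omega>. c)"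
 unfolding polyfun_def by (intro exI[of _ "mconst c"]) simp

lemma polyfun_add: "polyfun d f ==> polyfun d g ==> polyfun d (%\<omega>. f \<omega> + g \<omega>)"
 unfolding polyfun_def by (metis ev_simps(1))

lemma polyfun_mult: "polyfun d f ==> polyfun d g ==> polyfun d (%\<omega>. f \<omega> * g \<omega>)"
 unfolding polyfun_def by (metis ev_simps(2))

lemma polyfun_diff: "polyfun d f ==> polyfun d g ==> polyfun d (%\<omega>. f \<omega> - g \<omega>)"
 unfolding polyfun_def by (metis ev_simps(9))

lemma polyfun_sum: "(!!i. i \<in> I ==> polyfun d (f i)) ==> polyfun d (%\<omega>. \<Sum>i\<in>I. f i \<omega>)"
 by (induction I rule: infinite_finite_induct) (auto intro: polyfun_const polyfun_add)

lemma polyfun_coords: "polyfun d (%\<omega>. coords \<omega> v)"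
 unfolding polyfun_def by (intro exI[of _ "mvar v"]) simp

lemma polyfun_cong: "polyfun d f ==> (!!\<omega>. \<omega> \<in> forms d ==> f \<omega> = g \<omega>) ==> polyfun d g"
 unfolding polyfun_def by metis

text \<open>
  The same constructions on coefficients are needed over the space of forms and over the plane of
  lines; both rings of polynomial functions are instances of the following notion.
\<close>

definition function_algebra :: "('w => complex) set => bool" where
 "function_algebra A \<longleftrightarrow> (\<forall>c. (%_. c) \<in> A) &
   (\<forall>f\<in>A. \<forall>g\<in>A. (%x. f x + g x) \<in> A & (%x. f x * g x) \<in> A)"

lemma function_algebra_const: "function_algebra A ==> (%_. c) \<in> A"
 and function_algebra_add: "function_algebra A ==> f \<in> A ==> g \<in> A ==> (%x. f x + g x) \<in> A"
 and function_algebra_mult: "function_algebra A ==> f \<in> A ==> g \<in> A ==> (%x. f x * g x) \<in> A"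
 unfolding function_algebra_def by auto

lemma function_algebra_diff:
 assumes "function_algebra A" "f \<in> A" "g \<in> A"
 shows "(%x. f x - g x) \<in> A"
proof -
 have "(%x. f x + (- 1) * g x) \<in> A"
  by (intro function_algebra_add function_algebra_mult function_algebra_const assms)
 thus ?thesis by simp
qed

lemma function_algebra_power: "function_algebra A ==> f \<in> A ==> (%x. f x ^ n) \<in> A"
 by (induction n) (auto intro: function_algebra_const function_algebra_mult)

lemma function_algebra_sum:
 "function_algebra A ==> (!!i. i \<in> I ==> f i \<in> A) ==> (%x. \<Sum>i\<in>I. f i x) \<in> A"
 by (induction I rule: infinite_finite_induct) (auto intro: function_algebra_const function_algebra_add)

lemma function_algebra_polyfun: "function_algebra {f. polyfun d f}"
 unfolding function_algebra_def by (auto intro: polyfun_const polyfun_add polyfun_mult)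

lemma function_algebra_ev2: "function_algebra {f. \<exists>E. \<forall>X. f X = ev2 E (fst X) (snd X)}"
proof -
 have "\<exists>E. \<forall>X :: complex \<times> complex. c = ev2 E (fst X) (snd X)" for c
  by (intro exI[of _ "[:[:c:]:]"]) simp
 moreover have "\<exists>D. \<forall>X. f X + g X = ev2 D (fst X) (snd X)" "\<exists>D. \<forall>X. f X * g X = ev2 D (fst X) (snd X)"
  if "\<forall>X. f X = ev2 E (fst X) (snd X)" "\<forall>X. g X = ev2 E' (fst X) (snd X)" for f g E E'
  using that by (auto intro: exI[of _ "E + E'"] exI[of _ "E * E'"])
 ultimately show ?thesis unfolding function_algebra_def by blast
qed

text \<open>Families of polynomials whose coefficients belong to the algebra \<open>A\<close>.\<close>

definition polyfam :: "('w => complex) set => ('w => complex poly) => bool" where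
 "polyfam A G \<longleftrightarrow> (\<forall>j. (%x. coeff (G x) j) \<in> A)"

lemma polyfam_coeff: "polyfam A f ==> (%x. coeff (f x) j) \<in> A"
 unfolding polyfam_def by simp

context
 fixes A :: "('w => complex) set"
 assumes A: "function_algebra A"
begin

lemma polyfam_const: "polyfam A (%x. c)"
 unfolding polyfam_def by (simp add: function_algebra_const[OF A])

lemma polyfam_add: "polyfam A f ==> polyfam A g ==> polyfam A (%x. f x + g x)"
 unfolding polyfam_def by (simp add: function_algebra_add[OF A])

lemma polyfam_diff: "polyfam A f ==> polyfam A g ==> polyfam A (%x. f x - g x)"
 unfolding polyfam_def by (simp add: function_algebra_diff[OF A])

lemma polyfam_mult: "polyfam A f ==> polyfam A g ==> polyfam A (%x. f x * g x)"
 unfolding polyfam_def coeff_mult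
 by (intro allI function_algebra_sum[OF A] function_algebra_mult[OF A]) auto

lemma polyfam_power: "polyfam A f ==> polyfam A (%x. f x ^ n)"
 by (induction n) (auto intro: polyfam_const polyfam_mult)

lemma polyfam_pderiv: "polyfam A f ==> polyfam A (%x. pderiv (f x))"
 unfolding polyfam_def coeff_pderiv
 by (intro allI function_algebra_mult[OF A] function_algebra_const[OF A]) auto

lemma polyfam_smult: "f \<in> A ==> polyfam A g ==> polyfam A (%x. smult (f x) (g x))"
 unfolding polyfam_def coeff_smult by (intro allI function_algebra_mult[OF A]) auto

lemma polyfam_pCons: "f \<in> A ==> polyfam A g ==> polyfam A (%x. pCons (f x) (g x))"
 unfolding polyfam_def
proof
 fix j assume "f \<in> A" "\<forall>j. (%x. coeff (g x) j) \<in> A"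
 thus "(%x. coeff (pCons (f x) (g x)) j) \<in> A" by (cases j) auto
qed

lemma polyfam_sum: "(!!i. i \<in> I ==> polyfam A (f i)) ==> polyfam A (%x. \<Sum>i\<in>I. f i x)"
 by (induction I rule: infinite_finite_induct) (auto intro: polyfam_const polyfam_add)

lemmas polyfam_intros = polyfam_const polyfam_add polyfam_diff polyfam_mult polyfam_power
 polyfam_pderiv polyfam_smult polyfam_pCons polyfam_sum

end

definition scale :: "complex => form => form" where
 "scale c \<omega> = (\<chi> i. mconst c * \<omega> $ i)"

lemma proj_class_eq: "proj_class \<omega> = {scale c \<omega> |c. c ~= 0}"
 by (simp add: proj_class_def scale_def)

lemma scale_scale: "scale c (scale e \<omega>) = scale (c * e) \<omega>"
 by (simp add: scale_def vec_eq_iff comm_ring_homD[OF comm_ring_hom_mconst] mult_ac)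

lemma scale_1 [simp]: "scale 1 \<omega> = \<omega>"
 by (simp add: scale_def vec_eq_iff comm_ring_homD[OF comm_ring_hom_mconst])

lemma self_in_proj_class: "\<omega> \<in> proj_class \<omega>"
 unfolding proj_class_eq using scale_1[of \<omega>] by (metis (mono_tags, lifting) mem_Collect_eq zero_neq_one)

lemma coords_scale: "coords (scale c \<omega>) = (%v. c * coords \<omega> v)"
 by (auto simp: coords_def scale_def lookup_mconst_mult)

definition homog_part :: "nat => ('v, complex) mpol => ('v, complex) mpol" where
 "homog_part m F = (\<Sum>t\<in>{t\<in>keys F. monom_degree t = m}. Poly_Mapping.single t (lookup F t))"

lemma homogeneous_homog_part: "homogeneous m (homog_part m F)"
 unfolding homog_part_def by (rule homogeneous_sum) (auto simp: homogeneous_def)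

lemma mpol_eval_homog_part:
 "mpol_eval id x (homog_part m F) =
   (\<Sum>t\<in>{t\<in>keys F. monom_degree t = m}. lookup F t * monom_value x t)"
 unfolding homog_part_def by (simp only: mpol_eval_sum mpol_eval_single)

lemma mpol_eval_scaled_by_parts:
 "mpol_eval id (%v. c * x v) F =
   (\<Sum>m\<in>monom_degree ` keys F. c ^ m * mpol_eval id x (homog_part m F))"
proof -
 have mv: "monom_value (%v. c * x v) t = c ^ monom_degree t * monom_value x t" for t
  by (simp add: monom_value_def monom_degree_def power_mult_distrib prod.distrib power_sum)
 have "mpol_eval id (%v. c * x v) F =
   (\<Sum>t\<in>keys F. c ^ monom_degree t * (lookup F t * monom_value x t))"
  unfolding mpol_eval_def by (simp add: mv mult_ac)
 also have "\<dots> = (\<Sum>m\<in>monom_degree ` keys F. \<Sum>t\<in>{t\<in>keys F. monom_degree t = m}.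
   c ^ monom_degree t * (lookup F t * monom_value x t))"
  by (rule sum.image_gen) simp
 also have "\<dots> = (\<Sum>m\<in>monom_degree ` keys F. c ^ m * mpol_eval id x (homog_part m F))"
  unfolding mpol_eval_homog_part sum_distrib_left by (intro sum.cong) auto
 finally show ?thesis .
qed

text \<open>
  Vanishing on a punctured line through the origin is vanishing of all homogeneous parts, so
  arbitrary polynomials cut out the same closed sets as homogeneous ones.
\<close>

lemma zariski_closed_vanishing:
 assumes "polyfun d f"
 shows "zariski_closed d {P \<in> proj_forms d. \<forall>\<omega>\<in>P. f \<omega> = 0}"
proof -
 obtain F where F: "!!\<omega>. \<omega> \<in> forms d ==> f \<omega> = mpol_eval id (coords \<omega>) F"
  using assms unfolding polyfun_def by blast
 have forms: "scale c \<omega> \<in> forms d" if "\<omega> \<in> forms d" for c \<omega>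
  using that unfolding forms_def scale_def
  by (auto simp: homogeneous_mconst_mult mult.assoc simp flip: sum_distrib_left)
 define S where "S = range (%m. homog_part m F)"
 have "{P \<in> proj_forms d. \<forall>\<omega>\<in>P. f \<omega> = 0} = zero_locus d S"
 proof -
  have "(\<forall>\<omega>\<in>P. f \<omega> = 0) \<longleftrightarrow> (\<forall>G\<in>S. \<forall>\<omega>\<in>P. mpol_eval id (coords \<omega>) G = 0)"
   if P: "P \<in> proj_forms d" for P
  proof -
   obtain \<eta> where \<eta>: "\<eta> \<in> forms d" "P = proj_class \<eta>"
    using P unfolding proj_forms_def by auto
   have Pf: "\<omega> \<in> forms d" if "\<omega> \<in> P" for \<omega> using that \<eta> forms unfolding proj_class_eq by auto
   have Psc: "scale c \<omega> \<in> P" if "\<omega> \<in> P" "c ~= 0" for c \<omega>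
    using that \<eta>(2) scale_scale unfolding proj_class_eq by fastforce
   show ?thesis
   proof
    assume z: "\<forall>\<omega>\<in>P. f \<omega> = 0"
    show "\<forall>G\<in>S. \<forall>\<omega>\<in>P. mpol_eval id (coords \<omega>) G = 0"
    proof (intro ballI)
     fix G \<omega> assume "G \<in> S" and w: "\<omega> \<in> P"
     then obtain m where m: "G = homog_part m F" unfolding S_def by blast
     define r where "r = (\<Sum>m\<in>monom_degree ` keys F. monom (mpol_eval id (coords \<omega>) (homog_part m F)) m)"
     have "poly r c = 0" if "c ~= 0" for c
     proof -
      have "poly r c = mpol_eval id (coords (scale c \<omega>)) F"
       unfolding coords_scale mpol_eval_scaled_by_parts r_def
       by (simp add: poly_sum poly_monom mult_ac)
      also have "\<dots> = f (scale c \<omega>)" using F Pf Psc w that by simp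
      finally show ?thesis using z Psc w that by simp
     qed
     hence "- {0} \<subseteq> {c. poly r c = 0}" by auto
     moreover have "infinite (- {0::complex})" using infinite_UNIV_char_0[where 'a = complex] by (simp add: finite_compl)
     ultimately have "r = 0" using poly_roots_finite[of r] infinite_super by blast
     show "mpol_eval id (coords \<omega>) G = 0"
     proof (cases "m \<in> monom_degree ` keys F")
      case True
      have "coeff r m = (\<Sum>k\<in>monom_degree ` keys F. if k = m then mpol_eval id (coords \<omega>) (homog_part k F) else 0)"
       unfolding r_def coeff_sum coeff_monom by (rule sum.cong) auto
      thus ?thesis using True \<open>r = 0\<close> m by simp
     next
      case False
      hence "{t\<in>keys F. monom_degree t = m} = {}" by auto
      thus ?thesis unfolding m mpol_eval_homog_part by (metis sum.empty)
     qed
    qed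
   next
    assume z: "\<forall>G\<in>S. \<forall>\<omega>\<in>P. mpol_eval id (coords \<omega>) G = 0"
    show "\<forall>\<omega>\<in>P. f \<omega> = 0"
    proof
     fix \<omega> assume w: "\<omega> \<in> P"
     have "f \<omega> = mpol_eval id (%v. 1 * coords \<omega> v) F" using F Pf w by simp
     also have "\<dots> = 0"
      unfolding mpol_eval_scaled_by_parts by (rule sum.neutral) (use z w in \<open>auto simp: S_def\<close>)
     finally show "f \<omega> = 0" .
    qed
   qed
  qed
  thus ?thesis unfolding zero_locus_def by blast
 qed
 moreover have "\<forall>G\<in>S. \<exists>m. homogeneous m G" unfolding S_def using homogeneous_homog_part by blast
 ultimately show ?thesis unfolding zariski_closed_def by blast
qed

lemma scale_in_forms: "\<omega> \<in> forms d ==> scale c \<omega> \<in> forms d"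
 unfolding forms_def scale_def
 by (auto simp: homogeneous_mconst_mult mult.assoc simp flip: sum_distrib_left)

lemma openin_nonvanishing:
 assumes "polyfun d f"
 shows "openin (zariski d) {P \<in> proj_forms d. \<exists>\<omega>\<in>P. f \<omega> ~= 0}"
proof -
 have "proj_forms d - {P \<in> proj_forms d. \<exists>\<omega>\<in>P. f \<omega> ~= 0} = {P \<in> proj_forms d. \<forall>\<omega>\<in>P. f \<omega> = 0}"
  by blast
 thus ?thesis using zariski_closed_vanishing[OF assms] unfolding openin_zariski by auto
qed


section \<open>Semicontinuity of the dimension of a solution space\<close>

text \<open>
  Gaussian elimination with pivots that do not vanish at \<open>\<omega>0\<close>: the free variables \<open>T\<close>
 found there still determine every solution at all \<open>\<omega>\<close> where the product \<open>D\<close> of the pivots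
 is nonzero. Hence the dimension of the solution space can only drop near \<open>\<omega>0\<close>.
\<close>

lemma free_variables_near:
 fixes q :: "'j => 'i => form => complex"
 assumes "finite I" "!!j i. i \<in> I ==> polyfun d (q j i)"
 shows "\<exists>T\<subseteq>I. \<exists>D. polyfun d D & D \<omega>0 ~= 0 &
   (\<forall>\<omega> v. D \<omega> ~= 0 --> (\<forall>j. (\<Sum>i\<in>I. q j i \<omega> * v i) = 0) --> (\<forall>i\<in>T. v i = 0) --> (\<forall>i\<in>I. v i = 0)) &
   (\<forall>u. \<exists>v. (\<forall>i\<in>T. v i = u i) & (\<forall>j. (\<Sum>i\<in>I. q j i \<omega>0 * v i) = 0))"
 using assms
proof (induction "card I" arbitrary: I q)
 case 0
 hence "I = {}" by simp
 thus ?case by (intro exI[of _ "{}"] conjI exI[of _ "%_. 1"]) (auto intro: polyfun_const)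
next
 case (Suc n)
 show ?case
 proof (cases "\<forall>j. \<forall>i\<in>I. q j i \<omega>0 = 0")
  case True
  thus ?thesis
   by (intro exI[of _ I] conjI exI[of _ "%_. 1"]) (auto intro: polyfun_const)
 next
  case False
  then obtain j0 i0 where p: "i0 \<in> I" "q j0 i0 \<omega>0 ~= 0" by blast
  define I' where "I' = I - {i0}"
  have I: "I = insert i0 I'" "i0 \<notin> I'" "finite I'" using p Suc.prems(1) by (auto simp: I'_def)
  define q' where "q' j i \<omega> = q j0 i0 \<omega> * q j i \<omega> - q j i0 \<omega> * q j0 i \<omega>" for j i \<omega>
  have "n = card I'" using Suc.hyps(2) I by simp
  moreover have "polyfun d (q' j i)" if "i \<in> I'" for j i
   unfolding q'_def using Suc.prems(2) that I(1) by (intro polyfun_diff polyfun_mult) auto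
  ultimately obtain T D where IH: "T \<subseteq> I'" "polyfun d D" "D \<omega>0 ~= 0"
   "!!\<omega> v. D \<omega> ~= 0 ==> (\<forall>j. (\<Sum>i\<in>I'. q' j i \<omega> * v i) = 0) ==> (\<forall>i\<in>T. v i = 0) ==> (\<forall>i\<in>I'. v i = 0)"
   "!!u. \<exists>v. (\<forall>i\<in>T. v i = u i) & (\<forall>j. (\<Sum>i\<in>I'. q' j i \<omega>0 * v i) = 0)"
   using Suc.hyps(1)[of I' q'] I(3) by blast
  have sumI: "(\<Sum>i\<in>I. q j i \<omega> * v i) = q j i0 \<omega> * v i0 + (\<Sum>i\<in>I'. q j i \<omega> * v i)" for j \<omega> v
   using I by simp
  have sum': "(\<Sum>i\<in>I'. q' j i \<omega> * v i) =
    q j0 i0 \<omega> * (\<Sum>i\<in>I'. q j i \<omega> * v i) - q j i0 \<omega> * (\<Sum>i\<in>I'. q j0 i \<omega> * v i)" for j \<omega> v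
   by (simp add: q'_def algebra_simps sum_subtractf sum_distrib_left)
  show ?thesis
  proof (intro exI[of _ T] conjI exI[of _ "%\<omega>. q j0 i0 \<omega> * D \<omega>"] allI impI)
   show "T \<subseteq> I" using IH(1) I(1) by auto
   show "polyfun d (%\<omega>. q j0 i0 \<omega> * D \<omega>)" using Suc.prems(2) p(1) IH(2) by (intro polyfun_mult)
   show "q j0 i0 \<omega>0 * D \<omega>0 ~= 0" using p IH(3) by simp
  next
   fix \<omega> v
   assume nz: "q j0 i0 \<omega> * D \<omega> ~= 0" and sol: "\<forall>j. (\<Sum>i\<in>I. q j i \<omega> * v i) = 0"
    and T0: "\<forall>i\<in>T. v i = 0"
   have e: "(\<Sum>i\<in>I'. q j i \<omega> * v i) = - (q j i0 \<omega> * v i0)" for j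
    using sol sumI[of j \<omega> v] by (simp add: add_eq_0_iff)
   have "\<forall>j. (\<Sum>i\<in>I'. q' j i \<omega> * v i) = 0" unfolding sum' e by simp
   hence v0: "\<forall>i\<in>I'. v i = 0" using IH(4) nz T0 by auto
   hence "v i0 = 0" using e[of j0] nz by simp
   thus "\<forall>i\<in>I. v i = 0" using v0 I(1) by auto
  next
   fix u
   obtain v where v: "\<forall>i\<in>T. v i = u i" "\<forall>j. (\<Sum>i\<in>I'. q' j i \<omega>0 * v i) = 0" using IH(5) by blast
   define s where "s j = (\<Sum>i\<in>I'. q j i \<omega>0 * v i)" for j
   define w where "w = v(i0 := - s j0 / q j0 i0 \<omega>0)"
   have w': "(\<Sum>i\<in>I'. q j i \<omega>0 * w i) = s j" for j
    unfolding s_def by (rule sum.cong) (use I(2) in \<open>auto simp: w_def\<close>)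
   have "q j0 i0 \<omega>0 * s j = q j i0 \<omega>0 * s j0" for j
    using v(2) unfolding sum' by (simp add: s_def)
   hence "(\<Sum>i\<in>I. q j i \<omega>0 * w i) = 0" for j
    unfolding sumI w' using p(2) by (simp add: w_def field_simps)
   moreover have "\<forall>i\<in>T. w i = u i" using v(1) IH(1) I(2) by (auto simp: w_def)
   ultimately show "\<exists>v. (\<forall>i\<in>T. v i = u i) & (\<forall>j. (\<Sum>i\<in>I. q j i \<omega>0 * v i) = 0)" by blast
  qed
 qed
qed

text \<open>
  Linear independence of \<open>card A\<close> vectors in \<open>\<complex>\<^sup>B\<close>,
 stated by relations because the index sets vary with the foliation.
\<close>

lemma card_le_if_independent:
 fixes w :: "'a => 'b => complex"
 assumes "finite B" "finite A"
  "!!u. (!!b. b \<in> B ==> (\<Sum>a\<in>A. u a * w a b) = 0) ==> (!!a. a \<in> A ==> u a = 0)"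
 shows "card A \<le> card B"
 using assms
proof (induction B arbitrary: A w rule: finite_induct)
 case empty
 have "A = {}" using empty(2)[of "%_. 1"] by auto
 thus ?case by simp
next
 case (insert b B)
 show ?case
 proof (cases "\<forall>a\<in>A. w a b = 0")
  case True
  have "card A \<le> card B"
  proof (rule insert.IH[OF insert.prems(1)])
   fix u a assume "!!b. b \<in> B ==> (\<Sum>a\<in>A. u a * w a b) = 0" "a \<in> A"
   hence z: "!!c. c \<in> insert b B ==> (\<Sum>a\<in>A. u a * w a c) = 0" using True by auto
   show "u a = 0" by (rule insert.prems(2)[OF z \<open>a \<in> A\<close>])
  qed
  thus ?thesis using insert.hyps by simp
 next
  case False
  then obtain a0 where a0: "a0 \<in> A" "w a0 b ~= 0" by blast
  define A' where "A' = A - {a0}"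
  have A: "A = insert a0 A'" "a0 \<notin> A'" "finite A'" using a0 insert.prems(1) by (auto simp: A'_def)
  define w' where "w' a c = w a c - w a b / w a0 b * w a0 c" for a c
  have "card A' \<le> card B"
  proof (rule insert.IH[OF A(3)])
   fix u a assume u: "!!c. c \<in> B ==> (\<Sum>a\<in>A'. u a * w' a c) = 0" and a: "a \<in> A'"
   define u' where "u' = u(a0 := - (\<Sum>a\<in>A'. u a * w a b) / w a0 b)"
   have s: "(\<Sum>a\<in>A. u' a * w a c) = u' a0 * w a0 c + (\<Sum>a\<in>A'. u a * w a c)" for c
   proof -
    have "(\<Sum>a\<in>A'. u' a * w a c) = (\<Sum>a\<in>A'. u a * w a c)"
     by (rule sum.cong) (use A(2) in \<open>auto simp: u'_def\<close>)
    thus ?thesis using A by simp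
   qed
   have "(\<Sum>a\<in>A. u' a * w a c) = 0" if "c \<in> insert b B" for c
   proof (cases "c = b")
    case True
    thus ?thesis unfolding s using a0(2) by (simp add: u'_def)
   next
    case False
    have "(\<Sum>a\<in>A'. u a * w' a c) = (\<Sum>a\<in>A'. u a * w a c) - (\<Sum>a\<in>A'. u a * w a b) / w a0 b * w a0 c"
     by (simp add: w'_def algebra_simps sum_subtractf sum_distrib_left sum_divide_distrib)
    thus ?thesis using u[of c] that False unfolding s by (simp add: u'_def)
   qed
   hence "u' a = 0" using insert.prems(2)[of u' a] a A(1) by auto
   thus "u a = 0" using a A(2) by (auto simp: u'_def split: if_splits)
  qed
  thus ?thesis using A insert.hyps by simp
 qed
qed

section \<open>The linear system for locally constant functions\<close>

text \<open>Elements of \<open>\<complex>[q][p][s]\<close> are specialised at a point \<open>(p, q)\<close>.\<close>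

definition at_pt :: "cpoly3 => complex => complex => complex poly" where
 "at_pt F p q = map_poly (%c. ev2 c p q) F"

definition diff_p :: "cpoly3 => cpoly3" where
 "diff_p F = map_poly pderiv F"

definition diff_q :: "cpoly3 => cpoly3" where
 "diff_q F = map_poly (map_poly pderiv) F"

lemma coeff_at_pt: "coeff (at_pt F p q) j = ev2 (coeff F j) p q"
 by (simp add: at_pt_def coeff_map_poly)

lemma coeff_diff_p: "coeff (diff_p F) j = pderiv (coeff F j)"
 by (simp add: diff_p_def coeff_map_poly)

lemma coeff_diff_q: "coeff (diff_q F) j = map_poly pderiv (coeff F j)"
 by (simp add: diff_q_def coeff_map_poly)

lemma degree_at_pt_le: "degree (at_pt F p q) \<le> degree F"
 by (rule degree_le) (simp add: coeff_at_pt coeff_eq_0)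

lemma degree_diff_p_le: "degree (diff_p F) \<le> degree F"
 by (rule degree_le) (simp add: coeff_diff_p coeff_eq_0)

lemma degree_diff_q_le: "degree (diff_q F) \<le> degree F"
 by (rule degree_le) (simp add: coeff_diff_q coeff_eq_0)

lemma at_pt_0 [simp]: "at_pt 0 p q = 0"
 by (simp add: at_pt_def)

lemma at_pt_pCons: "at_pt (pCons c F) p q = pCons (ev2 c p q) (at_pt F p q)"
 by (rule poly_eqI) (simp add: coeff_at_pt coeff_pCons split: nat.split)

lemma diff_p_pCons: "diff_p (pCons c F) = pCons (pderiv c) (diff_p F)"
 by (rule poly_eqI) (simp add: coeff_diff_p coeff_pCons split: nat.split)

lemma diff_q_pCons: "diff_q (pCons c F) = pCons (map_poly pderiv c) (diff_q F)"
 by (rule poly_eqI) (simp add: coeff_diff_q coeff_pCons split: nat.split)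

lemma map_poly_pderiv_of_nat_mult: "map_poly pderiv (of_nat n * c) = of_nat n * map_poly pderiv (c :: cpoly2)"
proof -
 have "map_poly pderiv (a + b) = map_poly pderiv a + map_poly pderiv (b :: cpoly2)" for a b
  by (rule poly_eqI) (simp add: coeff_map_poly pderiv_add)
 thus ?thesis by (induction n) (simp_all add: algebra_simps)
qed

lemma pderiv_of_nat_mult: "pderiv (of_nat n * c) = of_nat n * pderiv (c :: cpoly2)"
 by (induction n) (simp_all add: algebra_simps pderiv_add)

lemma ev2_of_nat: "ev2 (of_nat n) p q = of_nat n"
 by (induction n) simp_all

lemma pderiv_at_pt: "pderiv (at_pt F p q) = at_pt (pderiv F) p q"
 by (rule poly_eqI) (simp add: coeff_at_pt coeff_pderiv ev2_of_nat flip: of_nat_Suc)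

lemma diff_p_pderiv: "diff_p (pderiv F) = pderiv (diff_p F)"
 by (rule poly_eqI) (simp add: coeff_diff_p coeff_pderiv pderiv_of_nat_mult flip: of_nat_Suc)

lemma diff_q_pderiv: "diff_q (pderiv F) = pderiv (diff_q F)"
 by (rule poly_eqI) (simp add: coeff_diff_q coeff_pderiv map_poly_pderiv_of_nat_mult flip: of_nat_Suc)

lemma DERIV_at_pt:
 assumes "(P has_field_derivative P') (at z)" "(Q has_field_derivative Q') (at z)"
  "(S has_field_derivative S') (at z)"
 shows "((%z. poly (at_pt F (P z) (Q z)) (S z)) has_field_derivative
   poly (at_pt (diff_p F) (P z) (Q z)) (S z) * P' + poly (at_pt (diff_q F) (P z) (Q z)) (S z) * Q' +
   poly (pderiv (at_pt F (P z) (Q z))) (S z) * S') (at z)"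
proof (induction F)
 case 0
 thus ?case by (simp add: diff_p_def diff_q_def)
next
 case (pCons c F)
 have "((%z. ev2 c (P z) (Q z) + S z * poly (at_pt F (P z) (Q z)) (S z)) has_field_derivative
   (ev2 (pderiv c) (P z) (Q z) * P' + ev2 (map_poly pderiv c) (P z) (Q z) * Q') +
   (S z * (poly (at_pt (diff_p F) (P z) (Q z)) (S z) * P' + poly (at_pt (diff_q F) (P z) (Q z)) (S z) * Q' +
   poly (pderiv (at_pt F (P z) (Q z))) (S z) * S') + S' * poly (at_pt F (P z) (Q z)) (S z))) (at z)"
  by (rule DERIV_add[OF DERIV_ev2[OF assms(1,2)] DERIV_mult'[OF assms(3) pCons.IH]])
 thus ?case
  by (simp add: at_pt_pCons diff_p_pCons diff_q_pCons pderiv_pCons algebra_simps)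
qed

text \<open>
  Reduction modulo \<open>F\<close>, a polynomial of formal degree \<open>d\<close> whose leading coefficient \<open>f\<close> need not
 be invertible: \<open>f\<^sup>m s\<^sup>m\<close> is congruent to \<open>power_rem d F m\<close>.
\<close>

fun power_rem :: "nat => complex poly => nat => complex poly" where
 "power_rem d F 0 = 1"
| "power_rem d F (Suc m) = smult (coeff F d) (pCons 0 (power_rem d F m)) -
   smult (coeff (power_rem d F m) (d - 1)) F"

definition reduce :: "nat => nat => complex poly => complex poly => complex poly" where
 "reduce d M F U = (\<Sum>m\<le>M. smult (coeff U m * coeff F d ^ (M - m)) (power_rem d F m))"

lemma degree_power_rem:
 assumes "1 \<le> d" "degree F \<le> d"
 shows "degree (power_rem d F m) < d"
proof -
 have "\<forall>i\<ge>d. coeff (power_rem d F m) i = 0"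
 proof (induction m)
  case 0
  thus ?case using assms(1) by (simp add: coeff_1)
 next
  case (Suc m)
  show ?case
  proof (intro allI impI)
   fix i assume i: "d \<le> i"
   then obtain i' where i': "i = Suc i'" using assms(1) by (cases i) auto
   show "coeff (power_rem d F (Suc m)) i = 0"
   proof (cases "i = d")
    case True
    hence "d = Suc i'" using i' by simp
    thus ?thesis unfolding True by simp
   next
    case False
    thus ?thesis using Suc i i' assms(2) by (simp add: coeff_eq_0)
   qed
  qed
 qed
 hence "degree (power_rem d F m) \<le> d - 1" by (intro degree_le) auto
 thus ?thesis using assms(1) by linarith
qed

lemma poly_power_rem: "poly F x = 0 ==> poly (power_rem d F m) x = (coeff F d * x) ^ m"
 by (induction m) (simp_all add: mult_ac)

lemma degree_reduce:
 assumes "1 \<le> d" "degree F \<le> d"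
 shows "degree (reduce d M F U) < d"
proof -
 have "degree (reduce d M F U) \<le> d - 1"
  unfolding reduce_def
 proof (rule degree_sum_le)
  fix m
  have "degree (power_rem d F m) \<le> d - 1" using degree_power_rem[OF assms, of m] by linarith
  thus "degree (smult (coeff U m * coeff F d ^ (M - m)) (power_rem d F m)) \<le> d - 1"
   by (rule order_trans[OF degree_smult_le])
 qed auto
 thus ?thesis using assms(1) by linarith
qed

lemma poly_altdef_ge: "degree (p :: complex poly) \<le> n ==> poly p x = (\<Sum>i\<le>n. coeff p i * x ^ i)"
 unfolding poly_altdef by (rule sum.mono_neutral_left) (auto simp: coeff_eq_0)

lemma poly_altdef_less: "degree (p :: complex poly) < n ==> poly p x = (\<Sum>i<n. coeff p i * x ^ i)"
 unfolding poly_altdef by (rule sum.mono_neutral_left) (auto simp: coeff_eq_0)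

lemma poly_reduce:
 assumes "poly F x = 0" "degree U \<le> M"
 shows "poly (reduce d M F U) x = coeff F d ^ M * poly U x"
proof -
 have "poly (reduce d M F U) x = (\<Sum>m\<le>M. coeff F d ^ M * (coeff U m * x ^ m))"
  unfolding reduce_def poly_sum
 proof (rule sum.cong[OF refl])
  fix m assume "m \<in> {..M}"
  hence "coeff F d ^ M = coeff F d ^ (M - m) * coeff F d ^ m"
   by (simp flip: power_add)
  thus "poly (smult (coeff U m * coeff F d ^ (M - m)) (power_rem d F m)) x = coeff F d ^ M * (coeff U m * x ^ m)"
   by (simp add: poly_power_rem[OF assms(1)] power_mult_distrib mult_ac)
 qed
 thus ?thesis by (simp add: poly_altdef_ge[OF assms(2)] flip: sum_distrib_left)
qed

text \<open>
  With \<open>u = F'\<close> and \<open>w\<close> the derivative of \<open>F\<close> in a direction of the \<open>(p,q)\<close>-plane, a root \<open>s\<close> of \<open>F\<close>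
 moves with velocity \<open>- w / u\<close> in this direction. The two operators below are the numerators
 that arise when \<open>s\<^sup>k / u\<close> is differentiated along this motion.
\<close>

definition num_u :: "complex poly => nat => complex poly" where
 "num_u F k = (pderiv F)\<^sup>2 * monom 1 k"

definition num_v :: "complex poly => complex poly => nat => complex poly" where
 "num_v F W k = pderiv F * W * pderiv (monom 1 k) +
   (pderiv F * pderiv W - W * pderiv (pderiv F)) * monom 1 k"

definition transport_num ::
 "complex poly => complex poly => nat => (nat => nat => complex) => (nat => nat => complex) =>
   complex => complex => complex" where
 "transport_num F W d h h' s t = (\<Sum>k<d. \<Sum>l<d.
   h' k l * poly (num_u F k) s * poly (num_u F l) t -
   h k l * (poly (num_v F W k) s * poly (num_u F l) t + poly (num_u F k) s * poly (num_v F W l) t))"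

definition transport_coeff ::
 "complex poly => complex poly => nat => (nat => nat => complex) => (nat => nat => complex) =>
   nat => nat => complex" where
 "transport_coeff F W d h h' a b = (\<Sum>k<d. \<Sum>l<d.
   h' k l * coeff (reduce d (4 * d) F (num_u F k)) a * coeff (reduce d (4 * d) F (num_u F l)) b -
   h k l * (coeff (reduce d (4 * d) F (num_v F W k)) a * coeff (reduce d (4 * d) F (num_u F l)) b +
    coeff (reduce d (4 * d) F (num_u F k)) a * coeff (reduce d (4 * d) F (num_v F W l)) b))"

definition pair_value :: "nat => (nat => nat => complex) => complex => complex => complex" where
 "pair_value d h s t = (\<Sum>k<d. \<Sum>l<d. h k l * s ^ k * t ^ l)"

lemma degree_mult_le_trans: "degree p \<le> a ==> degree q \<le> b ==> degree (p * q) \<le> a + b"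
 by (meson add_mono degree_mult_le order_trans)

lemma degree_num_u:
 assumes "degree F \<le> d" "k < d"
 shows "degree (num_u F k) \<le> 4 * d"
proof -
 have 1: "degree (pderiv F) \<le> d" using assms(1) by (simp add: degree_pderiv)
 have "degree (num_u F k) \<le> (d + d) + d"
  unfolding num_u_def power2_eq_square
  by (intro degree_mult_le_trans 1) (use assms(2) in \<open>simp add: degree_monom_eq\<close>)
 thus ?thesis by simp
qed

lemma degree_num_v:
 assumes "degree F \<le> d" "degree W \<le> d" "k < d"
 shows "degree (num_v F W k) \<le> 4 * d"
proof -
 have 1: "degree (pderiv F) \<le> d" "degree (pderiv W) \<le> d" "degree (pderiv (pderiv F)) \<le> d"
  "degree (monom (1::complex) k) \<le> d" "degree (pderiv (monom (1::complex) k)) \<le> d"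
  using assms by (simp_all add: degree_pderiv degree_monom_eq)
 have "degree (pderiv F * W * pderiv (monom 1 k)) \<le> d + d + d"
  by (intro degree_mult_le_trans 1 assms)
 moreover have "degree ((pderiv F * pderiv W - W * pderiv (pderiv F)) * monom 1 k) \<le> d + d + d"
  by (intro degree_mult_le_trans degree_diff_le 1 assms)
 ultimately show ?thesis
  unfolding num_v_def by (intro degree_add_le) auto
qed

lemma sum_transport_coeff:
 assumes d: "1 \<le> d" and F: "degree F \<le> d" and W: "degree W \<le> d" and s: "poly F s = 0" and t: "poly F t = 0"
 shows "(\<Sum>a<d. \<Sum>b<d. transport_coeff F W d h h' a b * s ^ a * t ^ b) =
  coeff F d ^ (8 * d) * transport_num F W d h h' s t"
proof -
 let ?c = "%U. coeff (reduce d (4 * d) F U)"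
 have P: "(\<Sum>a<d. \<Sum>b<d. (x * (?c U a * ?c V b)) * (s ^ a * t ^ b)) =
   coeff F d ^ (8 * d) * (x * (poly U s * poly V t))"
  if "degree U \<le> 4 * d" "degree V \<le> 4 * d" for x U V
 proof -
  have "(\<Sum>a<d. \<Sum>b<d. (x * (?c U a * ?c V b)) * (s ^ a * t ^ b)) =
    x * (poly (reduce d (4 * d) F U) s * poly (reduce d (4 * d) F V) t)"
   unfolding poly_altdef_less[OF degree_reduce[OF d F]] unfolding sum_product unfolding sum_distrib_left
   by (intro sum.cong refl) (simp only: mult_ac)
  also have "\<dots> = x * ((coeff F d ^ (4 * d) * poly U s) * (coeff F d ^ (4 * d) * poly V t))"
   using poly_reduce[OF s that(1)] poly_reduce[OF t that(2)] by simp
  also have "\<dots> = coeff F d ^ (4 * d + 4 * d) * (x * (poly U s * poly V t))"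
   by (simp only: power_add mult_ac)
  finally show ?thesis by simp
 qed
 have "(\<Sum>a<d. \<Sum>b<d. transport_coeff F W d h h' a b * s ^ a * t ^ b) =
  (\<Sum>a<d. \<Sum>b<d. \<Sum>k<d. \<Sum>l<d.
   (h' k l * (?c (num_u F k) a * ?c (num_u F l) b)) * (s ^ a * t ^ b) -
   ((h k l * (?c (num_v F W k) a * ?c (num_u F l) b)) * (s ^ a * t ^ b) +
    (h k l * (?c (num_u F k) a * ?c (num_v F W l) b)) * (s ^ a * t ^ b)))"
  unfolding transport_coeff_def sum_distrib_right
  by (intro sum.cong refl) (simp only: algebra_simps)
 also have "\<dots> = (\<Sum>k<d. \<Sum>l<d. \<Sum>a<d. \<Sum>b<d.
   (h' k l * (?c (num_u F k) a * ?c (num_u F l) b)) * (s ^ a * t ^ b) -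
   ((h k l * (?c (num_v F W k) a * ?c (num_u F l) b)) * (s ^ a * t ^ b) +
    (h k l * (?c (num_u F k) a * ?c (num_v F W l) b)) * (s ^ a * t ^ b)))"
 proof -
  have sw: "(\<Sum>a<d. \<Sum>b<d. \<Sum>k<d. \<Sum>l<d. f a b k l) = (\<Sum>k<d. \<Sum>l<d. \<Sum>a<d. \<Sum>b<d. f a b k l)" for f :: "nat => nat => nat => nat => complex"
  proof -
   have "(\<Sum>a<d. \<Sum>b<d. \<Sum>k<d. \<Sum>l<d. f a b k l) = (\<Sum>a<d. \<Sum>k<d. \<Sum>l<d. \<Sum>b<d. f a b k l)"
   proof (rule sum.cong[OF refl])
    fix a
    have "(\<Sum>b<d. \<Sum>k<d. \<Sum>l<d. f a b k l) = (\<Sum>k<d. \<Sum>b<d. \<Sum>l<d. f a b k l)" by (rule sum.swap)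
    also have "\<dots> = (\<Sum>k<d. \<Sum>l<d. \<Sum>b<d. f a b k l)" by (rule sum.cong[OF refl]) (rule sum.swap)
    finally show "(\<Sum>b<d. \<Sum>k<d. \<Sum>l<d. f a b k l) = (\<Sum>k<d. \<Sum>l<d. \<Sum>b<d. f a b k l)" .
   qed
   also have "\<dots> = (\<Sum>k<d. \<Sum>a<d. \<Sum>l<d. \<Sum>b<d. f a b k l)" by (rule sum.swap)
   also have "\<dots> = (\<Sum>k<d. \<Sum>l<d. \<Sum>a<d. \<Sum>b<d. f a b k l)"
    by (rule sum.cong[OF refl]) (rule sum.swap)
   finally show ?thesis .
  qed
  show ?thesis by (rule sw)
 qed
 also have "\<dots> = (\<Sum>k<d. \<Sum>l<d.
   coeff F d ^ (8 * d) * (h' k l * (poly (num_u F k) s * poly (num_u F l) t)) -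
   (coeff F d ^ (8 * d) * (h k l * (poly (num_v F W k) s * poly (num_u F l) t)) +
    coeff F d ^ (8 * d) * (h k l * (poly (num_u F k) s * poly (num_v F W l) t))))"
  unfolding sum_subtractf sum.distrib
  by (intro arg_cong2[of _ _ _ _ "(-)"] arg_cong2[of _ _ _ _ "(+)"] sum.cong refl P degree_num_u degree_num_v F W) auto
 also have "\<dots> = coeff F d ^ (8 * d) * transport_num F W d h h' s t"
  unfolding transport_num_def sum_distrib_left
  by (intro sum.cong refl) (simp only: algebra_simps)
 finally show ?thesis .
qed

text \<open>
  A polynomial of degree below \<open>d\<close> in each variable is determined by its values on a
 \<open>d \<times> d\<close> grid.
\<close>

lemma grid_zero:
 assumes "finite S" "card S = d" "!!s t. s \<in> S ==> t \<in> S ==> (\<Sum>a<d. \<Sum>b<d. e a b * s ^ a * t ^ b) = (0::complex)"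
  "a < d" "b < d"
 shows "e a b = 0"
proof -
 have one: "g a = 0" if "!!s. s \<in> S ==> (\<Sum>a<d. g a * s ^ a) = 0" "a < d" for g :: "nat => complex" and a
 proof -
  define P where "P = (\<Sum>a<d. monom (g a) a)"
  have "degree P \<le> d - 1" unfolding P_def
   by (rule degree_sum_le) (auto intro: order_trans[OF degree_monom_le])
  hence "degree P < card S" using that(2) assms(2) by linarith
  moreover have "poly P s = poly 0 s" if "s \<in> S" for s
   using \<open>!!s. s \<in> S ==> (\<Sum>a<d. g a * s ^ a) = 0\<close>[OF that] by (simp add: P_def poly_sum poly_monom)
  ultimately have "P = 0" using assms(1) by (intro poly_eq_if_agree[of S]) auto
  moreover have "coeff P a = g a" using that(2) by (simp add: P_def coeff_sum coeff_monom)
  ultimately show ?thesis by simp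
 qed
 have "(\<Sum>b<d. e a b * t ^ b) = 0" if "t \<in> S" for t
 proof (rule one[OF _ assms(4), of "%a. \<Sum>b<d. e a b * t ^ b"])
  fix s assume "s \<in> S"
  thus "(\<Sum>a<d. (\<Sum>b<d. e a b * t ^ b) * s ^ a) = 0"
   using assms(3)[of s t] that by (simp add: sum_distrib_left mult_ac)
 qed
 thus ?thesis by (rule one[OF _ assms(5)])
qed

text \<open>
  The quotient rule for \<open>h a b / (u v)\<close>, with the velocities of the two roots
 inserted and denominators cleared.
\<close>

lemma transport_identity:
 fixes u v :: complex
 assumes S: "u * S' = - (wp * P' + wq * Q')" and T: "v * T' = - (xp * P' + xq * Q')"
 shows "u * v * (((hp * P' + hq * Q') * a0 * b0 + h * (a1 * S') * b0 + h * a0 * (b1 * T')) * (u * v)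
   - h * a0 * b0 * ((up * P' + uq * Q' + u2 * S') * v + u * (vp * P' + vq * Q' + v2 * T')))
  = (hp * (u\<^sup>2 * a0) * (v\<^sup>2 * b0) - h * ((u * wp * a1 + (u * up - wp * u2) * a0) * (v\<^sup>2 * b0)
     + (u\<^sup>2 * a0) * (v * xp * b1 + (v * vp - xp * v2) * b0))) * P'
  + (hq * (u\<^sup>2 * a0) * (v\<^sup>2 * b0) - h * ((u * wq * a1 + (u * uq - wq * u2) * a0) * (v\<^sup>2 * b0)
     + (u\<^sup>2 * a0) * (v * xq * b1 + (v * vq - xq * v2) * b0))) * Q'"
proof -
 have "u * v * (((hp * P' + hq * Q') * a0 * b0 + h * (a1 * S') * b0 + h * a0 * (b1 * T')) * (u * v)
   - h * a0 * b0 * ((up * P' + uq * Q' + u2 * S') * v + u * (vp * P' + vq * Q' + v2 * T')))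
  = (hp * P' + hq * Q') * a0 * b0 * u\<^sup>2 * v\<^sup>2 + h * a1 * b0 * u * v\<^sup>2 * (u * S') + h * a0 * b1 * u\<^sup>2 * v * (v * T')
   - h * a0 * b0 * (u * v\<^sup>2 * (up * P' + uq * Q') + u2 * v\<^sup>2 * (u * S') + u\<^sup>2 * v * (vp * P' + vq * Q') + u\<^sup>2 * v2 * (v * T'))"
  by (simp add: algebra_simps power2_eq_square)
 also have "\<dots> = (hp * (u\<^sup>2 * a0) * (v\<^sup>2 * b0) - h * ((u * wp * a1 + (u * up - wp * u2) * a0) * (v\<^sup>2 * b0)
     + (u\<^sup>2 * a0) * (v * xp * b1 + (v * vp - xp * v2) * b0))) * P'
  + (hq * (u\<^sup>2 * a0) * (v\<^sup>2 * b0) - h * ((u * wq * a1 + (u * uq - wq * u2) * a0) * (v\<^sup>2 * b0)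
     + (u\<^sup>2 * a0) * (v * xq * b1 + (v * vq - xq * v2) * b0))) * Q'"
  unfolding S T by (simp add: algebra_simps power2_eq_square)
 finally show ?thesis .
qed

text \<open>
  Along a motion of \<open>(p, q)\<close> under which \<open>s\<close> and \<open>t\<close> remain roots of \<open>F\<close>, the function
 \<open>H(s,t) / (F'(s) F'(t))\<close> varies by the transport numerators.
\<close>

lemma DERIV_pair_ratio:
 fixes h :: "nat => nat => cpoly2"
 assumes P: "(P has_field_derivative P') (at z)" and Q: "(Q has_field_derivative Q') (at z)"
  and S: "(S has_field_derivative S') (at z)" and T: "(T has_field_derivative T') (at z)"
  and Sz: "((%z. poly (at_pt F (P z) (Q z)) (S z)) has_field_derivative 0) (at z)"
  and Tz: "((%z. poly (at_pt F (P z) (Q z)) (T z)) has_field_derivative 0) (at z)"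
  and uS: "poly (pderiv (at_pt F (P z) (Q z))) (S z) ~= 0"
  and uT: "poly (pderiv (at_pt F (P z) (Q z))) (T z) ~= 0"
 shows "((%z. pair_value d (%k l. ev2 (h k l) (P z) (Q z)) (S z) (T z) /
    (poly (pderiv (at_pt F (P z) (Q z))) (S z) * poly (pderiv (at_pt F (P z) (Q z))) (T z)))
   has_field_derivative
   (transport_num (at_pt F (P z) (Q z)) (at_pt (diff_p F) (P z) (Q z)) d
     (%k l. ev2 (h k l) (P z) (Q z)) (%k l. ev2 (pderiv (h k l)) (P z) (Q z)) (S z) (T z) * P' +
    transport_num (at_pt F (P z) (Q z)) (at_pt (diff_q F) (P z) (Q z)) d
     (%k l. ev2 (h k l) (P z) (Q z)) (%k l. ev2 (map_poly pderiv (h k l)) (P z) (Q z)) (S z) (T z) * Q') /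
    (poly (pderiv (at_pt F (P z) (Q z))) (S z) * poly (pderiv (at_pt F (P z) (Q z))) (T z)) ^ 3) (at z)"
proof -
 let ?F = "at_pt F (P z) (Q z)" and ?Wp = "at_pt (diff_p F) (P z) (Q z)" and ?Wq = "at_pt (diff_q F) (P z) (Q z)"
 define u where "u = poly (pderiv ?F) (S z)"
 define v where "v = poly (pderiv ?F) (T z)"
 have S': "u * S' = - (poly ?Wp (S z) * P' + poly ?Wq (S z) * Q')"
  using DERIV_unique[OF DERIV_at_pt[OF P Q S] Sz] by (simp add: u_def add_eq_0_iff)
 have T': "v * T' = - (poly ?Wp (T z) * P' + poly ?Wq (T z) * Q')"
  using DERIV_unique[OF DERIV_at_pt[OF P Q T] Tz] by (simp add: v_def add_eq_0_iff)
 define du where "du = poly (pderiv ?Wp) (S z) * P' + poly (pderiv ?Wq) (S z) * Q' + poly (pderiv (pderiv ?F)) (S z) * S'"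
 define dv where "dv = poly (pderiv ?Wp) (T z) * P' + poly (pderiv ?Wq) (T z) * Q' + poly (pderiv (pderiv ?F)) (T z) * T'"
 have Du: "((%z. poly (pderiv (at_pt F (P z) (Q z))) (S z)) has_field_derivative du) (at z)"
  using DERIV_at_pt[OF P Q S, of "pderiv F"]
  by (simp add: du_def pderiv_at_pt diff_p_pderiv diff_q_pderiv)
 have Dv: "((%z. poly (pderiv (at_pt F (P z) (Q z))) (T z)) has_field_derivative dv) (at z)"
  using DERIV_at_pt[OF P Q T, of "pderiv F"]
  by (simp add: dv_def pderiv_at_pt diff_p_pderiv diff_q_pderiv)
 define dh where "dh k l = ev2 (pderiv (h k l)) (P z) (Q z) * P' + ev2 (map_poly pderiv (h k l)) (P z) (Q z) * Q'" for k l
 define pw where "pw s k = poly (pderiv (monom (1::complex) k)) s" for s k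
 have Dpw: "((%z. R z ^ k) has_field_derivative pw (R z) k * R') (at z)" if "(R has_field_derivative R') (at z)" for R R' k
  using DERIV_chain2[OF poly_DERIV that, of "monom 1 k"] by (simp add: pw_def poly_monom)
 define H where "H = pair_value d (%k l. ev2 (h k l) (P z) (Q z)) (S z) (T z)"
 define dH where "dH = (\<Sum>k<d. \<Sum>l<d. dh k l * S z ^ k * T z ^ l + ev2 (h k l) (P z) (Q z) * (pw (S z) k * S') * T z ^ l
    + ev2 (h k l) (P z) (Q z) * S z ^ k * (pw (T z) l * T'))"
 have DH: "((%z. pair_value d (%k l. ev2 (h k l) (P z) (Q z)) (S z) (T z)) has_field_derivative dH) (at z)"
  unfolding pair_value_def dH_def
  by (intro DERIV_sum, rule DERIV_cong[OF DERIV_mult'[OF DERIV_mult'[OF DERIV_ev2[OF P Q] Dpw[OF S]] Dpw[OF T]]])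
   (simp add: dh_def algebra_simps)
 have num: "u * v * (dH * (u * v) - H * (du * v + u * dv)) =
   transport_num ?F ?Wp d (%k l. ev2 (h k l) (P z) (Q z)) (%k l. ev2 (pderiv (h k l)) (P z) (Q z)) (S z) (T z) * P' +
   transport_num ?F ?Wq d (%k l. ev2 (h k l) (P z) (Q z)) (%k l. ev2 (map_poly pderiv (h k l)) (P z) (Q z)) (S z) (T z) * Q'"
  unfolding dH_def H_def pair_value_def transport_num_def sum_distrib_right sum_distrib_left
   sum_subtractf[symmetric] sum.distrib[symmetric]
 proof (intro sum.cong refl)
  fix k l
  show "u * v * ((dh k l * S z ^ k * T z ^ l + ev2 (h k l) (P z) (Q z) * (pw (S z) k * S') * T z ^ l +
      ev2 (h k l) (P z) (Q z) * S z ^ k * (pw (T z) l * T')) * (u * v) -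
     ev2 (h k l) (P z) (Q z) * S z ^ k * T z ^ l * (du * v + u * dv)) =
    (ev2 (pderiv (h k l)) (P z) (Q z) * poly (num_u ?F k) (S z) * poly (num_u ?F l) (T z) -
    ev2 (h k l) (P z) (Q z) * (poly (num_v ?F ?Wp k) (S z) * poly (num_u ?F l) (T z) +
     poly (num_u ?F k) (S z) * poly (num_v ?F ?Wp l) (T z))) * P' +
    (ev2 (map_poly pderiv (h k l)) (P z) (Q z) * poly (num_u ?F k) (S z) * poly (num_u ?F l) (T z) -
    ev2 (h k l) (P z) (Q z) * (poly (num_v ?F ?Wq k) (S z) * poly (num_u ?F l) (T z) +
     poly (num_u ?F k) (S z) * poly (num_v ?F ?Wq l) (T z))) * Q'"
   unfolding dh_def du_def dv_def
   by (rule trans[OF transport_identity[OF S' T']])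
    (simp add: num_u_def num_v_def poly_monom pw_def u_def v_def power2_eq_square)
 qed
 have nz: "u ~= 0" "v ~= 0" using uS uT by (simp_all add: u_def v_def)
 have quot: "((%z. pair_value d (%k l. ev2 (h k l) (P z) (Q z)) (S z) (T z) /
    (poly (pderiv (at_pt F (P z) (Q z))) (S z) * poly (pderiv (at_pt F (P z) (Q z))) (T z)))
   has_field_derivative (dH * (u * v) - H * (du * v + u * dv)) / ((u * v) * (u * v))) (at z)"
  unfolding H_def u_def v_def
  by (rule DERIV_cong[OF DERIV_divide[OF DH DERIV_mult'[OF Du Dv]]])
   (use uS uT in \<open>auto simp: algebra_simps\<close>)
 have "(dH * (u * v) - H * (du * v + u * dv)) / ((u * v) * (u * v)) =
   (u * v * (dH * (u * v) - H * (du * v + u * dv))) / (u * v) ^ 3"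
  using nz by (simp add: power3_eq_cube)
 thus ?thesis using quot unfolding num by (simp add: u_def v_def)
qed

section \<open>Solutions of the system for a Galois covering\<close>

text \<open>
  The coefficients of the transport numerators in the \<open>p\<close>- and the
 \<open>q\<close>-direction, after reduction modulo \<open>F\<close>.
\<close>

abbreviation Tp :: "cpoly3 => nat => (nat => nat => cpoly2) => complex => complex => nat => nat => complex" where
 "Tp F d h p q \<equiv> transport_coeff (at_pt F p q) (at_pt (diff_p F) p q) d
   (%k l. ev2 (h k l) p q) (%k l. ev2 (pderiv (h k l)) p q)"

abbreviation Tq :: "cpoly3 => nat => (nat => nat => cpoly2) => complex => complex => nat => nat => complex" where
 "Tq F d h p q \<equiv> transport_coeff (at_pt F p q) (at_pt (diff_q F) p q) d
   (%k l. ev2 (h k l) p q) (%k l. ev2 (map_poly pderiv (h k l)) p q)"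

text \<open>
  The unknowns are the coefficients \<open>h k l\<close> of a polynomial \<open>H(s,t)\<close>.
 The conditions say that \<open>H(s,t) / (F'(s) F'(t))\<close> is constant along the
 \<open>(p,q)\<close>-plane for any two roots \<open>s\<close>, \<open>t\<close> of
 \<open>F\<close>, and that \<open>H\<close> is symmetric or antisymmetric. They are linear in
 \<open>h\<close>, with coefficients polynomial in those of \<open>F\<close>, and make sense for
 every form.
\<close>

definition is_sol ::
 "cpoly3 => nat => complex => (nat => nat => cpoly2) => bool" where
 "is_sol F d eps h \<longleftrightarrow>
   (\<forall>k<d. \<forall>l<d. \<forall>p q. ev2 (h k l) p q = eps * ev2 (h l k) p q) &
   (\<forall>a<d. \<forall>b<d. \<forall>p q.
    Tp F d h p q a b = 0 &
    Tq F d h p q a b = 0)"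

lemma power_rem_polyfam:
 assumes "function_algebra A" "polyfam A F"
 shows "polyfam A (%x. power_rem d (F x) m)"
proof (induction m)
 case 0
 thus ?case by (simp add: polyfam_const[OF assms(1)])
next
 case (Suc m)
 thus ?case
  unfolding power_rem.simps
  by (intro polyfam_intros[OF assms(1)] polyfam_coeff assms function_algebra_const[OF assms(1)])
qed

lemma reduce_polyfam:
 assumes "function_algebra A" "polyfam A F" "polyfam A U"
 shows "polyfam A (%x. reduce d M (F x) (U x))"
 unfolding reduce_def
 by (intro polyfam_sum[OF assms(1)] polyfam_smult[OF assms(1)] power_rem_polyfam assms
   function_algebra_mult[OF assms(1)] function_algebra_power[OF assms(1)] polyfam_coeff)

lemma transport_coeff_function_algebra:
 assumes A: "function_algebra A" and F: "polyfam A F" and W: "polyfam A W"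
  and "!!k l. h k l \<in> A" "!!k l. h' k l \<in> A"
 shows "(%x. transport_coeff (F x) (W x) d (%k l. h k l x) (%k l. h' k l x) a b) \<in> A"
proof -
 have "polyfam A (%x. num_u (F x) k)" for k
  unfolding num_u_def by (intro polyfam_intros[OF A] F)
 moreover have "polyfam A (%x. num_v (F x) (W x) k)" for k
  unfolding num_v_def by (intro polyfam_intros[OF A] F W)
 ultimately show ?thesis
  unfolding transport_coeff_def
  by (intro function_algebra_sum[OF A] function_algebra_diff[OF A] function_algebra_add[OF A]
    function_algebra_mult[OF A] polyfam_coeff reduce_polyfam A F assms)
qed

lemma gen_near:
 assumes "eventually P gen"
 shows "\<forall>\<^sub>F X in gen. (\<forall>\<^sub>F u in nhds (fst X). P (u, snd X)) & (\<forall>\<^sub>F v in nhds (snd X). P (fst X, v))"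
proof -
 obtain D where D: "D ~= 0" "!!x y. ev2 D x y ~= 0 ==> P (x, y)"
  using assms unfolding eventually_gen by blast
 have "(\<forall>\<^sub>F u in nhds x. P (u, y)) & (\<forall>\<^sub>F v in nhds y. P (x, v))" if "ev2 D x y ~= 0" for x y
 proof
  have "open {u. ev2 D u y ~= 0}" "open {v. ev2 D x v ~= 0}"
   by (intro open_Collect_neq continuous_ev2 continuous_intros)+
  hence "\<forall>\<^sub>F u in nhds x. u \<in> {u. ev2 D u y ~= 0}" "\<forall>\<^sub>F v in nhds y. v \<in> {v. ev2 D x v ~= 0}"
   using that by (intro eventually_nhds_in_open; simp)+
  thus "\<forall>\<^sub>F u in nhds x. P (u, y)" "\<forall>\<^sub>F v in nhds y. P (x, v)"
   using D(2) by (auto elim: eventually_mono)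
 qed
 thus ?thesis using D(1) unfolding eventually_gen by auto
qed

lemma has_partials_cong_all:
 assumes "\<forall>\<^sub>F X in gen. f X = g X"
 shows "\<forall>\<^sub>F X in gen. \<forall>a b. has_partials f a b X \<longleftrightarrow> has_partials g a b X"
 using gen_near[OF assms]
proof eventually_elim
 case (elim X)
 show ?case
  unfolding has_partials_def
  by (intro allI arg_cong2[of _ _ _ _ "(\<and>)"] DERIV_cong_ev refl) (use elim in auto)
qed

lemma has_partials_const: "has_partials (%_. c) 0 0 X"
 by (simp add: has_partials_def)

lemma gen_partials_zero:
 assumes "\<forall>\<^sub>F X in gen. g X = c"
 shows "\<forall>\<^sub>F X in gen. has_partials g 0 0 X"
 using has_partials_cong_all[OF assms] by eventually_elim (simp add: has_partials_const)

lemma simple_roots: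
 fixes f :: "complex poly"
 assumes "f ~= 0" "degree f \<le> d" "finite S" "card S = d" "!!s. s \<in> S ==> poly f s = 0" "s \<in> S"
 shows "poly (pderiv f) s ~= 0"
proof
 assume z: "poly (pderiv f) s = 0"
 obtain g where g: "f = [:-s, 1:] * g" using assms(5)[OF assms(6)] by (auto simp: poly_eq_0_iff_dvd)
 have "g ~= 0" using assms(1) g by auto
 have "poly g s = 0" using z unfolding g by (simp add: pderiv_mult pderiv_pCons del: mult_pCons_left)
 hence sub: "S \<subseteq> {x. poly g x = 0}" using assms(5) g by auto
 have "degree f = degree [:-s, 1:] + degree g" unfolding g using \<open>g ~= 0\<close> by (intro degree_mult_eq) auto
 hence "degree g < d" using assms(2) by simp
 moreover have "card S \<le> card {x. poly g x = 0}"
  using sub poly_roots_finite[OF \<open>g ~= 0\<close>] by (rule card_mono[rotated])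
 ultimately show False using card_poly_roots_bound[OF \<open>g ~= 0\<close>] assms(4) by linarith
qed

text \<open>The coefficients of \<open>F(s) / (s - \<rho>)\<close> at a root \<open>\<rho>\<close>.\<close>

definition cofactor :: "complex poly => nat => complex => complex" where
 "cofactor F k \<rho> = poly (poly_shift (Suc k) F) \<rho>"

lemma poly_shift_rec: "poly (poly_shift k F) \<rho> = coeff F k + \<rho> * cofactor F k \<rho>"
proof -
 have "poly_shift k F = pCons (coeff F k) (poly_shift (Suc k) F)"
  by (rule poly_eqI) (simp add: coeff_poly_shift coeff_pCons split: nat.split)
 thus ?thesis by (simp add: cofactor_def)
qed

lemma cofactor_eq_0: "degree F \<le> d ==> d \<le> k ==> cofactor F k \<rho> = 0"
proof -
 assume "degree F \<le> d" "d \<le> k"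
 hence "poly_shift (Suc k) F = 0"
  by (intro poly_eqI) (simp add: coeff_poly_shift coeff_eq_0)
 thus ?thesis by (simp add: cofactor_def)
qed

lemma cofactor_quotient:
 assumes "poly F \<rho> = 0" "degree F \<le> d"
 shows "F = [:-\<rho>, 1:] * (\<Sum>k<d. monom (cofactor F k \<rho>) k)"
proof (rule poly_eqI)
 fix n
 define G where "G = (\<Sum>k<d. monom (cofactor F k \<rho>) k)"
 have G: "coeff G k = cofactor F k \<rho>" for k
  using cofactor_eq_0[OF assms(2)] by (auto simp: G_def coeff_sum coeff_monom not_less)
 show "coeff F n = coeff ([:-\<rho>, 1:] * (\<Sum>k<d. monom (cofactor F k \<rho>) k)) n"
 proof (cases n)
  case 0
  thus ?thesis using poly_shift_rec[of 0 F \<rho>] assms(1)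
   by (simp add: G flip: G_def) (simp add: add_eq_0_iff)
 next
  case (Suc m)
  thus ?thesis using poly_shift_rec[of "Suc m" F \<rho>]
   by (simp add: G cofactor_def[of F m] flip: G_def)
 qed
qed

text \<open>
  With the next lemma: the cofactors at the roots are, up to the factors
  \<open>F'(\<rho>)\<close>, the basis dual to the powers of the roots.
\<close>

lemma sum_cofactor_other:
 assumes "poly F \<rho> = 0" "degree F \<le> d" "poly F s = 0" "s ~= \<rho>"
 shows "(\<Sum>k<d. cofactor F k \<rho> * s ^ k) = 0"
proof -
 have "poly F s = (s - \<rho>) * (\<Sum>k<d. cofactor F k \<rho> * s ^ k)"
  using arg_cong[OF cofactor_quotient[OF assms(1,2)], of "%f. poly f s"]
  by (simp add: poly_sum poly_monom algebra_simps)
 thus ?thesis using assms(3,4) by simp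
qed

lemma sum_cofactor_self:
 assumes "poly F \<rho> = 0" "degree F \<le> d"
 shows "(\<Sum>k<d. cofactor F k \<rho> * \<rho> ^ k) = poly (pderiv F) \<rho>"
proof -
 define G where "G = (\<Sum>k<d. monom (cofactor F k \<rho>) k)"
 have "F = [:-\<rho>, 1:] * G" using cofactor_quotient[OF assms] by (simp add: G_def)
 hence "pderiv F = pderiv ([:-\<rho>, 1:] * G)" by simp
 hence "poly (pderiv F) \<rho> = poly G \<rho>"
  by (simp add: pderiv_mult pderiv_pCons del: mult_pCons_left)
 thus ?thesis by (simp add: G_def poly_sum poly_monom)
qed

text \<open>
  The two expressions for a cofactor, in nonnegative and in negative powers of the root, bound it
  by the coefficients of \<open>F\<close> although the root itself may be large.
\<close>

lemma norm_cofactor_le: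
 assumes "poly F \<rho> = 0" "degree F \<le> d"
 shows "norm (cofactor F k \<rho>) \<le> (\<Sum>j\<le>d. norm (coeff F j))"
proof (cases "k < d")
 case False
 thus ?thesis using cofactor_eq_0[OF assms(2), of k \<rho>] by (simp add: sum_nonneg)
next
 case k: True
 show ?thesis
 proof (cases "norm \<rho> \<le> 1")
  case True
  have deg: "degree (poly_shift (Suc k) F) \<le> d - Suc k"
   by (rule degree_le) (use assms(2) k in \<open>simp add: coeff_poly_shift coeff_eq_0\<close>)
  have "cofactor F k \<rho> = (\<Sum>i\<le>d - Suc k. coeff F (i + Suc k) * \<rho> ^ i)"
   unfolding cofactor_def poly_altdef_ge[OF deg] by (simp add: coeff_poly_shift)
  also have "norm \<dots> \<le> (\<Sum>i\<le>d - Suc k. norm (coeff F (i + Suc k)))"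
   using True by (intro order_trans[OF norm_sum] sum_mono)
    (simp add: norm_mult norm_power mult_left_le power_le_one)
  also have "\<dots> = (\<Sum>j\<in>(%i. i + Suc k) ` {..d - Suc k}. norm (coeff F j))"
   by (subst sum.reindex) (auto simp: inj_on_def)
  also have "\<dots> \<le> (\<Sum>j\<le>d. norm (coeff F j))"
   by (rule sum_mono2) (use k in auto)
  finally show ?thesis .
 next
  case False
  hence nz: "norm \<rho> > 1" by simp
  have split: "poly F \<rho> = (\<Sum>j\<le>m. coeff F j * \<rho> ^ j) + \<rho> ^ Suc m * cofactor F m \<rho>" for m
  proof (induction m)
   case 0
   thus ?case using poly_shift_rec[of 0 F \<rho>] by simp
  next
   case (Suc m)
   have "cofactor F m \<rho> = coeff F (Suc m) + \<rho> * cofactor F (Suc m) \<rho>"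
    using poly_shift_rec[of "Suc m" F \<rho>] by (simp add: cofactor_def[of F m])
   thus ?case using Suc by (simp add: algebra_simps)
  qed
  have "norm \<rho> ^ Suc k * norm (cofactor F k \<rho>) = norm (\<Sum>j\<le>k. coeff F j * \<rho> ^ j)"
   using split[of k] assms(1) by (metis add_eq_0_iff norm_minus_cancel norm_mult norm_power)
  also have "\<dots> \<le> (\<Sum>j\<le>k. norm (coeff F j) * norm \<rho> ^ Suc k)"
   using nz by (intro order_trans[OF norm_sum] sum_mono)
    (auto simp: norm_mult norm_power simp del: power_Suc intro!: mult_left_mono power_increasing)
  also have "\<dots> = norm \<rho> ^ Suc k * (\<Sum>j\<le>k. norm (coeff F j))"
   by (simp add: sum_distrib_left mult_ac)
  also have "\<dots> \<le> norm \<rho> ^ Suc k * (\<Sum>j\<le>d. norm (coeff F j))"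
   using k nz by (intro mult_left_mono sum_mono2) auto
  finally have le: "norm \<rho> ^ Suc k * norm (cofactor F k \<rho>) \<le> norm \<rho> ^ Suc k * (\<Sum>j\<le>d. norm (coeff F j))" .
  have "0 < norm \<rho> ^ Suc k" using nz by (intro zero_less_power) linarith
  with le show ?thesis by (simp only: mult_le_cancel_left_pos)
 qed
qed

section \<open>The tangency polynomial of a foliation\<close>

definition line_coords :: "complex => complex => 3 => complex poly" where
 "line_coords p q = vec3 [:0, 1:] [:q, p:] 1"

definition on_line :: "complex => complex => cpol => complex poly" where
 "on_line p q e = mpol_eval (%c. [:c:]) (line_coords p q) e"

definition line_coords_univ :: "3 => cpoly3" where
 "line_coords_univ = vec3 [:0, 1:] [:[:[:0, 1:]:], [:0, 1:]:] 1"

text \<open>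
  On the line \<open>y = p x + q\<close> with parameter \<open>s = x\<close>, the form \<open>a dx + b dy + c dz\<close> restricts to
 \<open>(a + p b) ds\<close>; the roots of this polynomial in \<open>s\<close> are the points of tangency.
\<close>

definition tangency :: "form => cpoly3" where
 "tangency \<omega> = mpol_eval (%c. [:[:[:c:]:]:]) line_coords_univ (\<omega> $ 1) +
   [:[:0, 1:]:] * mpol_eval (%c. [:[:[:c:]:]:]) line_coords_univ (\<omega> $ 2)"

lemma comm_ring_hom_const_poly: "comm_ring_hom (%c. [:c:])"
 by (simp add: comm_ring_hom_def)

lemma comm_ring_hom_poly: "comm_ring_hom (%p. poly p x)"
 by (simp add: comm_ring_hom_def)

lemma at_pt_add: "at_pt (F + G) p q = at_pt F p q + at_pt G p q"
 by (rule poly_eqI) (simp add: coeff_at_pt)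

lemma at_pt_mult: "at_pt (F * G) p q = at_pt F p q * at_pt G p q"
 by (rule poly_eqI) (simp add: coeff_at_pt coeff_mult ev2_sum)

lemma comm_ring_hom_at_pt: "comm_ring_hom (%F. at_pt F p q)"
 by (simp add: comm_ring_hom_def at_pt_add at_pt_mult one_pCons at_pt_pCons)

lemma comm_ring_hom_on_line: "comm_ring_hom (on_line p q)"
 unfolding on_line_def[abs_def] by (rule comm_ring_hom_mpol_eval[OF comm_ring_hom_const_poly])

lemma at_pt_tangency: "at_pt (tangency \<omega>) p q = on_line p q (\<omega> $ 1) + [:p:] * on_line p q (\<omega> $ 2)"
proof -
 have "(%F. at_pt F p q) \<circ> (%c. [:[:[:c:]:]:]) = (%c. [:c:])"
  by (simp add: fun_eq_iff at_pt_pCons)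
 moreover have "(%F. at_pt F p q) \<circ> line_coords_univ = line_coords p q"
  by (simp add: line_coords_univ_def line_coords_def comp_vec3 at_pt_pCons one_pCons)
 ultimately have "at_pt (mpol_eval (%c. [:[:[:c:]:]:]) line_coords_univ e) p q = on_line p q e" for e
  using mpol_eval_commute[OF comm_ring_hom_at_pt[of p q], of "%c. [:[:[:c:]:]:]" line_coords_univ e]
  by (simp add: on_line_def)
 hence "at_pt (tangency \<omega>) p q = on_line p q (\<omega> $ 1) + at_pt [:[:0, 1:]:] p q * on_line p q (\<omega> $ 2)"
  by (simp only: tangency_def at_pt_add at_pt_mult)
 thus ?thesis by (simp add: at_pt_pCons)
qed

lemma poly_on_line: "poly (on_line p q e) s = ev (vec3 s (p * s + q) 1) e"
proof -
 have "(%f. poly f s) \<circ> (%c. [:c:]) = id" by (simp add: fun_eq_iff)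
 moreover have "(%f. poly f s) \<circ> line_coords p q = vec3 s (p * s + q) 1"
  by (simp add: line_coords_def comp_vec3 algebra_simps)
 ultimately show ?thesis
  using mpol_eval_commute[OF comm_ring_hom_poly[of s], of "%c. [:c:]" "line_coords p q" e]
  by (simp add: on_line_def)
qed

lemma poly_tangency:
 "poly (at_pt (tangency \<omega>) p q) s =
   ev (vec3 s (p * s + q) 1) (\<omega> $ 1) + p * ev (vec3 s (p * s + q) 1) (\<omega> $ 2)"
 by (simp add: at_pt_tangency poly_on_line)

lemma
 assumes "homogeneous n e"
 shows degree_on_line: "degree (on_line p q e) \<le> n"
  and lead_on_line: "coeff (on_line p q e) n = ev (vec3 1 p 0) e"
proof -
 have mv: "coeff (monom_value (line_coords p q) t) m =
   (if m < lookup t 1 then 0 else coeff ([:q, p:] ^ lookup t 2) (m - lookup t 1))" for t m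
 proof -
  have "[:0, 1:] ^ k = (monom 1 k :: complex poly)" for k
   by (simp add: monom_altdef)
  hence "monom_value (line_coords p q) t = monom 1 (lookup t 1) * [:q, p:] ^ lookup t 2"
   by (simp add: monom_value_3 line_coords_def)
  thus ?thesis by (simp add: coeff_monom_mult)
 qed
 have c: "coeff (on_line p q e) m = (\<Sum>t\<in>keys e. lookup e t * coeff (monom_value (line_coords p q) t) m)" for m
  by (simp add: on_line_def mpol_eval_def coeff_sum)
 show "degree (on_line p q e) \<le> n"
 proof (rule degree_le, intro allI impI)
  fix m assume m: "n < m"
  show "coeff (on_line p q e) m = 0"
   unfolding c
  proof (rule sum.neutral, rule ballI)
   fix t assume "t \<in> keys e"
   hence "monom_degree t = n" using assms by (simp add: homogeneous_def)
   moreover have "degree ([:q, p:] ^ lookup t 2) \<le> lookup t 2"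
    by (rule order_trans[OF degree_power_le]) simp
   ultimately have "coeff (monom_value (line_coords p q) t) m = 0"
    using m by (auto simp: mv monom_degree_3 intro!: coeff_eq_0)
   thus "lookup e t * coeff (monom_value (line_coords p q) t) m = 0" by simp
  qed
 qed
 show "coeff (on_line p q e) n = ev (vec3 1 p 0) e"
  unfolding c mpol_eval_def
 proof (rule sum.cong[OF refl])
  fix t assume "t \<in> keys e"
  hence t: "monom_degree t = n" using assms by (simp add: homogeneous_def)
  have deg: "degree ([:q, p:] ^ lookup t 2) \<le> lookup t 2"
   by (rule order_trans[OF degree_power_le]) simp
  have "coeff (monom_value (line_coords p q) t) n = monom_value (vec3 1 p 0) t"
  proof (cases "lookup t 3 = 0")
   case True
   hence "n = lookup t 1 + lookup t 2" using t by (simp add: monom_degree_3)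
   thus ?thesis unfolding mv using True by (simp add: coeff_linear_poly_power monom_value_3)
  next
   case False
   hence "lookup t 2 < n - lookup t 1" using t by (simp add: monom_degree_3)
   with deg show ?thesis unfolding mv using False by (simp add: coeff_eq_0 monom_value_3)
  qed
  thus "lookup e t * coeff (monom_value (line_coords p q) t) n = id (lookup e t) * monom_value (vec3 1 p 0) t"
   by simp
 qed
qed

lemma forms_homogeneous: "\<omega> \<in> forms d ==> homogeneous (d + 1) (\<omega> $ i)"
 by (simp add: forms_def)

lemma forms_relation: "\<omega> \<in> forms d ==> \<omega> $ 1 * mvar 1 + \<omega> $ 2 * mvar 2 + \<omega> $ 3 * mvar 3 = 0"
 by (simp add: forms_def sum_3)

lemma forms_relation_ev:
 assumes "\<omega> \<in> forms d"
 shows "ev v (\<omega> $ 1) * v 1 + ev v (\<omega> $ 2) * v 2 + ev v (\<omega> $ 3) * v 3 = 0"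
 using arg_cong[OF forms_relation[OF assms], of "ev v"] by simp

lemma tangency_shift:
 assumes "\<omega> \<in> forms d"
 shows "pCons 0 (at_pt (tangency \<omega>) p q) = - ([:q:] * on_line p q (\<omega> $ 2) + on_line p q (\<omega> $ 3))"
proof -
 have "on_line p q (\<omega> $ 1 * mvar 1 + \<omega> $ 2 * mvar 2 + \<omega> $ 3 * mvar 3) = 0"
  using forms_relation[OF assms] comm_ring_homD(1)[OF comm_ring_hom_on_line] by metis
 hence "on_line p q (\<omega> $ 1) * [:0, 1:] + on_line p q (\<omega> $ 2) * [:q, p:] + on_line p q (\<omega> $ 3) = 0"
  using mpol_eval_mvar[OF comm_ring_hom_const_poly, of "line_coords p q", folded on_line_def]
  by (simp add: comm_ring_homD[OF comm_ring_hom_on_line] line_coords_def)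
 note rel = this
 show ?thesis
 proof (intro poly_eq_poly_eq_iff[THEN iffD1] ext)
  fix s
  have "poly (on_line p q (\<omega> $ 1)) s * s + poly (on_line p q (\<omega> $ 2)) s * (q + s * p) + poly (on_line p q (\<omega> $ 3)) s = 0"
   using arg_cong[OF rel, of "%f. poly f s"] by (simp add: algebra_simps)
  hence "s * (poly (on_line p q (\<omega> $ 1)) s + p * poly (on_line p q (\<omega> $ 2)) s)
    = - (q * poly (on_line p q (\<omega> $ 2)) s + poly (on_line p q (\<omega> $ 3)) s)" by algebra
  thus "poly (pCons 0 (at_pt (tangency \<omega>) p q)) s = poly (- ([:q:] * on_line p q (\<omega> $ 2) + on_line p q (\<omega> $ 3))) s"
   by (simp add: at_pt_tangency)
 qed
qed

lemma degree_at_pt_tangency: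
 assumes "\<omega> \<in> forms d"
 shows "degree (at_pt (tangency \<omega>) p q) \<le> d"
proof -
 have "degree (- ([:q:] * on_line p q (\<omega> $ 2) + on_line p q (\<omega> $ 3))) \<le> d + 1"
  unfolding degree_minus
  by (intro degree_add_le order_trans[OF degree_mult_le]) (use degree_on_line[OF forms_homogeneous[OF assms]] in auto)
 hence "degree (pCons 0 (at_pt (tangency \<omega>) p q)) \<le> d + 1"
  unfolding tangency_shift[OF assms] .
 thus ?thesis by (simp split: if_splits)
qed

lemma degree_tangency:
 assumes "\<omega> \<in> forms d"
 shows "degree (tangency \<omega>) \<le> d"
proof (rule degree_le, intro allI impI)
 fix i assume i: "d < i"
 show "coeff (tangency \<omega>) i = 0"
 proof (rule ev2_zero_imp_zero)
  fix p q
  show "ev2 (coeff (tangency \<omega>) i) p q = 0"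
   using i degree_at_pt_tangency[OF assms, of p q] by (simp add: coeff_eq_0 flip: coeff_at_pt)
 qed
qed

lemma lead_tangency:
 assumes "\<omega> \<in> forms d"
 shows "coeff (at_pt (tangency \<omega>) p q) d = - (q * ev (vec3 1 p 0) (\<omega> $ 2) + ev (vec3 1 p 0) (\<omega> $ 3))"
proof -
 have "coeff (at_pt (tangency \<omega>) p q) d = coeff (pCons 0 (at_pt (tangency \<omega>) p q)) (d + 1)" by simp
 also have "\<dots> = - (q * ev (vec3 1 p 0) (\<omega> $ 2) + ev (vec3 1 p 0) (\<omega> $ 3))"
  unfolding tangency_shift[OF assms]
  using lead_on_line[OF forms_homogeneous[OF assms]] by simp
 finally show ?thesis .
qed

text \<open>A form that vanishes identically on the line at infinity is divisible by \<open>z\<close>.\<close>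

lemma mvar_dvd_if_zero:
 fixes e :: cpol
 assumes "!!x y. ev (vec3 x y 0) e = 0"
 shows "mvar 3 dvd e"
proof -
 define e0 where "e0 = (\<Sum>t\<in>{t\<in>keys e. lookup t 3 = 0}. Poly_Mapping.single t (lookup e t))"
 define e1 where "e1 = (\<Sum>t\<in>{t\<in>keys e. lookup t 3 ~= 0}. Poly_Mapping.single t (lookup e t))"
 have e: "e = e0 + e1"
 proof -
  have "e = (\<Sum>t\<in>{t\<in>keys e. lookup t 3 = 0} \<union> {t\<in>keys e. lookup t 3 ~= 0}. Poly_Mapping.single t (lookup e t))"
   by (subst mpol_expand[of e], rule sum.cong) auto
  also have "\<dots> = e0 + e1" unfolding e0_def e1_def by (rule sum.union_disjoint) auto
  finally show ?thesis .
 qed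
 have "mvar 3 dvd e1"
  unfolding e1_def
 proof (rule dvd_sum)
  fix t assume "t \<in> {t\<in>keys e. lookup t 3 ~= 0}"
  hence "Poly_Mapping.single 3 1 + (t - Poly_Mapping.single 3 1) = t"
   by (intro poly_mapping_eqI) (auto simp: lookup_add lookup_minus lookup_single when_def)
  hence "Poly_Mapping.single t (lookup e t) = mvar 3 * Poly_Mapping.single (t - Poly_Mapping.single 3 1) (lookup e t)"
   by (simp add: mvar_def mult_single)
  thus "mvar 3 dvd Poly_Mapping.single t (lookup e t)" by simp
 qed
 moreover have "e0 = 0"
 proof (rule ev_zero_imp_zero)
  fix v :: "3 => complex"
  have s: "ev w e0 = (\<Sum>t\<in>{t\<in>keys e. lookup t 3 = 0}. lookup e t * monom_value w t)" for w
   unfolding e0_def by (simp only: mpol_eval_sum mpol_eval_single)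
  have s1: "ev w e1 = (\<Sum>t\<in>{t\<in>keys e. lookup t 3 ~= 0}. lookup e t * monom_value w t)" for w
   unfolding e1_def by (simp only: mpol_eval_sum mpol_eval_single)
  have "ev v e0 = ev (vec3 (v 1) (v 2) 0) e0"
   unfolding s by (intro sum.cong) (auto simp: monom_value_3)
  also have "\<dots> = ev (vec3 (v 1) (v 2) 0) e - ev (vec3 (v 1) (v 2) 0) e1"
   using arg_cong[OF e, of "ev (vec3 (v 1) (v 2) 0)"] by simp
  also have "ev (vec3 (v 1) (v 2) 0) e1 = 0"
   unfolding s1 by (intro sum.neutral) (auto simp: monom_value_3)
  finally show "ev v e0 = 0" by (simp only: assms diff_self)
 qed
 ultimately show ?thesis using e by simp
qed

lemma mvar_not_unit: "\<not> mvar 3 dvd (1 :: cpol)"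
proof
 assume "mvar 3 dvd (1 :: cpol)"
 then obtain k where "1 = mvar 3 * (k :: cpol)" by blast
 from arg_cong[OF this, of "ev (%_. 0)"] show False by simp
qed

text \<open>
  The coefficient of \<open>s\<^sup>d\<close> is a combination of the values of \<open>b\<close>
 and \<open>c\<close> at the point at infinity of the line; it vanishes for all lines only if the
 line at infinity is a common factor.
\<close>

lemma lead_tangency_nonzero:
 assumes w: "\<omega> \<in> forms d" and ncf: "no_common_factor \<omega>"
 shows "coeff (tangency \<omega>) d ~= 0"
proof
 assume z: "coeff (tangency \<omega>) d = 0"
 have "q * ev (vec3 1 p 0) (\<omega> $ 2) + ev (vec3 1 p 0) (\<omega> $ 3) = 0" for p q
  using lead_tangency[OF w, of p q, unfolded coeff_at_pt z ev2_simps(1)] by (metis neg_equal_0_iff_equal)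
 from this[of 0] this[of 1] have b: "ev (vec3 1 p 0) (\<omega> $ 2) = 0" and c: "ev (vec3 1 p 0) (\<omega> $ 3) = 0" for p
  by simp_all
 have a: "ev (vec3 1 p 0) (\<omega> $ 1) = 0" for p
  using forms_relation_ev[OF w, of "vec3 1 p 0"] b c by simp
 have one: "ev (vec3 1 p 0) (\<omega> $ i) = 0" for p i
  using a b c exhaust_3[of i] by auto
 have nz: "ev (vec3 x y 0) (\<omega> $ i) = 0" if "x ~= 0" for x y i
 proof -
  have "vec3 x y 0 = (%k. x * vec3 1 (y / x) 0 k)" using that by (auto simp: vec3_def)
  thus ?thesis using ev_homogeneous[OF forms_homogeneous[OF w]] one by simp
 qed
 have "ev (vec3 x y 0) (\<omega> $ i) = 0" for x y i
 proof -
  define f where "f = mpol_eval (%c. [:c:]) (vec3 [:0, 1:] [:y:] 0) (\<omega> $ i)"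
  have f: "poly f x = ev (vec3 x y 0) (\<omega> $ i)" for x
  proof -
   have "(%f. poly f x) \<circ> (%c. [:c:]) = id" by (simp add: fun_eq_iff)
   thus ?thesis
    using mpol_eval_commute[OF comm_ring_hom_poly[of x], of "%c. [:c:]" "vec3 [:0, 1:] [:y:] 0" "\<omega> $ i"]
    by (simp add: f_def comp_vec3)
  qed
  have "- {0} \<subseteq> {x. poly f x = 0}" using nz f by auto
  moreover have "infinite (- {0::complex})" using infinite_UNIV_char_0[where 'a = complex] by (simp add: finite_compl)
  ultimately have "f = 0" using poly_roots_finite[of f] infinite_super by blast
  thus ?thesis using f[of x] by simp
 qed
 hence "mvar 3 dvd \<omega> $ i" for i by (intro mvar_dvd_if_zero)
 thus False using ncf mvar_not_unit unfolding no_common_factor_def by blast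
qed

lemma finite_monomials: "finite {t :: 3 \<Rightarrow>\<^sub>0 nat. monom_degree t = n}"
proof (rule finite_imageD)
 let ?g = "%t. (lookup t 1, lookup t 2, lookup t (3 :: 3))"
 show "finite (?g ` {t. monom_degree t = n})"
  by (rule finite_subset[of _ "{..n} \<times> {..n} \<times> {..n}"]) (auto simp: monom_degree_3)
 show "inj_on ?g {t. monom_degree t = n}" by (auto intro!: inj_onI lookup_3_eqI)
qed

lemma tangency_expand:
 assumes "\<omega> \<in> forms d"
 shows "tangency \<omega> = (\<Sum>t\<in>{t. monom_degree t = d + 1}.
  [:[:[:coords \<omega> (1, t):]:]:] * monom_value line_coords_univ t +
  [:[:[:coords \<omega> (2, t):]:]:] * ([:[:0, 1:]:] * monom_value line_coords_univ t))"
proof -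
 have "mpol_eval (%c. [:[:[:c:]:]:]) line_coords_univ (\<omega> $ i) =
   (\<Sum>t\<in>{t. monom_degree t = d + 1}. [:[:[:coords \<omega> (i, t):]:]:] * monom_value line_coords_univ t)" for i
  unfolding coords_def prod.case
  by (rule mpol_eval_superset) (use finite_monomials forms_homogeneous[OF assms, of i] in \<open>auto simp: homogeneous_def\<close>)
 thus ?thesis
  by (simp only: tangency_def sum.distrib sum_distrib_left mult.left_commute)
qed

lemma ev2_coeff_tangency:
 assumes "\<omega> \<in> forms d"
 shows "ev2 (coeff (tangency \<omega>) j) p q = (\<Sum>t\<in>{t. monom_degree t = d + 1}.
  coords \<omega> (1, t) * ev2 (coeff (monom_value line_coords_univ t) j) p q +
  coords \<omega> (2, t) * ev2 (coeff ([:[:0, 1:]:] * monom_value line_coords_univ t) j) p q)"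
proof -
 have "coeff ([:[:[:c:]:]:] * f) j = [:[:c:]:] * coeff f j" for c and f :: "cpoly3" by simp
 moreover have "ev2 ([:[:c:]:] * f) p q = c * ev2 f p q" for c f by (simp add: ev2_def)
 ultimately show ?thesis
  unfolding tangency_expand[OF assms] coeff_sum coeff_add ev2_sum ev2_simps(3) by (simp only:)
qed

lemma polyfam_tangency:
 "polyfam {f. polyfun d f} (%\<omega>. at_pt (tangency \<omega>) p q)"
 "polyfam {f. polyfun d f} (%\<omega>. at_pt (diff_p (tangency \<omega>)) p q)"
 "polyfam {f. polyfun d f} (%\<omega>. at_pt (diff_q (tangency \<omega>)) p q)"
proof -
 have lin: "polyfun d (%\<omega>. \<Sum>t\<in>{t. monom_degree t = d + 1}. coords \<omega> (1, t) * g t + coords \<omega> (2, t) * g' t)" for g g'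
  by (intro polyfun_sum polyfun_add polyfun_mult polyfun_coords polyfun_const)
 show "polyfam {f. polyfun d f} (%\<omega>. at_pt (tangency \<omega>) p q)"
  unfolding polyfam_def coeff_at_pt mem_Collect_eq
  by (intro allI, rule polyfun_cong[OF lin], rule ev2_coeff_tangency[symmetric])
 have c: "coeff ([:[:[:c:]:]:] * f) j = [:[:c:]:] * coeff f j" for c j and f :: "cpoly3" by simp
 have p1: "pderiv ([:[:c:]:] * f) = [:[:c:]:] * pderiv f" for c and f :: "cpoly2"
  by (simp add: pderiv_smult)
 have p2: "map_poly pderiv ([:[:c:]:] * f) = [:[:c:]:] * map_poly pderiv f" for c and f :: "cpoly2"
  by (rule poly_eqI) (simp add: coeff_map_poly pderiv_smult)
 have p3: "map_poly pderiv (f + g) = map_poly pderiv f + map_poly pderiv g" for f g :: "cpoly2"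
  by (rule poly_eqI) (simp add: coeff_map_poly pderiv_add)
 have p4: "map_poly pderiv (\<Sum>t\<in>T. f t) = (\<Sum>t\<in>T. map_poly pderiv (f t))" for T and f :: "'z => cpoly2"
  by (induction T rule: infinite_finite_induct) (simp_all add: p3)
 have p5: "pderiv (\<Sum>t\<in>T. f t) = (\<Sum>t\<in>T. pderiv (f t))" for T and f :: "'z => cpoly2"
  by (induction T rule: infinite_finite_induct) (simp_all add: pderiv_add)
 have e: "ev2 ([:[:c:]:] * f) p q = c * ev2 f p q" for c f by (simp add: ev2_def)
 show "polyfam {f. polyfun d f} (%\<omega>. at_pt (diff_p (tangency \<omega>)) p q)"
  unfolding polyfam_def coeff_at_pt mem_Collect_eq
 proof
  fix j
  have "ev2 (coeff (diff_p (tangency \<omega>)) j) p q = (\<Sum>t\<in>{t. monom_degree t = d + 1}.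
   coords \<omega> (1, t) * ev2 (pderiv (coeff (monom_value line_coords_univ t) j)) p q +
   coords \<omega> (2, t) * ev2 (pderiv (coeff ([:[:0, 1:]:] * monom_value line_coords_univ t) j)) p q)"
   if "\<omega> \<in> forms d" for \<omega>
   unfolding tangency_expand[OF that] coeff_diff_p coeff_sum coeff_add c p5 pderiv_add p1 ev2_sum ev2_simps(3) e ..
  thus "polyfun d (%\<omega>. ev2 (coeff (diff_p (tangency \<omega>)) j) p q)"
   by (intro polyfun_cong[OF lin]) (rule sym)
 qed
 show "polyfam {f. polyfun d f} (%\<omega>. at_pt (diff_q (tangency \<omega>)) p q)"
  unfolding polyfam_def coeff_at_pt mem_Collect_eq
 proof
  fix j
  have "ev2 (coeff (diff_q (tangency \<omega>)) j) p q = (\<Sum>t\<in>{t. monom_degree t = d + 1}.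
   coords \<omega> (1, t) * ev2 (map_poly pderiv (coeff (monom_value line_coords_univ t) j)) p q +
   coords \<omega> (2, t) * ev2 (map_poly pderiv (coeff ([:[:0, 1:]:] * monom_value line_coords_univ t) j)) p q)"
   if "\<omega> \<in> forms d" for \<omega>
   unfolding tangency_expand[OF that] coeff_diff_q coeff_sum coeff_add c p4 p3 p2 ev2_sum ev2_simps(3) e ..
  thus "polyfun d (%\<omega>. ev2 (coeff (diff_q (tangency \<omega>)) j) p q)"
   by (intro polyfun_cong[OF lin]) (rule sym)
 qed
qed

text \<open>The exponent of growth of the coefficients depends on the degree alone.\<close>

lemma tangency_growth:
 "\<exists>n. \<forall>\<omega>\<in>forms d. \<exists>C. \<forall>p q. (\<Sum>j\<le>d. norm (coeff (at_pt (tangency \<omega>) p q) j)) \<le> C * ((1 + norm p) * (1 + norm q)) ^ n"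
proof -
 let ?T = "{t :: 3 \<Rightarrow>\<^sub>0 nat. monom_degree t = d + 1}"
 define G where "G = (\<Union>t\<in>?T. \<Union>j\<in>{..d}. {coeff (monom_value line_coords_univ t) j, coeff ([:[:0, 1:]:] * monom_value line_coords_univ t) j})"
 have "finite G" unfolding G_def using finite_monomials by auto
 have "\<forall>f\<in>G. \<exists>n0. \<forall>n\<ge>n0. \<exists>C\<ge>0. \<forall>p q. norm (ev2 f p q) \<le> C * ((1 + norm p) * (1 + norm q)) ^ n"
  using ev2_growth by blast
 from bchoice[OF this] obtain n0 where
  n0: "!!f n. f \<in> G ==> n \<ge> n0 f ==> \<exists>C\<ge>0. \<forall>p q. norm (ev2 f p q) \<le> C * ((1 + norm p) * (1 + norm q)) ^ n" by blast
 define n where "n = (\<Sum>f\<in>G. n0 f)"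
 have "\<forall>f\<in>G. \<exists>C. C \<ge> 0 & (\<forall>p q. norm (ev2 f p q) \<le> C * ((1 + norm p) * (1 + norm q)) ^ n)"
  using n0 \<open>finite G\<close> by (auto simp: n_def member_le_sum)
 from bchoice[OF this] obtain K where
  K: "!!f p q. f \<in> G ==> norm (ev2 f p q) \<le> K f * ((1 + norm p) * (1 + norm q)) ^ n" by blast
 show ?thesis
 proof (rule exI[of _ n], rule ballI)
  fix \<omega> assume w: "\<omega> \<in> forms d"
  let ?f = "%t j. coeff (monom_value line_coords_univ t) j"
  let ?g = "%t j. coeff ([:[:0, 1:]:] * monom_value line_coords_univ t) j"
  define B where "B = (\<Sum>j\<le>d. \<Sum>t\<in>?T. norm (coords \<omega> (1, t)) * K (?f t j) + norm (coords \<omega> (2, t)) * K (?g t j))"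
  have "(\<Sum>j\<le>d. norm (coeff (at_pt (tangency \<omega>) p q) j)) \<le> B * ((1 + norm p) * (1 + norm q)) ^ n" for p q
  proof -
   let ?w = "((1 + norm p) * (1 + norm q)) ^ n"
   have "norm (coeff (at_pt (tangency \<omega>) p q) j) \<le> (\<Sum>t\<in>?T. (norm (coords \<omega> (1, t)) * K (?f t j) + norm (coords \<omega> (2, t)) * K (?g t j)) * ?w)"
    if j: "j \<in> {..d}" for j
    unfolding coeff_at_pt ev2_coeff_tangency[OF w]
   proof (intro order_trans[OF norm_sum] sum_mono order_trans[OF norm_triangle_ineq])
    fix t :: "3 \<Rightarrow>\<^sub>0 nat" assume t: "t \<in> ?T"
    have fg: "?f t j \<in> G" "?g t j \<in> G" unfolding G_def using t j by blast+
    have "norm (coords \<omega> (1, t)) * norm (ev2 (?f t j) p q) \<le> norm (coords \<omega> (1, t)) * (K (?f t j) * ?w)"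
     "norm (coords \<omega> (2, t)) * norm (ev2 (?g t j) p q) \<le> norm (coords \<omega> (2, t)) * (K (?g t j) * ?w)"
     by (intro mult_left_mono K fg norm_ge_zero)+
    thus "norm (coords \<omega> (1, t) * ev2 (?f t j) p q) + norm (coords \<omega> (2, t) * ev2 (?g t j) p q)
     \<le> (norm (coords \<omega> (1, t)) * K (?f t j) + norm (coords \<omega> (2, t)) * K (?g t j)) * ?w"
     unfolding norm_mult by (simp only: distrib_right mult.assoc add_mono)
   qed
   thus ?thesis unfolding B_def sum_distrib_right by (rule sum_mono)
  qed
  thus "\<exists>C. \<forall>p q. (\<Sum>j\<le>d. norm (coeff (at_pt (tangency \<omega>) p q) j)) \<le> C * ((1 + norm p) * (1 + norm q)) ^ n"
   by blast
 qed
qed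


section \<open>Values of rational functions at generic points\<close>

lemma mconst_1 [simp]: "mconst 1 = (1 :: ('v, complex) mpol)"
 by (rule comm_ring_homD(2)[OF comm_ring_hom_mconst])

definition pt :: "complex \<times> complex => 3 => complex" where
 "pt X = vec3 (fst X) (snd X) 1"

text \<open>
  A rational function may be undefined at a point for one of its fractions and defined for
  another; all fractions that are defined there have the same value.
\<close>

definition fdef :: "cpol fract => complex \<times> complex => bool" where
 "fdef f X \<longleftrightarrow> (\<exists>P Q. f = Fract P Q & ev (pt X) Q ~= 0)"

definition fval :: "cpol fract => complex \<times> complex => complex" where
 "fval f X = (SOME w. \<exists>P Q. f = Fract P Q & ev (pt X) Q ~= 0 & w = ev (pt X) P / ev (pt X) Q)"

lemma ev_nonzero: "ev v Q ~= 0 ==> Q ~= 0"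
 by auto

lemma fval_Fract:
 assumes "ev (pt X) Q ~= 0"
 shows "fval (Fract P Q) X = ev (pt X) P / ev (pt X) Q"
proof -
 have "\<exists>w. \<exists>P' Q'. Fract P Q = Fract P' Q' & ev (pt X) Q' ~= 0 & w = ev (pt X) P' / ev (pt X) Q'"
  using assms by blast
 from someI_ex[OF this] obtain P' Q' where *: "Fract P Q = Fract P' Q'" "ev (pt X) Q' ~= 0"
  "fval (Fract P Q) X = ev (pt X) P' / ev (pt X) Q'"
  unfolding fval_def by blast
 have "P * Q' = P' * Q"
  using *(1) ev_nonzero[OF assms] ev_nonzero[OF *(2)] by (simp add: eq_fract)
 from arg_cong[OF this, of "ev (pt X)"] show ?thesis
  unfolding *(3) using *(2) assms by (simp add: frac_eq_eq)
qed

lemma fdef_Fract: "ev (pt X) Q ~= 0 ==> fdef (Fract P Q) X"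
 unfolding fdef_def by blast

lemma fdefE:
 assumes "fdef f X"
 obtains P Q where "f = Fract P Q" "ev (pt X) Q ~= 0" "Q ~= 0" "fval f X = ev (pt X) P / ev (pt X) Q"
 using assms fval_Fract ev_nonzero unfolding fdef_def by metis

lemma fval_add:
 assumes "fdef f X" "fdef g X"
 shows "fdef (f + g) X & fval (f + g) X = fval f X + fval g X"
 using assms by (auto elim!: fdefE simp: fval_Fract fdef_Fract add_frac_eq)

lemma fval_mult:
 assumes "fdef f X" "fdef g X"
 shows "fdef (f * g) X & fval (f * g) X = fval f X * fval g X"
 using assms by (auto elim!: fdefE simp: fval_Fract fdef_Fract)

lemma fval_const: "fdef (Fract (mconst c) 1) X & fval (Fract (mconst c) 1) X = c"
 by (simp add: fval_Fract fdef_Fract)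

lemma fval_0: "fdef 0 X & fval 0 X = 0"
 using fval_const[of 0 X] by (simp add: mconst_def Zero_fract_def)

lemma fval_1: "fdef 1 X & fval 1 X = 1"
 using fval_const[of 1 X] by (simp add: One_fract_def)

lemma fval_sum: "(!!i. i \<in> I ==> fdef (f i) X) ==> fdef (\<Sum>i\<in>I. f i) X & fval (\<Sum>i\<in>I. f i) X = (\<Sum>i\<in>I. fval (f i) X)"
 by (induction I rule: infinite_finite_induct) (auto simp: fval_0 fval_add)

lemma fval_prod: "(!!i. i \<in> I ==> fdef (f i) X) ==> fdef (\<Prod>i\<in>I. f i) X & fval (\<Prod>i\<in>I. f i) X = (\<Prod>i\<in>I. fval (f i) X)"
 by (induction I rule: infinite_finite_induct) (auto simp: fval_1 fval_mult)

lemma fval_power: "fdef f X ==> fdef (f ^ n) X & fval (f ^ n) X = fval f X ^ n"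
 by (induction n) (auto simp: fval_1 fval_mult)

lemma fval_uminus: "fdef f X ==> fdef (- f) X & fval (- f) X = - fval f X"
 by (auto elim!: fdefE simp: fval_Fract fdef_Fract)

lemma fval_diff: "fdef f X ==> fdef g X ==> fdef (f - g) X & fval (f - g) X = fval f X - fval g X"
 using fval_add[of f X "- g"] fval_uminus[of g X] by simp

lemma fval_has_partials:
 assumes "fdef f X"
 shows "\<exists>a b. has_partials (fval f) a b X"
proof -
 obtain P Q where f: "f = Fract P Q" "ev (pt X) Q ~= 0" using assms unfolding fdef_def by blast
 obtain x y where X: "X = (x, y)" by (cases X)
 have evq: "ev (pt (u, v)) R = ev2 (in_plane R) u v" for u v R by (simp add: pt_def ev2_in_plane)
 have nz: "ev2 (in_plane Q) x y ~= 0" using f(2) X evq by simp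
 have val: "fval f (u, v) = ev2 (in_plane P) u v / ev2 (in_plane Q) u v" if "ev2 (in_plane Q) u v ~= 0" for u v
  using fval_Fract[of "(u, v)" Q P] that evq f(1) by simp
 have "open {u. ev2 (in_plane Q) u y ~= 0}" "open {v. ev2 (in_plane Q) x v ~= 0}"
  by (intro open_Collect_neq continuous_ev2 continuous_intros)+
 hence n1: "\<forall>\<^sub>F u in nhds x. u \<in> {u. ev2 (in_plane Q) u y ~= 0}" and n2: "\<forall>\<^sub>F v in nhds y. v \<in> {v. ev2 (in_plane Q) x v ~= 0}"
  using nz by (intro eventually_nhds_in_open; simp)+
 have D1: "\<exists>a. ((%u. ev2 (in_plane P) u y / ev2 (in_plane Q) u y) has_field_derivative a) (at x)"
  using DERIV_divide[OF DERIV_ev2[OF DERIV_ident DERIV_const] DERIV_ev2[OF DERIV_ident DERIV_const] nz] by blast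
 have D2: "\<exists>b. ((%v. ev2 (in_plane P) x v / ev2 (in_plane Q) x v) has_field_derivative b) (at y)"
  using DERIV_divide[OF DERIV_ev2[OF DERIV_const DERIV_ident] DERIV_ev2[OF DERIV_const DERIV_ident] nz] by blast
 have "\<exists>a. ((%u. fval f (u, y)) has_field_derivative a) (at x)"
  using D1 DERIV_cong_ev[OF refl eventually_mono[OF n1] refl, of "%u. fval f (u, y)" "%u. ev2 (in_plane P) u y / ev2 (in_plane Q) u y"] val
  by simp
 moreover have "\<exists>b. ((%v. fval f (x, v)) has_field_derivative b) (at y)"
  using D2 DERIV_cong_ev[OF refl eventually_mono[OF n2] refl, of "%v. fval f (x, v)" "%v. ev2 (in_plane P) x v / ev2 (in_plane Q) x v"] val
  by simp
 ultimately show ?thesis unfolding has_partials_def X by auto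
qed

definition is_subfield :: "'a::field set => bool" where
 "is_subfield S \<longleftrightarrow> 0 \<in> S & 1 \<in> S & (\<forall>x\<in>S. \<forall>y\<in>S. x + y \<in> S & x * y \<in> S) &
   (\<forall>x\<in>S. - x \<in> S & inverse x \<in> S)"

lemma is_subfieldD:
 assumes "is_subfield S"
 shows "0 \<in> S" "1 \<in> S" "x \<in> S ==> y \<in> S ==> x + y \<in> S" "x \<in> S ==> y \<in> S ==> x * y \<in> S"
  "x \<in> S ==> - x \<in> S" "x \<in> S ==> inverse x \<in> S"
  "x \<in> S ==> y \<in> S ==> x - y \<in> S" "x \<in> S ==> y \<in> S ==> x / y \<in> S"
 using assms unfolding is_subfield_def by (auto simp: divide_inverse) (metis diff_conv_add_uminus)

lemma is_subfield_sum: "is_subfield S ==> (!!i. i \<in> I ==> f i \<in> S) ==> (\<Sum>i\<in>I. f i) \<in> S"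
 by (induction I rule: infinite_finite_induct) (auto simp: is_subfieldD)

lemma is_subfield_prod: "is_subfield S ==> (!!i. i \<in> I ==> f i \<in> S) ==> (\<Prod>i\<in>I. f i) \<in> S"
 by (induction I rule: infinite_finite_induct) (auto simp: is_subfieldD)

lemma is_subfield_power: "is_subfield S ==> x \<in> S ==> x ^ n \<in> S"
 by (induction n) (auto simp: is_subfieldD)

abbreviation "LL \<equiv> plane_function_field"

lemma LL_I: "homogeneous m P ==> homogeneous m Q ==> Q ~= 0 ==> Fract P Q \<in> LL"
 unfolding plane_function_field_def by blast

lemma LL_E:
 assumes "f \<in> LL"
 obtains P Q m where "f = Fract P Q" "homogeneous m P" "homogeneous m Q" "Q ~= 0"
 using assms unfolding plane_function_field_def by blast

lemma LL_const: "Fract (mconst c) 1 \<in> LL"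
 by (rule LL_I[of 0]) (auto simp: homogeneous_mconst homogeneous_1)

lemma LL_0: "0 \<in> LL"
 using LL_const[of 0] by (simp add: mconst_def Zero_fract_def)

lemma sub_LL: "is_subfield LL"
 unfolding is_subfield_def
proof (intro conjI ballI)
 show "0 \<in> LL" by (rule LL_0)
 show "1 \<in> LL" using LL_const[of 1] by (simp add: One_fract_def)
 fix f g assume "f \<in> LL" "g \<in> LL"
 then obtain P Q m P' Q' m' where fg: "f = Fract P Q" "homogeneous m P" "homogeneous m Q" "Q ~= 0"
  "g = Fract P' Q'" "homogeneous m' P'" "homogeneous m' Q'" "Q' ~= 0" by (elim LL_E)
 thus "f + g \<in> LL" "f * g \<in> LL"
  by (auto intro!: LL_I[of "m + m'"] homogeneous_add intro: homogeneous_mult homogeneous_mult[of m' _ m, unfolded add.commute[of m' m]])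
next
 fix f assume "f \<in> LL"
 then obtain P Q m where f: "f = Fract P Q" "homogeneous m P" "homogeneous m Q" "Q ~= 0" by (elim LL_E)
 thus "- f \<in> LL" by (auto intro!: LL_I[of m] homogeneous_uminus)
 show "inverse f \<in> LL"
 proof (cases "P = 0")
  case True
  hence "inverse f = 0" unfolding f(1) by (simp add: fract_collapse)
  thus ?thesis using LL_0 by metis
 qed (use f in \<open>auto intro!: LL_I[of m]\<close>)
qed

lemma gen_ev_nonzero: "homogeneous m Q ==> Q ~= 0 ==> \<forall>\<^sub>F X in gen. ev (pt X) Q ~= 0"
 using eventually_genI[of "in_plane Q"] by (simp add: in_plane_eq_0_iff ev2_in_plane pt_def)

lemma gen_fdef: "f \<in> LL ==> \<forall>\<^sub>F X in gen. fdef f X"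
proof (elim LL_E)
 fix P Q m assume f: "f = Fract P Q" "homogeneous m Q" "Q ~= 0"
 from gen_ev_nonzero[OF f(2,3)] show "\<forall>\<^sub>F X in gen. fdef f X"
  unfolding f(1) by eventually_elim (rule fdef_Fract)
qed

lemma LL_eqI:
 assumes "f \<in> LL" "g \<in> LL" "\<forall>\<^sub>F X in gen. fval f X = fval g X"
 shows "f = g"
proof -
 obtain P Q m P' Q' m' where fg: "f = Fract P Q" "homogeneous m P" "homogeneous m Q" "Q ~= 0"
  "g = Fract P' Q'" "homogeneous m' P'" "homogeneous m' Q'" "Q' ~= 0"
  using assms(1,2) by (elim LL_E)
 have "\<forall>\<^sub>F X in gen. ev2 (in_plane (P * Q')) (fst X) (snd X) = ev2 (in_plane (P' * Q)) (fst X) (snd X)"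
  using assms(3) gen_ev_nonzero[OF fg(3,4)] gen_ev_nonzero[OF fg(7,8)]
  by eventually_elim (simp add: fg fval_Fract ev2_in_plane pt_def field_simps)
 hence "in_plane (P * Q') = in_plane (P' * Q)" by (rule gen_ev2_eq_imp_eq)
 hence "P * Q' = P' * Q"
  by (intro homogeneous_eqI[of "m + m'"] homogeneous_mult[OF fg(2,7)] homogeneous_mult[OF fg(6,3), unfolded add.commute[of m' m]])
   (metis ev2_in_plane)
 thus ?thesis using fg by (simp add: eq_fract)
qed

lemma gen_fval_nonzero: "f \<in> LL ==> f ~= 0 ==> \<forall>\<^sub>F X in gen. fval f X ~= 0"
proof (elim LL_E)
 fix P Q m assume "f ~= 0" and f: "f = Fract P Q" "homogeneous m P" "homogeneous m Q" "Q ~= 0"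
 hence "P ~= 0" by (auto simp: fract_collapse)
 from gen_ev_nonzero[OF f(3,4)] gen_ev_nonzero[OF f(2) this]
 show "\<forall>\<^sub>F X in gen. fval f X ~= 0" by eventually_elim (simp add: f fval_Fract)
qed

lemma gen_fval_neq:
 assumes "f \<in> LL" "g \<in> LL" "f ~= g"
 shows "\<forall>\<^sub>F X in gen. fval f X ~= fval g X"
proof -
 have "f - g \<in> LL" "f - g ~= 0" using assms is_subfieldD(7)[OF sub_LL] by auto
 from gen_fval_nonzero[OF this] gen_fdef[OF assms(1)] gen_fdef[OF assms(2)]
 show ?thesis by eventually_elim (simp add: fval_diff)
qed

lemma compose_hom: "comm_ring_hom (%p. compose_form p \<omega>)"
 unfolding compose_form_def by (rule comm_ring_hom_mpol_eval[OF comm_ring_hom_mconst])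

lemma ev_compose_form: "ev v (compose_form p \<omega>) = ev (%i. ev v (\<omega> $ i)) p"
 unfolding compose_form_def by (rule ev_compose)

lemma gauss_I: "homogeneous m P ==> homogeneous m Q ==> compose_form Q \<omega> ~= 0 ==>
  Fract (compose_form P \<omega>) (compose_form Q \<omega>) \<in> gauss_subfield \<omega>"
 unfolding gauss_subfield_def by blast

lemma gauss_E:
 assumes "f \<in> gauss_subfield \<omega>"
 obtains P Q m where "f = Fract (compose_form P \<omega>) (compose_form Q \<omega>)" "homogeneous m P" "homogeneous m Q"
  "compose_form Q \<omega> ~= 0"
 using assms unfolding gauss_subfield_def by blast

lemma gauss_const: "Fract (mconst c) 1 \<in> gauss_subfield \<omega>"
proof -
 have "compose_form (mconst c) \<omega> = mconst c" "compose_form 1 \<omega> = 1"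
  using comm_ring_homD(2)[OF compose_hom[of \<omega>]]
  by (simp_all add: compose_form_def mpol_eval_mconst[OF comm_ring_hom_mconst])
 thus ?thesis using gauss_I[OF homogeneous_mconst homogeneous_1, of \<omega> c] by simp
qed

lemma gauss_0: "0 \<in> gauss_subfield \<omega>"
 using gauss_const[of 0] by (simp add: mconst_def Zero_fract_def)

lemma subfield_gauss: "is_subfield (gauss_subfield \<omega>)"
 unfolding is_subfield_def
proof (intro conjI ballI)
 show "0 \<in> gauss_subfield \<omega>" by (rule gauss_0)
 show "1 \<in> gauss_subfield \<omega>" using gauss_const[of 1] by (simp add: One_fract_def)
 fix f g assume "f \<in> gauss_subfield \<omega>" "g \<in> gauss_subfield \<omega>"
 then obtain P Q m P' Q' m' where fg: "f = Fract (compose_form P \<omega>) (compose_form Q \<omega>)" "homogeneous m P" "homogeneous m Q" "compose_form Q \<omega> ~= 0"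
  "g = Fract (compose_form P' \<omega>) (compose_form Q' \<omega>)" "homogeneous m' P'" "homogeneous m' Q'" "compose_form Q' \<omega> ~= 0"
  by (elim gauss_E)
 note hom = comm_ring_homD[OF compose_hom, symmetric]
 have "f + g = Fract (compose_form (P * Q' + P' * Q) \<omega>) (compose_form (Q * Q') \<omega>)"
  "f * g = Fract (compose_form (P * P') \<omega>) (compose_form (Q * Q') \<omega>)"
  using fg by (simp_all add: comm_ring_homD[OF compose_hom])
 moreover have "compose_form (Q * Q') \<omega> ~= 0" using fg by (simp add: comm_ring_homD[OF compose_hom])
 moreover have "homogeneous (m + m') (P * Q' + P' * Q)"
  by (intro homogeneous_add homogeneous_mult[OF fg(2,7)] homogeneous_mult[OF fg(6,3), unfolded add.commute[of m' m]])
 moreover have "homogeneous (m + m') (P * P')" "homogeneous (m + m') (Q * Q')"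
  using fg by (auto intro: homogeneous_mult)
 ultimately show "f + g \<in> gauss_subfield \<omega>" "f * g \<in> gauss_subfield \<omega>"
  using gauss_I by metis+
next
 fix f assume "f \<in> gauss_subfield \<omega>"
 then obtain P Q m where f: "f = Fract (compose_form P \<omega>) (compose_form Q \<omega>)" "homogeneous m P" "homogeneous m Q" "compose_form Q \<omega> ~= 0"
  by (elim gauss_E)
 have "compose_form (- P) \<omega> = - compose_form P \<omega>"
  using comm_ring_homD(3)[OF compose_hom[of \<omega>], of P "- P"] comm_ring_homD(1)[OF compose_hom] by (simp add: add_eq_0_iff)
 hence "- f = Fract (compose_form (- P) \<omega>) (compose_form Q \<omega>)" using f by simp
 thus "- f \<in> gauss_subfield \<omega>" using gauss_I[OF homogeneous_uminus[OF f(2)] f(3,4)] by simp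
 show "inverse f \<in> gauss_subfield \<omega>"
 proof (cases "compose_form P \<omega> = 0")
  case True
  hence "inverse f = 0" unfolding f(1) by (simp add: fract_collapse)
  thus ?thesis using gauss_0 by metis
 next
  case False
  thus ?thesis using gauss_I[OF f(3,2) False] f by simp
 qed
qed

lemma gauss_subset_LL:
 assumes "\<omega> \<in> forms d"
 shows "gauss_subfield \<omega> \<subseteq> LL"
proof
 fix f assume "f \<in> gauss_subfield \<omega>"
 then obtain P Q m where f: "f = Fract (compose_form P \<omega>) (compose_form Q \<omega>)" "homogeneous m P" "homogeneous m Q" "compose_form Q \<omega> ~= 0"
  by (elim gauss_E)
 have "homogeneous (m * (d + 1)) (compose_form R \<omega>)" if "homogeneous m R" for R
  unfolding compose_form_def by (rule homogeneous_compose[OF that forms_homogeneous[OF assms]])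
 thus "f \<in> LL" unfolding f(1) using f(2-4) by (intro LL_I) auto
qed

declare mvar_neq_0 [simp]

section \<open>Lines that avoid the singular points\<close>

text \<open>
  An element of least degree in the ideal of \<open>A\<close> and \<open>B\<close> divides both up
 to factors from \<open>\<complex>[y]\<close>, by pseudo-division; Gauss's lemma makes its
 primitive part a common divisor.
\<close>

lemma eliminate_outer_variable:
 fixes A B :: "cpoly2"
 assumes "!!p. p dvd A ==> p dvd B ==> p dvd 1"
 shows "\<exists>U V r. r ~= 0 & U * A + V * B = [:r:]"
proof -
 define I where "I = {U * A + V * B | U V. True}"
 have I_mult: "f * g \<in> I" if g: "g \<in> I" for f g
 proof -
  obtain U V where "g = U * A + V * B" using g unfolding I_def by blast
  hence "f * g = (f * U) * A + (f * V) * B" by (simp add: algebra_simps)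
  thus ?thesis unfolding I_def by blast
 qed
 have I_diff: "f - g \<in> I" if fg: "f \<in> I" "g \<in> I" for f g
 proof -
  obtain U V U' V' where "f = U * A + V * B" "g = U' * A + V' * B" using fg unfolding I_def by blast
  hence "f - g = (U - U') * A + (V - V') * B" by (simp add: algebra_simps)
  thus ?thesis unfolding I_def by blast
 qed
 have AI: "A \<in> I" and BI: "B \<in> I"
  unfolding I_def by (auto intro: exI[of _ 1] exI[of _ 0])
 have "A ~= 0 \<or> B ~= 0"
 proof (rule ccontr)
  assume "\<not> ?thesis"
  hence "(0 :: cpoly2) dvd 1" using assms[of 0] by simp
  thus False by simp
 qed
 hence "\<exists>G. G \<in> I & G ~= 0" using AI BI by blast
 then obtain G where G: "G \<in> I" "G ~= 0" and min: "!!H. H \<in> I ==> H ~= 0 ==> degree G \<le> degree H"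
  using ex_has_least_nat[of "%G. G \<in> I & G ~= 0" _ degree] by blast
 have div: "\<exists>a q. a ~= 0 & smult a H = G * q" if H: "H \<in> I" for H
 proof -
  obtain a q where a: "a ~= 0" "smult a H = G * q + pseudo_mod H G"
   using pseudo_mod(1)[OF G(2), of H] by blast
  have "pseudo_mod H G = [:a:] * H - q * G" using a(2) by (simp add: algebra_simps)
  hence "pseudo_mod H G \<in> I" using I_diff I_mult H G(1) by metis
  hence "pseudo_mod H G = 0"
   using min[of "pseudo_mod H G"] pseudo_mod(2)[OF G(2), of H] by linarith
  thus ?thesis using a by auto
 qed
 have "degree G = 0"
 proof (rule ccontr)
  assume deg: "degree G ~= 0"
  define P where "P = primitive_part G"
  have P: "content P = 1" "P dvd G" "degree P = degree G"
   using G(2) by (auto simp: P_def) (metis dvd_smult content_times_primitive_part dvd_refl)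
  have "P dvd H" if H: "H \<in> I" for H
  proof -
   obtain a q where a: "a ~= 0" "smult a H = G * q" using div[OF H] by blast
   hence "P dvd smult a H" using P(2) by simp
   hence "fract_poly P dvd fract_poly (smult a H)"
    by (metis dvdE dvdI fract_poly_mult)
   hence "fract_poly P dvd fract_poly H"
    using a(1) by (simp add: fract_poly_smult dvd_smult_iff)
   thus ?thesis using P(1) by (rule fract_poly_dvdD)
  qed
  hence "P dvd 1" using assms AI BI by blast
  thus False using deg P(3) by (auto elim: is_unit_polyE)
 qed
 then obtain r where "G = [:r:]" by (metis degree_eq_zeroE)
 moreover obtain U V where "G = U * A + V * B" using G(1) unfolding I_def by blast
 ultimately show ?thesis using G(2) by (metis pCons_0_0)
qed

lemma finite_common_zeros:
 fixes A B :: "cpoly2"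
 assumes cop: "!!p. p dvd A ==> p dvd B ==> p dvd 1"
 shows "finite {(x, y). ev2 A x y = 0 & ev2 B x y = 0}"
proof -
 obtain U V r where r: "r ~= 0" "U * A + V * B = [:r:]" using eliminate_outer_variable[OF cop] by blast
 have fin_y: "finite {y. poly r y = 0}" using r(1) by (rule poly_roots_finite)
 have y: "poly r y = 0" if "ev2 A x y = 0" "ev2 B x y = 0" for x y
  using arg_cong[OF r(2), of "%f. ev2 f x y"] that by simp
 have fin_x: "finite {x. ev2 A x y = 0 & ev2 B x y = 0}" for y
 proof (cases "slice A y = 0 & slice B y = 0")
  case True
  have "[:[:-y, 1:]:] dvd f" if "slice f y = 0" for f
  proof -
   have "poly (coeff f i) y = 0" for i
    using arg_cong[OF that, of "%p. coeff p i"] by (simp add: slice_def coeff_map_poly)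
   thus ?thesis by (simp add: const_poly_dvd_iff poly_eq_0_iff_dvd)
  qed
  hence "[:[:-y, 1:]:] dvd 1" using True cop by blast
  hence False by (simp add: is_unit_const_poly_iff is_unit_poly_iff)
  thus ?thesis ..
 next
  case False
  hence "finite {x. poly (slice A y) x = 0} \<or> finite {x. poly (slice B y) x = 0}"
   using poly_roots_finite by blast
  thus ?thesis unfolding poly_slice by (rule disjE) (auto elim: rev_finite_subset)
 qed
 have "{(x, y). ev2 A x y = 0 & ev2 B x y = 0} \<subseteq>
   (\<Union>y\<in>{y. poly r y = 0}. (%x. (x, y)) ` {x. ev2 A x y = 0 & ev2 B x y = 0})"
  using y by auto
 thus ?thesis by (rule finite_subset) (use fin_y fin_x in auto)
qed

lemma generic_line_avoids_finite:
 assumes "finite (Z :: (complex \<times> complex) set)"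
 shows "\<forall>\<^sub>F X in gen. \<forall>(x, y)\<in>Z. y ~= fst X * x + snd X"
proof -
 have "\<forall>\<^sub>F X in gen. ev2 [:[:y, -1:], [:-x:]:] (fst X) (snd X) ~= 0" for x y
  by (rule eventually_genI) simp
 hence "\<forall>\<^sub>F X in gen. y ~= fst X * x + snd X" for x y
  by (rule eventually_mono[of _ gen]) (auto simp: algebra_simps)
 thus ?thesis using assms by (intro eventually_ball_finite) auto
qed

definition bounded_degree :: "nat => cpoly2 => bool" where
 "bounded_degree N f \<longleftrightarrow> (\<forall>i j. N < i + j --> coeff (coeff f i) j = 0)"

definition total_degree :: "cpoly2 => nat" where
 "total_degree f = (LEAST N. bounded_degree N f)"

lemma bounded_total_degree: "bounded_degree (total_degree f) f"
 unfolding total_degree_def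
proof (rule LeastI)
 have "coeff (coeff f i) j = 0" if "degree f + (\<Sum>i\<le>degree f. degree (coeff f i)) < i + j" for i j
 proof (cases "i \<le> degree f")
  case True
  hence "degree (coeff f i) \<le> (\<Sum>i\<le>degree f. degree (coeff f i))" by (intro member_le_sum) auto
  thus ?thesis using that True by (intro coeff_eq_0) linarith
 qed (simp add: coeff_eq_0)
 thus "bounded_degree (degree f + (\<Sum>i\<le>degree f. degree (coeff f i))) f"
  unfolding bounded_degree_def by blast
qed

lemma total_degree_attained:
 assumes "f ~= 0"
 shows "\<exists>i\<le>total_degree f. coeff (coeff f i) (total_degree f - i) ~= 0"
proof -
 obtain i j where ij: "coeff (coeff f i) j ~= 0" "total_degree f \<le> i + j"
 proof (cases "total_degree f")
  case 0
  obtain i where "coeff f i ~= 0" using assms by (metis poly_eqI coeff_0)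
  then obtain j where "coeff (coeff f i) j ~= 0" by (metis poly_eqI coeff_0)
  thus ?thesis using 0 that by auto
 next
  case (Suc n)
  hence "\<not> bounded_degree n f" using not_less_Least[of n "%N. bounded_degree N f"] unfolding total_degree_def by auto
  thus ?thesis using that Suc unfolding bounded_degree_def by auto
 qed
 have "i + j \<le> total_degree f" using ij(1) bounded_total_degree[of f] unfolding bounded_degree_def by (meson not_less)
 hence "i + j = total_degree f" using ij(2) by simp
 hence "i \<le> total_degree f" "total_degree f - i = j" by auto
 thus ?thesis using ij(1) by blast
qed

definition homogenize :: "cpoly2 => cpol" where
 "homogenize f = (\<Sum>i\<le>total_degree f. \<Sum>j\<le>total_degree f - i.
   mconst (coeff (coeff f i) j) * (mvar 1 ^ i * mvar 2 ^ j * mvar 3 ^ (total_degree f - i - j)))"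

lemma homogeneous_homogenize: "homogeneous (total_degree f) (homogenize f)"
 unfolding homogenize_def
proof (intro homogeneous_sum homogeneous_mconst_mult)
 fix i j assume "i \<in> {..total_degree f}" "j \<in> {..total_degree f - i}"
 hence e: "i * 1 + j * 1 + (total_degree f - i - j) * 1 = total_degree f" by simp
 have "homogeneous (i * 1 + j * 1 + (total_degree f - i - j) * 1)
  (mvar 1 ^ i * mvar 2 ^ j * mvar 3 ^ (total_degree f - i - j) :: cpol)"
  by (intro homogeneous_mult homogeneous_power homogeneous_mvar)
 thus "homogeneous (total_degree f) (mvar 1 ^ i * mvar 2 ^ j * mvar 3 ^ (total_degree f - i - j) :: cpol)"
  unfolding e .
qed

lemma ev_homogenize:
 "ev v (homogenize f) = (\<Sum>i\<le>total_degree f. \<Sum>j\<le>total_degree f - i.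
   coeff (coeff f i) j * (v 1 ^ i * v 2 ^ j * v 3 ^ (total_degree f - i - j)))"
 unfolding homogenize_def by (simp add: mpol_eval_sum)

lemma ev_homogenize_plane: "ev (vec3 x y 1) (homogenize f) = ev2 f x y"
proof -
 let ?N = "total_degree f"
 note b = bounded_total_degree[of f, unfolded bounded_degree_def, rule_format]
 have d1: "degree f \<le> ?N"
 proof (rule degree_le, intro allI impI)
  fix i assume "?N < i"
  thus "coeff f i = 0" using b[of i] by (intro poly_eqI) auto
 qed
 have d2: "degree (coeff f i) \<le> ?N - i" if "i \<le> ?N" for i
  by (rule degree_le) (use b[of i] that in auto)
 have "ev2 f x y = poly (\<Sum>i\<le>?N. coeff f i * [:x:] ^ i) y"
  unfolding ev2_def poly_altdef[of f]
  by (rule arg_cong[of _ _ "%p. poly p y"], rule sum.mono_neutral_left) (use d1 in \<open>auto simp: coeff_eq_0\<close>)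
 also have "\<dots> = (\<Sum>i\<le>?N. poly (coeff f i) y * x ^ i)"
  by (simp add: poly_sum poly_power)
 also have "\<dots> = (\<Sum>i\<le>?N. (\<Sum>j\<le>?N - i. coeff (coeff f i) j * y ^ j) * x ^ i)"
  by (intro sum.cong refl) (simp add: poly_altdef_ge[OF d2])
 also have "\<dots> = ev (vec3 x y 1) (homogenize f)"
  unfolding ev_homogenize by (simp add: sum_distrib_right sum_distrib_left mult_ac)
 finally show ?thesis ..
qed

lemma in_plane_homogenize: "in_plane (homogenize f) = f"
 by (rule ev2_eqI) (simp add: ev2_in_plane ev_homogenize_plane)

definition at_infinity_line :: "cpol => cpoly2" where
 "at_infinity_line p = mpol_eval (%c. [:[:c:]:]) (vec3 [:0, 1:] [:[:0, 1:]:] 0) p"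

lemma ev2_at_infinity_line: "ev2 (at_infinity_line p) x y = ev (vec3 x y 0) p"
proof -
 have "(%f. ev2 f x y) \<circ> (%c. [:[:c:]:]) = id" by (simp add: fun_eq_iff)
 moreover have "(%f. ev2 f x y) \<circ> vec3 [:0, 1:] [:[:0, 1:]:] 0 = vec3 x y 0"
  by (simp add: comp_vec3)
 ultimately show ?thesis
  using mpol_eval_commute[OF comm_ring_hom_ev2[of x y], of "%c. [:[:c:]:]" "vec3 [:0, 1:] [:[:0, 1:]:] 0" p]
  by (simp add: at_infinity_line_def)
qed

lemma at_infinity_line_mult: "at_infinity_line (p * q) = at_infinity_line p * at_infinity_line q"
 by (rule ev2_eqI) (simp add: ev2_at_infinity_line)

lemma at_infinity_line_homogenize:
 assumes "f ~= 0"
 shows "at_infinity_line (homogenize f) ~= 0"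
proof
 assume z: "at_infinity_line (homogenize f) = 0"
 let ?N = "total_degree f"
 define h where "h = (\<Sum>i\<le>?N. monom (coeff (coeff f i) (?N - i)) i)"
 have "poly h x = 0" for x
 proof -
  have "poly h x = (\<Sum>i\<le>?N. coeff (coeff f i) (?N - i) * x ^ i)"
   by (simp add: h_def poly_sum poly_monom)
  also have "\<dots> = (\<Sum>i\<le>?N. \<Sum>j\<le>?N - i. if j = ?N - i then coeff (coeff f i) j * x ^ i else 0)"
   by (intro sum.cong refl) simp
  also have "\<dots> = ev (vec3 x 1 0) (homogenize f)"
   unfolding ev_homogenize by (intro sum.cong refl) (auto simp: power_0_left)
  finally show ?thesis using z ev2_at_infinity_line[of "homogenize f" x 1] by simp
 qed
 hence "h = 0" using poly_all_0_iff_0 by blast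
 moreover obtain i where i: "i \<le> ?N" "coeff (coeff f i) (?N - i) ~= 0"
  using total_degree_attained[OF assms] by blast
 moreover have "coeff h i = (\<Sum>k\<le>?N. if k = i then coeff (coeff f k) (?N - k) else 0)"
  unfolding h_def coeff_sum coeff_monom by (rule sum.cong) auto
 ultimately show False by simp
qed

lemma mvar_power_cancel:
 fixes a b :: cpol
 assumes "mvar 3 ^ (m + n) * a = mvar 3 ^ m * b"
 shows "mvar 3 ^ n * a = b"
proof -
 have "mvar 3 ^ m * (mvar 3 ^ n * a) = mvar 3 ^ m * b" using assms by (simp add: power_add mult.assoc)
 moreover have "mvar 3 ^ m ~= (0 :: cpol)" using mvar_neq_0 by simp
 ultimately show ?thesis by simp
qed

text \<open>
  Homogenizing a factor of \<open>a(x,y,1)\<close> gives a factor of \<open>a\<close>, because the line at infinity is not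
 a component of a homogenization.
\<close>

lemma homogenize_dvd:
 assumes a: "homogeneous D a" and f: "f dvd in_plane a"
 shows "homogenize f dvd a"
proof (cases "a = 0")
 case False
 obtain g where g: "in_plane a = f * g" using f by blast
 have nz: "f ~= 0" "g ~= 0" using g False in_plane_eq_0_iff[OF a] by auto
 let ?n = "total_degree f + total_degree g"
 have eq: "mvar 3 ^ ?n * a = mvar 3 ^ D * (homogenize f * homogenize g)"
 proof (rule homogeneous_eqI)
  have hz: "homogeneous (k * 1) (mvar 3 ^ k :: cpol)" for k by (intro homogeneous_power homogeneous_mvar)
  show "homogeneous (?n * 1 + D) (mvar 3 ^ ?n * a)" by (intro homogeneous_mult hz a)
  have "homogeneous (D * 1 + ?n) (mvar 3 ^ D * (homogenize f * homogenize g))"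
   by (intro homogeneous_mult hz homogeneous_homogenize)
  thus "homogeneous (?n * 1 + D) (mvar 3 ^ D * (homogenize f * homogenize g))" by (simp add: add.commute)
  show "ev (vec3 x y 1) (mvar 3 ^ ?n * a) = ev (vec3 x y 1) (mvar 3 ^ D * (homogenize f * homogenize g))" for x y
   using arg_cong[OF g, of "%f. ev2 f x y"] by (simp add: ev_homogenize_plane ev2_in_plane)
 qed
 show ?thesis
 proof (cases "?n \<le> D")
  case True
  then obtain k where k: "D = ?n + k" using le_iff_add by blast
  have "a = mvar 3 ^ k * (homogenize f * homogenize g)"
   using mvar_power_cancel[of ?n k "homogenize f * homogenize g" a] eq by (simp add: k)
  thus ?thesis by simp
 next
  case False
  then obtain k where k: "?n = D + Suc k" using less_imp_Suc_add by (metis not_le add_Suc_right)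
  have "mvar 3 ^ Suc k * a = homogenize f * homogenize g"
   by (rule mvar_power_cancel) (use eq k in simp)
  hence "at_infinity_line (homogenize f * homogenize g) = 0"
   by (metis ev2_at_infinity_line ev2_zero_imp_zero ev_simps(2,6,7) mult_zero_left power_0_Suc vec3_simps(3))
  thus ?thesis using at_infinity_line_homogenize nz by (simp add: at_infinity_line_mult)
 qed
qed simp

lemma plane_forms_coprime:
 assumes w: "\<omega> \<in> forms d" and ncf: "no_common_factor \<omega>"
  and f: "f dvd in_plane (\<omega> $ 1)" "f dvd in_plane (\<omega> $ 2)"
 shows "f dvd 1"
proof -
 note hom = forms_homogeneous[OF w]
 have c: "mvar 3 * \<omega> $ 3 = - (\<omega> $ 1 * mvar 1 + \<omega> $ 2 * mvar 2)"
  using forms_relation[OF w] by (simp add: mult.commute add_eq_0_iff2 add.commute)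
 have f0: "f ~= 0"
 proof
  assume "f = 0"
  hence z: "\<omega> $ 1 = 0" "\<omega> $ 2 = 0" using f in_plane_eq_0_iff[OF hom] by auto
  hence "\<omega> $ 3 = 0" using c by simp
  hence "\<omega> $ i = 0" for i using z exhaust_3[of i] by auto
  thus False using ncf mvar_not_unit unfolding no_common_factor_def by (metis dvd_0_right)
 qed
 have d12: "homogenize f dvd \<omega> $ 1" "homogenize f dvd \<omega> $ 2"
  using homogenize_dvd[OF hom] f by auto
 have "homogenize f dvd mvar 3 * \<omega> $ 3" unfolding c using d12 by simp
 then obtain K where K: "mvar 3 * \<omega> $ 3 = homogenize f * K" by blast
 have "at_infinity_line (homogenize f * K) = 0"
  unfolding K[symmetric] by (rule ev2_zero_imp_zero) (simp add: ev2_at_infinity_line)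
 hence "at_infinity_line K = 0" using at_infinity_line_homogenize[OF f0] by (simp add: at_infinity_line_mult)
 hence "ev (vec3 x y 0) K = 0" for x y using ev2_at_infinity_line[of K x y] by simp
 then obtain K' where K': "K = mvar 3 * K'" using mvar_dvd_if_zero by blast
 have "mvar 3 * \<omega> $ 3 = mvar 3 * (homogenize f * K')" using K K' by (simp add: mult_ac)
 hence "\<omega> $ 3 = homogenize f * K'" by simp
 hence "homogenize f dvd \<omega> $ i" for i using d12 exhaust_3[of i] by auto
 hence unit: "homogenize f dvd 1" using ncf unfolding no_common_factor_def by blast
 have "total_degree f = 0"
 proof (rule ccontr)
  assume N: "total_degree f ~= 0"
  have "ev (%_. 0) (homogenize f) = 0"
   using ev_homogeneous[OF homogeneous_homogenize, of 0 "%_. 0" f] N by (simp add: power_0_left)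
  moreover obtain u where u: "1 = homogenize f * u" using unit by blast
  have "1 = ev (%_. 0) (homogenize f) * ev (%_. 0) u"
   unfolding ev_simps(2)[symmetric] u[symmetric] by (rule ev_simps(4)[symmetric])
  ultimately show False by simp
 qed
 hence z: "coeff (coeff f i) j = 0" if "0 < i + j" for i j
  using bounded_total_degree[of f] that unfolding bounded_degree_def by auto
 have fc: "f = [:[:coeff (coeff f 0) 0:]:]"
 proof (intro poly_eqI)
  fix i j
  show "coeff (coeff f i) j = coeff (coeff [:[:coeff (coeff f 0) 0:]:] i) j"
   by (cases i; cases j) (simp_all add: z)
 qed
 moreover have "coeff (coeff f 0) 0 ~= 0" using f0 fc by (metis pCons_0_0)
 hence "[:[:coeff (coeff f 0) 0:]:] * [:[:inverse (coeff (coeff f 0) 0):]:] = 1"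
  by (simp add: one_pCons)
 ultimately show ?thesis by (metis dvdI)
qed

text \<open>
  Tangency at a point where \<open>b = 0\<close> forces \<open>a = b = 0\<close>, which happens at
 finitely many points of the affine plane; a generic line avoids them.
\<close>

lemma generic_line_regular:
 assumes w: "\<omega> \<in> forms d" and ncf: "no_common_factor \<omega>"
 shows "\<forall>\<^sub>F X in gen. \<forall>s. poly (at_pt (tangency \<omega>) (fst X) (snd X)) s = 0 -->
   ev (vec3 s (fst X * s + snd X) 1) (\<omega> $ 2) ~= 0"
proof -
 let ?Z = "{(x, y). ev2 (in_plane (\<omega> $ 1)) x y = 0 & ev2 (in_plane (\<omega> $ 2)) x y = 0}"
 have "finite ?Z" by (rule finite_common_zeros) (rule plane_forms_coprime[OF w ncf])
 from generic_line_avoids_finite[OF this] show ?thesis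
 proof eventually_elim
  case (elim X)
  show ?case
  proof (intro allI impI notI)
   fix s assume r: "poly (at_pt (tangency \<omega>) (fst X) (snd X)) s = 0"
    and b: "ev (vec3 s (fst X * s + snd X) 1) (\<omega> $ 2) = 0"
   hence "(s, fst X * s + snd X) \<in> ?Z" by (simp add: poly_tangency ev2_in_plane)
   thus False using elim by auto
  qed
 qed
qed

section \<open>Automorphisms of a Galois extension\<close>

lemma aut_simps:
 assumes s: "\<sigma> \<in> field_automorphisms_over K S" and S: "is_subfield S"
 shows "x \<in> S ==> \<sigma> x \<in> S" "x \<in> S ==> y \<in> S ==> \<sigma> (x + y) = \<sigma> x + \<sigma> y"
  "x \<in> S ==> y \<in> S ==> \<sigma> (x * y) = \<sigma> x * \<sigma> y" "x \<in> K ==> \<sigma> x = x"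
  "x \<in> S ==> y \<in> S ==> \<sigma> x = \<sigma> y \<longleftrightarrow> x = y" "\<sigma> 0 = 0" "\<sigma> 1 = 1"
proof -
 have b: "bij_betw \<sigma> S S" and add: "!!x y. x \<in> S ==> y \<in> S ==> \<sigma> (x + y) = \<sigma> x + \<sigma> y"
  and mul: "!!x y. x \<in> S ==> y \<in> S ==> \<sigma> (x * y) = \<sigma> x * \<sigma> y" and fix': "!!x. x \<in> K ==> \<sigma> x = x"
  using s unfolding field_automorphisms_over_def by auto
 show "x \<in> S ==> \<sigma> x \<in> S" using b by (auto simp: bij_betw_def)
 show inj: "x \<in> S ==> y \<in> S ==> \<sigma> x = \<sigma> y \<longleftrightarrow> x = y" for x y using b by (auto simp: bij_betw_def inj_on_def)
 show "x \<in> S ==> y \<in> S ==> \<sigma> (x + y) = \<sigma> x + \<sigma> y" "x \<in> S ==> y \<in> S ==> \<sigma> (x * y) = \<sigma> x * \<sigma> y"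
  "x \<in> K ==> \<sigma> x = x" by (fact add mul fix')+
 have z: "0 \<in> S" "1 \<in> S" using S by (auto simp: is_subfieldD)
 have "\<sigma> 0 = \<sigma> 0 + \<sigma> 0" using add[OF z(1) z(1)] by (simp only: add_0_left)
 thus z0: "\<sigma> 0 = 0" by (metis add_cancel_right_right)
 have "\<sigma> 1 * \<sigma> 1 = \<sigma> 1" using mul[OF z(2) z(2)] by simp
 moreover have "\<sigma> 1 ~= 0" using inj[OF z(2) z(1)] z0 by simp
 ultimately show "\<sigma> 1 = 1" by simp
qed

lemma automorphism_sum:
 assumes s: "\<sigma> \<in> field_automorphisms_over K S" and S: "is_subfield S"
  and f: "!!i. i \<in> I ==> f i \<in> S"
 shows "\<sigma> (\<Sum>i\<in>I. f i) = (\<Sum>i\<in>I. \<sigma> (f i))"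
 using f
proof (induction I rule: infinite_finite_induct)
 case (insert i I)
 have "(\<Sum>i\<in>I. f i) \<in> S" using insert.prems by (intro is_subfield_sum[OF S]) auto
 thus ?case using insert aut_simps(2)[OF s S] by auto
qed (simp_all add: aut_simps(6)[OF s S])

lemma automorphism_prod:
 assumes s: "\<sigma> \<in> field_automorphisms_over K S" and S: "is_subfield S"
  and f: "!!i. i \<in> I ==> f i \<in> S"
 shows "\<sigma> (\<Prod>i\<in>I. f i) = (\<Prod>i\<in>I. \<sigma> (f i))"
 using f
proof (induction I rule: infinite_finite_induct)
 case (insert i I)
 have "(\<Prod>i\<in>I. f i) \<in> S" using insert.prems by (intro is_subfield_prod[OF S]) auto
 thus ?case using insert aut_simps(3)[OF s S] by auto
qed (simp_all add: aut_simps(7)[OF s S])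

lemma automorphism_power:
 assumes s: "\<sigma> \<in> field_automorphisms_over K S" and S: "is_subfield S" and x: "x \<in> S"
 shows "\<sigma> (x ^ n) = \<sigma> x ^ n"
 by (induction n) (simp_all add: aut_simps(3,7)[OF s S] is_subfield_power[OF S] x)

lemma automorphism_comp:
 assumes "\<sigma> \<in> field_automorphisms_over K S" "\<tau> \<in> field_automorphisms_over K S"
 shows "\<sigma> \<circ> \<tau> \<in> field_automorphisms_over K S"
proof -
 have "!!x. x \<in> S ==> \<tau> x \<in> S" using assms(2) unfolding field_automorphisms_over_def by (auto simp: bij_betw_def)
 thus ?thesis
  using assms unfolding field_automorphisms_over_def by (auto intro: bij_betw_trans)
qed

lemma automorphism_id: "id \<in> field_automorphisms_over K S"
 unfolding field_automorphisms_over_def by auto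

lemma automorphism_inv:
 assumes s: "\<sigma> \<in> field_automorphisms_over K S" and S: "is_subfield S" and KS: "K \<subseteq> S"
 shows "inv_into S \<sigma> \<in> field_automorphisms_over K S"
proof -
 have b: "bij_betw \<sigma> S S" using s unfolding field_automorphisms_over_def by auto
 have iS: "inv_into S \<sigma> x \<in> S" "\<sigma> (inv_into S \<sigma> x) = x" if "x \<in> S" for x
  using b that by (auto simp: bij_betw_def inv_into_into f_inv_into_f)
 have li: "inv_into S \<sigma> (\<sigma> x) = x" if "x \<in> S" for x
  using b that by (auto simp: bij_betw_def inv_into_f_f)
 have "inv_into S \<sigma> (x + y) = inv_into S \<sigma> x + inv_into S \<sigma> y &
   inv_into S \<sigma> (x * y) = inv_into S \<sigma> x * inv_into S \<sigma> y" if "x \<in> S" "y \<in> S" for x y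
  using li[of "inv_into S \<sigma> x + inv_into S \<sigma> y"] li[of "inv_into S \<sigma> x * inv_into S \<sigma> y"] iS that
   aut_simps(2,3)[OF s S] is_subfieldD(3,4)[OF S] by metis
 moreover have "inv_into S \<sigma> x = x" if "x \<in> K" for x
  using li[of x] aut_simps(4)[OF s S that] that KS by auto
 ultimately show ?thesis
  using bij_betw_inv_into[OF b] unfolding field_automorphisms_over_def by blast
qed

lemma automorphism_inv_apply:
 assumes "\<sigma> \<in> field_automorphisms_over K S" "x \<in> S"
 shows "\<sigma> (inv_into S \<sigma> x) = x" "inv_into S \<sigma> (\<sigma> x) = x"
 using assms unfolding field_automorphisms_over_def by (auto simp: bij_betw_def f_inv_into_f inv_into_f_f)


section \<open>The covering attached to a Galois foliation\<close>

lemma isCont_fval: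
 assumes "fdef f X"
 shows "isCont (fval f) X"
proof -
 obtain P Q where f: "f = Fract P Q" "ev (pt X) Q ~= 0" using assms unfolding fdef_def by blast
 have evq: "ev (pt Y) R = ev2 (in_plane R) (fst Y) (snd Y)" for Y R by (simp add: pt_def ev2_in_plane)
 have c: "isCont (%Y. ev2 (in_plane R) (fst Y) (snd Y)) X" for R
 proof -
  have "continuous_on UNIV (%Y. ev2 (in_plane R) (fst Y) (snd Y))"
   by (intro continuous_ev2 continuous_intros)
  thus ?thesis by (rule continuous_on_interior) simp
 qed
 have "open {Y. ev2 (in_plane Q) (fst Y) (snd Y) ~= 0}"
  by (intro open_Collect_neq continuous_ev2 continuous_intros)
 hence "\<forall>\<^sub>F Y in nhds X. ev2 (in_plane Q) (fst Y) (snd Y) ~= 0"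
  using f(2) evq eventually_nhds_in_open[of "{Y. ev2 (in_plane Q) (fst Y) (snd Y) ~= 0}" X] by simp
 hence "\<forall>\<^sub>F Y in nhds X. fval f Y = ev2 (in_plane P) (fst Y) (snd Y) / ev2 (in_plane Q) (fst Y) (snd Y)"
  by eventually_elim (simp add: f(1) fval_Fract evq)
 from isCont_cong[OF this] show ?thesis
  using isCont_divide[OF c c] f(2) evq by simp
qed

lemma gen_zero_at:
 fixes g :: "complex \<times> complex => complex"
 assumes "isCont g X" "\<forall>\<^sub>F X in gen. g X = 0"
 shows "g X = 0"
proof (rule ccontr)
 assume "g X ~= 0"
 hence "\<forall>\<^sub>F Y in nhds X. g Y ~= 0"
  using tendsto_imp_eventually_ne[OF isContD[OF assms(1)], of 0]
  by (auto simp: eventually_at_filter elim: eventually_mono)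
 with gen_frequently_nhds[OF assms(2), of X] show False by (simp add: frequently_def)
qed

definition cst :: "complex => cpol fract" where
 "cst c = Fract (mconst c) 1"

definition x_elt :: "cpol fract" where "x_elt = Fract (mvar 1) (mvar 3)"
definition y_elt :: "cpol fract" where "y_elt = Fract (mvar 2) (mvar 3)"

lemma cst_in: "cst c \<in> gauss_subfield \<omega>" "cst c \<in> LL"
 unfolding cst_def by (rule gauss_const LL_const)+

lemma fval_cst: "fdef (cst c) X & fval (cst c) X = c"
 unfolding cst_def by (rule fval_const)

lemma x_elt_in: "x_elt \<in> LL" and y_elt_in: "y_elt \<in> LL"
 unfolding x_elt_def y_elt_def by (auto intro!: LL_I[of 1] homogeneous_mvar[unfolded One_nat_def])

lemma fval_x_elt: "fdef x_elt X & fval x_elt X = fst X" and fval_y_elt: "fdef y_elt X & fval y_elt X = snd X"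
 unfolding x_elt_def y_elt_def by (simp_all add: fdef_Fract fval_Fract pt_def)

definition eval_at :: "cpol fract => cpol fract => cpol => cpol fract" where
 "eval_at g1 g2 P = (\<Sum>t\<in>keys P. cst (lookup P t) *
   (g1 ^ lookup t 1 * g2 ^ lookup t 2))"

lemma eval_at_in: "is_subfield S ==> (!!c. cst c \<in> S) ==> g1 \<in> S ==> g2 \<in> S ==> eval_at g1 g2 P \<in> S"
 unfolding eval_at_def
 by (intro is_subfield_sum is_subfieldD(4) is_subfield_power) auto

lemma fval_eval_at:
 assumes "fdef g1 X" "fdef g2 X"
 shows "fdef (eval_at g1 g2 P) X & fval (eval_at g1 g2 P) X = ev (vec3 (fval g1 X) (fval g2 X) 1) P"
proof -
 have t: "fdef (cst c * (g1 ^ i * g2 ^ j)) X & fval (cst c * (g1 ^ i * g2 ^ j)) X = c * (fval g1 X ^ i * fval g2 X ^ j)" for c i j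
  using fval_mult fval_power fval_cst assms by metis
 show ?thesis
  unfolding eval_at_def using fval_sum[of "keys P" "%t. cst (lookup P t) *
   (g1 ^ lookup t 1 * g2 ^ lookup t 2)" X] t
  by (simp add: mpol_eval_def monom_value_3)
qed

text \<open>Every element of the function field is a quotient of polynomials in \<open>x\<close> and \<open>y\<close>.\<close>

lemma LL_quotient:
 assumes "f \<in> LL"
 shows "\<exists>P Q. eval_at x_elt y_elt Q ~= 0 & f = eval_at x_elt y_elt P / eval_at x_elt y_elt Q"
proof -
 obtain P Q m where f: "f = Fract P Q" "homogeneous m P" "homogeneous m Q" "Q ~= 0" using assms by (rule LL_E)
 have v: "fdef (eval_at x_elt y_elt R) X" "fval (eval_at x_elt y_elt R) X = ev (pt X) R" for R X
  using fval_eval_at[of x_elt X y_elt R] fval_x_elt fval_y_elt by (auto simp: pt_def)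
 have inL: "eval_at x_elt y_elt R \<in> LL" for R
  by (intro eval_at_in sub_LL cst_in x_elt_in y_elt_in)
 have "eval_at x_elt y_elt Q ~= 0"
 proof
  assume z: "eval_at x_elt y_elt Q = 0"
  have "ev (pt X) Q = 0" for X using v[of Q X] fval_0[of X] unfolding z by simp
  hence "\<forall>\<^sub>F X in gen. False" using gen_ev_nonzero[OF f(3,4)] by (auto elim: eventually_mono)
  thus False by simp
 qed
 moreover have "f * eval_at x_elt y_elt Q = eval_at x_elt y_elt P"
 proof (rule LL_eqI)
  show "\<forall>\<^sub>F X in gen. fval (f * eval_at x_elt y_elt Q) X = fval (eval_at x_elt y_elt P) X"
   using gen_ev_nonzero[OF f(3,4)]
   by eventually_elim (use v in \<open>simp add: f(1) fval_mult fdef_Fract fval_Fract\<close>)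
 qed (use assms inL sub_LL in \<open>auto intro: is_subfieldD(4)\<close>)
 ultimately show ?thesis by (metis nonzero_mult_div_cancel_right)
qed

locale galois_form =
 fixes d :: nat and \<omega> :: form
 assumes d: "1 \<le> d" and w: "\<omega> \<in> forms d" and ncf: "no_common_factor \<omega>"
  and gal: "galois_extension (gauss_subfield \<omega>) LL"
begin

abbreviation "K \<equiv> gauss_subfield \<omega>"
abbreviation "G \<equiv> field_automorphisms_over K LL"
abbreviation "F \<equiv> tangency \<omega>"

definition p_elt :: "cpol fract" where "p_elt = Fract (- (\<omega> $ 1)) (\<omega> $ 2)"
definition q_elt :: "cpol fract" where "q_elt = Fract (- (\<omega> $ 3)) (\<omega> $ 2)"
definition pf :: "complex \<times> complex => complex" where "pf X = fval p_elt X"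
definition qf :: "complex \<times> complex => complex" where "qf X = fval q_elt X"

abbreviation FX :: "complex \<times> complex => complex poly" where
 "FX X \<equiv> at_pt F (pf X) (qf X)"

abbreviation uX :: "cpol fract => complex \<times> complex => complex" where
 "uX f X \<equiv> poly (pderiv (FX X)) (fval f X)"

abbreviation regular :: "complex \<times> complex => bool" where
 "regular X \<equiv> ev (pt X) (\<omega> $ 2) ~= 0"

lemma K_LL: "K \<subseteq> LL"
 by (rule gauss_subset_LL[OF w])

lemma fixed_in_K: "f \<in> LL ==> (!!\<sigma>. \<sigma> \<in> G ==> \<sigma> f = f) ==> f \<in> K"
 using gal unfolding galois_extension_def by auto

lemma algebraic: "f \<in> LL ==> \<exists>p. p ~= 0 & (\<forall>j. coeff p j \<in> K) & poly p f = 0"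
 using gal unfolding galois_extension_def by auto

lemma degree_FX: "degree (at_pt F p q) \<le> d"
 by (rule degree_at_pt_tangency[OF w])

lemma generic_lead: "\<forall>\<^sub>F X in gen. coeff (at_pt F (fst X) (snd X)) d ~= 0"
 unfolding coeff_at_pt by (rule eventually_genI[OF lead_tangency_nonzero[OF w ncf]])

lemma root_exists: "coeff (at_pt F p q) d ~= 0 ==> \<exists>s. poly (at_pt F p q) s = 0"
proof -
 assume l: "coeff (at_pt F p q) d ~= 0"
 hence "degree (at_pt F p q) = d" using degree_FX[of p q] le_degree[OF l] by simp
 thus ?thesis using d by (intro fundamental_theorem_of_algebra) (simp add: constant_degree)
qed

lemma b_nonzero: "\<omega> $ 2 ~= 0"
proof
 assume z: "\<omega> $ 2 = 0"
 have "\<forall>\<^sub>F X in gen. False"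
  using generic_line_regular[OF w ncf] generic_lead
  by eventually_elim (use root_exists z in force)
 thus False by simp
qed

lemma generic_regular: "\<forall>\<^sub>F X in gen. regular X"
 by (rule gen_ev_nonzero[OF forms_homogeneous[OF w] b_nonzero])

lemma regular_values:
 assumes "regular X"
 shows "fdef p_elt X" "fdef q_elt X" "pf X = - ev (pt X) (\<omega> $ 1) / ev (pt X) (\<omega> $ 2)"
  "qf X = - ev (pt X) (\<omega> $ 3) / ev (pt X) (\<omega> $ 2)" "snd X = pf X * fst X + qf X"
proof -
 show "fdef p_elt X" "fdef q_elt X" using assms by (simp_all add: p_elt_def q_elt_def fdef_Fract)
 show p: "pf X = - ev (pt X) (\<omega> $ 1) / ev (pt X) (\<omega> $ 2)" and q: "qf X = - ev (pt X) (\<omega> $ 3) / ev (pt X) (\<omega> $ 2)"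
  using assms by (simp_all add: pf_def qf_def p_elt_def q_elt_def fval_Fract)
 have "ev (pt X) (\<omega> $ 1) * fst X + ev (pt X) (\<omega> $ 2) * snd X + ev (pt X) (\<omega> $ 3) = 0"
  using forms_relation_ev[OF w, of "pt X"] by (simp add: pt_def)
 thus "snd X = pf X * fst X + qf X" unfolding p q using assms by (simp add: field_simps) (simp add: add_eq_0_iff algebra_simps)
qed

lemma regular_root:
 assumes "regular X"
 shows "poly (FX X) (fst X) = 0"
proof -
 have "vec3 (fst X) (pf X * fst X + qf X) 1 = pt X"
  using regular_values(5)[OF assms] by (simp add: pt_def)
 thus ?thesis
  unfolding poly_tangency using assms by (simp add: regular_values(3)[OF assms])
qed

lemma root_regular:
 assumes "poly (at_pt F p q) s = 0" "ev (vec3 s (p * s + q) 1) (\<omega> $ 2) ~= 0"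
 shows "regular (s, p * s + q)" "pf (s, p * s + q) = p" "qf (s, p * s + q) = q"
proof -
 show r: "regular (s, p * s + q)" using assms(2) by (simp add: pt_def)
 show p: "pf (s, p * s + q) = p"
  unfolding regular_values(3)[OF r] using assms by (simp add: pt_def poly_tangency add_eq_0_iff2)
 show "qf (s, p * s + q) = q"
  using regular_values(5)[OF r] p by simp
qed

lemma p_elt_in: "p_elt \<in> K" and q_elt_in: "q_elt \<in> K"
proof -
 have c: "compose_form (mvar i) \<omega> = \<omega> $ i" for i
  unfolding compose_form_def by (rule mpol_eval_mvar[OF comm_ring_hom_mconst])
 have m: "compose_form (- mvar i) \<omega> = - \<omega> $ i" for i
  using comm_ring_homD(3)[OF compose_hom[of \<omega>], of "mvar i" "- mvar i"] comm_ring_homD(1)[OF compose_hom[of \<omega>]]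
  by (simp add: c add_eq_0_iff)
 have "Fract (compose_form (- mvar i) \<omega>) (compose_form (mvar 2) \<omega>) \<in> K" for i
  by (rule gauss_I[OF homogeneous_uminus homogeneous_mvar]) (simp_all add: homogeneous_mvar c b_nonzero del: One_nat_def)
 thus "p_elt \<in> K" "q_elt \<in> K" by (simp_all add: c m p_elt_def q_elt_def)
qed

text \<open>
  A quotient \<open>P(a,b,c) / Q(a,b,c)\<close> depends on \<open>a/b = -p\<close> and \<open>c/b
 = -q\<close> alone.
\<close>

lemma K_rational:
 assumes "k \<in> K"
 shows "\<exists>N E. E ~= 0 & (k ~= 0 --> N ~= 0) &
  (\<forall>\<^sub>F X in gen. ev2 E (pf X) (qf X) ~= 0 & fval k X = ev2 N (pf X) (qf X) / ev2 E (pf X) (qf X))"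
proof -
 obtain P Q m where k: "k = Fract (compose_form P \<omega>) (compose_form Q \<omega>)" "homogeneous m P" "homogeneous m Q"
  "compose_form Q \<omega> ~= 0" using assms by (rule gauss_E)
 define dual where "dual R = mpol_eval (%c. [:[:c:]:]) (vec3 [:0, -1:] 1 [:[:0, -1:]:]) R" for R :: cpol
 have dual: "ev2 (dual R) p q = ev (vec3 (-p) 1 (-q)) R" for R p q
 proof -
  have "(%f. ev2 f p q) \<circ> (%c. [:[:c:]:]) = id" by (simp add: fun_eq_iff)
  moreover have "(%f. ev2 f p q) \<circ> vec3 [:0, -1:] 1 [:[:0, -1:]:] = vec3 (-p) 1 (-q)"
   by (simp add: comp_vec3)
  ultimately show ?thesis
   using mpol_eval_commute[OF comm_ring_hom_ev2[of p q], of "%c. [:[:c:]:]" "vec3 [:0, -1:] 1 [:[:0, -1:]:]" R]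
   by (simp add: dual_def)
 qed
 have val: "ev (pt X) (compose_form R \<omega>) = ev (pt X) (\<omega> $ 2) ^ m * ev2 (dual R) (pf X) (qf X)"
  if "homogeneous m R" "regular X" for R X
 proof -
  have "(%i. ev (pt X) (\<omega> $ i)) = (%i. ev (pt X) (\<omega> $ 2) * vec3 (- pf X) 1 (- qf X) i)"
  proof
   fix i :: 3
   show "ev (pt X) (\<omega> $ i) = ev (pt X) (\<omega> $ 2) * vec3 (- pf X) 1 (- qf X) i"
    using exhaust_3[of i] that(2) regular_values(3,4)[OF that(2)] by auto
  qed
  thus ?thesis
   unfolding ev_compose_form dual using ev_homogeneous[OF that(1)] by simp
 qed
 have hom: "homogeneous (m * (d + 1)) (compose_form R \<omega>)" if "homogeneous m R" for R
  unfolding compose_form_def by (rule homogeneous_compose[OF that forms_homogeneous[OF w]])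
 have nz: "dual R ~= 0" if "homogeneous m R" "compose_form R \<omega> ~= 0" for R
 proof
  assume "dual R = 0"
  have "\<forall>\<^sub>F X in gen. False"
   using gen_ev_nonzero[OF hom[OF that(1)] that(2)] generic_regular
   by eventually_elim (simp add: val[OF that(1)] \<open>dual R = 0\<close>)
  thus False by simp
 qed
 show ?thesis
 proof (rule exI[of _ "dual P"], rule exI[of _ "dual Q"], intro conjI)
  show "dual Q ~= 0" by (rule nz[OF k(3,4)])
  show "k ~= 0 --> dual P ~= 0"
  proof
   assume "k ~= 0"
   hence "compose_form P \<omega> ~= 0" using k(1) by (auto simp: fract_collapse)
   thus "dual P ~= 0" by (rule nz[OF k(2)])
  qed
 next
  show "\<forall>\<^sub>F X in gen. ev2 (dual Q) (pf X) (qf X) ~= 0 & fval k X = ev2 (dual P) (pf X) (qf X) / ev2 (dual Q) (pf X) (qf X)"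
   using gen_ev_nonzero[OF hom[OF k(3)] k(4)] generic_regular
   by eventually_elim (auto simp: k(1) fval_Fract val[OF k(2)] val[OF k(3)])
 qed
qed

text \<open>Clearing denominators in a polynomial equation over \<open>K\<close>.\<close>

lemma K_relation:
 fixes n :: nat
 assumes "!!j. j \<le> n ==> \<kappa> j \<in> K"
 shows "\<exists>N E. E ~= 0 & (\<forall>j\<le>n. \<kappa> j ~= 0 --> N j ~= 0) &
  (\<forall>\<^sub>F X in gen. ev2 E (pf X) (qf X) ~= 0 & (\<forall>j\<le>n. ev2 (N j) (pf X) (qf X) = ev2 E (pf X) (qf X) * fval (\<kappa> j) X))"
proof -
 have "\<forall>j\<in>{..n}. \<exists>NE. snd NE ~= 0 & (\<kappa> j ~= 0 --> fst NE ~= 0) &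
  (\<forall>\<^sub>F X in gen. ev2 (snd NE) (pf X) (qf X) ~= 0 & fval (\<kappa> j) X = ev2 (fst NE) (pf X) (qf X) / ev2 (snd NE) (pf X) (qf X))"
  using K_rational assms by (force simp: split_paired_Ex)
 from bchoice[OF this] obtain NE where NE: "!!j. j \<le> n ==> snd (NE j) ~= 0" "!!j. j \<le> n ==> \<kappa> j ~= 0 ==> fst (NE j) ~= 0"
  "!!j. j \<le> n ==> \<forall>\<^sub>F X in gen. ev2 (snd (NE j)) (pf X) (qf X) ~= 0 & fval (\<kappa> j) X = ev2 (fst (NE j)) (pf X) (qf X) / ev2 (snd (NE j)) (pf X) (qf X)"
  by auto
 define E where "E = (\<Prod>i\<le>n. snd (NE i))"
 define N where "N j = fst (NE j) * (\<Prod>i\<in>{..n} - {j}. snd (NE i))" for j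
 have split: "E = snd (NE j) * (\<Prod>i\<in>{..n} - {j}. snd (NE i))" if "j \<le> n" for j
  unfolding E_def by (rule prod.remove) (use that in auto)
 have "E ~= 0" unfolding E_def using NE(1) by simp
 moreover have "\<forall>j\<le>n. \<kappa> j ~= 0 --> N j ~= 0" unfolding N_def using NE(1,2) by simp
 moreover have "\<forall>\<^sub>F X in gen. ev2 E (pf X) (qf X) ~= 0 & (\<forall>j\<le>n. ev2 (N j) (pf X) (qf X) = ev2 E (pf X) (qf X) * fval (\<kappa> j) X)"
 proof -
  have "\<forall>\<^sub>F X in gen. \<forall>j\<in>{..n}. ev2 (snd (NE j)) (pf X) (qf X) ~= 0 & fval (\<kappa> j) X = ev2 (fst (NE j)) (pf X) (qf X) / ev2 (snd (NE j)) (pf X) (qf X)"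
   using NE(3) by (intro eventually_ball_finite) auto
  thus ?thesis
  proof eventually_elim
   case (elim X)
   have "ev2 (N j) (pf X) (qf X) = ev2 E (pf X) (qf X) * fval (\<kappa> j) X" if "j \<le> n" for j
    using elim that unfolding split[OF that] N_def by simp
   thus ?case using elim by (auto simp: E_def ev2_prod)
  qed
 qed
 ultimately show ?thesis by blast
qed

lemma isCont_ev2_pq:
 assumes "regular X"
 shows "isCont (%X. ev2 N (pf X) (qf X)) X"
proof -
 have c: "isCont pf X" "isCont qf X"
  using isCont_fval regular_values(1,2)[OF assms] by (auto simp: pf_def[abs_def] qf_def[abs_def])
 have "continuous_on UNIV (%Y. ev2 N (fst Y) (snd Y))" by (intro continuous_ev2 continuous_intros)
 hence "isCont (%Y. ev2 N (fst Y) (snd Y)) (pf X, qf X)" by (rule continuous_on_interior) simp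
 moreover have "isCont (%X. (pf X, qf X)) X" using c by (intro isCont_Pair)
 ultimately show ?thesis
  using isCont_o2[of X "%X. (pf X, qf X)" "%Y. ev2 N (fst Y) (snd Y)"] by simp
qed

text \<open>
  On a generic line all points of tangency are generic: a polynomial \<open>D\<close> in \<open>x\<close> and \<open>y\<close> satisfies
 an equation over \<open>K\<close> with nonzero constant term, and this term vanishes at \<open>(p,q)\<close> whenever \<open>D\<close>
 vanishes at one of these points.
\<close>

lemma generic_tangency_points:
 assumes "eventually P gen"
 shows "\<forall>\<^sub>F Y in gen. coeff (at_pt F (fst Y) (snd Y)) d ~= 0 &
   (\<forall>s. poly (at_pt F (fst Y) (snd Y)) s = 0 -->
    P (s, fst Y * s + snd Y) & regular (s, fst Y * s + snd Y) &
    pf (s, fst Y * s + snd Y) = fst Y & qf (s, fst Y * s + snd Y) = snd Y)"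
proof -
 obtain D where D: "D ~= 0" "!!x y. ev2 D x y ~= 0 ==> P (x, y)"
  using assms unfolding eventually_gen by blast
 define f where "f = eval_at x_elt y_elt (homogenize D)"
 have fL: "f \<in> LL" unfolding f_def by (intro eval_at_in sub_LL cst_in x_elt_in y_elt_in)
 have fv: "fdef f X & fval f X = ev2 D (fst X) (snd X)" for X
  unfolding f_def using fval_eval_at[of x_elt X y_elt] fval_x_elt fval_y_elt ev_homogenize_plane by simp
 have f0: "f ~= 0"
 proof
  assume "f = 0"
  hence "ev2 D x y = 0" for x y using fv[of "(x, y)"] fval_0[of "(x, y)"] by simp
  thus False using D(1) ev2_zero_imp_zero by blast
 qed
 obtain pl where pl: "pl ~= 0" "!!j. coeff pl j \<in> K" "poly pl f = 0" using algebraic[OF fL] by blast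
 define n where "n = (LEAST n. coeff pl n ~= 0)"
 have n: "coeff pl n ~= 0" unfolding n_def by (rule LeastI[of _ "degree pl"]) (use pl(1) in simp)
 have n': "coeff pl i = 0" if "i < n" for i using that not_less_Least[of i "%n. coeff pl n ~= 0"] unfolding n_def by auto
 define g where "g = poly_shift n pl"
 have "pl = monom 1 n * g"
  by (rule poly_eqI) (simp add: coeff_monom_mult g_def coeff_poly_shift n' not_less)
 hence gf: "poly g f = 0" using pl(3) f0 by (simp add: poly_monom)
 have g0: "coeff g 0 ~= 0" and gK: "coeff g j \<in> K" for j using n pl(2) by (simp_all add: g_def coeff_poly_shift)
 obtain N E where NE': "E ~= 0 & (\<forall>j\<le>degree g. coeff g j ~= 0 --> N j ~= 0) &
  (\<forall>\<^sub>F X in gen. ev2 E (pf X) (qf X) ~= 0 & (\<forall>j\<le>degree g. ev2 (N j) (pf X) (qf X) = ev2 E (pf X) (qf X) * fval (coeff g j) X))"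
  using K_relation[of "degree g" "coeff g", OF gK] by (elim exE) (rule that)
 hence NE: "E ~= 0" "!!j. j \<le> degree g ==> coeff g j ~= 0 ==> N j ~= 0"
  "\<forall>\<^sub>F X in gen. ev2 E (pf X) (qf X) ~= 0 & (\<forall>j\<le>degree g. ev2 (N j) (pf X) (qf X) = ev2 E (pf X) (qf X) * fval (coeff g j) X)"
  by (simp_all only: simp_thms)
 have "\<forall>\<^sub>F X in gen. \<forall>j\<in>{..degree g}. fdef (coeff g j) X"
  using gK K_LL gen_fdef by (intro eventually_ball_finite) auto
 with NE(3) have gen0: "\<forall>\<^sub>F X in gen. (\<Sum>j\<le>degree g. ev2 (N j) (pf X) (qf X) * ev2 D (fst X) (snd X) ^ j) = 0"
 proof eventually_elim
  case (elim X)
  have dj: "fdef (coeff g j * f ^ j) X & fval (coeff g j * f ^ j) X = fval (coeff g j) X * ev2 D (fst X) (snd X) ^ j"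
   if "j \<in> {..degree g}" for j
   using elim(2) that fval_mult fval_power fv by metis
  have "0 = fval (poly g f) X" using gf fval_0 by simp
  also have "\<dots> = (\<Sum>j\<le>degree g. fval (coeff g j) X * ev2 D (fst X) (snd X) ^ j)"
   unfolding poly_altdef using fval_sum[of "{..degree g}" "%j. coeff g j * f ^ j" X] dj by simp
  finally have "0 = ev2 E (pf X) (qf X) * (\<Sum>j\<le>degree g. fval (coeff g j) X * ev2 D (fst X) (snd X) ^ j)" by simp
  also have "\<dots> = (\<Sum>j\<le>degree g. ev2 (N j) (pf X) (qf X) * ev2 D (fst X) (snd X) ^ j)"
   unfolding sum_distrib_left by (intro sum.cong refl) (use elim(1) in simp)
  finally show ?case ..
 qed
 have all0: "(\<Sum>j\<le>degree g. ev2 (N j) (pf X) (qf X) * ev2 D (fst X) (snd X) ^ j) = 0" if r: "regular X" for X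
 proof (rule gen_zero_at[OF _ gen0])
  have "continuous_on UNIV (%X. ev2 D (fst X) (snd X))" by (intro continuous_ev2 continuous_intros)
  hence "isCont (%X. ev2 D (fst X) (snd X)) X" by (rule continuous_on_interior) simp
  thus "isCont (%X. \<Sum>j\<le>degree g. ev2 (N j) (pf X) (qf X) * ev2 D (fst X) (snd X) ^ j) X"
   by (intro continuous_intros isCont_ev2_pq[OF r]) auto
 qed
 have "N 0 ~= 0" using NE(2) g0 by simp
 from eventually_genI[OF this] generic_line_regular[OF w ncf] generic_lead
 show ?thesis
 proof eventually_elim
  case (elim Y)
  have "P (s, fst Y * s + snd Y) & regular (s, fst Y * s + snd Y) &
    pf (s, fst Y * s + snd Y) = fst Y & qf (s, fst Y * s + snd Y) = snd Y"
   if s: "poly (at_pt F (fst Y) (snd Y)) s = 0" for s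
  proof -
   note r = root_regular[OF s elim(2)[rule_format, OF s]]
   have "P (s, fst Y * s + snd Y)"
   proof (rule D(2), rule notI)
    assume z: "ev2 D s (fst Y * s + snd Y) = 0"
    have "(\<Sum>j\<le>degree g. ev2 (N j) (fst Y) (snd Y) * 0 ^ j) = 0"
     using all0[OF r(1)] r z by simp
    hence "ev2 (N 0) (fst Y) (snd Y) = 0" by (simp add: sum.atMost_shift)
    thus False using elim(1) by simp
   qed
   thus ?thesis using r by blast
  qed
  thus ?case using elim(3) by blast
 qed
qed

text \<open>The value \<open>E(p,q)\<close> in the function field.\<close>

definition pq_elt :: "cpoly2 => cpol fract" where
 "pq_elt E = (\<Sum>i\<le>degree E. \<Sum>j\<le>degree (coeff E i). cst (coeff (coeff E i) j) * (p_elt ^ i * q_elt ^ j))"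

lemma pq_elt_in: "pq_elt E \<in> K"
 unfolding pq_elt_def
 by (intro is_subfield_sum[OF subfield_gauss] is_subfieldD(4)[OF subfield_gauss] is_subfield_power[OF subfield_gauss]
   cst_in p_elt_in q_elt_in)

lemma fval_pq_elt:
 assumes r: "regular X"
 shows "fdef (pq_elt E) X & fval (pq_elt E) X = ev2 E (pf X) (qf X)"
proof -
 have t: "fdef (cst c * (p_elt ^ i * q_elt ^ j)) X & fval (cst c * (p_elt ^ i * q_elt ^ j)) X = c * (pf X ^ i * qf X ^ j)" for c i j
  using fval_mult fval_power fval_cst regular_values(1,2)[OF r] unfolding pf_def qf_def by metis
 have "fdef (pq_elt E) X & fval (pq_elt E) X = (\<Sum>i\<le>degree E. \<Sum>j\<le>degree (coeff E i). coeff (coeff E i) j * (pf X ^ i * qf X ^ j))"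
  unfolding pq_elt_def using t by (simp add: fval_sum)
 also have "(\<Sum>i\<le>degree E. \<Sum>j\<le>degree (coeff E i). coeff (coeff E i) j * (pf X ^ i * qf X ^ j)) = ev2 E (pf X) (qf X)"
  unfolding ev2_def poly_altdef[of E] poly_sum
  by (simp add: poly_altdef[of "coeff E _"] sum_distrib_right sum_distrib_left poly_power mult_ac)
 finally show ?thesis .
qed

text \<open>
  The functions \<open>p\<close> and \<open>q\<close> are algebraically independent, because every
 generic line \<open>(p,q)\<close> is the tangent at one of its points.
\<close>

lemma dominant:
 assumes "E ~= 0"
 shows "\<forall>\<^sub>F X in gen. ev2 E (pf X) (qf X) ~= 0"
proof -
 define e where "e = pq_elt E"
 have eL: "e \<in> LL" using pq_elt_in K_LL by (auto simp: e_def)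
 have ev: "fval e X = ev2 E (pf X) (qf X)" if "regular X" for X
  using fval_pq_elt[OF that] by (simp add: e_def)
 have "e ~= 0"
 proof
  assume "e = 0"
  hence z: "ev2 E (pf X) (qf X) = 0" if "regular X" for X using ev[OF that] fval_0 by simp
  have "\<forall>\<^sub>F Y in gen. False"
   using generic_tangency_points[OF generic_regular] eventually_genI[OF assms]
  proof eventually_elim
   case (elim Y)
   obtain s where s: "poly (at_pt F (fst Y) (snd Y)) s = 0" using root_exists elim(1) by blast
   let ?X = "(s, fst Y * s + snd Y)"
   have "regular ?X" "pf ?X = fst Y" "qf ?X = snd Y" using elim(1) s by blast+
   thus False using z[of ?X] elim(2) by simp
  qed
  thus False by simp
 qed
 from gen_fval_nonzero[OF eL this] generic_regular show ?thesis
  by eventually_elim (simp add: ev)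
qed

end

lemma has_partials_unique:
 "has_partials f a b X ==> has_partials f a' b' X ==> a = a' & b = b'"
 unfolding has_partials_def by (blast intro: DERIV_unique)

lemma has_partials_fst: "has_partials fst 1 0 X" and has_partials_snd: "has_partials snd 0 1 X"
 by (simp_all add: has_partials_def)

lemma has_partials_at_pt:
 assumes "has_partials P P1 P2 X" "has_partials Q Q1 Q2 X" "has_partials S S1 S2 X"
 shows "has_partials (%X. poly (at_pt H (P X) (Q X)) (S X))
  (poly (at_pt (diff_p H) (P X) (Q X)) (S X) * P1 + poly (at_pt (diff_q H) (P X) (Q X)) (S X) * Q1 +
   poly (pderiv (at_pt H (P X) (Q X))) (S X) * S1)
  (poly (at_pt (diff_p H) (P X) (Q X)) (S X) * P2 + poly (at_pt (diff_q H) (P X) (Q X)) (S X) * Q2 +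
   poly (pderiv (at_pt H (P X) (Q X))) (S X) * S2) X"
 using assms unfolding has_partials_def
 using DERIV_at_pt[of "%u. P (u, snd X)" P1 "fst X" "%u. Q (u, snd X)" Q1 "%u. S (u, snd X)" S1 H]
  DERIV_at_pt[of "%u. P (fst X, u)" P2 "snd X" "%u. Q (fst X, u)" Q2 "%u. S (fst X, u)" S2 H]
 by simp

lemma fval_poly:
 assumes "!!j. fdef (coeff p j) X" "fdef f X" "degree p \<le> n"
 shows "fdef (poly p f) X & fval (poly p f) X = (\<Sum>j\<le>n. fval (coeff p j) X * fval f X ^ j)"
proof -
 have t: "fdef (coeff p j * f ^ j) X & fval (coeff p j * f ^ j) X = fval (coeff p j) X * fval f X ^ j" for j
  using fval_mult fval_power assms(1,2) by metis
 have "(\<Sum>j\<le>degree p. fval (coeff p j) X * fval f X ^ j) = (\<Sum>j\<le>n. fval (coeff p j) X * fval f X ^ j)"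
  by (rule sum.mono_neutral_left) (use assms(3) in \<open>auto simp: coeff_eq_0 fval_0\<close>)
 thus ?thesis
  unfolding poly_altdef using fval_sum[of "{..degree p}" "%j. coeff p j * f ^ j" X] t by simp
qed

lemma cst_add: "cst (a + b) = cst a + cst b"
 unfolding cst_def by (simp add: comm_ring_homD[OF comm_ring_hom_mconst])

lemma of_nat_cst: "of_nat n = cst (of_nat n)"
proof (induction n)
 case 0
 thus ?case by (simp add: cst_def mconst_def Zero_fract_def)
next
 case (Suc n)
 have "cst 1 = 1" by (simp add: cst_def One_fract_def)
 thus ?case using Suc by (simp add: cst_add)
qed

lemma of_nat_nonzero: "n ~= 0 ==> (of_nat n :: cpol fract) ~= 0"
proof
 assume n: "n ~= 0" and z: "(of_nat n :: cpol fract) = 0"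
 have "fval (of_nat n) (0, 0) = of_nat n" unfolding of_nat_cst[of n] using fval_cst by blast
 thus False using n fval_0[of "(0, 0)"] unfolding z by simp
qed

context galois_form
begin

lemma gen_all_fdef: "(!!j. f j \<in> LL) ==> finite {j. f j ~= 0} ==> \<forall>\<^sub>F X in gen. \<forall>j::nat. fdef (f j) X"
proof -
 assume f: "!!j. f j \<in> LL" "finite {j. f j ~= 0}"
 have "\<forall>\<^sub>F X in gen. \<forall>j\<in>{j. f j ~= 0}. fdef (f j) X"
  using f gen_fdef by (intro eventually_ball_finite) auto
 thus ?thesis by eventually_elim (metis fval_0 mem_Collect_eq)
qed

lemma finite_coeffs: "finite {j. coeff (p :: cpol fract poly) j ~= 0}"
 by (rule finite_subset[of _ "{..degree p}"]) (auto simp: le_degree)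

text \<open>
  The map \<open>(x,y) \<mapsto> (p,q)\<close> is generically unramified: \<open>x\<close> is a simple root of its minimal polynomial
 over \<open>K\<close>, so its differential, and with it the one of \<open>y = p x + q\<close>, is a combination of \<open>dp\<close> and \<open>dq\<close>.
\<close>

lemma jacobian:
 "\<forall>\<^sub>F X in gen. \<exists>P1 P2 Q1 Q2. has_partials pf P1 P2 X & has_partials qf Q1 Q2 X & P1 * Q2 - P2 * Q1 ~= 0"
proof -
 define kills where "kills pl \<longleftrightarrow> pl ~= 0 & (\<forall>j. coeff pl j \<in> K) & poly pl x_elt = 0" for pl
 obtain pl0 where "pl0 ~= 0 & (\<forall>j. coeff pl0 j \<in> K) & poly pl0 x_elt = 0"
  using algebraic[OF x_elt_in] by (elim exE) (rule that)
 hence "kills pl0" unfolding kills_def .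
 from ex_has_least_nat[of kills, OF this, of degree]
 obtain pl where k: "kills pl" and min': "\<forall>p. kills p --> degree pl \<le> degree p" by (elim exE conjE) (rule that)
 have pl: "pl ~= 0" "!!j. coeff pl j \<in> K" "poly pl x_elt = 0" using k unfolding kills_def by simp_all
 have min: "degree pl \<le> degree p" if "p ~= 0" "\<forall>j. coeff p j \<in> K" "poly p x_elt = 0" for p
  using min' that unfolding kills_def by simp
 define n where "n = degree pl"
 have npos: "n ~= 0"
 proof
  assume "n = 0"
  then obtain c where "pl = [:c:]" unfolding n_def by (metis degree_eq_zeroE)
  thus False using pl(1,3) by simp
 qed
 have d_ne: "poly (pderiv pl) x_elt ~= 0"
 proof
  assume z: "poly (pderiv pl) x_elt = 0"
  have "coeff (pderiv pl) (n - 1) ~= 0"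
   using npos pl(1) of_nat_nonzero[OF npos] unfolding coeff_pderiv by (simp add: n_def)
  hence "pderiv pl ~= 0" by auto
  moreover have "\<forall>j. coeff (pderiv pl) j \<in> K"
   unfolding coeff_pderiv of_nat_cst using pl(2) cst_in is_subfieldD(4)[OF subfield_gauss] by blast
  ultimately have "n \<le> degree (pderiv pl)" using min z unfolding n_def by blast
  moreover have "degree (pderiv pl) \<le> n - 1"
   unfolding n_def by (rule degree_le) (auto simp: coeff_pderiv coeff_eq_0)
  ultimately show False using npos by simp
 qed
 have dL: "poly (pderiv pl) x_elt \<in> LL"
  unfolding poly_altdef coeff_pderiv of_nat_cst
  using pl(2) K_LL by (intro is_subfield_sum[OF sub_LL] is_subfieldD(4)[OF sub_LL] is_subfield_power[OF sub_LL] cst_in x_elt_in) auto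
 obtain N E where NE': "E ~= 0 & (\<forall>j\<le>n. coeff pl j ~= 0 --> N j ~= 0) &
  (\<forall>\<^sub>F X in gen. ev2 E (pf X) (qf X) ~= 0 & (\<forall>j\<le>n. ev2 (N j) (pf X) (qf X) = ev2 E (pf X) (qf X) * fval (coeff pl j) X))"
  using K_relation[of n "coeff pl", OF pl(2)] by (elim exE) (rule that)
 hence NE: "\<forall>\<^sub>F X in gen. ev2 E (pf X) (qf X) ~= 0 & (\<forall>j\<le>n. ev2 (N j) (pf X) (qf X) = ev2 E (pf X) (qf X) * fval (coeff pl j) X)"
  by (simp only: simp_thms)
 define H where "H = (\<Sum>j\<le>n. monom (N j) j)"
 have cH: "coeff (at_pt H p q) j = (if j \<le> n then ev2 (N j) p q else 0)" for p q j
  unfolding coeff_at_pt H_def coeff_sum coeff_monom by simp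
 have dH: "degree (at_pt H p q) \<le> n" for p q by (rule degree_le) (simp add: cH)
 have fd: "\<forall>\<^sub>F X in gen. \<forall>j. fdef (coeff pl j) X"
  using pl(2) K_LL by (intro gen_all_fdef finite_coeffs) auto
 have H0: "\<forall>\<^sub>F X in gen. poly (at_pt H (pf X) (qf X)) (fst X) = 0"
  using NE fd
 proof eventually_elim
  case (elim X)
  have "poly (at_pt H (pf X) (qf X)) (fst X) = (\<Sum>j\<le>n. ev2 E (pf X) (qf X) * (fval (coeff pl j) X * fst X ^ j))"
   unfolding poly_altdef_ge[OF dH] by (intro sum.cong) (use elim(1) in \<open>auto simp: cH\<close>)
  also have "\<dots> = ev2 E (pf X) (qf X) * fval (poly pl x_elt) X"
   using fval_poly[of pl X x_elt n] elim(2) fval_x_elt by (simp add: n_def sum_distrib_left)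
  finally show ?case using pl(3) fval_0 by simp
 qed
 have H1: "\<forall>\<^sub>F X in gen. poly (pderiv (at_pt H (pf X) (qf X))) (fst X) ~= 0"
  using NE fd gen_fval_nonzero[OF dL d_ne]
 proof eventually_elim
  case (elim X)
  have c': "fdef (coeff (pderiv pl) j) X & fval (coeff (pderiv pl) j) X = of_nat (Suc j) * fval (coeff pl (Suc j)) X" for j
   unfolding coeff_pderiv of_nat_cst using elim(2) fval_cst fval_mult by metis
  have dp: "degree (pderiv pl) \<le> n - 1"
   unfolding n_def by (rule degree_le) (auto simp: coeff_pderiv coeff_eq_0)
  have dp': "degree (pderiv (at_pt H (pf X) (qf X))) \<le> n - 1"
   using dH[of "pf X" "qf X"] by (simp add: degree_pderiv)
  have "poly (pderiv (at_pt H (pf X) (qf X))) (fst X) =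
    (\<Sum>j\<le>n - 1. ev2 E (pf X) (qf X) * ((of_nat (Suc j) * fval (coeff pl (Suc j)) X) * fst X ^ j))"
   unfolding poly_altdef_ge[OF dp'] coeff_pderiv
   by (intro sum.cong) (use elim(1) npos in \<open>auto simp: cH\<close>)
  also have "\<dots> = ev2 E (pf X) (qf X) * fval (poly (pderiv pl) x_elt) X"
   using fval_poly[of "pderiv pl" X x_elt "n - 1"] dp c' fval_x_elt by (simp add: sum_distrib_left del: of_nat_Suc)
  finally show ?case using elim by simp
 qed
 have qf_eq: "\<forall>\<^sub>F X in gen. qf X = snd X - pf X * fst X"
  using generic_regular by eventually_elim (use regular_values(5) in \<open>simp add: algebra_simps\<close>)
 show ?thesis
  using generic_regular H1 gen_partials_zero[OF H0] has_partials_cong_all[OF qf_eq]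
 proof eventually_elim
  case (elim X)
  obtain P1 P2 where P: "has_partials pf P1 P2 X"
   using fval_has_partials[OF regular_values(1)[OF elim(1)]] unfolding pf_def[abs_def] by blast
  define Q1 where "Q1 = - (pf X + fst X * P1)"
  define Q2 where "Q2 = 1 - fst X * P2"
  have P1: "((%u. pf (u, snd X)) has_field_derivative P1) (at (fst X))"
   and P2: "((%v. pf (fst X, v)) has_field_derivative P2) (at (snd X))" using P unfolding has_partials_def by auto
  have "((%u. snd X - pf (u, snd X) * u) has_field_derivative 0 - (pf (fst X, snd X) * 1 + P1 * fst X)) (at (fst X))"
   by (intro DERIV_diff DERIV_const DERIV_mult'[OF P1 DERIV_ident])
  moreover have "((%v. v - pf (fst X, v) * fst X) has_field_derivative 1 - (pf (fst X, snd X) * 0 + P2 * fst X)) (at (snd X))"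
   by (intro DERIV_diff DERIV_ident DERIV_mult'[OF P2 DERIV_const])
  ultimately have "has_partials (%X. snd X - pf X * fst X) Q1 Q2 X"
   unfolding has_partials_def Q1_def Q2_def by (simp add: mult.commute)
  hence Q: "has_partials qf Q1 Q2 X" using elim(4) by blast
  let ?wp = "poly (at_pt (diff_p H) (pf X) (qf X)) (fst X)" and ?wq = "poly (at_pt (diff_q H) (pf X) (qf X)) (fst X)"
   and ?u = "poly (pderiv (at_pt H (pf X) (qf X))) (fst X)"
  have "?wp * P1 + ?wq * Q1 + ?u * 1 = 0 & ?wp * P2 + ?wq * Q2 + ?u * 0 = 0"
   by (rule has_partials_unique[OF has_partials_at_pt[OF P Q has_partials_fst, of H] elim(3)])
  hence e: "?wp * P1 + ?wq * Q1 = - ?u" "?wp * P2 + ?wq * Q2 = 0" by (auto simp: add_eq_0_iff2)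
  have "P1 * Q2 - P2 * Q1 ~= 0"
  proof
   assume "P1 * Q2 - P2 * Q1 = 0"
   hence J: "P1 = - pf X * P2" unfolding Q1_def Q2_def by (simp add: algebra_simps add_eq_0_iff2)
   hence "Q1 = - pf X * Q2" unfolding Q1_def Q2_def by (simp add: algebra_simps)
   hence "?wp * P1 + ?wq * Q1 = - pf X * (?wp * P2 + ?wq * Q2)" using J by (simp add: algebra_simps)
   thus False using e elim(2) by simp
  qed
  thus ?case using P Q by blast
 qed
qed

lemma diff_tangency:
 "poly (at_pt (diff_p F) p q) s - s * poly (at_pt (diff_q F) p q) s = ev (vec3 s (p * s + q) 1) (\<omega> $ 2)"
proof -
 have "((%u. p + u) has_field_derivative 1) (at 0)" "((%u. q - u * s) has_field_derivative - s) (at 0)"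
  by (auto intro!: derivative_eq_intros)
 from DERIV_at_pt[OF this DERIV_const, of F s]
 have "((%u. poly (at_pt F (p + u) (q - u * s)) s) has_field_derivative
   poly (at_pt (diff_p F) p q) s - s * poly (at_pt (diff_q F) p q) s) (at 0)"
  by (simp add: mult.commute)
 moreover have "((%u. poly (at_pt F (p + u) (q - u * s)) s) has_field_derivative ev (vec3 s (p * s + q) 1) (\<omega> $ 2)) (at 0)"
 proof -
  have "poly (at_pt F (p + u) (q - u * s)) s = ev (vec3 s (p * s + q) 1) (\<omega> $ 1) + (p + u) * ev (vec3 s (p * s + q) 1) (\<omega> $ 2)" for u
   by (simp add: poly_tangency algebra_simps)
  thus ?thesis by (auto intro!: derivative_eq_intros)
 qed
 ultimately show ?thesis by (rule DERIV_unique)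
qed

lemma generic_root: "\<forall>\<^sub>F X in gen. poly (FX X) (fst X) = 0"
 using generic_regular by eventually_elim (rule regular_root)

lemma generic_simple: "\<forall>\<^sub>F X in gen. poly (pderiv (FX X)) (fst X) ~= 0"
 using jacobian generic_regular gen_partials_zero[OF generic_root]
proof eventually_elim
 case (elim X)
 obtain P1 P2 Q1 Q2 where PQ: "has_partials pf P1 P2 X" "has_partials qf Q1 Q2 X" "P1 * Q2 - P2 * Q1 ~= 0"
  using elim(1) by blast
 let ?wp = "poly (at_pt (diff_p F) (pf X) (qf X)) (fst X)" and ?wq = "poly (at_pt (diff_q F) (pf X) (qf X)) (fst X)"
  and ?u = "poly (pderiv (FX X)) (fst X)"
 have z: "?wp * P1 + ?wq * Q1 + ?u * 1 = 0 & ?wp * P2 + ?wq * Q2 + ?u * 0 = 0"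
  by (rule has_partials_unique[OF has_partials_at_pt[OF PQ(1,2) has_partials_fst, of F] elim(3)])
 show ?case
 proof
  assume u: "?u = 0"
  have e: "?wp * P1 + ?wq * Q1 = 0" "?wp * P2 + ?wq * Q2 = 0" using z u by auto
  have "?wp * (P1 * Q2 - P2 * Q1) = Q2 * (?wp * P1 + ?wq * Q1) - Q1 * (?wp * P2 + ?wq * Q2)"
   "?wq * (P1 * Q2 - P2 * Q1) = P1 * (?wp * P2 + ?wq * Q2) - P2 * (?wp * P1 + ?wq * Q1)"
   by (simp_all add: algebra_simps)
  hence "?wp = 0" "?wq = 0" using e PQ(3) by auto
  moreover have "vec3 (fst X) (pf X * fst X + qf X) 1 = pt X"
   using regular_values(5)[OF elim(2)] by (simp add: pt_def)
  ultimately show False using diff_tangency[of "pf X" "qf X" "fst X"] elim(2) by simp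
 qed
qed

definition poly_elt :: "cpoly3 => cpol fract => cpol fract" where
 "poly_elt H \<rho> = (\<Sum>j\<le>degree H. pq_elt (coeff H j) * \<rho> ^ j)"

lemma poly_elt_in: "\<rho> \<in> LL ==> poly_elt H \<rho> \<in> LL"
 unfolding poly_elt_def using pq_elt_in K_LL
 by (intro is_subfield_sum[OF sub_LL] is_subfieldD(4)[OF sub_LL] is_subfield_power[OF sub_LL]) auto

lemma fval_poly_elt:
 assumes "regular X" "fdef \<rho> X"
 shows "fdef (poly_elt H \<rho>) X & fval (poly_elt H \<rho>) X = poly (at_pt H (pf X) (qf X)) (fval \<rho> X)"
proof -
 have t: "fdef (pq_elt (coeff H j) * \<rho> ^ j) X & fval (pq_elt (coeff H j) * \<rho> ^ j) X = ev2 (coeff H j) (pf X) (qf X) * fval \<rho> X ^ j" for j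
  using fval_mult fval_power fval_pq_elt[OF assms(1)] assms(2) by metis
 thus ?thesis
  unfolding poly_elt_def poly_altdef_ge[OF degree_at_pt_le] coeff_at_pt by (simp add: fval_sum)
qed

lemma automorphism_poly_elt:
 assumes "\<sigma> \<in> G" "\<rho> \<in> LL"
 shows "\<sigma> (poly_elt H \<rho>) = poly_elt H (\<sigma> \<rho>)"
proof -
 have pq: "pq_elt E \<in> LL" for E using pq_elt_in K_LL by auto
 have pw: "\<rho> ^ j \<in> LL" for j by (rule is_subfield_power[OF sub_LL assms(2)])
 have t: "\<sigma> (pq_elt E * \<rho> ^ j) = pq_elt E * \<sigma> \<rho> ^ j" for E j
  unfolding aut_simps(3)[OF assms(1) sub_LL pq pw] aut_simps(4)[OF assms(1) sub_LL pq_elt_in]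
   automorphism_power[OF assms(1) sub_LL assms(2)] ..
 have "pq_elt E * \<rho> ^ j \<in> LL" for E j by (rule is_subfieldD(4)[OF sub_LL pq pw])
 thus ?thesis
  unfolding poly_elt_def by (subst automorphism_sum[OF assms(1) sub_LL]) (simp_all add: t)
qed

definition conjugates :: "cpol fract set" where
 "conjugates = {\<sigma> x_elt |\<sigma>. \<sigma> \<in> G}"

lemma conjugate_in: "\<rho> \<in> conjugates ==> \<rho> \<in> LL"
 unfolding conjugates_def using aut_simps(1)[OF _ sub_LL x_elt_in] by auto

lemma x_conjugate: "x_elt \<in> conjugates"
 unfolding conjugates_def using automorphism_id[of K LL] by (force intro: exI[of _ id])

lemma automorphism_conjugate: "\<sigma> \<in> G ==> \<rho> \<in> conjugates ==> \<sigma> \<rho> \<in> conjugates"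
proof -
 assume s: "\<sigma> \<in> G" and "\<rho> \<in> conjugates"
 then obtain \<tau> where t: "\<tau> \<in> G" "\<rho> = \<tau> x_elt" unfolding conjugates_def by blast
 hence "\<sigma> \<rho> = (\<sigma> \<circ> \<tau>) x_elt" by simp
 thus "\<sigma> \<rho> \<in> conjugates" unfolding conjugates_def using automorphism_comp[OF s t(1)] by blast
qed

lemma y_elt_eq: "y_elt = p_elt * x_elt + q_elt"
proof (rule LL_eqI[OF y_elt_in])
 show "p_elt * x_elt + q_elt \<in> LL"
  using p_elt_in q_elt_in K_LL x_elt_in is_subfieldD(3,4)[OF sub_LL] by blast
 show "\<forall>\<^sub>F X in gen. fval y_elt X = fval (p_elt * x_elt + q_elt) X"
  using generic_regular
 proof eventually_elim
  case (elim X)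
  have "fdef (p_elt * x_elt) X & fval (p_elt * x_elt) X = pf X * fst X"
   using fval_mult[OF regular_values(1)[OF elim], of x_elt] fval_x_elt[of X] by (simp add: pf_def)
  hence "fval (p_elt * x_elt + q_elt) X = pf X * fst X + qf X"
   using fval_add[of "p_elt * x_elt" X q_elt] regular_values(2)[OF elim] by (simp add: qf_def)
  thus ?case using regular_values(5)[OF elim] fval_y_elt[of X] by simp
 qed
qed

text \<open>
  The function field is generated by \<open>x\<close> over \<open>K\<close>, since \<open>y = p x
 + q\<close>.
\<close>

lemma automorphism_determined:
 assumes s: "\<sigma> \<in> G" and t: "\<tau> \<in> G" and e: "\<sigma> x_elt = \<tau> x_elt" and f: "f \<in> LL"
 shows "\<sigma> f = \<tau> f"
proof -
 have y: "\<upsilon> y_elt = p_elt * \<upsilon> x_elt + q_elt" if "\<upsilon> \<in> G" for \<upsilon>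
 proof -
  have m: "p_elt \<in> LL" "q_elt \<in> LL" "p_elt * x_elt \<in> LL"
   using p_elt_in q_elt_in K_LL x_elt_in is_subfieldD(4)[OF sub_LL] by auto
  show ?thesis
   unfolding y_elt_eq aut_simps(2)[OF that sub_LL m(3,2)]
    aut_simps(3)[OF that sub_LL m(1) x_elt_in]
    aut_simps(4)[OF that sub_LL p_elt_in] aut_simps(4)[OF that sub_LL q_elt_in] ..
 qed
 have a: "\<upsilon> (eval_at x_elt y_elt P) = eval_at (\<upsilon> x_elt) (\<upsilon> y_elt) P" if u: "\<upsilon> \<in> G" for \<upsilon> P
 proof -
  have tm: "cst c * (x_elt ^ i * y_elt ^ j) \<in> LL & \<upsilon> (cst c * (x_elt ^ i * y_elt ^ j)) = cst c * (\<upsilon> x_elt ^ i * \<upsilon> y_elt ^ j)" for c i j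
  proof -
   have m: "x_elt ^ i \<in> LL" "y_elt ^ j \<in> LL" "x_elt ^ i * y_elt ^ j \<in> LL" "cst c \<in> LL" "cst c \<in> K"
    using is_subfield_power[OF sub_LL] is_subfieldD(4)[OF sub_LL] x_elt_in y_elt_in cst_in by auto
   thus ?thesis
    using aut_simps(3,4)[OF u sub_LL] automorphism_power[OF u sub_LL] x_elt_in y_elt_in
     is_subfieldD(4)[OF sub_LL] by simp
  qed
  show ?thesis unfolding eval_at_def by (subst automorphism_sum[OF u sub_LL]) (simp_all add: tm)
 qed
 have same: "\<sigma> (eval_at x_elt y_elt P) = \<tau> (eval_at x_elt y_elt P)" for P
  using a[OF s] a[OF t] y[OF s] y[OF t] e by simp
 have inL: "eval_at x_elt y_elt P \<in> LL" for P by (intro eval_at_in sub_LL cst_in x_elt_in y_elt_in)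
 obtain P Q where PQ: "eval_at x_elt y_elt Q ~= 0" "f = eval_at x_elt y_elt P / eval_at x_elt y_elt Q"
  using LL_quotient[OF f] by blast
 have "f * eval_at x_elt y_elt Q = eval_at x_elt y_elt P" using PQ by simp
 hence "\<upsilon> f * \<upsilon> (eval_at x_elt y_elt Q) = \<upsilon> (eval_at x_elt y_elt P)" if "\<upsilon> \<in> G" for \<upsilon>
  using aut_simps(3)[OF that sub_LL f inL[of Q]] by simp
 from this[OF s] this[OF t] have "\<sigma> f * \<sigma> (eval_at x_elt y_elt Q) = \<tau> f * \<sigma> (eval_at x_elt y_elt Q)"
  by (simp only: same)
 moreover have "\<sigma> (eval_at x_elt y_elt Q) ~= 0"
  using aut_simps(5)[OF s sub_LL inL[of Q] LL_0] aut_simps(6)[OF s sub_LL] PQ(1) by simp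
 ultimately show ?thesis by simp
qed

lemma poly_elt_x: "poly_elt F x_elt = 0"
proof (rule LL_eqI[OF poly_elt_in[OF x_elt_in] LL_0])
 show "\<forall>\<^sub>F X in gen. fval (poly_elt F x_elt) X = fval 0 X"
  using generic_regular by eventually_elim (use fval_poly_elt fval_x_elt regular_root fval_0 in auto)
qed

lemma poly_elt_conjugate: "\<rho> \<in> conjugates ==> poly_elt F \<rho> = 0"
proof -
 assume "\<rho> \<in> conjugates"
 then obtain \<sigma> where s: "\<sigma> \<in> G" "\<rho> = \<sigma> x_elt" unfolding conjugates_def by blast
 hence "poly_elt F \<rho> = \<sigma> (poly_elt F x_elt)" using automorphism_poly_elt[OF s(1) x_elt_in] by simp
 thus ?thesis using poly_elt_x aut_simps(6)[OF s(1) sub_LL] by simp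
qed

lemma conjugate_root:
 assumes "\<rho> \<in> conjugates"
 shows "\<forall>\<^sub>F X in gen. poly (FX X) (fval \<rho> X) = 0"
 using generic_regular gen_fdef[OF conjugate_in[OF assms]]
proof eventually_elim
 case (elim X)
 thus ?case using fval_poly_elt[of X \<rho> F] poly_elt_conjugate[OF assms] fval_0[of X] by simp
qed

lemma generic_lead_pq: "\<forall>\<^sub>F X in gen. coeff (FX X) d ~= 0"
 unfolding coeff_at_pt by (rule dominant[OF lead_tangency_nonzero[OF w ncf]])

lemma distinct_values:
 assumes "finite S" "S \<subseteq> LL"
 shows "\<forall>\<^sub>F X in gen. inj_on (%\<rho>. fval \<rho> X) S"
proof -
 have "\<forall>\<^sub>F X in gen. \<forall>\<rho>\<in>S. \<forall>\<rho>'\<in>S. \<rho> ~= \<rho>' --> fval \<rho> X ~= fval \<rho>' X"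
 proof (intro eventually_ball_finite ballI assms(1))
  fix \<rho> \<rho>' assume "\<rho> \<in> S" "\<rho>' \<in> S"
  thus "\<forall>\<^sub>F X in gen. \<rho> ~= \<rho>' --> fval \<rho> X ~= fval \<rho>' X"
   using gen_fval_neq[of \<rho> \<rho>'] assms(2) by (cases "\<rho> = \<rho>'") auto
 qed
 thus ?thesis by eventually_elim (auto simp: inj_on_def)
qed

lemma card_conjugates_le:
 assumes "finite S" "S \<subseteq> conjugates"
 shows "card S \<le> d"
proof -
 have SL: "S \<subseteq> LL" using assms(2) conjugate_in by blast
 have "\<forall>\<^sub>F X in gen. \<forall>\<rho>\<in>S. poly (FX X) (fval \<rho> X) = 0"
  using assms conjugate_root by (intro eventually_ball_finite) auto
 hence "\<forall>\<^sub>F X in gen. card S \<le> d"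
  using distinct_values[OF assms(1) SL] generic_lead_pq
 proof eventually_elim
  case (elim X)
  have nz: "FX X ~= 0" using elim(3) by auto
  have "card S = card ((%\<rho>. fval \<rho> X) ` S)" using elim(2) by (simp add: card_image)
  also have "\<dots> \<le> card {s. poly (FX X) s = 0}"
   using elim(1) by (intro card_mono poly_roots_finite nz) auto
  also have "\<dots> \<le> d" using card_poly_roots_bound[OF nz] degree_FX order_trans by blast
  finally show ?case .
 qed
 thus ?thesis by simp
qed

lemma finite_conjugates: "finite conjugates"
 using finite_if_finite_subsets_card_bdd[of conjugates d] card_conjugates_le by blast

lemma automorphism_bij_conjugates:
 assumes "\<sigma> \<in> G"
 shows "bij_betw \<sigma> conjugates conjugates"
proof -
 have "inj_on \<sigma> conjugates"
  using aut_simps(5)[OF assms sub_LL] conjugate_in by (auto simp: inj_on_def)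
 moreover have "\<sigma> ` conjugates \<subseteq> conjugates" using automorphism_conjugate[OF assms] by blast
 ultimately show ?thesis
  using finite_conjugates by (simp add: bij_betw_def endo_inj_surj)
qed

text \<open>
  The monic polynomial with the conjugates of \<open>x\<close> as roots has coefficients in \<open>K\<close>, so it takes the
 same values at all \<open>d\<close> points of tangency of a generic line; each of them is one of its roots.
\<close>

lemma card_conjugates: "card conjugates = d"
proof (rule antisym)
 show "card conjugates \<le> d" by (rule card_conjugates_le[OF finite_conjugates subset_refl])
 show "d \<le> card conjugates"
 proof -
  let ?e = "card conjugates"
  define m where "m T = (\<Prod>\<rho>\<in>conjugates. cst T - \<rho>)" for T
  have diffL: "cst T - \<rho> \<in> LL" if "\<rho> \<in> conjugates" for T \<rho>
   using is_subfieldD(7)[OF sub_LL] cst_in conjugate_in[OF that] by blast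
  have mK: "m T \<in> K" for T
  proof (rule fixed_in_K)
   show "m T \<in> LL" unfolding m_def by (intro is_subfield_prod[OF sub_LL] diffL)
   fix \<sigma> assume s: "\<sigma> \<in> G"
   have sd: "\<sigma> (cst T - \<rho>) = cst T - \<sigma> \<rho>" if "\<rho> \<in> conjugates" for \<rho>
   proof -
    have "\<sigma> (cst T - \<rho>) + \<sigma> \<rho> = \<sigma> (cst T)"
     using aut_simps(2)[OF s sub_LL diffL[OF that] conjugate_in[OF that]] by simp
    thus ?thesis using aut_simps(4)[OF s sub_LL cst_in(1)] by (simp add: algebra_simps)
   qed
   have "\<sigma> (m T) = (\<Prod>\<rho>\<in>conjugates. cst T - \<sigma> \<rho>)"
    unfolding m_def using automorphism_prod[OF s sub_LL, of conjugates "%\<rho>. cst T - \<rho>"] diffL sd by simp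
   also have "\<dots> = m T" unfolding m_def by (rule prod.reindex_bij_betw[OF automorphism_bij_conjugates[OF s]])
   finally show "\<sigma> (m T) = m T" .
  qed
  obtain S :: "complex set" where S: "finite S" "card S = Suc ?e"
   using infinite_arbitrarily_large[OF infinite_UNIV_char_0] by blast
  have "\<forall>T\<in>S. \<exists>NE. \<forall>\<^sub>F X in gen. fval (m T) X = ev2 (fst NE) (pf X) (qf X) / ev2 (snd NE) (pf X) (qf X)"
  proof
   fix T assume "T \<in> S"
   obtain N E where NE: "E ~= 0 & (m T ~= 0 --> N ~= 0) & (\<forall>\<^sub>F X in gen. ev2 E (pf X) (qf X) ~= 0 &
     fval (m T) X = ev2 N (pf X) (qf X) / ev2 E (pf X) (qf X))"
    using K_rational[OF mK[of T]] by (elim exE) (rule that)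
   have "\<forall>\<^sub>F X in gen. fval (m T) X = ev2 N (pf X) (qf X) / ev2 E (pf X) (qf X)"
    using NE[THEN conjunct2, THEN conjunct2] by eventually_elim (elim conjE)
   thus "\<exists>NE. \<forall>\<^sub>F X in gen. fval (m T) X = ev2 (fst NE) (pf X) (qf X) / ev2 (snd NE) (pf X) (qf X)"
    by (intro exI[of _ "(N, E)"]) simp
  qed
  from bchoice[OF this] obtain NE where
   NE: "\<forall>T\<in>S. \<forall>\<^sub>F X in gen. fval (m T) X = ev2 (fst (NE T)) (pf X) (qf X) / ev2 (snd (NE T)) (pf X) (qf X)" ..
  have "\<forall>\<^sub>F X in gen. \<forall>T\<in>S. fval (m T) X = ev2 (fst (NE T)) (pf X) (qf X) / ev2 (snd (NE T)) (pf X) (qf X)"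
   using NE S(1) by (intro eventually_ball_finite) auto
  moreover have "\<forall>\<^sub>F X in gen. \<forall>\<rho>\<in>conjugates. fdef \<rho> X"
   using finite_conjugates conjugate_in gen_fdef by (intro eventually_ball_finite) auto
  ultimately have "\<forall>\<^sub>F X in gen. (\<forall>T\<in>S. (\<Prod>\<rho>\<in>conjugates. T - fval \<rho> X) =
     ev2 (fst (NE T)) (pf X) (qf X) / ev2 (snd (NE T)) (pf X) (qf X)) &
    poly (pderiv (FX X)) (fst X) ~= 0"
   using generic_simple
  proof eventually_elim
   case (elim X)
   have "fval (m T) X = (\<Prod>\<rho>\<in>conjugates. T - fval \<rho> X)" for T
   proof -
    have "fdef (cst T - \<rho>) X & fval (cst T - \<rho>) X = T - fval \<rho> X" if "\<rho> \<in> conjugates" for \<rho>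
     using fval_diff fval_cst elim(2) that by metis
    thus ?thesis unfolding m_def using fval_prod[of conjugates "%\<rho>. cst T - \<rho>" X] by simp
   qed
   thus ?case using elim by auto
  qed
  from generic_tangency_points[OF this] have "\<forall>\<^sub>F Y in gen. d \<le> ?e"
  proof eventually_elim
   case (elim Y)
   let ?f = "at_pt F (fst Y) (snd Y)"
   let ?X = "%s. (s, fst Y * s + snd Y)"
   have f0: "?f ~= 0" and degf: "degree ?f = d"
    using elim degree_FX[of "fst Y" "snd Y"] le_degree[of ?f d] by auto
   have "\<forall>s. \<not> (poly ?f s = 0 & poly (pderiv ?f) s = 0)"
   proof (intro allI notI)
    fix s assume s: "poly ?f s = 0 & poly (pderiv ?f) s = 0"
    hence ne: "poly (pderiv (at_pt F (pf (?X s)) (qf (?X s)))) (fst (?X s)) ~= 0"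
     and p: "pf (?X s) = fst Y" and q: "qf (?X s) = snd Y"
     using elim by blast+
    show False using ne s unfolding p q by simp
   qed
   hence "rsquarefree ?f" by (simp add: rsquarefree_roots)
   from complex_poly_decompose_rsquarefree[OF this]
   have "degree ?f = degree (\<Prod>z\<in>{z. poly ?f z = 0}. [:- z, 1:])"
    using f0 by (metis degree_smult_eq leading_coeff_0_iff)
   also have "\<dots> = card {z. poly ?f z = 0}"
    by (subst degree_prod_eq_sum_degree) auto
   finally have cardf: "card {z. poly ?f z = 0} = d" using degf by simp
   define M where "M s = (\<Prod>\<rho>\<in>conjugates. [:- fval \<rho> (?X s), 1:])" for s
   have degM: "degree (M s) = ?e" for s unfolding M_def by (subst degree_prod_eq_sum_degree) auto
   have same: "M s = M s'" if "poly ?f s = 0" "poly ?f s' = 0" for s s'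
   proof (rule poly_eq_if_agree[OF S(1)])
    fix T assume T: "T \<in> S"
    have "poly (M s) T = ev2 (fst (NE T)) (fst Y) (snd Y) / ev2 (snd (NE T)) (fst Y) (snd Y)" if "poly ?f s = 0" for s
    proof -
     have "(\<Prod>\<rho>\<in>conjugates. T - fval \<rho> (?X s)) = ev2 (fst (NE T)) (pf (?X s)) (qf (?X s)) / ev2 (snd (NE T)) (pf (?X s)) (qf (?X s))"
      "pf (?X s) = fst Y" "qf (?X s) = snd Y" using elim that T by blast+
     thus ?thesis by (simp add: M_def poly_prod)
    qed
    thus "poly (M s) T = poly (M s') T" using that by simp
   qed (simp_all add: degM S)
   have root: "poly (M s) s = 0" for s
    unfolding M_def poly_prod using finite_conjugates x_conjugate fval_x_elt[of "?X s"] by (auto intro!: bexI[of _ x_elt])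
   have "?f ~= 0 ==> \<exists>s0. poly ?f s0 = 0" using root_exists elim by blast
   then obtain s0 where s0: "poly ?f s0 = 0" using f0 by blast
   have M0: "M s0 ~= 0" unfolding M_def using finite_conjugates by auto
   have "{z. poly ?f z = 0} \<subseteq> {z. poly (M s0) z = 0}" using same[OF s0] root by force
   hence "d \<le> card {z. poly (M s0) z = 0}" using cardf card_mono[OF poly_roots_finite[OF M0]] by metis
   also have "\<dots> \<le> ?e" using card_poly_roots_bound[OF M0] degM by simp
   finally show ?case .
  qed
  thus ?thesis by simp
 qed
qed

end

section \<open>The number of involutions is locally constant\<close>

definition growth_exponent :: "nat => nat" where
 "growth_exponent d = (SOME n. \<forall>\<omega>\<in>forms d. \<exists>C. \<forall>p q.
   (\<Sum>j\<le>d. norm (coeff (at_pt (tangency \<omega>) p q) j)) \<le> C * ((1 + norm p) * (1 + norm q)) ^ n)"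

lemma growth_exponent:
 "\<omega> \<in> forms d ==> \<exists>C. \<forall>p q.
   (\<Sum>j\<le>d. norm (coeff (at_pt (tangency \<omega>) p q) j)) \<le> C * ((1 + norm p) * (1 + norm q)) ^ growth_exponent d"
 unfolding growth_exponent_def using someI_ex[OF tangency_growth[of d]] by blast

text \<open>The number of \<open>\<sigma>\<close> in the Galois group with \<open>\<sigma>\<^sup>2 = 1\<close>, each represented by the image of \<open>x\<close>.\<close>

definition involutions :: "form => nat" where
 "involutions \<omega> = card {\<rho>. \<exists>\<sigma>\<in>field_automorphisms_over (gauss_subfield \<omega>) LL. \<rho> = \<sigma> x_elt & \<sigma> \<rho> = x_elt}"

context galois_form
begin

abbreviation cofs :: "nat => nat => cpol fract => cpol fract => complex \<times> complex => complex" where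
 "cofs k l i j X \<equiv> cofactor (FX X) k (fval i X) * cofactor (FX X) l (fval j X)"

abbreviation uu :: "cpol fract => cpol fract => complex \<times> complex => complex" where
 "uu i j X \<equiv> uX i X * uX j X"

definition sg :: "cpol fract => cpol fract => cpol fract" where
 "sg \<rho> = (SOME \<sigma>. \<sigma> \<in> G & \<sigma> x_elt = \<rho>)"

text \<open>
  Ordered pairs of conjugates of \<open>x\<close> fall into \<open>d\<close> orbits under the
 Galois group. The orbit of \<open>(\<rho>, \<rho>')\<close> is recorded by its member \<open>(x,
 \<kappa>)\<close>; exchanging the two entries turns \<open>\<kappa>\<close> into the class of
 the inverse automorphism.
\<close>

definition cls :: "cpol fract => cpol fract => cpol fract" where
 "cls \<rho> \<rho>' = inv_into LL (sg \<rho>) \<rho>'"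

lemma sg: "\<rho> \<in> conjugates ==> sg \<rho> \<in> G & sg \<rho> x_elt = \<rho>"
proof -
 assume "\<rho> \<in> conjugates"
 then obtain \<sigma> where "\<sigma> \<in> G & \<sigma> x_elt = \<rho>" by (auto simp: conjugates_def)
 thus ?thesis unfolding sg_def by (rule someI[of "%\<sigma>. \<sigma> \<in> G & \<sigma> x_elt = \<rho>"])
qed

lemma sg_eq: "\<sigma> \<in> G ==> f \<in> LL ==> sg (\<sigma> x_elt) f = \<sigma> f"
 using sg[of "\<sigma> x_elt"] automorphism_determined[of "sg (\<sigma> x_elt)" \<sigma> f] by (auto simp: conjugates_def)

lemma cls_in: "\<rho> \<in> conjugates ==> \<rho>' \<in> conjugates ==> cls \<rho> \<rho>' \<in> conjugates"
 unfolding cls_def using sg automorphism_inv[OF _ sub_LL K_LL] automorphism_conjugate by blast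

lemma sg_cls: "\<rho> \<in> conjugates ==> \<rho>' \<in> conjugates ==> sg \<rho> (cls \<rho> \<rho>') = \<rho>'"
 unfolding cls_def using sg conjugate_in automorphism_inv_apply(1) by blast

lemma cls_unique: "\<rho> \<in> conjugates ==> \<kappa> \<in> conjugates ==> sg \<rho> \<kappa> = \<rho>' ==> cls \<rho> \<rho>' = \<kappa>"
 unfolding cls_def using sg conjugate_in automorphism_inv_apply(2) by blast

lemma cls_automorphism:
 assumes s: "\<sigma> \<in> G" and r: "\<rho> \<in> conjugates" "\<rho>' \<in> conjugates"
 shows "cls (\<sigma> \<rho>) (\<sigma> \<rho>') = cls \<rho> \<rho>'"
proof (rule cls_unique[OF automorphism_conjugate[OF s r(1)] cls_in[OF r]])
 have c: "\<sigma> \<circ> sg \<rho> \<in> G" using automorphism_comp s sg[OF r(1)] by blast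
 have "sg (\<sigma> \<rho>) (cls \<rho> \<rho>') = (\<sigma> \<circ> sg \<rho>) (cls \<rho> \<rho>')"
  using sg_eq[OF c conjugate_in[OF cls_in[OF r]]] sg[OF r(1)] by simp
 thus "sg (\<sigma> \<rho>) (cls \<rho> \<rho>') = \<sigma> \<rho>'" using sg_cls[OF r] by simp
qed

lemma cls_x: "\<rho> \<in> conjugates ==> cls x_elt \<rho> = \<rho>"
 by (rule cls_unique[OF x_conjugate]) (use sg_eq[OF automorphism_id, of \<rho>] conjugate_in in auto)

lemma cls_swap: "\<rho> \<in> conjugates ==> \<rho>' \<in> conjugates ==> cls \<rho>' \<rho> = cls (cls \<rho> \<rho>') x_elt"
 using cls_automorphism[of "sg \<rho>" "cls \<rho> \<rho>'" x_elt] sg[of \<rho>] sg_cls[of \<rho> \<rho>'] cls_in x_conjugate by simp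

definition pair_elt :: "(nat => nat => cpoly2) => cpol fract => cpol fract => cpol fract" where
 "pair_elt h \<rho> \<rho>' = (\<Sum>k<d. \<Sum>l<d. pq_elt (h k l) * (\<rho> ^ k * \<rho>' ^ l))"

lemma pq_elt_LL: "pq_elt E \<in> LL"
 using pq_elt_in K_LL by auto

lemma pair_term_in: "\<rho> \<in> LL ==> \<rho>' \<in> LL ==> pq_elt E * (\<rho> ^ k * \<rho>' ^ l) \<in> LL"
 by (intro is_subfieldD(4)[OF sub_LL] is_subfield_power[OF sub_LL] pq_elt_LL)

lemma pair_elt_in: "\<rho> \<in> LL ==> \<rho>' \<in> LL ==> pair_elt h \<rho> \<rho>' \<in> LL"
 unfolding pair_elt_def by (intro is_subfield_sum[OF sub_LL] pair_term_in)

lemma fval_pair_elt: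
 assumes "regular X" "fdef \<rho> X" "fdef \<rho>' X"
 shows "fdef (pair_elt h \<rho> \<rho>') X &
  fval (pair_elt h \<rho> \<rho>') X = pair_value d (%k l. ev2 (h k l) (pf X) (qf X)) (fval \<rho> X) (fval \<rho>' X)"
proof -
 have t: "fdef (pq_elt E * (\<rho> ^ k * \<rho>' ^ l)) X & fval (pq_elt E * (\<rho> ^ k * \<rho>' ^ l)) X = ev2 E (pf X) (qf X) * (fval \<rho> X ^ k * fval \<rho>' X ^ l)" for E k l
  using fval_mult fval_power fval_pq_elt[OF assms(1)] assms(2,3) by metis
 thus ?thesis unfolding pair_elt_def pair_value_def by (simp add: fval_sum mult.assoc)
qed

lemma automorphism_pair_elt:
 assumes s: "\<sigma> \<in> G" and r: "\<rho> \<in> LL" "\<rho>' \<in> LL"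
 shows "\<sigma> (pair_elt h \<rho> \<rho>') = pair_elt h (\<sigma> \<rho>) (\<sigma> \<rho>')"
proof -
 have pw: "\<rho> ^ k \<in> LL" "\<rho>' ^ k \<in> LL" "\<rho> ^ k * \<rho>' ^ l \<in> LL" for k l
  using r by (auto intro: is_subfieldD(4)[OF sub_LL] is_subfield_power[OF sub_LL])
 have t: "\<sigma> (pq_elt E * (\<rho> ^ k * \<rho>' ^ l)) = pq_elt E * (\<sigma> \<rho> ^ k * \<sigma> \<rho>' ^ l)" for E k l
  unfolding aut_simps(3)[OF s sub_LL pq_elt_LL pw(3)] aut_simps(3)[OF s sub_LL pw(1,2)]
   aut_simps(4)[OF s sub_LL pq_elt_in] automorphism_power[OF s sub_LL r(1)] automorphism_power[OF s sub_LL r(2)] ..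
 have inner: "(\<Sum>l<d. pq_elt (h k l) * (\<rho> ^ k * \<rho>' ^ l)) \<in> LL" for k
  by (intro is_subfield_sum[OF sub_LL] pair_term_in r)
 have i: "\<sigma> (\<Sum>l<d. pq_elt (h k l) * (\<rho> ^ k * \<rho>' ^ l)) = (\<Sum>l<d. pq_elt (h k l) * (\<sigma> \<rho> ^ k * \<sigma> \<rho>' ^ l))" for k
  by (subst automorphism_sum[OF s sub_LL]) (simp_all add: t pair_term_in r)
 show ?thesis
  unfolding pair_elt_def by (subst automorphism_sum[OF s sub_LL]) (simp_all add: inner i)
qed

text \<open>
  A relation between \<open>x\<close> and \<open>\<kappa>\<close> over \<open>K\<close> is carried
 to every other pair of the class by an automorphism.
\<close>

lemma spread:
 assumes k: "\<kappa> \<in> conjugates"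
  and const: "\<forall>\<^sub>F X in gen. pair_value d (%k l. ev2 (h k l) (pf X) (qf X)) (fval x_elt X) (fval \<kappa> X) =
     c * (uu x_elt \<kappa> X)"
  and ij: "i \<in> conjugates" "j \<in> conjugates" "cls i j = \<kappa>"
 shows "\<forall>\<^sub>F X in gen. pair_value d (%k l. ev2 (h k l) (pf X) (qf X)) (fval i X) (fval j X) =
     c * (uu i j X)"
proof -
 let ?U = "%\<rho>. poly_elt (pderiv F) \<rho>"
 have rhs_in: "cst c * (?U \<rho> * ?U \<rho>') \<in> LL" if "\<rho> \<in> LL" "\<rho>' \<in> LL" for \<rho> \<rho>'
  using that by (intro is_subfieldD(4)[OF sub_LL] cst_in poly_elt_in)
 have rhs_val: "fval (cst c * (?U \<rho> * ?U \<rho>')) X = c * (uu \<rho> \<rho>' X)"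
  if "regular X" "fdef \<rho> X" "fdef \<rho>' X" for \<rho> \<rho>' X
  using fval_poly_elt[OF that(1,2), of "pderiv F"] fval_poly_elt[OF that(1,3), of "pderiv F"] fval_cst[of c X]
   fval_mult[of "?U \<rho>" X "?U \<rho>'"] fval_mult[of "cst c" X "?U \<rho> * ?U \<rho>'"] by (simp add: pderiv_at_pt)
 note kL = conjugate_in[OF k] and iL = conjugate_in[OF ij(1)] and jL = conjugate_in[OF ij(2)]
 have eq: "pair_elt h x_elt \<kappa> = cst c * (?U x_elt * ?U \<kappa>)"
 proof (rule LL_eqI[OF pair_elt_in[OF x_elt_in kL] rhs_in[OF x_elt_in kL]])
  show "\<forall>\<^sub>F X in gen. fval (pair_elt h x_elt \<kappa>) X = fval (cst c * (?U x_elt * ?U \<kappa>)) X"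
   using const generic_regular gen_fdef[OF kL]
   by eventually_elim (use fval_pair_elt rhs_val fval_x_elt in simp)
 qed
 have s: "sg i \<in> G" "sg i x_elt = i" "sg i \<kappa> = j" using sg[OF ij(1)] sg_cls[OF ij(1,2)] ij(3) by auto
 have U: "?U x_elt \<in> LL" "?U \<kappa> \<in> LL" "?U x_elt * ?U \<kappa> \<in> LL"
  using poly_elt_in x_elt_in kL is_subfieldD(4)[OF sub_LL] by auto
 have "pair_elt h i j = sg i (cst c * (?U x_elt * ?U \<kappa>))"
  unfolding eq[symmetric] automorphism_pair_elt[OF s(1) x_elt_in kL] s(2,3) ..
 also have "\<dots> = cst c * (?U i * ?U j)"
  unfolding aut_simps(3)[OF s(1) sub_LL cst_in(2) U(3)] aut_simps(3)[OF s(1) sub_LL U(1,2)]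
   aut_simps(4)[OF s(1) sub_LL cst_in(1)] automorphism_poly_elt[OF s(1) x_elt_in]
   automorphism_poly_elt[OF s(1) kL] s(2,3) ..
 finally have eq': "pair_elt h i j = cst c * (?U i * ?U j)" .
 show ?thesis
  using generic_regular gen_fdef[OF iL] gen_fdef[OF jL]
 proof eventually_elim
  case (elim X)
  thus ?case using fval_pair_elt[of X i j h] rhs_val[of X i j] eq' by simp
 qed
qed

text \<open>
  The sum of a product of cofactors over one class of pairs is fixed by the Galois group, hence a
  rational function of \<open>(p,q)\<close>. Its growth is controlled by the bound on cofactors.
\<close>

lemma class_sum_poly:
 assumes k: "\<kappa> \<in> conjugates" and kl: "k < d" "l < d"
 shows "\<exists>h. degree h \<le> 2 * growth_exponent d & (\<forall>i. degree (coeff h i) \<le> 2 * growth_exponent d) &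
  (\<forall>\<^sub>F X in gen. ev2 h (pf X) (qf X) =
    (\<Sum>(i, j)\<in>{(i, j). i \<in> conjugates & j \<in> conjugates & cls i j = \<kappa>}.
     cofs k l i j X))"
proof -
 let ?P = "{(i, j). i \<in> conjugates & j \<in> conjugates & cls i j = \<kappa>}"
 let ?c = "%k \<rho>. poly_elt (poly_shift (Suc k) F) \<rho>"
 define z where "z = (\<Sum>x\<in>?P. ?c k (fst x) * ?c l (snd x))"
 have finP: "finite ?P" by (rule finite_subset[of _ "conjugates \<times> conjugates"]) (use finite_conjugates in auto)
 have term_in: "?c k (fst x) * ?c l (snd x) \<in> LL" if "x \<in> ?P" for x
  using that conjugate_in by (auto intro!: is_subfieldD(4)[OF sub_LL] poly_elt_in)
 have zK: "z \<in> K"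
 proof (rule fixed_in_K)
  show "z \<in> LL" unfolding z_def by (rule is_subfield_sum[OF sub_LL term_in])
  fix \<sigma> assume s: "\<sigma> \<in> G"
  define \<phi> where "\<phi> x = (\<sigma> (fst x), \<sigma> (snd x))" for x
  have "inj_on \<phi> ?P"
   using aut_simps(5)[OF s sub_LL] conjugate_in by (auto simp: inj_on_def \<phi>_def)
  moreover have "\<phi> ` ?P \<subseteq> ?P"
   using automorphism_conjugate[OF s] cls_automorphism[OF s] by (auto simp: \<phi>_def)
  ultimately have bij: "bij_betw \<phi> ?P ?P" using finP by (simp add: bij_betw_def endo_inj_surj)
  have t: "\<sigma> (?c k (fst x) * ?c l (snd x)) = ?c k (fst (\<phi> x)) * ?c l (snd (\<phi> x))" if "x \<in> ?P" for x
  proof -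
   have "fst x \<in> LL" "snd x \<in> LL" using that conjugate_in by auto
   thus ?thesis
    using aut_simps(3)[OF s sub_LL poly_elt_in poly_elt_in] automorphism_poly_elt[OF s]
    by (simp add: \<phi>_def)
  qed
  have "\<sigma> z = (\<Sum>x\<in>?P. ?c k (fst (\<phi> x)) * ?c l (snd (\<phi> x)))"
   unfolding z_def by (subst automorphism_sum[OF s sub_LL term_in]) (auto intro!: sum.cong t)
  also have "\<dots> = z" unfolding z_def by (rule sum.reindex_bij_betw[OF bij])
  finally show "\<sigma> z = z" .
 qed
 obtain N E where NE: "E ~= 0 & (z ~= 0 --> N ~= 0) &
  (\<forall>\<^sub>F X in gen. ev2 E (pf X) (qf X) ~= 0 & fval z X = ev2 N (pf X) (qf X) / ev2 E (pf X) (qf X))"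
  using K_rational[OF zK] by (elim exE) (rule that)
 have shift: "at_pt (poly_shift n F) p q = poly_shift n (at_pt F p q)" for n p q
  by (rule poly_eqI) (simp add: coeff_at_pt coeff_poly_shift)
 have "\<forall>\<^sub>F X in gen. \<forall>\<rho>\<in>conjugates. fdef \<rho> X & poly (FX X) (fval \<rho> X) = 0"
  using finite_conjugates conjugate_in gen_fdef conjugate_root by (intro eventually_ball_finite ballI eventually_conj) auto
 hence val: "\<forall>\<^sub>F X in gen. (\<forall>\<rho>\<in>conjugates. poly (FX X) (fval \<rho> X) = 0) &
   fval z X = (\<Sum>x\<in>?P. cofs k l (fst x) (snd x) X)"
  using generic_regular
 proof eventually_elim
  case (elim X)
  have t: "fdef (?c k (fst x) * ?c l (snd x)) X & fval (?c k (fst x) * ?c l (snd x)) X =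
    cofs k l (fst x) (snd x) X" if "x \<in> ?P" for x
  proof -
   have "fdef (fst x) X" "fdef (snd x) X" using that elim(1) by auto
   hence "fdef (?c k (fst x)) X & fval (?c k (fst x)) X = cofactor (FX X) k (fval (fst x) X)"
    "fdef (?c l (snd x)) X & fval (?c l (snd x)) X = cofactor (FX X) l (fval (snd x) X)"
    using fval_poly_elt[OF elim(2)] shift unfolding cofactor_def by auto
   thus ?thesis using fval_mult[of "?c k (fst x)" X "?c l (snd x)"] by simp
  qed
  have "fval z X = (\<Sum>x\<in>?P. fval (?c k (fst x) * ?c l (snd x)) X)"
   unfolding z_def using t by (intro fval_sum[THEN conjunct2]) blast
  also have "\<dots> = (\<Sum>x\<in>?P. cofs k l (fst x) (snd x) X)"
   by (rule sum.cong[OF refl]) (use t in blast)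
  finally show ?case using elim(1) by blast
 qed
 obtain B where B: "!!p q. (\<Sum>j\<le>d. norm (coeff (at_pt F p q) j)) \<le> B * ((1 + norm p) * (1 + norm q)) ^ growth_exponent d"
  using growth_exponent[OF w] by blast
 let ?n = "growth_exponent d"
 have B0: "0 \<le> B"
  using order_trans[OF sum_nonneg[of "{..d}" "%j. norm (coeff (at_pt F 0 0) j)"] B[of 0 0]] by simp
 have "\<forall>\<^sub>F X in gen. norm (ev2 N (pf X) (qf X)) \<le>
   (real (card ?P) * B\<^sup>2) * (1 + norm (pf X)) ^ (2 * ?n) * (1 + norm (qf X)) ^ (2 * ?n) * norm (ev2 E (pf X) (qf X))"
  using NE[THEN conjunct2, THEN conjunct2] val
 proof eventually_elim
  case (elim X)
  let ?w = "(1 + norm (pf X)) * (1 + norm (qf X))"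
  let ?cof = "%k \<rho>. cofactor (FX X) k (fval \<rho> X)"
  have cb: "norm (?cof k \<rho>) \<le> B * ?w ^ ?n" if "\<rho> \<in> conjugates" for k \<rho>
   using norm_cofactor_le[OF _ degree_FX, of "pf X" "qf X" "fval \<rho> X" k] elim(2) that B[of "pf X" "qf X"]
   by (meson order_trans)
  have "norm (fval z X) \<le> (\<Sum>x\<in>?P. norm (?cof k (fst x)) * norm (?cof l (snd x)))"
   using elim(2) norm_sum[of "%x. ?cof k (fst x) * ?cof l (snd x)" ?P] by (simp add: norm_mult)
  also have "\<dots> \<le> (\<Sum>x\<in>?P. (B * ?w ^ ?n) * (B * ?w ^ ?n))"
   using B0 by (intro sum_mono mult_mono cb) auto
  also have "\<dots> = (real (card ?P) * B\<^sup>2) * (1 + norm (pf X)) ^ (2 * ?n) * (1 + norm (qf X)) ^ (2 * ?n)"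
   by (simp add: power2_eq_square power_mult_distrib mult_2 mult_2_right power_add mult_ac)
  finally have "norm (fval z X) * norm (ev2 E (pf X) (qf X)) \<le>
   (real (card ?P) * B\<^sup>2) * (1 + norm (pf X)) ^ (2 * ?n) * (1 + norm (qf X)) ^ (2 * ?n) * norm (ev2 E (pf X) (qf X))"
   by (rule mult_right_mono) simp
  moreover have "norm (fval z X) * norm (ev2 E (pf X) (qf X)) = norm (ev2 N (pf X) (qf X))"
   using elim(1) by (simp add: norm_divide)
  ultimately show ?case by simp
 qed
 from generic_tangency_points[OF this]
 have bound_gen: "\<forall>\<^sub>F Y in gen. Y \<in> {Y. norm (ev2 N (fst Y) (snd Y)) \<le>
   (real (card ?P) * B\<^sup>2) * (1 + norm (fst Y)) ^ (2 * ?n) * (1 + norm (snd Y)) ^ (2 * ?n) * norm (ev2 E (fst Y) (snd Y))}"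
 proof eventually_elim
  case (elim Y)
  obtain s where s: "poly (at_pt F (fst Y) (snd Y)) s = 0" using root_exists elim by blast
  let ?X = "(s, fst Y * s + snd Y)"
  have b: "norm (ev2 N (pf ?X) (qf ?X)) \<le>
   (real (card ?P) * B\<^sup>2) * (1 + norm (pf ?X)) ^ (2 * ?n) * (1 + norm (qf ?X)) ^ (2 * ?n) * norm (ev2 E (pf ?X) (qf ?X))"
   and p: "pf ?X = fst Y" and q: "qf ?X = snd Y" using elim s by blast+
  show ?case using b unfolding p q by simp
 qed
 have "closed {Y. norm (ev2 N (fst Y) (snd Y)) \<le>
   (real (card ?P) * B\<^sup>2) * (1 + norm (fst Y)) ^ (2 * ?n) * (1 + norm (snd Y)) ^ (2 * ?n) * norm (ev2 E (fst Y) (snd Y))}"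
  by (intro closed_Collect_le continuous_intros continuous_ev2)
 from gen_closed[OF this bound_gen]
 have "norm (ev2 N p q) \<le> (real (card ?P) * B\<^sup>2) * (1 + norm p) ^ (2 * ?n) * (1 + norm q) ^ (2 * ?n) * norm (ev2 E p q)" for p q
  by (metis (mono_tags, lifting) fst_conv mem_Collect_eq snd_conv)
 from growth_divides2[OF NE[THEN conjunct1] this] obtain h where
  h: "N = h * E" "degree h \<le> 2 * ?n" "\<forall>i. degree (coeff h i) \<le> 2 * ?n" by (elim exE conjE) (rule that)
 have "\<forall>\<^sub>F X in gen. ev2 h (pf X) (qf X) = (\<Sum>(i, j)\<in>?P. cofs k l i j X)"
  using NE[THEN conjunct2, THEN conjunct2] val
  by eventually_elim (simp add: h(1) case_prod_beta)
 thus ?thesis using h(2,3) by blast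
qed

abbreviation "C \<equiv> conjugates"
abbreviation "r \<equiv> fval"
abbreviation "x0 \<equiv> x_elt"
abbreviation "M \<equiv> 2 * growth_exponent d"

lemma r_partials: "i \<in> C ==> \<forall>\<^sub>F X in gen. \<exists>a b. has_partials (r i) a b X"
 by (drule conjugate_in, drule gen_fdef, erule eventually_mono) (rule fval_has_partials)

lemma r_inj: "\<forall>\<^sub>F X in gen. inj_on (%i. r i X) C"
 by (rule distinct_values[OF finite_conjugates]) (use conjugate_in in blast)

abbreviation HX :: "(nat => nat => cpoly2) => cpol fract => cpol fract => complex \<times> complex => complex" where
 "HX h i j X \<equiv> pair_value d (%k l. ev2 (h k l) (pf X) (qf X)) (r i X) (r j X)"

text \<open>
  The numerators of the derivatives of \<open>HX / uu\<close> in the \<open>p\<close>- and the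
 \<open>q\<close>-direction.
\<close>

abbreviation Np :: "(nat => nat => cpoly2) => cpol fract => cpol fract => complex \<times> complex => complex" where
 "Np h i j X \<equiv> transport_num (FX X) (at_pt (diff_p F) (pf X) (qf X)) d
   (%k l. ev2 (h k l) (pf X) (qf X)) (%k l. ev2 (pderiv (h k l)) (pf X) (qf X)) (r i X) (r j X)"

abbreviation Nq :: "(nat => nat => cpoly2) => cpol fract => cpol fract => complex \<times> complex => complex" where
 "Nq h i j X \<equiv> transport_num (FX X) (at_pt (diff_q F) (pf X) (qf X)) d
   (%k l. ev2 (h k l) (pf X) (qf X)) (%k l. ev2 (map_poly pderiv (h k l)) (pf X) (qf X)) (r i X) (r j X)"

lemma all_roots: "\<forall>\<^sub>F X in gen. \<forall>i\<in>C. poly (FX X) (r i X) = 0"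
 using conjugate_root finite_conjugates by (intro eventually_ball_finite) auto

lemma good: "\<forall>\<^sub>F X in gen. coeff (FX X) d ~= 0 & (\<forall>i\<in>C. poly (FX X) (r i X) = 0) &
  inj_on (%i. r i X) C & (\<forall>i\<in>C. uX i X ~= 0)"
 using generic_lead_pq all_roots r_inj
proof eventually_elim
 case (elim X)
 have "uX i X ~= 0" if "i \<in> C" for i
 proof (rule simple_roots[OF _ degree_FX, of "pf X" "qf X" "(%i. r i X) ` C"])
  show "FX X ~= 0" using elim by auto
  show "card ((%i. r i X) ` C) = d" using elim card_conjugates by (simp add: card_image)
 qed (use elim finite_conjugates that in auto)
 thus ?case using elim by auto
qed

lemma gen_ratio_partials:
 assumes "i \<in> C" "j \<in> C"
 shows "\<forall>\<^sub>F X in gen. \<exists>P1 P2 Q1 Q2. P1 * Q2 - P2 * Q1 ~= 0 &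
  has_partials (%X. HX h i j X / (uu i j X))
   ((Np h i j X * P1 + Nq h i j X * Q1) / (uu i j X) ^ 3)
   ((Np h i j X * P2 + Nq h i j X * Q2) / (uu i j X) ^ 3) X"
 using jacobian r_partials[OF assms(1)] r_partials[OF assms(2)]
  gen_near[OF conjugate_root[OF assms(1)]] gen_near[OF conjugate_root[OF assms(2)]] good
proof eventually_elim
 case (elim X)
 obtain x y where X: "X = (x, y)" by (cases X)
 obtain P1 P2 Q1 Q2 where PQ: "has_partials pf P1 P2 X" "has_partials qf Q1 Q2 X" "P1 * Q2 - P2 * Q1 ~= 0"
  using elim(1) by blast
 obtain a1 a2 b1 b2 where ab: "has_partials (r i) a1 a2 X" "has_partials (r j) b1 b2 X"
  using elim(2,3) by blast
 have u: "uX i (x, y) ~= 0" "uX j (x, y) ~= 0" using elim(6) assms X by auto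
 have z1: "((%u. poly (FX (u, y)) (r k (u, y))) has_field_derivative 0) (at x)"
  if "\<forall>\<^sub>F u in nhds x. poly (FX (u, y)) (r k (u, y)) = 0" for k
  using DERIV_cong_ev[OF refl that refl, of 0] by simp
 have z2: "((%v. poly (FX (x, v)) (r k (x, v))) has_field_derivative 0) (at y)"
  if "\<forall>\<^sub>F v in nhds y. poly (FX (x, v)) (r k (x, v)) = 0" for k
  using DERIV_cong_ev[OF refl that refl, of 0] by simp
 have "has_partials (%X. HX h i j X / (uu i j X))
   ((Np h i j X * P1 + Nq h i j X * Q1) / (uu i j X) ^ 3)
   ((Np h i j X * P2 + Nq h i j X * Q2) / (uu i j X) ^ 3) X"
  using PQ ab elim(4,5) u unfolding has_partials_def X fst_conv snd_conv
  by (intro conjI DERIV_pair_ratio z1 z2) auto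
 thus ?case using PQ(3) by blast
qed

lemma transport_num_zero:
 assumes "is_sol F d eps h" "i \<in> C" "j \<in> C"
 shows "\<forall>\<^sub>F X in gen. Np h i j X = 0 & Nq h i j X = 0"
 using good
proof eventually_elim
 case (elim X)
 have W: "degree (at_pt (diff_p F) p q) \<le> d" "degree (at_pt (diff_q F) p q) \<le> d" for p q
  using degree_tangency[OF w] by (meson degree_at_pt_le degree_diff_p_le degree_diff_q_le order_trans)+
 have roots: "poly (FX X) (r i X) = 0" "poly (FX X) (r j X) = 0" using elim assms by auto
 have "coeff (FX X) d ^ (8 * d) * Np h i j X = 0"
  unfolding sum_transport_coeff[OF d degree_FX W(1) roots, symmetric]
  using assms(1) by (intro sum.neutral ballI) (simp add: is_sol_def)
 moreover have "coeff (FX X) d ^ (8 * d) * Nq h i j X = 0"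
  unfolding sum_transport_coeff[OF d degree_FX W(2) roots, symmetric]
  using assms(1) by (intro sum.neutral ballI) (simp add: is_sol_def)
 ultimately show ?case using elim by simp
qed

lemma sol_constant:
 assumes "is_sol F d eps h" "i \<in> C" "j \<in> C"
 shows "\<exists>c. \<forall>\<^sub>F X in gen. HX h i j X = c * (uu i j X)"
proof -
 have "\<forall>\<^sub>F X in gen. has_partials (%X. HX h i j X / (uu i j X)) 0 0 X"
  using gen_ratio_partials[OF assms(2,3), of h] transport_num_zero[OF assms]
  by eventually_elim auto
 from gen_constant[OF this] obtain c where "\<forall>\<^sub>F X in gen. HX h i j X / (uu i j X) = c" by blast
 hence "\<forall>\<^sub>F X in gen. HX h i j X = c * (uu i j X)"
  using good by eventually_elim (use assms in auto)
 thus ?thesis by blast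
qed

lemma inv_invol: "k \<in> C ==> cls k x0 \<in> C & cls (cls k x0) x0 = k"
 using cls_swap[of k x0] cls_x x_conjugate cls_in by auto

text \<open>A solution is described by its constant on each class of pairs of roots.\<close>

lemma sol_class_function:
 assumes sol: "is_sol F d eps h"
 shows "\<exists>c. (\<forall>\<kappa>\<in>C. c (cls \<kappa> x0) = eps * c \<kappa>) &
   (\<forall>i\<in>C. \<forall>j\<in>C. \<forall>\<^sub>F X in gen. HX h i j X = c (cls i j) * (uu i j X))"
proof -
 have "\<forall>\<kappa>\<in>C. \<exists>c. \<forall>\<^sub>F X in gen. HX h x0 \<kappa> X = c * (uu x0 \<kappa> X)"
  using sol_constant[OF sol x_conjugate] by blast
 from bchoice[OF this] obtain c
  where "\<forall>\<kappa>\<in>C. \<forall>\<^sub>F X in gen. HX h x0 \<kappa> X = c \<kappa> * (uu x0 \<kappa> X)" ..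
 hence c: "!!\<kappa>. \<kappa> \<in> C ==> \<forall>\<^sub>F X in gen. HX h x0 \<kappa> X = c \<kappa> * (uu x0 \<kappa> X)"
  by blast
 have all: "\<forall>\<^sub>F X in gen. HX h i j X = c (cls i j) * (uu i j X)" if "i \<in> C" "j \<in> C" for i j
  using spread[OF cls_in[OF that] c[OF cls_in[OF that]] that refl] .
 have "c (cls \<kappa> x0) = eps * c \<kappa>" if k: "\<kappa> \<in> C" for \<kappa>
 proof -
  have "\<forall>\<^sub>F X in gen. c (cls \<kappa> x0) = eps * c \<kappa>"
   using all[OF k x_conjugate] c[OF k] good
  proof eventually_elim
   case (elim X)
   have "HX h \<kappa> x0 X = eps * HX h x0 \<kappa> X"
   proof -
    have s: "ev2 (h k l) (pf X) (qf X) = eps * ev2 (h l k) (pf X) (qf X)" if "k < d" "l < d" for k l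
     using sol that unfolding is_sol_def by blast
    have "HX h \<kappa> x0 X = (\<Sum>k<d. \<Sum>l<d. eps * (ev2 (h l k) (pf X) (qf X) * r x0 X ^ l * r \<kappa> X ^ k))"
     unfolding pair_value_def
    proof (intro sum.cong refl)
     fix k l assume "k \<in> {..<d}" "l \<in> {..<d}"
     thus "ev2 (h k l) (pf X) (qf X) * r \<kappa> X ^ k * r x0 X ^ l =
      eps * (ev2 (h l k) (pf X) (qf X) * r x0 X ^ l * r \<kappa> X ^ k)"
      using s[of k l] by simp
    qed
    also have "\<dots> = eps * HX h x0 \<kappa> X"
     unfolding pair_value_def sum_distrib_left by (rule sum.swap)
    finally show ?thesis .
   qed
   thus ?case using elim k x_conjugate by (simp add: mult_ac)
  qed
  thus ?thesis by simp
 qed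
 thus ?thesis using all by blast
qed

lemma values_determine:
 assumes "\<forall>i\<in>C. \<forall>j\<in>C. \<forall>\<^sub>F X in gen. HX h i j X = 0" "k < d" "l < d"
 shows "h k l = 0"
proof (rule ccontr)
 assume "h k l ~= 0"
 have "\<forall>\<^sub>F X in gen. \<forall>i\<in>C. \<forall>j\<in>C. HX h i j X = 0"
  using assms(1) finite_conjugates by (intro eventually_ball_finite ballI) auto
 hence "\<forall>\<^sub>F X in gen. False"
  using good dominant[OF \<open>h k l ~= 0\<close>]
 proof eventually_elim
  case (elim X)
  have "ev2 (h k l) (pf X) (qf X) = 0"
  proof (rule grid_zero[of "(%i. r i X) ` C" d "%k l. ev2 (h k l) (pf X) (qf X)", OF _ _ _ assms(2,3)])
   show "card ((%i. r i X) ` C) = d" using elim card_conjugates by (simp add: card_image)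
  qed (use elim finite_conjugates in \<open>auto simp: pair_value_def\<close>)
  thus ?case using elim by simp
 qed
 thus False by simp
qed

lemma dominant_eq:
 assumes "\<forall>\<^sub>F X in gen. ev2 E (pf X) (qf X) = ev2 E' (pf X) (qf X)"
 shows "E = E'"
proof (rule ccontr)
 assume "E ~= E'"
 hence "\<forall>\<^sub>F X in gen. ev2 (E - E') (pf X) (qf X) ~= 0" by (intro dominant) simp
 with assms have "\<forall>\<^sub>F X in gen. False" by eventually_elim simp
 thus False by simp
qed

lemma polyfam_at_pt:
 "polyfam {f. \<exists>E. \<forall>X. f X = ev2 E (fst X) (snd X)} (%X. at_pt H (fst X) (snd X))"
 unfolding polyfam_def coeff_at_pt by blast

lemma constant_imp_transport:
 assumes "\<forall>i\<in>C. \<forall>j\<in>C. \<forall>\<^sub>F X in gen. HX h i j X = c i j * (uu i j X)" "a < d" "b < d"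
 shows "Tp F d h p q a b = 0"
  and "Tq F d h p q a b = 0"
proof -
 have "\<forall>\<^sub>F X in gen. Np h i j X = 0 & Nq h i j X = 0" if ij: "i \<in> C" "j \<in> C" for i j
 proof -
  have "\<forall>\<^sub>F X in gen. HX h i j X / (uu i j X) = c i j"
   using assms(1)[rule_format, OF ij] good by eventually_elim (use ij in auto)
  from gen_partials_zero[OF this] gen_ratio_partials[OF ij, of h] good
  show ?thesis
  proof eventually_elim
   case (elim X)
   obtain P1 P2 Q1 Q2 where PQ: "P1 * Q2 - P2 * Q1 ~= 0"
    "has_partials (%X. HX h i j X / (uu i j X))
     ((Np h i j X * P1 + Nq h i j X * Q1) / (uu i j X) ^ 3)
     ((Np h i j X * P2 + Nq h i j X * Q2) / (uu i j X) ^ 3) X"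
    using elim(2) by blast
   have "(Np h i j X * P1 + Nq h i j X * Q1) / (uu i j X) ^ 3 = 0"
    using PQ(2) elim(1) unfolding has_partials_def by (blast intro: DERIV_unique)
   moreover have "(Np h i j X * P2 + Nq h i j X * Q2) / (uu i j X) ^ 3 = 0"
    using PQ(2) elim(1) unfolding has_partials_def by (blast intro: DERIV_unique)
   ultimately have e: "Np h i j X * P1 + Nq h i j X * Q1 = 0" "Np h i j X * P2 + Nq h i j X * Q2 = 0"
    using elim(3) ij by auto
   have "Np h i j X * (P1 * Q2 - P2 * Q1) = Q2 * (Np h i j X * P1 + Nq h i j X * Q1) - Q1 * (Np h i j X * P2 + Nq h i j X * Q2)"
    "Nq h i j X * (P1 * Q2 - P2 * Q1) = P1 * (Np h i j X * P2 + Nq h i j X * Q2) - P2 * (Np h i j X * P1 + Nq h i j X * Q1)"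
    by (simp_all add: algebra_simps)
   thus ?case using e PQ(1) by simp
  qed
 qed
 hence N0: "\<forall>\<^sub>F X in gen. \<forall>i\<in>C. \<forall>j\<in>C. Np h i j X = 0 & Nq h i j X = 0"
  using finite_conjugates by (intro eventually_ball_finite ballI) auto
 have W: "degree (at_pt (diff_p F) p q) \<le> d" "degree (at_pt (diff_q F) p q) \<le> d" for p q
  using degree_tangency[OF w] by (meson degree_at_pt_le degree_diff_p_le degree_diff_q_le order_trans)+
 let ?tp = "%X. Tp F d h (fst X) (snd X) a b"
 let ?tq = "%X. Tq F d h (fst X) (snd X) a b"
 have "?tp \<in> {f. \<exists>E. \<forall>X. f X = ev2 E (fst X) (snd X)}" "?tq \<in> {f. \<exists>E. \<forall>X. f X = ev2 E (fst X) (snd X)}"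
  by (rule transport_coeff_function_algebra[OF function_algebra_ev2 polyfam_at_pt polyfam_at_pt]; blast)+
 then obtain Ep Eq where E: "!!X. ?tp X = ev2 Ep (fst X) (snd X)" "!!X. ?tq X = ev2 Eq (fst X) (snd X)"
  by blast
 have "\<forall>\<^sub>F X in gen. ?tp (pf X, qf X) = 0 & ?tq (pf X, qf X) = 0"
  using N0 good
 proof eventually_elim
  case (elim X)
  show ?case unfolding fst_conv snd_conv
  proof (intro conjI; rule grid_zero[of "(%i. r i X) ` C" d, OF _ _ _ assms(2,3)])
   show "card ((%i. r i X) ` C) = d" "card ((%i. r i X) ` C) = d" using elim card_conjugates by (simp_all add: card_image)
   show "finite ((%i. r i X) ` C)" "finite ((%i. r i X) ` C)" using finite_conjugates by auto
  qed (use elim sum_transport_coeff[OF d degree_FX W(1)] sum_transport_coeff[OF d degree_FX W(2)] in auto)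
 qed
 hence "\<forall>\<^sub>F X in gen. ev2 Ep (pf X) (qf X) = ev2 0 (pf X) (qf X) & ev2 Eq (pf X) (qf X) = ev2 0 (pf X) (qf X)"
 proof eventually_elim
  case (elim X)
  thus ?case using E(1)[of "(pf X, qf X)"] E(2)[of "(pf X, qf X)"] by simp
 qed
 hence "Ep = 0" "Eq = 0"
  by (auto intro!: dominant_eq simp: eventually_conj_iff)
 thus "Tp F d h p q a b = 0"
  "Tq F d h p q a b = 0"
  using E(1)[of "(p, q)"] E(2)[of "(p, q)"] by auto
qed

text \<open>Conversely, every class function with the right symmetry comes from a solution.\<close>

lemma class_function_sol:
 assumes c: "!!\<kappa>. \<kappa> \<in> C ==> c (cls \<kappa> x0) = eps * c \<kappa>"
 shows "\<exists>h. is_sol F d eps h &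
   (\<forall>k<d. \<forall>l<d. degree (h k l) \<le> M & (\<forall>i. degree (coeff (h k l) i) \<le> M)) &
   (\<forall>i\<in>C. \<forall>j\<in>C. \<forall>\<^sub>F X in gen. HX h i j X = c (cls i j) * (uu i j X))"
proof -
 define good_poly where "good_poly \<kappa> k l g \<longleftrightarrow> degree g \<le> M & (\<forall>i. degree (coeff g i) \<le> M) &
     (\<forall>\<^sub>F X in gen. ev2 g (pf X) (qf X) = (\<Sum>(i, j)\<in>{(i, j). i \<in> C & j \<in> C & cls i j = \<kappa>}.
       cofs k l i j X))" for \<kappa> k l g
 have "\<forall>\<kappa> k l. \<exists>g. \<kappa> \<in> C & k < d & l < d --> good_poly \<kappa> k l g"
  using class_sum_poly unfolding good_poly_def by blast
 then obtain g where "\<forall>\<kappa> k l. \<kappa> \<in> C & k < d & l < d --> good_poly \<kappa> k l (g \<kappa> k l)"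
  unfolding choice_iff by blast
 hence g: "good_poly \<kappa> k l (g \<kappa> k l)" if "\<kappa> \<in> C" "k < d" "l < d" for \<kappa> k l
  using that by blast
 define h where "h k l = (\<Sum>\<kappa>\<in>C. smult [:c \<kappa>:] (g \<kappa> k l))" for k l
 have deg: "degree (h k l) \<le> M & (\<forall>i. degree (coeff (h k l) i) \<le> M)" if "k < d" "l < d" for k l
 proof
  show "degree (h k l) \<le> M"
   unfolding h_def
   by (rule degree_sum_le[OF finite_conjugates]) (use g that in \<open>auto simp: good_poly_def intro: order_trans[OF degree_smult_le]\<close>)
  show "\<forall>i. degree (coeff (h k l) i) \<le> M"
   unfolding h_def coeff_sum
   by (intro allI degree_sum_le[OF finite_conjugates]) (use g that in \<open>auto simp: good_poly_def intro: order_trans[OF degree_smult_le]\<close>)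
 qed
 have smul: "ev2 (smult [:a:] f) p q = a * ev2 f p q" for a f p q by (simp add: ev2_def)
 have h: "\<forall>\<^sub>F X in gen. ev2 (h k l) (pf X) (qf X) =
   (\<Sum>i\<in>C. \<Sum>j\<in>C. c (cls i j) * (cofs k l i j X))" if "k < d" "l < d" for k l
 proof -
  have "\<forall>\<^sub>F X in gen. \<forall>\<kappa>\<in>C. ev2 (g \<kappa> k l) (pf X) (qf X) = (\<Sum>(i, j)\<in>{(i, j). i \<in> C & j \<in> C & cls i j = \<kappa>}.
       cofs k l i j X)"
   using g that finite_conjugates by (intro eventually_ball_finite) (auto simp: good_poly_def)
  thus ?thesis
  proof eventually_elim
   case (elim X)
   let ?f = "%i j. cofs k l i j X"
   have "(\<Sum>i\<in>C. \<Sum>j\<in>C. c (cls i j) * ?f i j) = (\<Sum>(i, j)\<in>C \<times> C. c (cls i j) * ?f i j)"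
    by (rule sum.cartesian_product)
   also have "\<dots> = (\<Sum>\<kappa>\<in>C. \<Sum>(i, j)\<in>{x \<in> C \<times> C. (case x of (i, j) => cls i j) = \<kappa>}. c (cls i j) * ?f i j)"
    by (rule sum.group[symmetric]) (use finite_conjugates cls_in in auto)
   also have "\<dots> = (\<Sum>\<kappa>\<in>C. c \<kappa> * (\<Sum>(i, j)\<in>{(i, j). i \<in> C & j \<in> C & cls i j = \<kappa>}. ?f i j))"
    unfolding sum_distrib_left by (intro sum.cong refl) auto
   also have "\<dots> = ev2 (h k l) (pf X) (qf X)"
    using elim by (simp add: h_def ev2_sum smul)
   finally show ?case ..
  qed
 qed
 have h_all: "\<forall>\<^sub>F X in gen. \<forall>k\<in>{..<d}. \<forall>l\<in>{..<d}. ev2 (h k l) (pf X) (qf X) =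
   (\<Sum>i\<in>C. \<Sum>j\<in>C. c (cls i j) * (cofs k l i j X))"
  using h by (intro eventually_ball_finite ballI) auto
 have val: "\<forall>\<^sub>F X in gen. HX h i j X = c (cls i j) * (uu i j X)" if ij: "i \<in> C" "j \<in> C" for i j
  using h_all good
 proof eventually_elim
  case (elim X)
  let ?e = "%m n. \<Sum>k<d. cofactor (FX X) k (r m X) * r n X ^ k"
  have e: "?e m n = (if m = n then uX n X else 0)" if "m \<in> C" "n \<in> C" for m n
  proof (cases "m = n")
   case True
   thus ?thesis using sum_cofactor_self[OF _ degree_FX] elim(2) that by simp
  next
   case False
   hence "r n X ~= r m X" using elim(2) that by (metis inj_onD)
   thus ?thesis using sum_cofactor_other[OF _ degree_FX] elim(2) that False by simp
  qed
  have "HX h i j X = (\<Sum>k<d. \<Sum>l<d. \<Sum>m\<in>C. \<Sum>n\<in>C. c (cls m n) *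
    ((cofactor (FX X) k (r m X) * r i X ^ k) * (cofactor (FX X) l (r n X) * r j X ^ l)))"
   unfolding pair_value_def
   by (intro sum.cong refl) (use elim(1) in \<open>simp add: sum_distrib_left mult_ac\<close>)
  also have "\<dots> = (\<Sum>m\<in>C. \<Sum>n\<in>C. \<Sum>k<d. \<Sum>l<d. c (cls m n) *
    ((cofactor (FX X) k (r m X) * r i X ^ k) * (cofactor (FX X) l (r n X) * r j X ^ l)))"
  proof -
   have "(\<Sum>k<d. \<Sum>l<d. \<Sum>m\<in>C. \<Sum>n\<in>C. f k l m n) = (\<Sum>m\<in>C. \<Sum>n\<in>C. \<Sum>k<d. \<Sum>l<d. f k l m n)"
    for f :: "nat => nat => cpol fract => cpol fract => complex"
   proof -
    have "(\<Sum>k<d. \<Sum>l<d. \<Sum>m\<in>C. \<Sum>n\<in>C. f k l m n) = (\<Sum>k<d. \<Sum>m\<in>C. \<Sum>n\<in>C. \<Sum>l<d. f k l m n)"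
    proof (rule sum.cong[OF refl])
     fix k
     have "(\<Sum>l<d. \<Sum>m\<in>C. \<Sum>n\<in>C. f k l m n) = (\<Sum>m\<in>C. \<Sum>l<d. \<Sum>n\<in>C. f k l m n)" by (rule sum.swap)
     also have "\<dots> = (\<Sum>m\<in>C. \<Sum>n\<in>C. \<Sum>l<d. f k l m n)" by (rule sum.cong[OF refl]) (rule sum.swap)
     finally show "(\<Sum>l<d. \<Sum>m\<in>C. \<Sum>n\<in>C. f k l m n) = (\<Sum>m\<in>C. \<Sum>n\<in>C. \<Sum>l<d. f k l m n)" .
    qed
    also have "\<dots> = (\<Sum>m\<in>C. \<Sum>k<d. \<Sum>n\<in>C. \<Sum>l<d. f k l m n)" by (rule sum.swap)
    also have "\<dots> = (\<Sum>m\<in>C. \<Sum>n\<in>C. \<Sum>k<d. \<Sum>l<d. f k l m n)" by (rule sum.cong[OF refl]) (rule sum.swap)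
    finally show ?thesis .
   qed
   thus ?thesis .
  qed
  also have "\<dots> = (\<Sum>m\<in>C. \<Sum>n\<in>C. c (cls m n) * (?e m i * ?e n j))"
   unfolding sum_product unfolding sum_distrib_left ..
  also have "\<dots> = (\<Sum>m\<in>C. \<Sum>n\<in>C. if m = i & n = j then c (cls m n) * (uu i j X) else 0)"
   by (intro sum.cong refl) (use e ij in auto)
  also have "\<dots> = (\<Sum>m\<in>C. if m = i then c (cls m j) * (uu i j X) else 0)"
   by (intro sum.cong refl) (use finite_conjugates ij in \<open>auto simp: if_distrib if_distribR\<close>)
  also have "\<dots> = c (cls i j) * (uu i j X)" using finite_conjugates ij by simp
  finally show ?case .
 qed
 have sym: "h k l = smult [:eps:] (h l k)" if "k < d" "l < d" for k l
 proof (rule dominant_eq)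
  show "\<forall>\<^sub>F X in gen. ev2 (h k l) (pf X) (qf X) = ev2 (smult [:eps:] (h l k)) (pf X) (qf X)"
   using h[OF that] h[OF that(2,1)]
  proof eventually_elim
   case (elim X)
   have "(\<Sum>i\<in>C. \<Sum>j\<in>C. c (cls i j) * (cofs k l i j X)) =
    (\<Sum>j\<in>C. \<Sum>i\<in>C. c (cls i j) * (cofs k l i j X))"
    by (rule sum.swap)
   also have "\<dots> = (\<Sum>j\<in>C. \<Sum>i\<in>C. eps * (c (cls j i) * (cofactor (FX X) l (r j X) * cofactor (FX X) k (r i X))))"
   proof (intro sum.cong refl)
    fix i j assume "i \<in> C" "j \<in> C"
    hence "c (cls i j) = eps * c (cls j i)" using c cls_swap[of j i] cls_in by metis
    thus "c (cls i j) * (cofs k l i j X) =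
     eps * (c (cls j i) * (cofactor (FX X) l (r j X) * cofactor (FX X) k (r i X)))" by simp
   qed
   finally show ?case using elim by (simp add: smul sum_distrib_left)
  qed
 qed
 have "is_sol F d eps h"
  unfolding is_sol_def
 proof (intro conjI allI impI)
  fix k l p q assume "k < d" "l < d"
  thus "ev2 (h k l) p q = eps * ev2 (h l k) p q" using sym[of k l] smul by metis
 qed (use constant_imp_transport[of h "%i j. c (cls i j)"] val in auto)
 thus ?thesis using deg val by blast
qed

end

section \<open>The dimension of the solution space\<close>

type_synonym index = "nat \<times> nat \<times> nat \<times> nat"

definition indices :: "nat => nat => index set" where
 "indices d M = {..M} \<times> {..M} \<times> {..<d} \<times> {..<d}"

definition basis_poly :: "index => nat => nat => cpoly2" where
 "basis_poly = (%(i, j, k, l) k' l'. if k' = k & l' = l then monom (monom 1 j) i else 0)"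

definition of_vector :: "nat => nat => (index => complex) => nat => nat => cpoly2" where
 "of_vector d M v k l = (\<Sum>x\<in>indices d M. smult [:v x:] (basis_poly x k l))"

lemma finite_indices [simp]: "finite (indices d M)"
 by (simp add: indices_def)

lemma coeff_of_vector:
 assumes "(i, j, k, l) \<in> indices d M"
 shows "coeff (coeff (of_vector d M v k l) i) j = v (i, j, k, l)"
proof -
 have "coeff (coeff (of_vector d M v k l) i) j = (\<Sum>x\<in>indices d M. v x * coeff (coeff (basis_poly x k l) i) j)"
  by (simp add: of_vector_def coeff_sum)
 also have "\<dots> = (\<Sum>x\<in>indices d M. if x = (i, j, k, l) then v x else 0)"
  by (intro sum.cong refl) (auto simp: basis_poly_def coeff_monom split: prod.splits)
 finally show ?thesis using assms by simp
qed

lemma of_vector_coeffs: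
 assumes "k < d" "l < d" "degree (h k l) \<le> M" "\<forall>i. degree (coeff (h k l) i) \<le> M"
 shows "of_vector d M (%(i, j, k, l). coeff (coeff (h k l) i) j) k l = h k l"
proof (intro poly_eqI)
 fix i j
 show "coeff (coeff (of_vector d M (%(i, j, k, l). coeff (coeff (h k l) i) j) k l) i) j = coeff (coeff (h k l) i) j"
 proof (cases "i \<le> M & j \<le> M")
  case True
  thus ?thesis using coeff_of_vector[of i j k l d M] assms(1,2) by (simp add: indices_def)
 next
  case False
  have "coeff (coeff (basis_poly x k l) i) j = 0" if "x \<in> indices d M" for x
   using that False by (auto simp: basis_poly_def indices_def coeff_monom split: prod.splits)
  hence "coeff (coeff (of_vector d M (%(i, j, k, l). coeff (coeff (h k l) i) j) k l) i) j = 0"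
   by (simp add: of_vector_def coeff_sum)
  moreover have "coeff (coeff (h k l) i) j = 0"
  proof (cases "i \<le> M")
   case True
   thus ?thesis using False assms(4) by (meson coeff_eq_0 le_less_trans not_le)
  next
   case False
   hence "degree (h k l) < i" using assms(3) by simp
   thus ?thesis by (simp add: coeff_eq_0)
  qed
  ultimately show ?thesis by simp
 qed
qed

lemma ev2_smult_const: "ev2 (smult [:a:] f) p q = a * ev2 f p q"
 by (simp add: ev2_def)

lemma map_poly_pderiv_add: "map_poly pderiv (f + g) = map_poly pderiv f + map_poly pderiv (g :: cpoly2)"
 by (rule poly_eqI) (simp add: coeff_map_poly pderiv_add)

lemma
 fixes h :: "'x => cpoly2"
 shows ev2_combination: "ev2 (\<Sum>x\<in>I. smult [:v x:] (h x)) p q = (\<Sum>x\<in>I. v x * ev2 (h x) p q)"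
  and ev2_pderiv_combination: "ev2 (pderiv (\<Sum>x\<in>I. smult [:v x:] (h x))) p q = (\<Sum>x\<in>I. v x * ev2 (pderiv (h x)) p q)"
  and ev2_map_pderiv_combination: "ev2 (map_poly pderiv (\<Sum>x\<in>I. smult [:v x:] (h x))) p q = (\<Sum>x\<in>I. v x * ev2 (map_poly pderiv (h x)) p q)"
proof -
 have m: "map_poly pderiv (smult [:a:] f) = smult [:a:] (map_poly pderiv f)" for a :: complex and f
  by (rule poly_eqI) (simp add: coeff_map_poly pderiv_smult)
 have p: "pderiv (smult [:a:] f) = smult [:a:] (pderiv f)" for a :: complex and f
  by (simp only: pderiv_smult)
 show "ev2 (\<Sum>x\<in>I. smult [:v x:] (h x)) p q = (\<Sum>x\<in>I. v x * ev2 (h x) p q)"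
  by (simp only: ev2_sum ev2_smult_const)
 show "ev2 (pderiv (\<Sum>x\<in>I. smult [:v x:] (h x))) p q = (\<Sum>x\<in>I. v x * ev2 (pderiv (h x)) p q)"
  by (induction I rule: infinite_finite_induct) (simp_all add: pderiv_add p ev2_smult_const)
 show "ev2 (map_poly pderiv (\<Sum>x\<in>I. smult [:v x:] (h x))) p q = (\<Sum>x\<in>I. v x * ev2 (map_poly pderiv (h x)) p q)"
  by (induction I rule: infinite_finite_induct) (simp_all add: map_poly_pderiv_add m ev2_smult_const)
qed

lemma transport_coeff_combination:
 "transport_coeff F W d (%k l. \<Sum>x\<in>I. v x * h x k l) (%k l. \<Sum>x\<in>I. v x * h' x k l) a b =
   (\<Sum>x\<in>I. v x * transport_coeff F W d (h x) (h' x) a b)"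
proof (induction I rule: infinite_finite_induct)
 case (insert x I)
 show ?case
  unfolding sum.insert[OF insert.hyps] insert.IH[symmetric] unfolding transport_coeff_def
  by (simp add: sum_distrib_left sum.distrib[symmetric] algebra_simps sum_subtractf[symmetric])
qed (simp_all add: transport_coeff_def)

definition system_entry ::
 "cpoly3 => nat => complex => nat \<times> nat \<times> nat \<times> complex \<times> complex => index => complex" where
 "system_entry F d eps = (%(kind, a, b, p, q) x.
   if \<not> (a < d & b < d) then 0
   else if kind = 0 then Tp F d (basis_poly x) p q a b
   else if kind = 1 then Tq F d (basis_poly x) p q a b
   else ev2 (basis_poly x a b) p q - eps * ev2 (basis_poly x b a) p q)"

lemma is_sol_of_vector:
 "is_sol F d eps (of_vector d M v) \<longleftrightarrow> (\<forall>e. (\<Sum>x\<in>indices d M. system_entry F d eps e x * v x) = 0)"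
proof -
 have e0: "(\<Sum>x\<in>indices d M. system_entry F d eps (0, a, b, p, q) x * v x) =
   (if a < d & b < d then Tp F d (of_vector d M v) p q a b else 0)" for a b p q
  unfolding of_vector_def ev2_combination ev2_pderiv_combination transport_coeff_combination
  by (auto simp: system_entry_def mult.commute)
 have e1: "(\<Sum>x\<in>indices d M. system_entry F d eps (1, a, b, p, q) x * v x) =
   (if a < d & b < d then Tq F d (of_vector d M v) p q a b else 0)" for a b p q
  unfolding of_vector_def ev2_combination ev2_map_pderiv_combination transport_coeff_combination
  by (auto simp: system_entry_def mult.commute)
 have e2: "(\<Sum>x\<in>indices d M. system_entry F d eps (n, a, b, p, q) x * v x) =
   (if a < d & b < d then ev2 (of_vector d M v a b) p q - eps * ev2 (of_vector d M v b a) p q else 0)"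
  if "n ~= 0" "n ~= 1" for n a b p q
  unfolding of_vector_def ev2_combination sum_distrib_left sum_subtractf[symmetric]
  using that by (auto simp: system_entry_def algebra_simps intro!: sum.cong)
 show ?thesis
 proof
  assume sol: "is_sol F d eps (of_vector d M v)"
  show "\<forall>e. (\<Sum>x\<in>indices d M. system_entry F d eps e x * v x) = 0"
  proof
   fix e :: "nat \<times> nat \<times> nat \<times> complex \<times> complex"
   obtain n a b p q where e: "e = (n, a, b, p, q)" by (cases e)
   consider "n = 0" | "n = 1" | "n ~= 0" "n ~= 1" by blast
   thus "(\<Sum>x\<in>indices d M. system_entry F d eps e x * v x) = 0"
   proof cases
    case 1
    thus ?thesis using sol unfolding e 1 e0 is_sol_def by simp
   next
    case 2
    thus ?thesis using sol unfolding e 2 e1 is_sol_def by simp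
   next
    case 3
    have "ev2 (of_vector d M v a b) p q = eps * ev2 (of_vector d M v b a) p q" if "a < d" "b < d"
     using sol that unfolding is_sol_def by blast
    thus ?thesis unfolding e e2[OF 3] by simp
   qed
  qed
 next
  assume z: "\<forall>e. (\<Sum>x\<in>indices d M. system_entry F d eps e x * v x) = 0"
  show "is_sol F d eps (of_vector d M v)"
   unfolding is_sol_def
  proof (intro conjI allI impI)
   fix k l p q assume "k < d" "l < d"
   thus "ev2 (of_vector d M v k l) p q = eps * ev2 (of_vector d M v l k) p q"
    using z[rule_format, of "(2, k, l, p, q)"] unfolding e2[of 2, simplified] by simp
  next
   fix a b p q assume "a < d" "b < d"
   thus "Tp F d (of_vector d M v) p q a b = 0"
    using z[rule_format, of "(0, a, b, p, q)"] unfolding e0 by simp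
   from \<open>a < d\<close> \<open>b < d\<close> show "Tq F d (of_vector d M v) p q a b = 0"
    using z[rule_format, of "(1, a, b, p, q)"] unfolding e1 by simp
  qed
 qed
qed

lemma of_vector_combination:
 "of_vector d M (%x. \<Sum>a\<in>A. u a * w a x) k l = (\<Sum>a\<in>A. smult [:u a:] (of_vector d M (w a) k l))"
proof (induction A rule: infinite_finite_induct)
 case (insert a A)
 have "of_vector d M (%x. u a * w a x + f x) k l = smult [:u a:] (of_vector d M (w a) k l) + of_vector d M f k l" for f
 proof -
  have "smult [:u a * w a x + f x:] g = smult [:u a:] (smult [:w a x:] g) + smult [:f x:] g" for x and g :: "cpoly2"
  proof -
   have "[:u a * w a x + f x:] = [:u a:] * [:w a x:] + [:f x:]" by simp
   thus ?thesis by (metis smult_add_left smult_smult)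
  qed
  moreover have "smult c (\<Sum>x\<in>S. g x) = (\<Sum>x\<in>S. smult c (g x))" for c S and g :: "index => cpoly2"
   by (induction S rule: infinite_finite_induct) (simp_all add: smult_add_right)
  ultimately show ?thesis by (simp only: of_vector_def sum.distrib)
 qed
 thus ?case unfolding sum.insert[OF insert.hyps] insert.IH[symmetric] .
qed (simp_all add: of_vector_def)

lemma transport_coeff_cong:
 "(!!k l. k < d ==> l < d ==> h k l = g k l) ==> (!!k l. k < d ==> l < d ==> h' k l = g' k l) ==>
   transport_coeff F W d h h' a b = transport_coeff F W d g g' a b"
 unfolding transport_coeff_def by (intro sum.cong refl) simp

lemma is_sol_cong:
 assumes e: "!!k l. k < d ==> l < d ==> h k l = g k l"
 shows "is_sol F d eps h \<longleftrightarrow> is_sol F d eps g"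
proof -
 have "Tp F d h p q a b =
   Tp F d g p q a b" for a b p q
  by (rule transport_coeff_cong) (simp_all add: e)
 moreover have "Tq F d h p q a b =
   Tq F d g p q a b" for a b p q
  by (rule transport_coeff_cong) (simp_all add: e)
 moreover have "(\<forall>k<d. \<forall>l<d. \<forall>p q. ev2 (h k l) p q = eps * ev2 (h l k) p q) \<longleftrightarrow>
   (\<forall>k<d. \<forall>l<d. \<forall>p q. ev2 (g k l) p q = eps * ev2 (g l k) p q)"
  using e by auto
 ultimately show ?thesis unfolding is_sol_def by simp
qed

lemma solution_combination:
 assumes "!!a. a \<in> A ==> is_sol F d eps (of_vector d M (w a))"
 shows "is_sol F d eps (of_vector d M (%x. \<Sum>a\<in>A. u a * w a x))"
 unfolding is_sol_of_vector
proof
 fix e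
 have "(\<Sum>x\<in>indices d M. system_entry F d eps e x * (\<Sum>a\<in>A. u a * w a x)) =
   (\<Sum>a\<in>A. u a * (\<Sum>x\<in>indices d M. system_entry F d eps e x * w a x))"
  unfolding sum_distrib_left by (subst sum.swap) (intro sum.cong refl, simp add: mult_ac)
 thus "(\<Sum>x\<in>indices d M. system_entry F d eps e x * (\<Sum>a\<in>A. u a * w a x)) = 0"
  using assms unfolding is_sol_of_vector by simp
qed

context galois_form
begin

text \<open>
  One class from each orbit of the involution \<open>\<kappa> \<mapsto> \<kappa>\<^sup>-\<^sup>1\<close>; for \<open>eps = -1\<close> the fixed classes carry no
 nonzero symmetric function.
\<close>

definition half :: "cpol fract set" where
 "half = {\<kappa>\<in>C. to_nat_on C \<kappa> < to_nat_on C (cls \<kappa> x0)}"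

definition self_inverse :: "cpol fract set" where
 "self_inverse = {\<kappa>\<in>C. cls \<kappa> x0 = \<kappa>}"

definition representatives :: "complex => cpol fract set" where
 "representatives eps = (if eps = 1 then half \<union> self_inverse else half)"

lemma to_nat_inj: "\<kappa> \<in> C ==> \<kappa>' \<in> C ==> to_nat_on C \<kappa> = to_nat_on C \<kappa>' \<longleftrightarrow> \<kappa> = \<kappa>'"
 by (rule to_nat_on_inj[OF countable_finite[OF finite_conjugates]])

lemma card_half: "2 * card half + card self_inverse = d"
proof -
 define other where "other = {\<kappa>\<in>C. to_nat_on C (cls \<kappa> x0) < to_nat_on C \<kappa>}"
 have "bij_betw (%\<kappa>. cls \<kappa> x0) half other"
  by (rule bij_betwI[of _ _ _ "%\<kappa>. cls \<kappa> x0"]) (use inv_invol in \<open>auto simp: half_def other_def\<close>)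
 hence "card half = card other" by (rule bij_betw_same_card)
 moreover have "C = half \<union> other \<union> self_inverse"
  using inv_invol to_nat_inj unfolding half_def other_def self_inverse_def by (auto simp: not_less_iff_gr_or_eq)
 moreover have "card (half \<union> other \<union> self_inverse) = card half + card other + card self_inverse"
 proof -
  have fin: "finite half" "finite other" "finite self_inverse" using finite_conjugates unfolding half_def other_def self_inverse_def by auto
  have "half \<inter> other = {}" "(half \<union> other) \<inter> self_inverse = {}" unfolding half_def other_def self_inverse_def by auto
  thus ?thesis using fin by (simp add: card_Un_disjoint)
 qed
 ultimately show ?thesis using card_conjugates by simp
qed

lemma representatives_sub: "representatives eps \<subseteq> C" "finite (representatives eps)"
 using finite_conjugates unfolding representatives_def half_def self_inverse_def by auto

lemma zero_on_representatives:
 assumes eps: "eps = 1 \<or> eps = -1" and c: "!!\<kappa>. \<kappa> \<in> C ==> c (cls \<kappa> x0) = eps * (c \<kappa> :: complex)"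
  and z: "!!\<kappa>. \<kappa> \<in> representatives eps ==> c \<kappa> = 0" and k: "\<kappa> \<in> C"
 shows "c \<kappa> = 0"
proof -
 have half0: "c \<kappa> = 0" if "\<kappa> \<in> half" for \<kappa> using z that unfolding representatives_def by (auto split: if_splits)
 consider "to_nat_on C \<kappa> < to_nat_on C (cls \<kappa> x0)" | "to_nat_on C (cls \<kappa> x0) < to_nat_on C \<kappa>" | "cls \<kappa> x0 = \<kappa>"
  using to_nat_inj[OF k, of "cls \<kappa> x0"] inv_invol[OF k] by (metis linorder_neqE_nat)
 thus ?thesis
 proof cases
  case 1
  thus ?thesis using half0 k unfolding half_def by simp
 next
  case 2
  hence "cls \<kappa> x0 \<in> half" using inv_invol[OF k] unfolding half_def by simp
  hence "eps * c \<kappa> = 0" using half0 c[OF k] by metis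
  thus ?thesis using eps by auto
 next
  case 3
  show ?thesis
  proof (cases "eps = 1")
   case True
   thus ?thesis using z k 3 unfolding representatives_def self_inverse_def by simp
  next
   case False
   hence "c \<kappa> = - c \<kappa>" using eps c[OF k] 3 by simp
   thus ?thesis by simp
  qed
 qed
qed

lemma delta_class_function:
 assumes eps: "eps = 1 \<or> eps = -1" and a: "a \<in> representatives eps"
 shows "\<exists>c :: cpol fract => complex. (\<forall>\<kappa>\<in>C. c (cls \<kappa> x0) = eps * c \<kappa>) &
   (\<forall>b\<in>representatives eps. c b = (if b = a then 1 else 0))"
proof -
 have aC: "a \<in> C" using a representatives_sub by auto
 define c where "c \<kappa> = (if \<kappa> = a then 1 else if \<kappa> = cls a x0 then eps else 0)" for \<kappa>
 have fix1: "eps = 1" if "cls a x0 = a"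
  using a that unfolding representatives_def half_def by (auto split: if_splits)
 have "c (cls \<kappa> x0) = eps * c \<kappa>" if k: "\<kappa> \<in> C" for \<kappa>
 proof -
  have "cls \<kappa> x0 = a \<longleftrightarrow> \<kappa> = cls a x0" "cls \<kappa> x0 = cls a x0 \<longleftrightarrow> \<kappa> = a"
   using inv_invol[OF k] inv_invol[OF aC] by metis+
  thus ?thesis using eps fix1 by (auto simp: c_def)
 qed
 moreover have "c b = (if b = a then 1 else 0)" if b: "b \<in> representatives eps" for b
 proof -
  have "b ~= cls a x0" if "b ~= a"
  proof
   assume e: "b = cls a x0"
   have "a \<in> half \<or> a \<in> self_inverse" "b \<in> half \<or> b \<in> self_inverse"
    using a b unfolding representatives_def by (auto split: if_splits)
   thus False using e that inv_invol[OF aC] unfolding half_def self_inverse_def by auto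
  qed
  thus ?thesis by (auto simp: c_def)
 qed
 ultimately show ?thesis by blast
qed

lemma HX_combination:
 "HX (%k l. \<Sum>a\<in>A. smult [:u a:] (h a k l)) i j X = (\<Sum>a\<in>A. u a * HX (h a) i j X)"
proof -
 have "HX (%k l. \<Sum>a\<in>A. smult [:u a:] (h a k l)) i j X =
   (\<Sum>k<d. \<Sum>l<d. \<Sum>a\<in>A. u a * (ev2 (h a k l) (pf X) (qf X) * r i X ^ k * r j X ^ l))"
  unfolding pair_value_def ev2_combination by (simp add: sum_distrib_left mult_ac)
 also have "\<dots> = (\<Sum>k<d. \<Sum>a\<in>A. \<Sum>l<d. u a * (ev2 (h a k l) (pf X) (qf X) * r i X ^ k * r j X ^ l))"
  by (rule sum.cong[OF refl]) (rule sum.swap)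
 also have "\<dots> = (\<Sum>a\<in>A. \<Sum>k<d. \<Sum>l<d. u a * (ev2 (h a k l) (pf X) (qf X) * r i X ^ k * r j X ^ l))"
  by (rule sum.swap)
 finally show ?thesis by (simp add: pair_value_def sum_distrib_left)
qed

lemma vector_zero_if_values_zero:
 assumes "\<forall>i\<in>C. \<forall>j\<in>C. \<forall>\<^sub>F X in gen. HX (of_vector d M v) i j X = 0" "x \<in> indices d M"
 shows "v x = 0"
proof -
 obtain i j k l where x: "x = (i, j, k, l)" by (cases x)
 hence "of_vector d M v k l = 0" using values_determine[OF assms(1), of k l] assms(2) by (simp add: indices_def)
 thus ?thesis using coeff_of_vector[of i j k l d M v] assms(2) x by simp
qed

text \<open>
  The solution space has at least as many dimensions as there are class functions with
  \<open>c(\<kappa>\<^sup>-\<^sup>1) = eps c(\<kappa>)\<close>: the solutions belonging to the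
 indicator functions of the orbits are independent.
\<close>

lemma card_representatives_le:
 assumes eps: "eps = 1 \<or> eps = -1" and T: "finite T"
  and inj: "!!v. is_sol F d eps (of_vector d M v) ==> (\<forall>x\<in>T. v x = 0) ==> \<forall>x\<in>indices d M. v x = 0"
 shows "card (representatives eps) \<le> card T"
proof -
 let ?R = "representatives eps"
 have "\<forall>a\<in>?R. \<exists>v. is_sol F d eps (of_vector d M v) &
   (\<forall>b\<in>?R. \<forall>\<^sub>F X in gen. HX (of_vector d M v) x0 b X = (if b = a then 1 else 0) * (uu x0 b X))"
 proof
  fix a assume "a \<in> ?R"
  from delta_class_function[OF eps this] obtain c :: "cpol fract => complex"
   where c': "(\<forall>\<kappa>\<in>C. c (cls \<kappa> x0) = eps * c \<kappa>) & (\<forall>b\<in>?R. c b = (if b = a then 1 else 0))" ..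
  hence c: "!!\<kappa>. \<kappa> \<in> C ==> c (cls \<kappa> x0) = eps * c \<kappa>" "!!b. b \<in> ?R ==> c b = (if b = a then 1 else 0)"
   by (blast, blast)
  from class_function_sol[of c eps, OF c(1)] obtain h where h': "is_sol F d eps h &
   (\<forall>k<d. \<forall>l<d. degree (h k l) \<le> M & (\<forall>i. degree (coeff (h k l) i) \<le> M)) &
   (\<forall>i\<in>C. \<forall>j\<in>C. \<forall>\<^sub>F X in gen. HX h i j X = c (cls i j) * (uu i j X))" ..
  note h = h'[THEN conjunct1] h'[THEN conjunct2, THEN conjunct1] h'[THEN conjunct2, THEN conjunct2]
  define v where "v = (%(i, j, k, l). coeff (coeff (h k l) i) j)"
  have e: "of_vector d M v k l = h k l" if "k < d" "l < d" for k l
   unfolding v_def by (rule of_vector_coeffs) (use h(2) that in auto)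
  have sol: "is_sol F d eps (of_vector d M v)"
   using h(1) by (rule is_sol_cong[THEN iffD1, rotated]) (simp add: e)
  moreover have "\<forall>b\<in>?R. \<forall>\<^sub>F X in gen. HX (of_vector d M v) x0 b X = (if b = a then 1 else 0) * (uu x0 b X)"
  proof
   fix b assume b: "b \<in> ?R"
   hence bC: "b \<in> C" using representatives_sub by auto
   have "HX (of_vector d M v) x0 b X = HX h x0 b X" for X
    unfolding pair_value_def by (intro sum.cong refl) (simp add: e)
   thus "\<forall>\<^sub>F X in gen. HX (of_vector d M v) x0 b X = (if b = a then 1 else 0) * (uu x0 b X)"
    using h(3)[rule_format, OF x_conjugate bC] c(2)[OF b] cls_x[OF bC] by simp
  qed
  ultimately show "\<exists>v. is_sol F d eps (of_vector d M v) &
   (\<forall>b\<in>?R. \<forall>\<^sub>F X in gen. HX (of_vector d M v) x0 b X = (if b = a then 1 else 0) * (uu x0 b X))" by blast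
 qed
 from bchoice[OF this] obtain w where
  w': "\<forall>a\<in>?R. is_sol F d eps (of_vector d M (w a)) &
   (\<forall>b\<in>?R. \<forall>\<^sub>F X in gen. HX (of_vector d M (w a)) x0 b X = (if b = a then 1 else 0) * (uu x0 b X))" ..
 have w: "!!a. a \<in> ?R ==> is_sol F d eps (of_vector d M (w a))"
  "!!a b. a \<in> ?R ==> b \<in> ?R ==> \<forall>\<^sub>F X in gen. HX (of_vector d M (w a)) x0 b X = (if b = a then 1 else 0) * (uu x0 b X)"
  using w' by (blast, blast)
 show ?thesis
 proof (rule card_le_if_independent[OF T representatives_sub(2)])
  fix u b
  assume z: "!!x. x \<in> T ==> (\<Sum>a\<in>?R. u a * w a x) = 0" and b: "b \<in> ?R"
  define v where "v x = (\<Sum>a\<in>?R. u a * w a x)" for x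
  have "is_sol F d eps (of_vector d M v)" unfolding v_def by (rule solution_combination[OF w(1)])
  hence v0: "\<forall>x\<in>indices d M. v x = 0" using inj z unfolding v_def by blast
  hence "of_vector d M v k l = 0" for k l unfolding of_vector_def by (intro sum.neutral) simp
  hence H0: "HX (of_vector d M v) x0 b X = 0" for X by (simp add: pair_value_def)
  have Hs: "HX (of_vector d M v) x0 b X = (\<Sum>a\<in>?R. u a * HX (of_vector d M (w a)) x0 b X)" for X
  proof -
   have "of_vector d M v = (%k l. \<Sum>a\<in>?R. smult [:u a:] (of_vector d M (w a) k l))"
    unfolding v_def[abs_def] by (intro ext of_vector_combination)
   thus ?thesis using HX_combination[where h = "%a. of_vector d M (w a)"] by simp
  qed
  have "\<forall>\<^sub>F X in gen. \<forall>a\<in>?R. HX (of_vector d M (w a)) x0 b X = (if b = a then 1 else 0) * (uu x0 b X)"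
   using w(2) b representatives_sub(2) by (intro eventually_ball_finite) auto
  hence "\<forall>\<^sub>F X in gen. u b = 0"
   using good
  proof eventually_elim
   case (elim X)
   have "0 = (\<Sum>a\<in>?R. u a * ((if b = a then 1 else 0) * (uu x0 b X)))"
    using H0[of X] Hs[of X] elim(1) by simp
   also have "\<dots> = (\<Sum>a\<in>?R. if a = b then u a * (uu x0 b X) else 0)"
    by (intro sum.cong refl) auto
   also have "\<dots> = u b * (uu x0 b X)" using b representatives_sub(2) by simp
   finally show ?case using elim(2) b representatives_sub(1) x_conjugate by auto
  qed
  thus "u b = 0" by simp
 qed
qed

text \<open>
  Conversely, a solution is determined by its class function, so independent values on
  \<open>T\<close> give independent class functions.
\<close>

lemma card_le_representatives:
 assumes eps: "eps = 1 \<or> eps = -1" and T: "T \<subseteq> indices d M"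
  and ex: "!!u. \<exists>v. (\<forall>x\<in>T. v x = u x) & is_sol F d eps (of_vector d M v)"
 shows "card T \<le> card (representatives eps)"
proof -
 let ?R = "representatives eps"
 have finT: "finite T" using T finite_indices by (rule finite_subset)
 have "\<forall>t\<in>T. \<exists>vc. (\<forall>x\<in>T. fst vc x = (if x = t then 1 else 0)) & is_sol F d eps (of_vector d M (fst vc)) &
   (\<forall>\<kappa>\<in>C. snd vc (cls \<kappa> x0) = eps * snd vc \<kappa>) &
   (\<forall>i\<in>C. \<forall>j\<in>C. \<forall>\<^sub>F X in gen. HX (of_vector d M (fst vc)) i j X = snd vc (cls i j) * (uu i j X))"
 proof
  fix t assume "t \<in> T"
  from ex[of "%x. if x = t then 1 else 0"] obtain v
   where v: "(\<forall>x\<in>T. v x = (if x = t then 1 else 0)) & is_sol F d eps (of_vector d M v)" ..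
  from sol_class_function[OF v[THEN conjunct2]] obtain c where "(\<forall>\<kappa>\<in>C. c (cls \<kappa> x0) = eps * c \<kappa>) &
   (\<forall>i\<in>C. \<forall>j\<in>C. \<forall>\<^sub>F X in gen. HX (of_vector d M v) i j X = c (cls i j) * (uu i j X))" ..
  thus "\<exists>vc. (\<forall>x\<in>T. fst vc x = (if x = t then 1 else 0)) & is_sol F d eps (of_vector d M (fst vc)) &
   (\<forall>\<kappa>\<in>C. snd vc (cls \<kappa> x0) = eps * snd vc \<kappa>) &
   (\<forall>i\<in>C. \<forall>j\<in>C. \<forall>\<^sub>F X in gen. HX (of_vector d M (fst vc)) i j X = snd vc (cls i j) * (uu i j X))"
   using v by (intro exI[of _ "(v, c)"]) simp
 qed
 from bchoice[OF this] obtain vc where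
  vc: "\<forall>t\<in>T. (\<forall>x\<in>T. fst (vc t) x = (if x = t then 1 else 0)) & is_sol F d eps (of_vector d M (fst (vc t))) &
   (\<forall>\<kappa>\<in>C. snd (vc t) (cls \<kappa> x0) = eps * snd (vc t) \<kappa>) &
   (\<forall>i\<in>C. \<forall>j\<in>C. \<forall>\<^sub>F X in gen. HX (of_vector d M (fst (vc t))) i j X = snd (vc t) (cls i j) * (uu i j X))" ..
 define w where "w t = fst (vc t)" for t
 define c where "c t = snd (vc t)" for t
 have w1: "w t x = (if x = t then 1 else 0)" if "t \<in> T" "x \<in> T" for t x using vc that unfolding w_def by blast
 have w2: "is_sol F d eps (of_vector d M (w t))" if "t \<in> T" for t using vc that unfolding w_def by blast
 have c1: "c t (cls \<kappa> x0) = eps * c t \<kappa>" if "t \<in> T" "\<kappa> \<in> C" for t \<kappa> using vc that unfolding c_def by blast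
 have c2: "\<forall>\<^sub>F X in gen. HX (of_vector d M (w t)) i j X = c t (cls i j) * (uu i j X)"
  if "t \<in> T" "i \<in> C" "j \<in> C" for t i j using vc that unfolding c_def w_def by blast
 show ?thesis
 proof (rule card_le_if_independent[OF representatives_sub(2) finT, where w = c])
  fix u t
  assume z: "!!b. b \<in> ?R ==> (\<Sum>t\<in>T. u t * c t b) = 0" and t: "t \<in> T"
  define cc where "cc \<kappa> = (\<Sum>t\<in>T. u t * c t \<kappa>)" for \<kappa>
  have "cc (cls \<kappa> x0) = eps * cc \<kappa>" if "\<kappa> \<in> C" for \<kappa>
   unfolding cc_def sum_distrib_left by (intro sum.cong refl) (simp add: c1 that)
  hence cc0: "cc \<kappa> = 0" if "\<kappa> \<in> C" for \<kappa>
   using zero_on_representatives[OF eps, of cc] z that unfolding cc_def by blast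
  define v where "v x = (\<Sum>t\<in>T. u t * w t x)" for x
  have "\<forall>\<^sub>F X in gen. HX (of_vector d M v) i j X = 0" if ij: "i \<in> C" "j \<in> C" for i j
  proof -
   have "\<forall>\<^sub>F X in gen. \<forall>t\<in>T. HX (of_vector d M (w t)) i j X = c t (cls i j) * (uu i j X)"
    using c2 ij finT by (intro eventually_ball_finite) auto
   thus ?thesis
   proof eventually_elim
    case (elim X)
    have "of_vector d M v = (%k l. \<Sum>a\<in>T. smult [:u a:] (of_vector d M (w a) k l))"
     unfolding v_def[abs_def] by (intro ext of_vector_combination)
    hence "HX (of_vector d M v) i j X = (\<Sum>t\<in>T. u t * HX (of_vector d M (w t)) i j X)"
     using HX_combination[where h = "%a. of_vector d M (w a)"] by simp
    also have "\<dots> = cc (cls i j) * (uu i j X)"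
     unfolding cc_def sum_distrib_right by (intro sum.cong refl) (use elim in simp)
    finally show ?case using cc0 cls_in[OF ij] by simp
   qed
  qed
  hence "v t = 0" using vector_zero_if_values_zero[of v t] T t by blast
  moreover have "v t = (\<Sum>s\<in>T. if s = t then u s else 0)"
   unfolding v_def by (intro sum.cong refl) (use w1 t in auto)
  ultimately show "u t = 0" using t finT by simp
 qed
qed


lemma involutions_eq: "involutions \<omega> = card {\<kappa>\<in>conjugates. cls \<kappa> x_elt = \<kappa>}"
proof -
 have "{\<rho>. \<exists>\<sigma>\<in>G. \<rho> = \<sigma> x_elt & \<sigma> \<rho> = x_elt} = {\<kappa>\<in>conjugates. cls \<kappa> x_elt = \<kappa>}"
 proof (intro set_eqI iffI)
  fix \<rho> assume "\<rho> \<in> {\<rho>. \<exists>\<sigma>\<in>G. \<rho> = \<sigma> x_elt & \<sigma> \<rho> = x_elt}"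
  then obtain \<sigma> where s: "\<sigma> \<in> G" "\<rho> = \<sigma> x_elt" "\<sigma> \<rho> = x_elt" by blast
  hence r: "\<rho> \<in> conjugates" by (auto simp: conjugates_def)
  moreover have "sg \<rho> \<rho> = x_elt" using sg_eq[OF s(1) conjugate_in[OF r]] s by simp
  ultimately show "\<rho> \<in> {\<kappa>\<in>conjugates. cls \<kappa> x_elt = \<kappa>}" using cls_unique[of \<rho> \<rho> x_elt] by simp
 next
  fix \<rho> assume "\<rho> \<in> {\<kappa>\<in>conjugates. cls \<kappa> x_elt = \<kappa>}"
  hence r: "\<rho> \<in> conjugates" "cls \<rho> x_elt = \<rho>" by auto
  have "sg \<rho> \<in> G" "\<rho> = sg \<rho> x_elt" "sg \<rho> \<rho> = x_elt"
   using sg[OF r(1)] sg_cls[OF r(1) x_conjugate] r(2) by auto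
  thus "\<rho> \<in> {\<rho>. \<exists>\<sigma>\<in>G. \<rho> = \<sigma> x_elt & \<sigma> \<rho> = x_elt}" by (intro CollectI bexI[of _ "sg \<rho>"] conjI)
 qed
 thus ?thesis by (simp add: involutions_def)
qed

end

text \<open>
  Both eigenspaces of the exchange of the two roots can only become smaller near \<open>\<omega>0\<close>, and their
 dimensions add up to \<open>d\<close>; hence both are constant, and so is the trace of the exchange.
\<close>

theorem involutions_locally_constant:
 assumes "galois_form d \<omega>0"
 shows "\<exists>D. polyfun d D & D \<omega>0 ~= 0 & (\<forall>\<omega>. galois_form d \<omega> --> D \<omega> ~= 0 --> involutions \<omega> = involutions \<omega>0)"
proof -
 let ?M = "2 * growth_exponent d"
 interpret f0: galois_form d \<omega>0 by fact
 have entry: "polyfun d (%\<omega>. system_entry (tangency \<omega>) d eps e x)" for eps e x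
 proof -
  obtain n a b p q where e: "e = (n, a, b, p, q)" by (cases e)
  have A: "function_algebra {f. polyfun d f}" by (rule function_algebra_polyfun)
  have t1: "(%\<omega>. Tp (tangency \<omega>) d (basis_poly x) p q a b) \<in> {f. polyfun d f}"
   by (rule transport_coeff_function_algebra[OF A polyfam_tangency(1,2)]) (simp_all add: polyfun_const)
  have t2: "(%\<omega>. Tq (tangency \<omega>) d (basis_poly x) p q a b) \<in> {f. polyfun d f}"
   by (rule transport_coeff_function_algebra[OF A polyfam_tangency(1,3)]) (simp_all add: polyfun_const)
  note t = t1[unfolded mem_Collect_eq] t2[unfolded mem_Collect_eq]
  show ?thesis unfolding e system_entry_def prod.case
   by (cases "a < d & b < d"; cases "n = 0"; cases "n = 1") (simp_all only: if_True if_False simp_thms t polyfun_const)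
 qed
 have near: "\<exists>D T. polyfun d D & D \<omega>0 ~= 0 & T \<subseteq> indices d ?M &
   (\<forall>\<omega> v. D \<omega> ~= 0 --> is_sol (tangency \<omega>) d eps (of_vector d ?M v) --> (\<forall>i\<in>T. v i = 0) --> (\<forall>i\<in>indices d ?M. v i = 0)) &
   (\<forall>u. \<exists>v. (\<forall>i\<in>T. v i = u i) & is_sol (tangency \<omega>0) d eps (of_vector d ?M v))" for eps
  unfolding is_sol_of_vector
  using free_variables_near[OF finite_indices, of d ?M d "%e x \<omega>. system_entry (tangency \<omega>) d eps e x" \<omega>0] entry
  by blast
 obtain D1 T1 where D1: "polyfun d D1" "D1 \<omega>0 ~= 0" "T1 \<subseteq> indices d ?M"
   "!!\<omega> v. D1 \<omega> ~= 0 ==> is_sol (tangency \<omega>) d 1 (of_vector d ?M v) ==> (\<forall>i\<in>T1. v i = 0) ==> (\<forall>i\<in>indices d ?M. v i = 0)"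
   "!!u. \<exists>v. (\<forall>i\<in>T1. v i = u i) & is_sol (tangency \<omega>0) d 1 (of_vector d ?M v)"
  using near[of 1] by blast
 obtain D2 T2 where D2: "polyfun d D2" "D2 \<omega>0 ~= 0" "T2 \<subseteq> indices d ?M"
   "!!\<omega> v. D2 \<omega> ~= 0 ==> is_sol (tangency \<omega>) d (- 1) (of_vector d ?M v) ==> (\<forall>i\<in>T2. v i = 0) ==> (\<forall>i\<in>indices d ?M. v i = 0)"
   "!!u. \<exists>v. (\<forall>i\<in>T2. v i = u i) & is_sol (tangency \<omega>0) d (- 1) (of_vector d ?M v)"
  using near[of "- 1"] by blast
 have fin: "finite T1" "finite T2" using D1(3) D2(3) finite_subset finite_indices by blast+
 have u1: "card T1 \<le> card (f0.representatives 1)" and u2: "card T2 \<le> card (f0.representatives (- 1))"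
  using f0.card_le_representatives[of 1 T1] f0.card_le_representatives[of "- 1" T2] D1(3,5) D2(3,5) by auto
 show ?thesis
 proof (intro exI[of _ "%\<omega>. D1 \<omega> * D2 \<omega>"] conjI allI impI)
  show "polyfun d (%\<omega>. D1 \<omega> * D2 \<omega>)" using D1(1) D2(1) by (rule polyfun_mult)
  show "D1 \<omega>0 * D2 \<omega>0 ~= 0" using D1(2) D2(2) by simp
  fix \<omega> assume "galois_form d \<omega>" and nz: "D1 \<omega> * D2 \<omega> ~= 0"
  interpret f: galois_form d \<omega> by fact
  have "card (f.representatives 1) \<le> card T1"
   by (rule f.card_representatives_le) (use fin D1(4) nz in auto)
  moreover have "card (f.representatives (- 1)) \<le> card T2"
   by (rule f.card_representatives_le) (use fin D2(4) nz in auto)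
  ultimately have le: "card (f.representatives 1) \<le> card (f0.representatives 1)"
   "card (f.representatives (- 1)) \<le> card (f0.representatives (- 1))" using u1 u2 by auto
  have card1: "card (f.half \<union> f.self_inverse) = card f.half + card f.self_inverse"
   using f.finite_conjugates by (intro card_Un_disjoint) (auto simp: f.half_def f.self_inverse_def)
  have card2: "card (f0.half \<union> f0.self_inverse) = card f0.half + card f0.self_inverse"
   using f0.finite_conjugates by (intro card_Un_disjoint) (auto simp: f0.half_def f0.self_inverse_def)
  have "card f.half + card f.self_inverse \<le> card f0.half + card f0.self_inverse" "card f.half \<le> card f0.half"
   using le by (simp_all add: f.representatives_def f0.representatives_def card1 card2)
  moreover have "involutions \<omega> = card f.self_inverse" "involutions \<omega>0 = card f0.self_inverse"
   by (simp_all add: f.involutions_eq f0.involutions_eq f.self_inverse_def f0.self_inverse_def)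
  ultimately show "involutions \<omega> = involutions \<omega>0"
   using f.card_half f0.card_half by linarith
 qed
qed

section \<open>Pulling back along a rational self-map of the plane\<close>

text \<open>
  Composition with a rational map needs that no denominator vanishes identically on the image. It
  suffices that a generic point has a preimage at which the map is defined.
\<close>

locale plane_map =
 fixes x' y' :: "cpol fract"
 assumes x': "x' \<in> LL" and y': "y' \<in> LL"
  and onto: "\<forall>\<^sub>F Y in gen. \<exists>X. fdef x' X & fdef y' X & (fval x' X, fval y' X) = Y"
begin

definition T :: "complex \<times> complex => complex \<times> complex" where
 "T X = (fval x' X, fval y' X)"

definition pull :: "cpol fract => cpol fract" where
 "pull f = (SOME g. g \<in> LL & (\<forall>\<^sub>F X in gen. fval g X = fval f (T X)))"

lemma eval_at_nonzero:
 assumes "homogeneous m Q" "Q ~= 0"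
 shows "eval_at x' y' Q ~= 0"
proof
 assume z: "eval_at x' y' Q = 0"
 have "\<forall>\<^sub>F Y in gen. False"
  using gen_ev_nonzero[OF assms] onto
 proof eventually_elim
  case (elim Y)
  then obtain X where X: "fdef x' X" "fdef y' X" "(fval x' X, fval y' X) = Y" by blast
  have "pt Y = vec3 (fval x' X) (fval y' X) 1" using X(3) by (auto simp: pt_def)
  hence "ev (pt Y) Q = 0" using fval_eval_at[OF X(1,2), of Q] fval_0[of X] unfolding z by simp
  with elim(1) show ?case ..
 qed
 thus False by simp
qed

lemma eval_at_LL: "eval_at x' y' Q \<in> LL"
 by (intro eval_at_in sub_LL cst_in x' y')

lemma fval_eval_at_T: "\<forall>\<^sub>F X in gen. fdef (eval_at x' y' Q) X & fval (eval_at x' y' Q) X = ev (pt (T X)) Q"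
 using gen_fdef[OF x'] gen_fdef[OF y'] by eventually_elim (simp add: fval_eval_at pt_def T_def)

lemma generic_image:
 assumes "eventually P gen"
 shows "\<forall>\<^sub>F X in gen. P (T X)"
proof -
 obtain D where D: "D ~= 0" "!!x y. ev2 D x y ~= 0 ==> P (x, y)" using assms unfolding eventually_gen by blast
 have "homogenize D ~= 0" using D(1) in_plane_homogenize[of D] in_plane_eq_0_iff[OF homogeneous_homogenize] by metis
 from gen_fval_nonzero[OF eval_at_LL eval_at_nonzero[OF homogeneous_homogenize this]] fval_eval_at_T[of "homogenize D"]
 show ?thesis
 proof eventually_elim
  case (elim X)
  hence "ev2 D (fst (T X)) (snd (T X)) ~= 0" by (simp add: pt_def ev_homogenize_plane)
  from D(2)[OF this] show ?case by simp
 qed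
qed

lemma pull:
 assumes "f \<in> LL"
 shows "pull f \<in> LL & (\<forall>\<^sub>F X in gen. fval (pull f) X = fval f (T X))"
 unfolding pull_def
proof (rule someI_ex)
 obtain P Q m where f: "f = Fract P Q" "homogeneous m P" "homogeneous m Q" "Q ~= 0" using assms by (rule LL_E)
 have "eval_at x' y' P / eval_at x' y' Q \<in> LL" by (intro is_subfieldD(8)[OF sub_LL] eval_at_LL)
 moreover have "\<forall>\<^sub>F X in gen. fval (eval_at x' y' P / eval_at x' y' Q) X = fval f (T X)"
  using fval_eval_at_T[of P] fval_eval_at_T[of Q] generic_image[OF gen_ev_nonzero[OF f(3,4)]] gen_fdef[OF calculation]
 proof eventually_elim
  case (elim X)
  have "fval (eval_at x' y' P / eval_at x' y' Q) X * fval (eval_at x' y' Q) X = fval (eval_at x' y' P) X"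
   using fval_mult[OF elim(4) elim(2)[THEN conjunct1]] eval_at_nonzero[OF f(3,4)] by simp
  thus ?case using elim by (simp add: f(1) fval_Fract field_simps)
 qed
 ultimately show "\<exists>g. g \<in> LL & (\<forall>\<^sub>F X in gen. fval g X = fval f (T X))" by blast
qed

lemmas pull_in = pull[THEN conjunct1] and fval_pull = pull[THEN conjunct2]

lemma pull_eqI:
 assumes "f \<in> LL" "g \<in> LL" "\<forall>\<^sub>F X in gen. fval f (T X) = fval g X"
 shows "pull f = g"
proof (rule LL_eqI[OF pull_in[OF assms(1)] assms(2)])
 show "\<forall>\<^sub>F X in gen. fval (pull f) X = fval g X"
  using fval_pull[OF assms(1)] assms(3) by eventually_elim simp
qed

lemma pull_add:
 assumes "f \<in> LL" "g \<in> LL"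
 shows "pull (f + g) = pull f + pull g"
proof (rule pull_eqI)
 show "\<forall>\<^sub>F X in gen. fval (f + g) (T X) = fval (pull f + pull g) X"
  using fval_pull[OF assms(1)] fval_pull[OF assms(2)] generic_image[OF gen_fdef[OF assms(1)]] generic_image[OF gen_fdef[OF assms(2)]]
   gen_fdef[OF pull_in[OF assms(1)]] gen_fdef[OF pull_in[OF assms(2)]]
  by eventually_elim (simp add: fval_add)
qed (use assms pull_in is_subfieldD(3)[OF sub_LL] in auto)

lemma pull_mult:
 assumes "f \<in> LL" "g \<in> LL"
 shows "pull (f * g) = pull f * pull g"
proof (rule pull_eqI)
 show "\<forall>\<^sub>F X in gen. fval (f * g) (T X) = fval (pull f * pull g) X"
  using fval_pull[OF assms(1)] fval_pull[OF assms(2)] generic_image[OF gen_fdef[OF assms(1)]] generic_image[OF gen_fdef[OF assms(2)]]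
   gen_fdef[OF pull_in[OF assms(1)]] gen_fdef[OF pull_in[OF assms(2)]]
  by eventually_elim (simp add: fval_mult)
qed (use assms pull_in is_subfieldD(4)[OF sub_LL] in auto)

lemma pull_x: "pull x_elt = x'"
 by (rule pull_eqI[OF x_elt_in x']) (simp add: fval_x_elt T_def)

end

lemma pull_pull:
 assumes "plane_map x1 y1" "plane_map x2 y2" "plane_map x3 y3" "f \<in> LL"
  "\<forall>\<^sub>F X in gen. plane_map.T x2 y2 (plane_map.T x1 y1 X) = plane_map.T x3 y3 X"
 shows "plane_map.pull x1 y1 (plane_map.pull x2 y2 f) = plane_map.pull x3 y3 f"
proof -
 interpret m1: plane_map x1 y1 by fact
 interpret m2: plane_map x2 y2 by fact
 interpret m3: plane_map x3 y3 by fact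
 show ?thesis
 proof (rule m1.pull_eqI[OF m2.pull_in[OF assms(4)] m3.pull_in[OF assms(4)]])
  show "\<forall>\<^sub>F X in gen. fval (m2.pull f) (m1.T X) = fval (m3.pull f) X"
   using m1.generic_image[OF m2.fval_pull[OF assms(4)]] m3.fval_pull[OF assms(4)] assms(5)
   by eventually_elim simp
 qed
qed

section \<open>Polynomials over a subfield\<close>

definition over :: "'a::field set => 'a poly => bool" where
 "over S P \<longleftrightarrow> (\<forall>j. coeff P j \<in> S)"

lemma over_add: "is_subfield S ==> over S P ==> over S Q ==> over S (P + Q)"
 and over_diff: "is_subfield S ==> over S P ==> over S Q ==> over S (P - Q)"
 and over_smult: "is_subfield S ==> c \<in> S ==> over S P ==> over S (smult c P)"
 and over_pCons: "c \<in> S ==> over S P ==> over S (pCons c P)"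
 by (auto simp: over_def is_subfieldD coeff_pCons split: nat.split)

lemma over_0: "is_subfield S ==> over S 0"
 by (simp add: over_def is_subfieldD)

lemma over_mult: "is_subfield S ==> over S P ==> over S Q ==> over S (P * Q)"
 unfolding over_def coeff_mult by (auto intro!: is_subfield_sum is_subfieldD(4))

lemma over_prod: "is_subfield S ==> (!!i. i \<in> I ==> over S (P i)) ==> over S (\<Prod>i\<in>I. P i)"
proof (induction I rule: infinite_finite_induct)
 case (insert i I)
 thus ?case by (auto intro: over_mult)
qed (auto simp: over_def is_subfieldD)

lemma over_mono: "S \<subseteq> S' ==> over S P ==> over S' P"
 unfolding over_def by blast

text \<open>An automorphism over \<open>K\<close> permutes the roots of a polynomial over \<open>K\<close>.\<close>

lemma automorphism_poly_over:
 assumes s: "\<sigma> \<in> field_automorphisms_over K S" and S: "is_subfield S" "K \<subseteq> S" and P: "over K P" and f: "f \<in> S"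
 shows "\<sigma> (poly P f) = poly P (\<sigma> f)"
proof -
 have c: "coeff P j \<in> K" "coeff P j \<in> S" for j using P S(2) unfolding over_def by auto
 have t: "coeff P j * f ^ j \<in> S" "\<sigma> (coeff P j * f ^ j) = coeff P j * \<sigma> f ^ j" for j
  using aut_simps(3)[OF s S(1) c(2) is_subfield_power[OF S(1) f]] aut_simps(4)[OF s S(1) c(1)]
   automorphism_power[OF s S(1) f] is_subfieldD(4)[OF S(1) c(2) is_subfield_power[OF S(1) f]] by auto
 show ?thesis unfolding poly_altdef by (subst automorphism_sum[OF s S(1) t(1)]) (simp add: t(2))
qed

lemma automorphism_coeff_prod:
 assumes s: "\<sigma> \<in> field_automorphisms_over K S" and S: "is_subfield S"
  and P: "!!i. i \<in> I ==> over S (P i)" and P': "!!i j. i \<in> I ==> coeff (P' i) j = \<sigma> (coeff (P i) j)"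
 shows "coeff (\<Prod>i\<in>I. P' i) j = \<sigma> (coeff (\<Prod>i\<in>I. P i) j)"
 using P P'
proof (induction I arbitrary: j rule: infinite_finite_induct)
 case (insert i I)
 have o: "over S (P i)" "over S (\<Prod>i\<in>I. P i)" using insert.prems(1) over_prod[OF S, of I P] by auto
 have c: "coeff (P i) k \<in> S" "coeff (\<Prod>i\<in>I. P i) k \<in> S" for k using o unfolding over_def by auto
 have IH: "coeff (\<Prod>i\<in>I. P' i) j = \<sigma> (coeff (\<Prod>i\<in>I. P i) j)" for j using insert by auto
 have "\<sigma> (coeff (P i * (\<Prod>i\<in>I. P i)) j) = (\<Sum>k\<le>j. \<sigma> (coeff (P i) k * coeff (\<Prod>i\<in>I. P i) (j - k)))"
  unfolding coeff_mult by (rule automorphism_sum[OF s S is_subfieldD(4)[OF S c]])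
 also have "\<dots> = coeff (P' i * (\<Prod>i\<in>I. P' i)) j"
  unfolding coeff_mult by (simp add: aut_simps(3)[OF s S c] IH insert.prems(2))
 finally show ?case using insert.hyps by simp
qed (simp_all add: coeff_1 aut_simps(6,7)[OF s S])

text \<open>
  Every element of \<open>K(x)\<close> is a quotient of polynomials of degree below \<open>d\<close> in \<open>x\<close>, once \<open>x\<close> is a
 root of a polynomial of degree \<open>d\<close>. If all conjugates of \<open>x\<close> give the same quotient, then
 comparing coefficients shows that it lies in \<open>K\<close>.
\<close>

lemma low_degree_closed:
 assumes K: "is_subfield K" and d: "1 \<le> d" and M: "over K M" "degree M = d" "poly M x = 0"
 defines "V \<equiv> {poly P x |P. over K P & degree P < d}"
 shows "1 \<in> V" "u \<in> V ==> v \<in> V ==> u + v \<in> V" "c \<in> K ==> u \<in> V ==> c * u \<in> V" "u \<in> V ==> x * u \<in> V"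
proof -
 have "over K 1" unfolding over_def using is_subfieldD(1,2)[OF K] by (simp add: coeff_1)
 thus "1 \<in> V" unfolding V_def using d by (auto intro!: exI[of _ 1])
 show "u \<in> V ==> v \<in> V ==> u + v \<in> V"
  unfolding V_def using over_add[OF K] degree_add_less by (smt (verit) mem_Collect_eq poly_add)
 show "c \<in> K ==> u \<in> V ==> c * u \<in> V"
  unfolding V_def using over_smult[OF K] le_less_trans[OF degree_smult_le] by (smt (verit) mem_Collect_eq poly_smult)
 assume "u \<in> V"
 then obtain P where P: "u = poly P x" "over K P" "degree P < d" unfolding V_def by auto
 define R where "R = pCons 0 P - smult (coeff P (d - 1) / coeff M d) M"
 have "M ~= 0" using M(2) d by auto
 hence l: "coeff M d ~= 0" using M(2) leading_coeff_0_iff[of M] by simp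
 have "coeff R j = 0" if "d \<le> j" for j
 proof (cases "j = d")
  case True
  thus ?thesis using l d by (simp add: R_def coeff_pCons split: nat.split)
 next
  case False
  hence "coeff M j = 0" "coeff P (j - 1) = 0" using that P(3) M(2) by (auto intro: coeff_eq_0)
  thus ?thesis using d that by (cases j) (simp_all add: R_def)
 qed
 hence "degree R < d" using d by (intro degree_lessI) auto
 moreover have "over K R"
  unfolding R_def using P(2) M(1)
  by (intro over_diff[OF K] over_pCons over_smult[OF K] is_subfieldD[OF K]) (auto simp: over_def)
 moreover have "x * u = poly R x" by (simp add: R_def P(1) M(3))
 ultimately show "x * u \<in> V" unfolding V_def by blast
qed

lemma eval_at_low_degree:
 assumes K: "is_subfield K" "!!c. cst c \<in> K" and V: "1 \<in> V" "!!u v. u \<in> V ==> v \<in> V ==> u + v \<in> V"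
  "!!c u. c \<in> K ==> u \<in> V ==> c * u \<in> V" "!!u. u \<in> V ==> x * u \<in> V" and y: "y = q + p * x" "p \<in> K" "q \<in> K"
 shows "eval_at x y P \<in> V"
proof -
 have "y * v \<in> V" if "v \<in> V" for v
 proof -
  have "y * v = q * v + p * (x * v)" by (simp add: y(1) algebra_simps)
  thus ?thesis using V that y by simp
 qed
 hence yj: "y ^ j \<in> V" for j by (induction j) (auto simp: V(1))
 have xy: "x ^ i * y ^ j \<in> V" for i j
  by (induction i) (auto simp: yj mult.assoc intro: V(4))
 have z: "0 \<in> V" using V(3)[OF is_subfieldD(1)[OF K(1)] V(1)] by simp
 have "(\<Sum>i\<in>I. f i) \<in> V" if "!!i. i \<in> I ==> f i \<in> V" for I and f :: "(3 \<Rightarrow>\<^sub>0 nat) => cpol fract"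
  using that by (induction I rule: infinite_finite_induct) (auto intro: V(2) z)
 from this[OF V(3)[OF K(2) xy]] show ?thesis unfolding eval_at_def .
qed

text \<open>
  The polynomial \<open>f Q - P\<close> has more roots than its degree allows, so \<open>f\<close>
 is a quotient of two coefficients.
\<close>

lemma fixed_quotient:
 assumes K: "is_subfield K" and P: "over K P" "over K Q" "degree P < d" "degree Q < d" "Q ~= 0"
  and R: "card R = d" "!!\<rho>. \<rho> \<in> R ==> f * poly Q \<rho> = poly P \<rho>"
 shows "f \<in> K"
proof -
 have "smult f Q - P = 0"
 proof (rule ccontr)
  assume nz: "smult f Q - P ~= 0"
  have "R \<subseteq> {\<rho>. poly (smult f Q - P) \<rho> = 0}" using R(2) by auto
  hence "d \<le> card {\<rho>. poly (smult f Q - P) \<rho> = 0}" using card_mono[OF poly_roots_finite[OF nz]] R(1) by blast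
  also have "\<dots> \<le> degree (smult f Q - P)" by (rule card_poly_roots_bound[OF nz])
  also have "\<dots> < d" by (rule degree_diff_less) (use P in \<open>auto intro: le_less_trans[OF degree_smult_le]\<close>)
  finally show False by simp
 qed
 hence eq: "f * coeff Q j = coeff P j" for j
  by (metis coeff_smult eq_iff_diff_eq_0)
 obtain j where "coeff Q j ~= 0" using P(5) by (metis leading_coeff_0_iff)
 hence "f = coeff P j / coeff Q j" using eq[of j] by (simp add: field_simps)
 thus ?thesis using P(1,2) is_subfieldD(8)[OF K] unfolding over_def by metis
qed


section \<open>Scaling the form\<close>

lemma compose_form_scale:
 assumes "homogeneous m P"
 shows "compose_form P (scale c \<omega>) = mconst (c ^ m) * compose_form P \<omega>"
proof (rule ev_eqI)
 fix v
 have "(%i. ev v (scale c \<omega> $ i)) = (%i. c * ev v (\<omega> $ i))" by (simp add: scale_def fun_eq_iff)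
 thus "ev v (compose_form P (scale c \<omega>)) = ev v (mconst (c ^ m) * compose_form P \<omega>)"
  by (simp add: ev_compose_form ev_homogeneous[OF assms])
qed

lemma gauss_subfield_scale_subset:
 assumes "c ~= 0"
 shows "gauss_subfield \<omega> \<subseteq> gauss_subfield (scale c \<omega>)"
proof
 fix f assume "f \<in> gauss_subfield \<omega>"
 then obtain P Q m where f: "f = Fract (compose_form P \<omega>) (compose_form Q \<omega>)" "homogeneous m P" "homogeneous m Q" "compose_form Q \<omega> ~= 0"
  by (elim gauss_E)
 have nz: "mconst (c ^ m) ~= (0 :: cpol)" using assms by (metis lookup_mconst_mult lookup_zero lookup_single_eq mconst_def power_not_zero)
 hence "compose_form Q (scale c \<omega>) ~= 0" using f(4) by (simp add: compose_form_scale[OF f(3)])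
 from gauss_I[OF f(2,3) this] show "f \<in> gauss_subfield (scale c \<omega>)"
  using nz f(4) by (simp add: f(1) compose_form_scale[OF f(2)] compose_form_scale[OF f(3)] mult_fract_cancel)
qed

lemma gauss_subfield_scale:
 assumes "c ~= 0"
 shows "gauss_subfield (scale c \<omega>) = gauss_subfield \<omega>"
 using gauss_subfield_scale_subset[OF assms, of \<omega>] gauss_subfield_scale_subset[of "1 / c" "scale c \<omega>"] assms
 by (simp add: scale_scale)

lemma involutions_scale: "c ~= 0 ==> involutions (scale c \<omega>) = involutions \<omega>"
 by (simp add: involutions_def gauss_subfield_scale)

lemma no_common_factor_scale:
 assumes "c ~= 0" "no_common_factor \<omega>"
 shows "no_common_factor (scale c \<omega>)"
 unfolding no_common_factor_def
proof (intro allI impI)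
 fix p assume p: "\<forall>i. p dvd scale c \<omega> $ i"
 have "p dvd \<omega> $ i" for i
 proof -
  have "p dvd mconst (1 / c) * scale c \<omega> $ i" using p by (intro dvd_mult) blast
  also have "mconst (1 / c) * scale c \<omega> $ i = \<omega> $ i"
   by (rule ev_eqI) (use assms(1) in \<open>simp add: scale_def\<close>)
  finally show ?thesis .
 qed
 thus "p dvd 1" using assms(2) unfolding no_common_factor_def by blast
qed

section \<open>The foliation of a finite group of Moebius transformations\<close>

type_synonym mob = "complex \<times> complex \<times> complex \<times> complex"

fun num :: "mob => complex => complex => complex" where "num (a, b, c, e) x z = a * x + b * z"
fun den :: "mob => complex => complex => complex" where "den (a, b, c, e) x z = c * x + e * z"
fun disc :: "mob => complex" where "disc (a, b, c, e) = a * e - b * c"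
fun smul :: "complex => mob => mob" where "smul t (a, b, c, e) = (t * a, t * b, t * c, t * e)"
fun adj :: "mob => mob" where "adj (a, b, c, e) = (e, - b, - c, a)"
fun mm :: "mob => mob => mob" where
 "mm (a, b, c, e) (a', b', c', e') = (a * a' + b * c', a * b' + b * e', c * a' + e * c', c * b' + e * e')"

text \<open>The transformations of order at most 2: the scalar matrices and those of trace 0.\<close>

fun involutive :: "mob => bool" where
 "involutive (a, b, c, e) \<longleftrightarrow> a + e = 0 \<or> (b = 0 & c = 0 & a = e)"

abbreviation one_mob :: mob where "one_mob \<equiv> (1, 0, 0, 1)"

lemma num_mm: "num (mm g h) x z = num g (num h x z) (den h x z)"
 and den_mm: "den (mm g h) x z = den g (num h x z) (den h x z)"
 by (cases g; cases h; simp add: algebra_simps)+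

lemma num_smul: "num (smul t g) x z = t * num g x z" and den_smul: "den (smul t g) x z = t * den g x z"
 by (cases g; simp add: algebra_simps)+

lemma num_hom: "num g (t * x) (t * z) = t * num g x z" and den_hom: "den g (t * x) (t * z) = t * den g x z"
 by (cases g; simp add: algebra_simps)+

lemma mm_assoc: "mm (mm f g) h = mm f (mm g h)"
 by (cases f; cases g; cases h; simp add: algebra_simps)

lemma mm_smul: "mm (smul t g) h = smul t (mm g h)" "mm g (smul t h) = smul t (mm g h)"
 by (cases g; cases h; simp add: algebra_simps)+

lemma smul_smul: "smul s (smul t g) = smul (s * t) g" and smul_1: "smul 1 g = g"
 by (cases g; simp)+

lemma mm_adj: "mm g (adj g) = smul (disc g) one_mob" "mm (adj g) g = smul (disc g) one_mob"
 by (cases g; simp add: algebra_simps)+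

lemma mm_one: "mm g one_mob = g" "mm one_mob g = g"
 by (cases g; simp)+

lemma num_den_zero: "disc g ~= 0 ==> num g x z = 0 ==> den g x z = 0 ==> x = 0 & z = 0"
proof (cases g)
 case (fields a b c e)
 assume "disc g ~= 0" "num g x z = 0" "den g x z = 0"
 hence h: "a * e - b * c ~= 0" "a * x + b * z = 0" "c * x + e * z = 0" by (auto simp: fields)
 have "(a * e - b * c) * x = e * (a * x + b * z) - b * (c * x + e * z)"
  "(a * e - b * c) * z = a * (c * x + e * z) - c * (a * x + b * z)" by (simp_all add: algebra_simps)
 thus ?thesis using h by simp
qed

lemma involutive_iff:
 assumes "disc g ~= 0"
 shows "involutive g \<longleftrightarrow> (\<exists>t. mm g g = smul t one_mob)"
proof (cases g)
 case (fields a b c e)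
 have "(\<exists>t. mm g g = smul t one_mob) \<longleftrightarrow> a * a + b * c = c * b + e * e & b * (a + e) = 0 & c * (a + e) = 0"
  by (auto simp: fields algebra_simps)
 also have "\<dots> \<longleftrightarrow> involutive g"
  by (auto simp: fields algebra_simps add_eq_0_iff square_eq_iff)
 finally show ?thesis ..
qed

text \<open>A polynomial without zeros is constant along every line, by the fundamental theorem of algebra.\<close>

lemma constant_on_line:
 assumes "!!t. ev (%i. v i + t * w i) (e :: cpol) ~= 0"
 shows "ev (%i. v i + t * w i) e = ev v e"
proof -
 define f where "f = mpol_eval (%c. [:c:]) (%i. [:v i, w i:]) e"
 have f: "poly f t = ev (%i. v i + t * w i) e" for t
 proof -
  have "(%p. poly p t) \<circ> (%c. [:c:]) = id" by (simp add: fun_eq_iff)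
  moreover have "(%p. poly p t) \<circ> (%i. [:v i, w i:]) = (%i. v i + t * w i)" by (simp add: fun_eq_iff)
  ultimately show ?thesis
   using mpol_eval_commute[OF comm_ring_hom_poly[of t], of "%c. [:c:]" "%i. [:v i, w i:]" e] by (simp add: f_def)
 qed
 have "constant (poly f)" using fundamental_theorem_of_algebra[of f] assms f by auto
 hence "poly f t = poly f 0" by (simp add: constant_def)
 thus ?thesis unfolding f by simp
qed

text \<open>
  A finite group of Moebius transformations, each represented by one matrix: products are taken up
  to scalars and no two matrices are proportional.
\<close>

locale moebius_group =
 fixes \<Gamma> :: "mob set" and d :: nat
 assumes fin: "finite \<Gamma>" and card: "card \<Gamma> = d" and one: "one_mob \<in> \<Gamma>"
  and disc: "g \<in> \<Gamma> ==> disc g ~= 0"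
  and unique: "g \<in> \<Gamma> ==> h \<in> \<Gamma> ==> smul t g = h ==> g = h"
  and mult: "g \<in> \<Gamma> ==> h \<in> \<Gamma> ==> \<exists>k\<in>\<Gamma>. \<exists>t. t ~= 0 & mm g h = smul t k"
begin

lemma d_pos: "1 \<le> d"
 using card_gt_0_iff[of \<Gamma>] fin one card by auto

lemma right_mult:
 assumes h: "h \<in> \<Gamma>"
 shows "\<exists>\<pi> \<mu>. bij_betw \<pi> \<Gamma> \<Gamma> & (\<forall>g\<in>\<Gamma>. \<mu> g ~= 0 & mm g h = smul (\<mu> g) (\<pi> g))"
proof -
 have "\<forall>g\<in>\<Gamma>. \<exists>kt. fst kt \<in> \<Gamma> & snd kt ~= 0 & mm g h = smul (snd kt) (fst kt)"
 proof
  fix g assume "g \<in> \<Gamma>"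
  from mult[OF this h] obtain k t where "k \<in> \<Gamma>" "t ~= 0" "mm g h = smul t k" by blast
  thus "\<exists>kt. fst kt \<in> \<Gamma> & snd kt ~= 0 & mm g h = smul (snd kt) (fst kt)"
   by (intro exI[of _ "(k, t)"]) simp
 qed
 from bchoice[OF this] obtain f where
  f: "\<forall>g\<in>\<Gamma>. fst (f g) \<in> \<Gamma> & snd (f g) ~= 0 & mm g h = smul (snd (f g)) (fst (f g))" ..
 have inj: "inj_on (%g. fst (f g)) \<Gamma>"
 proof (rule inj_onI)
  fix g g' assume g: "g \<in> \<Gamma>" "g' \<in> \<Gamma>" "fst (f g) = fst (f g')"
  let ?s = "snd (f g) / snd (f g')"
  have "mm g h = smul ?s (mm g' h)" using f g by (simp add: smul_smul)
  hence "mm (mm g h) (adj h) = smul ?s (mm (mm g' h) (adj h))" by (simp add: mm_smul)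
  hence "smul (disc h) g = smul (?s * disc h) g'" by (simp add: mm_assoc mm_adj mm_smul mm_one smul_smul del: smul.simps)
  hence "smul (1 / disc h) (smul (disc h) g) = smul (1 / disc h) (smul (?s * disc h) g')" by simp
  hence "g = smul ?s g'" using disc[OF h] by (simp add: smul_smul smul_1)
  thus "g = g'" using unique[OF g(2,1)] by metis
 qed
 have "bij_betw (%g. fst (f g)) \<Gamma> \<Gamma>"
  unfolding bij_betw_def using inj endo_inj_surj[OF fin _ inj] f by blast
 thus ?thesis using f by (intro exI[of _ "%g. fst (f g)"] exI[of _ "%g. snd (f g)"]) simp
qed

lemma inverse_exists:
 assumes h: "h \<in> \<Gamma>"
 shows "\<exists>k\<in>\<Gamma>. \<exists>t. t ~= 0 & mm k h = smul t one_mob & mm h k = smul t one_mob"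
proof -
 obtain \<pi> \<mu> where b: "bij_betw \<pi> \<Gamma> \<Gamma>" and c: "\<forall>g\<in>\<Gamma>. \<mu> g ~= 0 & mm g h = smul (\<mu> g) (\<pi> g)"
  using right_mult[OF h] by blast
 obtain k where k: "k \<in> \<Gamma>" "\<pi> k = one_mob" using one b unfolding bij_betw_def by (metis imageE)
 have e: "mm k h = smul (\<mu> k) one_mob" "\<mu> k ~= 0" using c k by auto
 have "mm (mm k h) (adj h) = smul (\<mu> k) (adj h)" unfolding e(1) by (simp add: mm_smul mm_one del: smul.simps adj.simps)
 hence "smul (disc h) k = smul (\<mu> k) (adj h)" by (simp add: mm_assoc mm_adj mm_smul mm_one del: smul.simps adj.simps)
 hence "mm h (smul (disc h) k) = mm h (smul (\<mu> k) (adj h))" by simp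
 hence "smul (1 / disc h) (smul (disc h) (mm h k)) = smul (1 / disc h) (smul (\<mu> k) (smul (disc h) one_mob))"
  by (simp add: mm_smul mm_adj del: smul.simps)
 hence "mm h k = smul (\<mu> k) one_mob" using disc[OF h] by (simp add: smul_smul smul_1 del: smul.simps)
 thus ?thesis using k(1) e by blast
qed

subsection \<open>A pencil of binary forms permuted by the group\<close>

text \<open>
  The parameter \<open>\<beta>\<close> is a point outside the orbit of 0. Then \<open>A\<close>,
 vanishing on the orbit of \<open>0\<close> under inverses, and \<open>B\<close>, doing so for
 \<open>\<beta>\<close>, have no common zero.
\<close>

lemma base_point:
 "\<exists>\<beta>. \<forall>g\<in>\<Gamma>. \<forall>h\<in>\<Gamma>. \<forall>x z. num g x z = 0 --> num h x z = \<beta> * den h x z --> x = 0 & z = 0"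
proof -
 define bad where "bad = (%(g, h). num h (fst (snd g)) (- fst g) / den h (fst (snd g)) (- fst g)) ` (\<Gamma> \<times> \<Gamma>)"
 have "finite bad" using fin by (simp add: bad_def)
 then obtain \<beta> where b: "\<beta> \<notin> bad" using ex_new_if_finite[OF infinite_UNIV_char_0] by blast
 show ?thesis
 proof (intro exI[of _ \<beta>] ballI allI impI)
  fix g h x z assume gh: "g \<in> \<Gamma>" "h \<in> \<Gamma>" and n: "num g x z = 0" "num h x z = \<beta> * den h x z"
  obtain a b c e where g: "g = (a, b, c, e)" by (cases g)
  have ab: "a ~= 0 \<or> b ~= 0" using disc[OF gh(1)] by (auto simp: g)
  show "x = 0 & z = 0"
  proof (rule ccontr)
   assume nz: "\<not> (x = 0 & z = 0)"
   have "\<exists>t. x = t * b & z = t * (- a)"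
   proof (cases "b = 0")
    case True
    thus ?thesis using n(1) ab by (intro exI[of _ "- z / a"]) (auto simp: g)
   next
    case False
    thus ?thesis using n(1) by (intro exI[of _ "x / b"]) (auto simp: g field_simps add_eq_0_iff)
   qed
   then obtain t where t: "x = t * b" "z = t * (- a)" by blast
   hence t0: "t ~= 0" using nz by auto
   have e: "num h b (- a) = \<beta> * den h b (- a)"
    using n(2) t0 unfolding t num_hom den_hom by simp
   show False
   proof (cases "den h b (- a) = 0")
    case True
    hence "b = 0 & - a = 0" using num_den_zero[OF disc[OF gh(2)] _ True] e unfolding True mult_zero_right by blast
    thus False using ab by simp
   next
    case False
    hence "\<beta> = num h b (- a) / den h b (- a)" using e by simp
    moreover have "num h b (- a) / den h b (- a) \<in> bad"
     unfolding bad_def using gh by (auto intro!: image_eqI[of _ _ "(g, h)"] simp: g)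
    ultimately show False using b by simp
   qed
  qed
 qed
qed

definition \<beta> :: complex where
 "\<beta> = (SOME \<beta>. \<forall>g\<in>\<Gamma>. \<forall>h\<in>\<Gamma>. \<forall>x z. num g x z = 0 --> num h x z = \<beta> * den h x z --> x = 0 & z = 0)"

lemma \<beta>: "g \<in> \<Gamma> ==> h \<in> \<Gamma> ==> num g x z = 0 ==> num h x z = \<beta> * den h x z ==> x = 0 & z = 0"
 using someI_ex[OF base_point] unfolding \<beta>_def by blast

definition A :: "complex => complex => complex" where "A x z = (\<Prod>g\<in>\<Gamma>. num g x z)"
definition B :: "complex => complex => complex" where "B x z = (\<Prod>g\<in>\<Gamma>. num g x z - \<beta> * den g x z)"

lemma no_common_zero: "A x z = 0 ==> B x z = 0 ==> x = 0 & z = 0"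
proof -
 assume "A x z = 0" "B x z = 0"
 then obtain g h where "g \<in> \<Gamma>" "num g x z = 0" "h \<in> \<Gamma>" "num h x z - \<beta> * den h x z = 0"
  using prod_zero_iff[OF fin, of "%g. num g x z"] prod_zero_iff[OF fin, of "%g. num g x z - \<beta> * den g x z"]
  unfolding A_def B_def by blast
 thus ?thesis using \<beta>[of g h x z] by simp
qed

lemma A_hom: "A (t * x) (t * z) = t ^ d * A x z" and B_hom: "B (t * x) (t * z) = t ^ d * B x z"
proof -
 have "num g (t * x) (t * z) - \<beta> * den g (t * x) (t * z) = t * (num g x z - \<beta> * den g x z)" for g
  by (simp add: num_hom den_hom algebra_simps)
 thus "A (t * x) (t * z) = t ^ d * A x z" "B (t * x) (t * z) = t ^ d * B x z"
  by (simp_all add: A_def B_def num_hom prod.distrib card)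
qed

lemma semi_invariant:
 assumes h: "h \<in> \<Gamma>"
 shows "\<exists>\<mu>. \<mu> ~= 0 & (\<forall>x z. A (num h x z) (den h x z) = \<mu> * A x z & B (num h x z) (den h x z) = \<mu> * B x z)"
proof -
 obtain \<pi> \<mu> where b: "bij_betw \<pi> \<Gamma> \<Gamma>" and c: "\<forall>g\<in>\<Gamma>. \<mu> g ~= 0 & mm g h = smul (\<mu> g) (\<pi> g)"
  using right_mult[OF h] by blast
 have n: "num g (num h x z) (den h x z) = \<mu> g * num (\<pi> g) x z" "den g (num h x z) (den h x z) = \<mu> g * den (\<pi> g) x z"
  if "g \<in> \<Gamma>" for g x z
  using c that num_mm[of g h x z] den_mm[of g h x z] by (simp_all add: num_smul den_smul)
 have "A (num h x z) (den h x z) = (\<Prod>g\<in>\<Gamma>. \<mu> g) * A x z" for x z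
  unfolding A_def prod.reindex_bij_betw[OF b, of "%g. num g x z", symmetric]
  by (subst prod.distrib[symmetric]) (simp add: n)
 moreover have "B (num h x z) (den h x z) = (\<Prod>g\<in>\<Gamma>. \<mu> g) * B x z" for x z
  unfolding B_def prod.reindex_bij_betw[OF b, of "%g. num g x z - \<beta> * den g x z", symmetric]
  by (subst prod.distrib[symmetric]) (simp add: n algebra_simps)
 moreover have "(\<Prod>g\<in>\<Gamma>. \<mu> g) ~= 0" using c fin by simp
 ultimately show ?thesis by blast
qed

subsection \<open>The form\<close>

definition lin :: "complex => complex => cpol" where
 "lin a b = mconst a * mvar 1 + mconst b * mvar 3"

lemma ev_lin: "ev v (lin a b) = a * v 1 + b * v 3" and homogeneous_lin: "homogeneous 1 (lin a b)"
 unfolding lin_def by (simp, intro homogeneous_add homogeneous_mconst_mult homogeneous_mvar)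

definition numP :: "mob => cpol" where "numP g = lin (num g 1 0) (num g 0 1)"
definition denP :: "mob => cpol" where "denP g = lin (den g 1 0) (den g 0 1)"
definition AP :: cpol where "AP = (\<Prod>g\<in>\<Gamma>. numP g)"
definition BP :: cpol where "BP = (\<Prod>g\<in>\<Gamma>. numP g - mconst \<beta> * denP g)"

lemma ev_numP: "ev v (numP g) = num g (v 1) (v 3)" and ev_denP: "ev v (denP g) = den g (v 1) (v 3)"
 by (cases g; simp add: numP_def denP_def ev_lin)+

lemma ev_AP: "ev v AP = A (v 1) (v 3)" and ev_BP: "ev v BP = B (v 1) (v 3)"
 by (simp_all add: AP_def BP_def A_def B_def comm_ring_hom_prod[OF ev_hom] ev_numP ev_denP)

lemma homogeneous_AP: "homogeneous d AP" and homogeneous_BP: "homogeneous d BP"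
proof -
 have "homogeneous (\<Sum>g\<in>\<Gamma>. 1) AP" "homogeneous (\<Sum>g\<in>\<Gamma>. 1) BP"
  unfolding AP_def BP_def numP_def denP_def
  by (intro homogeneous_prod homogeneous_diff homogeneous_mconst_mult homogeneous_lin)+
 thus "homogeneous d AP" "homogeneous d BP" by (simp_all add: card)
qed

lemma denP_nonzero: "g \<in> \<Gamma> ==> denP g ~= 0"
proof
 assume g: "g \<in> \<Gamma>" and z: "denP g = 0"
 have "den g x y = 0" for x y using ev_denP[of "vec3 x 0 y" g] z by simp
 from this[of 1 0] this[of 0 1] disc[OF g] show False by (cases g) simp
qed

lemma BP_nonzero: "BP ~= 0"
proof -
 have "numP g - mconst \<beta> * denP g ~= 0" if g: "g \<in> \<Gamma>" for g
 proof
  assume z: "numP g - mconst \<beta> * denP g = 0"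
  have "num g x y - \<beta> * den g x y = 0" for x y
   using arg_cong[OF z, of "ev (vec3 x 0 y)"] by (simp add: ev_numP ev_denP)
  from this[of 1 0] this[of 0 1] disc[OF g] show False by (cases g) (simp add: algebra_simps)
 qed
 thus ?thesis using fin by (simp add: BP_def)
qed

text \<open>
  The form of the equation \<open>dy = r(x) dx\<close> with \<open>r = A/B\<close>, so that
 \<open>p = r(x)\<close> and \<open>q = y - x r(x)\<close>.
\<close>

definition \<omega> :: form where
 "\<omega> = (\<chi> i. vec3 (- (mvar 3 * AP)) (mvar 3 * BP) (mvar 1 * AP - mvar 2 * BP) i)"

lemma \<omega>_simps: "\<omega> $ 1 = - (mvar 3 * AP)" "\<omega> $ 2 = mvar 3 * BP" "\<omega> $ 3 = mvar 1 * AP - mvar 2 * BP"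
 by (simp_all add: \<omega>_def)

lemma \<omega>_forms: "\<omega> \<in> forms d"
 unfolding forms_def mem_Collect_eq
proof (intro conjI allI)
 fix i :: 3
 have "homogeneous (1 + d) (mvar k * P)" if "homogeneous d P" for k and P :: cpol
  by (rule homogeneous_mult[OF homogeneous_mvar that])
 thus "homogeneous (d + 1) (\<omega> $ i)"
  using exhaust_3[of i] homogeneous_AP homogeneous_BP
  by (auto simp: \<omega>_simps add.commute intro!: homogeneous_uminus homogeneous_diff)
 show "(\<Sum>i\<in>UNIV. \<omega> $ i * mvar i) = 0"
  by (simp add: sum_3 \<omega>_simps algebra_simps)
qed

text \<open>
  A common factor \<open>e\<close> has no zeros off the line at infinity, where \<open>A\<close>
 and \<open>B\<close> would vanish together, nor at a suitable point of this line. Being constant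
 along lines without zeros, it is constant.
\<close>

lemma \<omega>_no_common_factor: "no_common_factor \<omega>"
 unfolding no_common_factor_def
proof (intro allI impI)
 fix e assume dvd: "\<forall>i. e dvd \<omega> $ i"
 have zero: "ev v (\<omega> $ i) = 0" if "ev v e = 0" for v i
 proof -
  obtain k where "\<omega> $ i = e * k" using dvd unfolding dvd_def by blast
  thus ?thesis using that by simp
 qed
 have nz: "ev v e ~= 0" if "v 3 ~= 0" for v
 proof
  assume "ev v e = 0"
  from zero[OF this, of 1] zero[OF this, of 2] have "A (v 1) (v 3) = 0" "B (v 1) (v 3) = 0"
   using that by (simp_all add: \<omega>_simps ev_AP ev_BP)
  with no_common_zero that show False by blast
 qed
 have "\<exists>x y. x * A x 0 - y * B x 0 ~= 0"
 proof (cases "B 1 0 = 0")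
  case True
  hence "A 1 0 ~= 0" using no_common_zero[of 1 0] by auto
  thus ?thesis by (intro exI[of _ 1] exI[of _ 0]) simp
 next
  case False
  thus ?thesis by (intro exI[of _ 1] exI[of _ "(A 1 0 - 1) / B 1 0"]) simp
 qed
 then obtain x0 y0 where xy: "x0 * A x0 0 - y0 * B x0 0 ~= 0" by blast
 have inf: "ev (vec3 x0 y0 0) e ~= 0"
  using zero[of "vec3 x0 y0 0" 3] xy by (auto simp: \<omega>_simps ev_AP ev_BP)
 have const: "ev (vec3 x y z) e = ev (vec3 x0 y0 z) e" if "z ~= 0" for x y z
 proof -
  have "ev (%i. vec3 x0 y0 z i + 1 * vec3 (x - x0) (y - y0) 0 i) e = ev (vec3 x0 y0 z) e"
   by (rule constant_on_line) (use that nz in simp)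
  moreover have "(%i. vec3 x0 y0 z i + 1 * vec3 (x - x0) (y - y0) 0 i) = vec3 x y z"
   by (rule ext) (metis (no_types, lifting) exhaust_3 vec3_simps add_diff_cancel_left' add.right_neutral diff_add_cancel add.commute mult_1)
  ultimately show ?thesis by simp
 qed
 have vert: "ev (vec3 x0 y0 z) e = ev (vec3 x0 y0 0) e" for z
 proof -
  have v: "(%i. vec3 x0 y0 0 i + t * vec3 0 0 1 i) = vec3 x0 y0 t" for t
  proof
   fix i :: 3 show "vec3 x0 y0 0 i + t * vec3 0 0 1 i = vec3 x0 y0 t i" using exhaust_3[of i] by auto
  qed
  have "ev (vec3 x0 y0 t) e ~= 0" for t using nz[of "vec3 x0 y0 t"] inf by (cases "t = 0") auto
  thus ?thesis using constant_on_line[of "vec3 x0 y0 0" "vec3 0 0 1" e z] unfolding v by blast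
 qed
 define \<kappa> where "\<kappa> = ev (vec3 x0 y0 0) e"
 have "mvar 3 * (e - mconst \<kappa>) = 0"
 proof (rule ev_zero_imp_zero)
  fix v
  have "ev v e = \<kappa>" if "v 3 ~= 0"
   using const[OF that, of "v 1" "v 2"] vert[of "v 3"] unfolding vec3_eta \<kappa>_def by simp
  thus "ev v (mvar 3 * (e - mconst \<kappa>)) = 0" by auto
 qed
 hence e: "e = mconst \<kappa>" using mvar_neq_0[of 3] by simp
 have "mconst \<kappa> * mconst (1 / \<kappa>) = (1 :: cpol)"
  using inf by (simp flip: comm_ring_homD(4)[OF comm_ring_hom_mconst] add: \<kappa>_def)
 thus "e dvd 1" unfolding e by (metis dvd_triv_left)
qed

end

context moebius_group
begin

subsection \<open>The group acts on the function field\<close>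

definition r_elt :: "cpol fract" where "r_elt = Fract AP BP"
definition mx :: "mob => cpol fract" where "mx g = Fract (numP g) (denP g)"
text \<open>
  Together with \<open>x \<mapsto> g x\<close> this preserves \<open>r\<close> and \<open>q = y -
 x r\<close>, hence the whole field \<open>K\<close>.
\<close>

definition my :: "mob => cpol fract" where "my g = y_elt + (mx g - x_elt) * r_elt"

abbreviation "K \<equiv> gauss_subfield \<omega>"
abbreviation "G \<equiv> field_automorphisms_over K LL"

definition ok :: "complex \<times> complex => bool" where
 "ok X \<longleftrightarrow> B (fst X) 1 ~= 0 & (\<forall>g\<in>\<Gamma>. den g (fst X) 1 ~= 0)"

definition mv :: "mob => complex => complex" where "mv g x = num g x 1 / den g x 1"
definition rv :: "complex => complex" where "rv x = A x 1 / B x 1"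

lemma generic_ok: "\<forall>\<^sub>F X in gen. ok X"
proof -
 have "\<forall>\<^sub>F X in gen. B (fst X) 1 ~= 0"
  using gen_ev_nonzero[OF homogeneous_BP BP_nonzero] by (simp add: ev_BP pt_def)
 moreover have "\<forall>\<^sub>F X in gen. den g (fst X) 1 ~= 0" if "g \<in> \<Gamma>" for g
  using gen_ev_nonzero[OF homogeneous_lin denP_nonzero[OF that, unfolded denP_def]]
  by (simp add: denP_def[symmetric] ev_denP pt_def)
 hence "\<forall>\<^sub>F X in gen. \<forall>g\<in>\<Gamma>. den g (fst X) 1 ~= 0"
  by (intro eventually_ball_finite fin) blast
 ultimately show ?thesis by eventually_elim (simp add: ok_def)
qed

lemma r_elt_in: "r_elt \<in> LL"
 unfolding r_elt_def by (rule LL_I[OF homogeneous_AP homogeneous_BP BP_nonzero])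

lemma mx_in: "g \<in> \<Gamma> ==> mx g \<in> LL"
 unfolding mx_def using denP_nonzero by (intro LL_I[of 1]) (auto simp: numP_def denP_def intro: homogeneous_lin[unfolded One_nat_def])

lemma my_in: "g \<in> \<Gamma> ==> my g \<in> LL"
 unfolding my_def by (intro is_subfieldD(3,4,7)[OF sub_LL] y_elt_in x_elt_in r_elt_in mx_in)

lemma fval_r_elt: "B (fst X) 1 ~= 0 ==> fdef r_elt X & fval r_elt X = rv (fst X)"
 by (simp add: r_elt_def fdef_Fract fval_Fract ev_AP ev_BP rv_def pt_def)

lemma fval_mx: "den g (fst X) 1 ~= 0 ==> fdef (mx g) X & fval (mx g) X = mv g (fst X)"
 by (simp add: mx_def fdef_Fract fval_Fract ev_numP ev_denP mv_def pt_def)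

lemma fval_my:
 assumes "den g (fst X) 1 ~= 0" "B (fst X) 1 ~= 0"
 shows "fdef (my g) X & fval (my g) X = snd X + (mv g (fst X) - fst X) * rv (fst X)"
proof -
 have "fdef (mx g - x_elt) X & fval (mx g - x_elt) X = mv g (fst X) - fst X"
  using fval_diff[of "mx g" X x_elt] fval_mx[OF assms(1)] fval_x_elt[of X] by simp
 hence "fdef ((mx g - x_elt) * r_elt) X & fval ((mx g - x_elt) * r_elt) X = (mv g (fst X) - fst X) * rv (fst X)"
  using fval_mult[of "mx g - x_elt" X r_elt] fval_r_elt[OF assms(2)] by simp
 thus ?thesis unfolding my_def using fval_add[of y_elt X "(mx g - x_elt) * r_elt"] fval_y_elt[of X] by simp
qed

text \<open>The function \<open>r = A/B\<close> is invariant, because \<open>A\<close> and \<open>B\<close> are multiplied by the same constant.\<close>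

lemma values_transformed:
 assumes g: "g \<in> \<Gamma>" and D: "den g x 1 ~= 0"
 shows "\<exists>\<kappa>. \<kappa> ~= 0 & A (mv g x) 1 = \<kappa> * A x 1 & B (mv g x) 1 = \<kappa> * B x 1"
proof -
 obtain \<mu> where m: "\<mu> ~= 0" "!!x z. A (num g x z) (den g x z) = \<mu> * A x z" "!!x z. B (num g x z) (den g x z) = \<mu> * B x z"
  using semi_invariant[OF g] by blast
 have e: "num g x 1 = den g x 1 * mv g x" using D by (simp add: mv_def)
 have "\<mu> * A x 1 = den g x 1 ^ d * A (mv g x) 1" "\<mu> * B x 1 = den g x 1 ^ d * B (mv g x) 1"
  using m(2)[of x 1] m(3)[of x 1] A_hom[of "den g x 1" "mv g x" 1] B_hom[of "den g x 1" "mv g x" 1] by (simp_all add: e)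
 hence "A (mv g x) 1 = (\<mu> / den g x 1 ^ d) * A x 1" "B (mv g x) 1 = (\<mu> / den g x 1 ^ d) * B x 1"
  using D by (simp_all add: field_simps)
 thus ?thesis using m(1) D by (intro exI[of _ "\<mu> / den g x 1 ^ d"]) simp
qed

lemma rv_invariant: "g \<in> \<Gamma> ==> den g x 1 ~= 0 ==> rv (mv g x) = rv x"
 using values_transformed[of g x] by (auto simp: rv_def)

lemma mv_mm:
 assumes "den h x 1 ~= 0" "mm g h = smul t k" "t ~= 0"
 shows "mv g (mv h x) = mv k x"
proof -
 have e: "num h x 1 = den h x 1 * mv h x" using assms(1) by (simp add: mv_def)
 have "num g (num h x 1) (den h x 1) = den h x 1 * num g (mv h x) 1"
  "den g (num h x 1) (den h x 1) = den h x 1 * den g (mv h x) 1"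
  using num_hom[of g "den h x 1" "mv h x" 1] den_hom[of g "den h x 1" "mv h x" 1] by (simp_all add: e)
 hence "den h x 1 * num g (mv h x) 1 = t * num k x 1" "den h x 1 * den g (mv h x) 1 = t * den k x 1"
  using num_mm[of g h x 1] den_mm[of g h x 1] unfolding assms(2) num_smul den_smul by simp_all
 hence "num g (mv h x) 1 = (t / den h x 1) * num k x 1" "den g (mv h x) 1 = (t / den h x 1) * den k x 1"
  using assms(1) by (simp_all add: field_simps)
 thus ?thesis using assms(1,3) by (simp add: mv_def[of g] mv_def[of k])
qed

lemma plane_map: 
 assumes g: "g \<in> \<Gamma>"
 shows "plane_map (mx g) (my g)"
proof
 show "mx g \<in> LL" "my g \<in> LL" by (rule mx_in[OF g] my_in[OF g])+
 obtain k t where k: "k \<in> \<Gamma>" "t ~= 0" "mm g k = smul t one_mob" "mm k g = smul t one_mob" using inverse_exists[OF g] by blast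
 show "\<forall>\<^sub>F Y in gen. \<exists>X. fdef (mx g) X & fdef (my g) X & (fval (mx g) X, fval (my g) X) = Y"
  using generic_ok
 proof eventually_elim
  case (elim Y)
  have D: "den k (fst Y) 1 ~= 0" and b: "B (fst Y) 1 ~= 0" using elim k(1) by (auto simp: ok_def)
  define x where "x = mv k (fst Y)"
  have x: "mv g x = fst Y" using mv_mm[OF D k(3,2)] by (simp add: x_def mv_def)
  have bx: "B x 1 ~= 0" using values_transformed[OF k(1) D] b by (auto simp: x_def)
  have "den g (num k (fst Y) 1) (den k (fst Y) 1) = t"
   using den_mm[of g k "fst Y" 1] by (simp add: k(3))
  hence "den k (fst Y) 1 * den g x 1 = t"
   using den_hom[of g "den k (fst Y) 1" x 1] D by (simp add: x_def mv_def)
  hence dx: "den g x 1 ~= 0" using k(2) by auto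
  let ?X = "(x, snd Y - (fst Y - x) * rv x)"
  have "fdef (mx g) ?X & fval (mx g) ?X = fst Y" using fval_mx[of g ?X] dx x by simp
  moreover have "fdef (my g) ?X & fval (my g) ?X = snd Y" using fval_my[of g ?X] dx bx x by simp
  ultimately show ?case by (intro exI[of _ ?X]) simp
 qed
qed

abbreviation "T g \<equiv> plane_map.T (mx g) (my g)"
abbreviation "pull g \<equiv> plane_map.pull (mx g) (my g)"

lemma T_ok:
 assumes "g \<in> \<Gamma>" "ok X"
 shows "T g X = (mv g (fst X), snd X + (mv g (fst X) - fst X) * rv (fst X))"
 using fval_mx[of g X] fval_my[of g X] assms by (simp add: plane_map.T_def[OF plane_map[OF assms(1)]] ok_def)

lemma T_T:
 assumes gh: "g \<in> \<Gamma>" "h \<in> \<Gamma>" "k \<in> \<Gamma>" "t ~= 0" "mm g h = smul t k"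
 shows "\<forall>\<^sub>F X in gen. T g (T h X) = T k X"
 using generic_ok plane_map.generic_image[OF plane_map[OF gh(2)] generic_ok]
proof eventually_elim
 case (elim X)
 have D: "den h (fst X) 1 ~= 0" using elim(1) gh(2) by (auto simp: ok_def)
 show ?case
  using mv_mm[OF D gh(5,4)] rv_invariant[OF gh(2) D] T_ok[OF gh(1) elim(2)]
  unfolding T_ok[OF gh(2) elim(1)] T_ok[OF gh(3) elim(1)] by (simp add: algebra_simps)
qed

lemma mv_one: "mv one_mob x = x" by (simp add: mv_def)

lemma T_one: "\<forall>\<^sub>F X in gen. T one_mob X = X"
 using generic_ok by eventually_elim (simp add: T_ok[OF one] mv_one)

lemma pull_mm:
 assumes "g \<in> \<Gamma>" "h \<in> \<Gamma>" "k \<in> \<Gamma>" "t ~= 0" "mm g h = smul t k" "f \<in> LL"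
 shows "pull h (pull g f) = pull k f"
 by (rule pull_pull[OF plane_map[OF assms(2)] plane_map[OF assms(1)] plane_map[OF assms(3)] assms(6) T_T[OF assms(1-5)]])

lemma pull_one: "f \<in> LL ==> pull one_mob f = f"
 by (rule plane_map.pull_eqI[OF plane_map[OF one]]) (use T_one in \<open>auto elim: eventually_mono\<close>)

lemma pull_fixes_K:
 assumes g: "g \<in> \<Gamma>" and f: "f \<in> K"
 shows "pull g f = f"
proof -
 have fL: "f \<in> LL" using f gauss_subset_LL[OF \<omega>_forms] by blast
 obtain P Q m where k: "f = Fract (compose_form P \<omega>) (compose_form Q \<omega>)" "homogeneous m P" "homogeneous m Q" "compose_form Q \<omega> ~= 0"
  using f by (rule gauss_E)
 have hom: "homogeneous (m * (d + 1)) (compose_form Q \<omega>)"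
  unfolding compose_form_def by (rule homogeneous_compose[OF k(3) forms_homogeneous[OF \<omega>_forms]])
 have nz: "\<forall>\<^sub>F X in gen. ev (pt X) (compose_form Q \<omega>) ~= 0" by (rule gen_ev_nonzero[OF hom k(4)])
 show ?thesis
 proof (rule plane_map.pull_eqI[OF plane_map[OF g] fL fL])
  show "\<forall>\<^sub>F X in gen. fval f (T g X) = fval f X"
   using generic_ok nz
  proof eventually_elim
   case (elim X)
   have D: "den g (fst X) 1 ~= 0" and b: "B (fst X) 1 ~= 0" using elim(1) g by (auto simp: ok_def)
   obtain \<kappa> where c: "\<kappa> ~= 0" "A (mv g (fst X)) 1 = \<kappa> * A (fst X) 1" "B (mv g (fst X)) 1 = \<kappa> * B (fst X) 1"
    using values_transformed[OF g D] by blast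
   have "(%i. ev (pt (T g X)) (\<omega> $ i)) = (%i. \<kappa> * ev (pt X) (\<omega> $ i))"
   proof
    fix i :: 3
    have "(snd X + (mv g (fst X) - fst X) * rv (fst X)) * B (fst X) 1 = snd X * B (fst X) 1 + (mv g (fst X) - fst X) * A (fst X) 1"
     using b by (simp add: rv_def field_simps)
    hence "mv g (fst X) * A (fst X) 1 - (snd X + (mv g (fst X) - fst X) * rv (fst X)) * B (fst X) 1 = fst X * A (fst X) 1 - snd X * B (fst X) 1"
     by (simp add: algebra_simps)
    from arg_cong[OF this, of "%t. \<kappa> * t"]
    show "ev (pt (T g X)) (\<omega> $ i) = \<kappa> * ev (pt X) (\<omega> $ i)"
     using exhaust_3[of i] by (auto simp: T_ok[OF g elim(1)] \<omega>_simps pt_def ev_AP ev_BP c algebra_simps)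
   qed
   hence e: "ev (pt (T g X)) (compose_form R \<omega>) = \<kappa> ^ m * ev (pt X) (compose_form R \<omega>)" if "homogeneous m R" for R
    unfolding ev_compose_form by (simp add: ev_homogeneous[OF that])
   show ?case
    unfolding k(1) using elim(2) c(1) by (simp add: fval_Fract e[OF k(2)] e[OF k(3)])
  qed
 qed
qed

lemma pull_in_G:
 assumes g: "g \<in> \<Gamma>"
 shows "pull g \<in> G"
proof -
 interpret m: plane_map "mx g" "my g" by (rule plane_map[OF g])
 obtain k t where k: "k \<in> \<Gamma>" "t ~= 0" "mm g k = smul t one_mob" "mm k g = smul t one_mob" using inverse_exists[OF g] by blast
 interpret mk: plane_map "mx k" "my k" by (rule plane_map[OF k(1)])
 have "bij_betw m.pull LL LL"
  by (rule bij_betw_byWitness[of _ mk.pull])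
   (use pull_mm[OF g k(1) one k(2,3)] pull_mm[OF k(1) g one k(2,4)] pull_one m.pull_in mk.pull_in in auto)
 thus ?thesis
  unfolding field_automorphisms_over_def using m.pull_add m.pull_mult pull_fixes_K[OF g] by blast
qed

lemma pull_x: "g \<in> \<Gamma> ==> pull g x_elt = mx g"
 by (rule plane_map.pull_x[OF plane_map])

lemma gen_quadratic:
 assumes "\<forall>\<^sub>F X in gen. \<alpha> + \<beta>' * fst X + \<gamma> * (fst X * fst X) = 0"
 shows "\<alpha> = 0 & \<beta>' = 0 & \<gamma> = 0"
proof -
 have "[:[:\<alpha>:], [:\<beta>':], [:\<gamma>:]:] = (0 :: cpoly2)"
  by (rule gen_ev2_eq_imp_eq) (use assms in \<open>simp add: algebra_simps\<close>)
 thus ?thesis by simp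
qed

lemma inj_mx: "inj_on mx \<Gamma>"
proof (rule inj_onI)
 fix g h assume gh: "g \<in> \<Gamma>" "h \<in> \<Gamma>" "mx g = mx h"
 obtain a b c e a' b' c' e' where g: "g = (a, b, c, e)" and h: "h = (a', b', c', e')" by (metis prod_cases4)
 have "\<forall>\<^sub>F X in gen. (b * e' - b' * e) + (a * e' + b * c' - a' * e - b' * c) * fst X + (a * c' - a' * c) * (fst X * fst X) = 0"
  using generic_ok
 proof eventually_elim
  case (elim X)
  have D: "den g (fst X) 1 ~= 0" "den h (fst X) 1 ~= 0" using elim gh by (auto simp: ok_def)
  have "mv g (fst X) = mv h (fst X)" using fval_mx[OF D(1)] fval_mx[OF D(2)] gh(3) by simp
  hence "num g (fst X) 1 * den h (fst X) 1 = num h (fst X) 1 * den g (fst X) 1"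
   using D by (simp add: mv_def frac_eq_eq)
  thus ?case by (simp add: g h algebra_simps)
 qed
 from gen_quadratic[OF this] have z: "b * e' = b' * e" "a * e' + b * c' = a' * e + b' * c" "a * c' = a' * c"
  by (auto simp: algebra_simps)
 have "mm (adj h) g = smul (e' * a - b' * c) one_mob" using z by (simp add: g h algebra_simps)
 hence "mm h (mm (adj h) g) = smul (e' * a - b' * c) h" by (simp add: mm_smul mm_one del: smul.simps adj.simps)
 hence "smul (disc h) g = smul (e' * a - b' * c) h"
  unfolding mm_assoc[symmetric] mm_adj by (simp add: mm_smul mm_one del: smul.simps)
 hence "smul (1 / disc h) (smul (disc h) g) = smul (1 / disc h) (smul (e' * a - b' * c) h)" by simp
 hence "g = smul ((e' * a - b' * c) / disc h) h" using disc[OF gh(2)] by (simp add: smul_smul smul_1 del: smul.simps disc.simps)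
 thus "g = h" using unique[OF gh(2,1)] by metis
qed

subsection \<open>The function field is Galois over the image of the Gauss map\<close>

text \<open>
  The polynomial \<open>A(T) - r B(T)\<close> over \<open>K\<close>, whose roots are the
 \<open>d\<close> transforms \<open>g x\<close>.
\<close>

definition M :: "cpol fract poly" where
 "M = (\<Prod>g\<in>\<Gamma>. [:cst (num g 0 1), cst (num g 1 0):]) -
   smult r_elt (\<Prod>g\<in>\<Gamma>. [:cst (num g 0 1 - \<beta> * den g 0 1), cst (num g 1 0 - \<beta> * den g 1 0):])"

lemma \<omega>2_nonzero: "\<omega> $ 2 ~= 0"
 using BP_nonzero mvar_neq_0[of 3] by (simp add: \<omega>_simps)

lemma ratio_in_K: "Fract (- (\<omega> $ i)) (\<omega> $ 2) \<in> K"
proof -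
 have c: "compose_form (mvar i) \<omega> = \<omega> $ i" for i
  unfolding compose_form_def by (rule mpol_eval_mvar[OF comm_ring_hom_mconst])
 have m: "compose_form (- mvar i) \<omega> = - \<omega> $ i"
  by (rule ev_eqI) (simp add: ev_compose_form)
 show ?thesis
  using gauss_I[OF homogeneous_uminus[OF homogeneous_mvar[of i]] homogeneous_mvar[of 2], of \<omega>] \<omega>2_nonzero by (simp add: c m)
qed

lemma r_elt_in_K: "r_elt \<in> K"
proof -
 have "Fract (- (\<omega> $ 1)) (\<omega> $ 2) = r_elt"
  using BP_nonzero mvar_neq_0[of 3] by (simp add: r_elt_def \<omega>_simps mult_fract_cancel)
 thus ?thesis using ratio_in_K[of 1] by simp
qed

lemma y_elt_eq: "\<exists>q\<in>K. y_elt = q + r_elt * x_elt"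
proof (rule bexI[OF _ ratio_in_K[of 3]])
 have q: "Fract (- (\<omega> $ 3)) (\<omega> $ 2) \<in> LL" using ratio_in_K gauss_subset_LL[OF \<omega>_forms] by blast
 show "y_elt = Fract (- (\<omega> $ 3)) (\<omega> $ 2) + r_elt * x_elt"
 proof (rule LL_eqI[OF y_elt_in])
  show "Fract (- (\<omega> $ 3)) (\<omega> $ 2) + r_elt * x_elt \<in> LL"
   by (intro is_subfieldD(3,4)[OF sub_LL] q r_elt_in x_elt_in)
  show "\<forall>\<^sub>F X in gen. fval y_elt X = fval (Fract (- (\<omega> $ 3)) (\<omega> $ 2) + r_elt * x_elt) X"
   using generic_ok
  proof eventually_elim
   case (elim X)
   have b: "B (fst X) 1 ~= 0" using elim by (simp add: ok_def)
   have "fdef (Fract (- (\<omega> $ 3)) (\<omega> $ 2)) X & fval (Fract (- (\<omega> $ 3)) (\<omega> $ 2)) X = snd X - fst X * rv (fst X)"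
    using b by (simp add: fdef_Fract fval_Fract \<omega>_simps ev_AP ev_BP pt_def rv_def field_simps)
   moreover have "fdef (r_elt * x_elt) X & fval (r_elt * x_elt) X = rv (fst X) * fst X"
    using fval_mult[of r_elt X x_elt] fval_r_elt[OF b] fval_x_elt[of X] by simp
   ultimately show ?case
    using fval_add[of "Fract (- (\<omega> $ 3)) (\<omega> $ 2)" X "r_elt * x_elt"] fval_y_elt[of X] by simp
  qed
 qed
qed

lemma M_over: "over K M"
 unfolding M_def
 by (intro over_diff over_smult over_prod over_pCons over_0 subfield_gauss r_elt_in_K cst_in)

lemma fval_linear: "fdef f X ==> fdef (poly [:cst b, cst a:] f) X & fval (poly [:cst b, cst a:] f) X = a * fval f X + b"
 using fval_mult[of f X "cst a"] fval_add[of "cst b" X "f * cst a"] fval_cst[of a X] fval_cst[of b X] by simp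

lemma fval_M:
 assumes "fdef f X" "ok X"
 shows "fdef (poly M f) X & fval (poly M f) X = A (fval f X) 1 - rv (fst X) * B (fval f X) 1"
proof -
 have n: "num g 1 0 * x + num g 0 1 = num g x 1" "(num g 1 0 - \<beta> * den g 1 0) * x + (num g 0 1 - \<beta> * den g 0 1) = num g x 1 - \<beta> * den g x 1" for g x
  by (cases g; simp add: algebra_simps)+
 let ?u = "\<Prod>g\<in>\<Gamma>. poly [:cst (num g 0 1), cst (num g 1 0):] f"
 let ?v = "\<Prod>g\<in>\<Gamma>. poly [:cst (num g 0 1 - \<beta> * den g 0 1), cst (num g 1 0 - \<beta> * den g 1 0):] f"
 have u: "fdef ?u X & fval ?u X = A (fval f X) 1"
  using fval_prod[of \<Gamma> "%g. poly [:cst (num g 0 1), cst (num g 1 0):] f" X] fval_linear[OF assms(1)]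
  by (simp add: A_def n del: poly_pCons)
 have v: "fdef ?v X & fval ?v X = B (fval f X) 1"
  using fval_prod[of \<Gamma> "%g. poly [:cst (num g 0 1 - \<beta> * den g 0 1), cst (num g 1 0 - \<beta> * den g 1 0):] f" X] fval_linear[OF assms(1)]
  by (simp add: B_def n del: poly_pCons)
 have r: "fdef r_elt X & fval r_elt X = rv (fst X)" using fval_r_elt[of X] assms(2) by (simp add: ok_def)
 have "poly M f = ?u - r_elt * ?v" by (simp add: M_def poly_prod)
 thus ?thesis using fval_diff[of ?u X "r_elt * ?v"] fval_mult[of r_elt X ?v] u v r by simp
qed

lemma M_nonzero: "M ~= 0"
proof
 assume z: "M = 0"
 have b: "B \<beta> 1 = 0" unfolding B_def by (rule prod_zero[OF fin bexI[OF _ one]]) simp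
 have "\<forall>\<^sub>F X in gen. False"
  using generic_ok
 proof eventually_elim
  case (elim X)
  have "A \<beta> 1 = 0" using fval_M[of "cst \<beta>" X] elim fval_cst[of \<beta> X] fval_0[of X] b by (simp add: z)
  from no_common_zero[OF this b] show ?case by simp
 qed
 thus False by simp
qed

lemma M_root: "g \<in> \<Gamma> ==> poly M (mx g) = 0"
proof (rule LL_eqI)
 assume g: "g \<in> \<Gamma>"
 have "over LL M" using over_mono[OF gauss_subset_LL[OF \<omega>_forms] M_over] .
 thus "poly M (mx g) \<in> LL"
  unfolding poly_altdef over_def
  by (intro is_subfield_sum[OF sub_LL] is_subfieldD(4)[OF sub_LL] is_subfield_power[OF sub_LL] mx_in[OF g]) blast
 show "0 \<in> LL" by (rule LL_0)
 show "\<forall>\<^sub>F X in gen. fval (poly M (mx g)) X = fval 0 X"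
  using generic_ok
 proof eventually_elim
  case (elim X)
  have D: "den g (fst X) 1 ~= 0" and b: "B (fst X) 1 ~= 0" using elim g by (auto simp: ok_def)
  obtain \<kappa> where "A (mv g (fst X)) 1 = \<kappa> * A (fst X) 1" "B (mv g (fst X)) 1 = \<kappa> * B (fst X) 1"
   using values_transformed[OF g D] by blast
  thus ?case using fval_M[of "mx g" X] fval_mx[OF D] elim b fval_0[of X] by (simp add: rv_def)
 qed
qed

lemma card_mx: "card (mx ` \<Gamma>) = d"
 by (simp add: card_image inj_mx card)

lemma degree_M: "degree M = d"
proof (rule antisym)
 have "degree (\<Prod>g\<in>\<Gamma>. [:u g, v g:]) \<le> d" for u v :: "mob => cpol fract"
 proof -
  have "degree (\<Prod>g\<in>\<Gamma>. [:u g, v g:]) \<le> (\<Sum>g\<in>\<Gamma>. degree [:u g, v g:])" using degree_prod_sum_le[OF fin, of "%g. [:u g, v g:]"] unfolding o_def .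
  also have "\<dots> \<le> (\<Sum>g\<in>\<Gamma>. 1)" by (rule sum_mono) simp
  finally show ?thesis by (simp add: card)
 qed
 thus "degree M \<le> d" unfolding M_def by (intro degree_diff_le order_trans[OF degree_smult_le]) auto
 have "d \<le> card {f. poly M f = 0}"
  using card_mono[OF poly_roots_finite[OF M_nonzero], of "mx ` \<Gamma>"] M_root unfolding card_mx by blast
 thus "d \<le> degree M" using card_poly_roots_bound[OF M_nonzero] by linarith
qed

lemma M_roots: "poly M f = 0 ==> f \<in> mx ` \<Gamma>"
proof -
 assume "poly M f = 0"
 have fr: "finite {f. poly M f = 0}" by (rule poly_roots_finite[OF M_nonzero])
 have "mx ` \<Gamma> = {f. poly M f = 0}"
 proof (rule card_subset_eq[OF fr])
  show sub: "mx ` \<Gamma> \<subseteq> {f. poly M f = 0}" using M_root by blast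
  show "card (mx ` \<Gamma>) = card {f. poly M f = 0}"
   using card_mono[OF fr sub] card_poly_roots_bound[OF M_nonzero] unfolding card_mx degree_M by simp
 qed
 thus ?thesis using \<open>poly M f = 0\<close> by blast
qed

lemma K_LL: "K \<subseteq> LL" by (rule gauss_subset_LL[OF \<omega>_forms])

lemma mx_one: "mx one_mob = x_elt"
 using pull_x[OF one] pull_one[OF x_elt_in] by simp

lemma fixed_in_K:
 assumes f: "f \<in> LL" and fixed: "!!g. g \<in> \<Gamma> ==> pull g f = f"
 shows "f \<in> K"
proof -
 define V where "V = {poly P x_elt |P. over K P & degree P < d}"
 have Mx: "poly M x_elt = 0" using M_root[OF one] by (simp add: mx_one)
 note V = low_degree_closed[OF subfield_gauss d_pos M_over degree_M Mx, folded V_def]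
 obtain q where q: "q \<in> K" "y_elt = q + r_elt * x_elt" using y_elt_eq by blast
 obtain P Q where PQ: "eval_at x_elt y_elt Q ~= 0" "f = eval_at x_elt y_elt P / eval_at x_elt y_elt Q"
  using LL_quotient[OF f] by blast
 have "eval_at x_elt y_elt R \<in> V" for R
  by (rule eval_at_low_degree[OF subfield_gauss cst_in(1) V q(2) r_elt_in_K q(1)])
 then obtain p' q' where p: "eval_at x_elt y_elt P = poly p' x_elt" "over K p'" "degree p' < d"
  and q': "eval_at x_elt y_elt Q = poly q' x_elt" "over K q'" "degree q' < d"
  unfolding V_def by blast
 have inL: "poly q' x_elt \<in> LL" "poly p' x_elt \<in> LL"
  using p(1) q'(1) eval_at_in[OF sub_LL cst_in(2) x_elt_in y_elt_in] by metis+
 have e: "f * poly q' x_elt = poly p' x_elt" using PQ by (simp add: p(1) q'(1))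
 show ?thesis
 proof (rule fixed_quotient[OF subfield_gauss p(2) q'(2) p(3) q'(3) _ card_mx])
  show "q' ~= 0" using PQ(1) q'(1) by auto
  fix \<rho> assume "\<rho> \<in> mx ` \<Gamma>"
  then obtain g where g: "g \<in> \<Gamma>" "\<rho> = mx g" by blast
  note s = pull_in_G[OF g(1)]
  have "pull g f * pull g (poly q' x_elt) = pull g (poly p' x_elt)"
   using aut_simps(3)[OF s sub_LL f inL(1)] e by simp
  thus "f * poly q' \<rho> = poly p' \<rho>"
   using automorphism_poly_over[OF s sub_LL K_LL p(2) x_elt_in] automorphism_poly_over[OF s sub_LL K_LL q'(2) x_elt_in]
   by (simp add: fixed[OF g(1)] pull_x[OF g(1)] g(2))
 qed
qed

lemma algebraic:
 assumes f: "f \<in> LL"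
 shows "\<exists>p. p ~= 0 & (\<forall>j. coeff p j \<in> K) & poly p f = 0"
proof (intro exI conjI allI)
 let ?p = "\<Prod>g\<in>\<Gamma>. [:- pull g f, 1:]"
 have inL: "pull g f \<in> LL" if "g \<in> \<Gamma>" for g
  using plane_map.pull_in[OF plane_map[OF that] f] .
 have o: "over LL [:- pull g f, 1:]" if "g \<in> \<Gamma>" for g
  using inL[OF that] by (intro over_pCons over_0 sub_LL is_subfieldD[OF sub_LL])
 show "?p ~= 0" using fin by simp
 have "poly [:- pull one_mob f, 1:] f = 0" by (simp add: pull_one[OF f])
 thus "poly ?p f = 0" unfolding poly_prod using fin one by (intro prod_zero) blast+
 fix j
 show "coeff ?p j \<in> K"
 proof (rule fixed_in_K)
  have "over LL ?p" by (rule over_prod[OF sub_LL o])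
  thus "coeff ?p j \<in> LL" by (simp add: over_def)
  fix h assume h: "h \<in> \<Gamma>"
  note s = pull_in_G[OF h]
  obtain \<pi> \<mu> where b: "bij_betw \<pi> \<Gamma> \<Gamma>" and c: "\<forall>g\<in>\<Gamma>. \<mu> g ~= 0 & mm g h = smul (\<mu> g) (\<pi> g)"
   using right_mult[OF h] by blast
  have ph: "pull h (pull g f) = pull (\<pi> g) f" if "g \<in> \<Gamma>" for g
   using pull_mm[OF that h _ _ _ f, of "\<pi> g" "\<mu> g"] c b that by (auto simp: bij_betw_def)
  have neg: "pull h (- u) = - pull h u" if "u \<in> LL" for u
   using aut_simps(2)[OF s sub_LL that is_subfieldD(5)[OF sub_LL that]] aut_simps(6)[OF s sub_LL]
   by (simp add: add_eq_0_iff)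
  have "pull h (coeff ?p j) = coeff (\<Prod>g\<in>\<Gamma>. [:- pull (\<pi> g) f, 1:]) j"
  proof (rule automorphism_coeff_prod[OF s sub_LL o, symmetric])
   fix g j assume "g \<in> \<Gamma>"
   thus "coeff [:- pull (\<pi> g) f, 1:] j = pull h (coeff [:- pull g f, 1:] j)"
    using neg[OF inL] ph aut_simps(6,7)[OF s sub_LL]
    by (auto simp: coeff_pCons split: nat.split)
  qed
  also have "\<dots> = coeff ?p j" by (simp add: prod.reindex_bij_betw[OF b, of "%g. [:- pull g f, 1:]"])
  finally show "pull h (coeff ?p j) = coeff ?p j" .
 qed
qed

theorem galois: "galois_extension K LL"
 unfolding galois_extension_def
proof (intro conjI ballI algebraic K_LL)
 show "{x \<in> LL. \<forall>\<sigma>\<in>G. \<sigma> x = x} = K"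
  using fixed_in_K pull_in_G K_LL aut_simps(4)[OF _ sub_LL] by blast
qed

theorem galois_form: "galois_form d \<omega>"
 by (rule galois_form.intro[OF d_pos \<omega>_forms \<omega>_no_common_factor galois])

text \<open>
  An automorphism sends \<open>x\<close> to a root \<open>g x\<close> of \<open>M\<close>, and its
 square is the identity iff the Moebius transformation \<open>g\<^sup>2\<close> is.
\<close>

theorem involutions: "involutions \<omega> = card {g \<in> \<Gamma>. involutive g}"
proof -
 have "{\<rho>. \<exists>\<sigma>\<in>G. \<rho> = \<sigma> x_elt & \<sigma> \<rho> = x_elt} = mx ` {g \<in> \<Gamma>. involutive g}"
 proof (intro subset_antisym subsetI)
  fix \<rho> assume "\<rho> \<in> mx ` {g \<in> \<Gamma>. involutive g}"
  then obtain g where g: "g \<in> \<Gamma>" "involutive g" "\<rho> = mx g" by blast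
  then obtain t where t: "mm g g = smul t one_mob" using involutive_iff[OF disc[OF g(1)]] by blast
  obtain k u where k: "k \<in> \<Gamma>" "u ~= 0" "mm g g = smul u k" using mult[OF g(1,1)] by blast
  have "smul (t / u) one_mob = k"
   using arg_cong[OF t[unfolded k(3)], of "smul (1 / u)"] k(2) by (simp add: smul_smul smul_1 del: smul.simps)
  hence "k = one_mob" using unique[OF one k(1)] by metis
  hence "pull g (pull g x_elt) = x_elt" using pull_mm[OF g(1,1) k x_elt_in] pull_one[OF x_elt_in] by simp
  thus "\<rho> \<in> {\<rho>. \<exists>\<sigma>\<in>G. \<rho> = \<sigma> x_elt & \<sigma> \<rho> = x_elt}"
   using pull_in_G[OF g(1)] by (intro CollectI bexI[of _ "pull g"]) (simp_all add: pull_x[OF g(1)] g(3))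
 next
  fix \<rho> assume "\<rho> \<in> {\<rho>. \<exists>\<sigma>\<in>G. \<rho> = \<sigma> x_elt & \<sigma> \<rho> = x_elt}"
  then obtain \<sigma> where s: "\<sigma> \<in> G" "\<rho> = \<sigma> x_elt" "\<sigma> \<rho> = x_elt" by blast
  have "poly M \<rho> = 0"
   using automorphism_poly_over[OF s(1) sub_LL K_LL M_over x_elt_in] M_root[OF one] s(2)
    aut_simps(6)[OF s(1) sub_LL] by (simp add: mx_one)
  then obtain g where g: "g \<in> \<Gamma>" "\<rho> = mx g" using M_roots by blast
  obtain a b c e where abc: "g = (a, b, c, e)" by (cases g)
  note L = sub_LL
  have rel: "mx g * (cst c * x_elt + cst e) = cst a * x_elt + cst b"
  proof (rule LL_eqI)
   show "mx g * (cst c * x_elt + cst e) \<in> LL" "cst a * x_elt + cst b \<in> LL"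
    by (intro is_subfieldD(3,4)[OF L] cst_in x_elt_in mx_in[OF g(1)])+
   show "\<forall>\<^sub>F X in gen. fval (mx g * (cst c * x_elt + cst e)) X = fval (cst a * x_elt + cst b) X"
    using generic_ok
   proof eventually_elim
    case (elim X)
    have D: "den g (fst X) 1 ~= 0" using elim g(1) by (auto simp: ok_def)
    have l: "fdef (cst u * x_elt + cst v) X & fval (cst u * x_elt + cst v) X = u * fst X + v" for u v
     using fval_mult[of "cst u" X x_elt] fval_add[of "cst u * x_elt" X "cst v"] fval_cst[of _ X] fval_x_elt[of X] by simp
    show ?case using fval_mult[of "mx g" X "cst c * x_elt + cst e"] fval_mx[OF D] l D by (simp add: mv_def abc)
   qed
  qed
  have lin: "\<sigma> (cst u * x_elt + cst v) = cst u * mx g + cst v" for u v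
  proof -
   have "\<sigma> (cst u * x_elt + cst v) = \<sigma> (cst u * x_elt) + \<sigma> (cst v)"
    by (rule aut_simps(2)[OF s(1) L is_subfieldD(4)[OF L cst_in(2) x_elt_in] cst_in(2)])
   also have "\<sigma> (cst u * x_elt) = \<sigma> (cst u) * \<sigma> x_elt"
    by (rule aut_simps(3)[OF s(1) L cst_in(2) x_elt_in])
   finally show ?thesis unfolding aut_simps(4)[OF s(1) L cst_in(1)] s(2)[symmetric] g(2) .
  qed
  have "x_elt * (cst c * mx g + cst e) = cst a * mx g + cst b"
   using arg_cong[OF rel, of \<sigma>] aut_simps(3)[OF s(1) L mx_in[OF g(1)], of "cst c * x_elt + cst e"]
    is_subfieldD(3)[OF L is_subfieldD(4)[OF L cst_in(2) x_elt_in] cst_in(2)] s(3) by (simp add: lin g(2))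
  hence eq: "fval (x_elt * (cst c * mx g + cst e)) X = fval (cst a * mx g + cst b) X" for X by simp
  have "\<forall>\<^sub>F X in gen. - (b * (a + e)) + (b * c + e * e - a * a - b * c) * fst X + (c * (a + e)) * (fst X * fst X) = 0"
   using generic_ok
  proof eventually_elim
   case (elim X)
   have D: "den g (fst X) 1 ~= 0" using elim g(1) by (auto simp: ok_def)
   have l: "fdef (cst u * mx g + cst v) X & fval (cst u * mx g + cst v) X = u * mv g (fst X) + v" for u v
    using fval_mult[of "cst u" X "mx g"] fval_add[of "cst u * mx g" X "cst v"] fval_cst[of _ X] fval_mx[OF D] by simp
   have "fst X * (c * mv g (fst X) + e) = a * mv g (fst X) + b"
    using eq[of X] fval_mult[of x_elt X "cst c * mx g + cst e"] fval_x_elt[of X] l by simp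
   moreover have "num g (fst X) 1 = mv g (fst X) * den g (fst X) 1" using D by (simp add: mv_def)
   ultimately have "fst X * (c * num g (fst X) 1 + e * den g (fst X) 1) = a * num g (fst X) 1 + b * den g (fst X) 1"
    by algebra
   thus ?case by (simp add: abc algebra_simps)
  qed
  from gen_quadratic[OF this] have "b * (a + e) = 0" "e * e = a * a" "c * (a + e) = 0" by auto
  hence "involutive g" by (auto simp: abc square_eq_iff add_eq_0_iff)
  thus "\<rho> \<in> mx ` {g \<in> \<Gamma>. involutive g}" using g by blast
 qed
 moreover have "inj_on mx {g \<in> \<Gamma>. involutive g}" by (rule inj_on_subset[OF inj_mx]) blast
 ultimately show ?thesis unfolding involutions_def by (simp only: card_image)
qed

end

section \<open>The cyclic, dihedral, tetrahedral, octahedral and icosahedral groups\<close>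

lemma moebius_group_example:
 assumes "moebius_group \<Gamma> d"
 shows "\<exists>\<omega>. galois_form d \<omega> & involutions \<omega> = card {g \<in> \<Gamma>. involutive g}"
 using moebius_group.galois_form[OF assms] moebius_group.involutions[OF assms] by blast

definition unity :: "nat => complex set" where "unity n = {u. u ^ n = 1}"

lemma card_unity: "1 \<le> n ==> card (unity n) = n"
 unfolding unity_def by (rule card_complex_roots_unity)

lemma finite_unity: "1 \<le> n ==> finite (unity n)"
 using card_unity[of n] by (intro card_ge_0_finite) simp

lemma unity: "1 \<in> unity n" "u \<in> unity n ==> v \<in> unity n ==> u * v \<in> unity n" "u \<in> unity n ==> v \<in> unity n ==> u / v \<in> unity n"
 by (auto simp: unity_def power_mult_distrib power_divide)

lemma unity_nonzero: "1 \<le> n ==> u \<in> unity n ==> u ~= 0"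
 by (auto simp: unity_def power_0_left)

definition diag :: "complex => mob" where "diag u = (u, 0, 0, 1)"
definition anti :: "complex => mob" where "anti u = (0, u, 1, 0)"

lemma mm_diag_anti:
 "mm (diag u) (diag v) = smul 1 (diag (u * v))"
 "mm (diag u) (anti v) = smul 1 (anti (u * v))"
 "v ~= 0 ==> mm (anti u) (diag v) = smul v (anti (u / v))"
 "v ~= 0 ==> mm (anti u) (anti v) = smul v (diag (u / v))"
 by (simp_all add: diag_def anti_def)

lemma diag_neq_anti: "diag u ~= anti v"
 by (simp add: diag_def anti_def)

lemma inj_diag: "inj_on diag S" and inj_anti: "inj_on anti S"
 by (auto simp: inj_on_def diag_def anti_def)

lemma moebius_cyclic:
 assumes d: "1 \<le> d"
 shows "moebius_group (diag ` unity d) d"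
proof
 show "finite (diag ` unity d)" "card (diag ` unity d) = d"
  using d by (simp_all add: finite_unity card_unity card_image inj_diag)
 show "one_mob \<in> diag ` unity d" using unity(1) by (force simp: diag_def)
 show "disc g ~= 0" if "g \<in> diag ` unity d" for g
  using that unity_nonzero[OF d] by (auto simp: diag_def)
 show "g = h" if "g \<in> diag ` unity d" "h \<in> diag ` unity d" "smul t g = h" for g h t
  using that by (auto simp: diag_def)
 show "\<exists>k\<in>diag ` unity d. \<exists>t. t ~= 0 & mm g h = smul t k" if gh: "g \<in> diag ` unity d" "h \<in> diag ` unity d" for g h
 proof -
  obtain u v where "u \<in> unity d" "v \<in> unity d" "g = diag u" "h = diag v" using gh by blast
  thus ?thesis using unity(2)[of u d v] by (intro bexI[of _ "diag (u * v)"] exI[of _ 1]) (auto simp: mm_diag_anti)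
 qed
qed

lemma cyclic_example:
 assumes d: "1 \<le> d"
 shows "\<exists>\<omega>. galois_form d \<omega> & involutions \<omega> \<le> 2"
proof -
 have "{g \<in> diag ` unity d. involutive g} \<subseteq> {diag 1, diag (- 1)}"
  by (auto simp: diag_def eq_neg_iff_add_eq_0)
 hence "card {g \<in> diag ` unity d. involutive g} \<le> card {diag 1, diag (- 1)}"
  by (rule card_mono[rotated]) simp
 also have "\<dots> \<le> 2" by (simp add: card_insert_if)
 finally show ?thesis using moebius_group_example[OF moebius_cyclic[OF d]] by metis
qed

lemma moebius_dihedral:
 assumes n: "1 \<le> n"
 shows "moebius_group (diag ` unity n \<union> anti ` unity n) (2 * n)"
proof
 let ?\<Gamma> = "diag ` unity n \<union> anti ` unity n"
 have disj: "diag ` unity n \<inter> anti ` unity n = {}" using diag_neq_anti by blast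
 show "finite ?\<Gamma>" using n by (simp add: finite_unity)
 show "card ?\<Gamma> = 2 * n"
  using card_Un_disjoint[OF _ _ disj] n by (simp add: finite_unity card_image[OF inj_diag] card_image[OF inj_anti] card_unity)
 show "one_mob \<in> ?\<Gamma>" using unity(1) by (force simp: diag_def)
 show "disc g ~= 0" if "g \<in> ?\<Gamma>" for g
  using that unity_nonzero[OF n] by (elim UnE imageE) (simp_all add: diag_def anti_def)
 show "g = h" if "g \<in> ?\<Gamma>" "h \<in> ?\<Gamma>" "smul t g = h" for g h t
  using that by (auto simp: diag_def anti_def)
 show "\<exists>k\<in>?\<Gamma>. \<exists>t. t ~= 0 & mm g h = smul t k" if gh: "g \<in> ?\<Gamma>" "h \<in> ?\<Gamma>" for g h
 proof -
  have fin: ?thesis if "k \<in> ?\<Gamma>" "t ~= 0" "mm g h = smul t k" for k t using that by blast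
  obtain u v where u: "u \<in> unity n" "g = diag u \<or> g = anti u" and v: "v \<in> unity n" "h = diag v \<or> h = anti v"
   using gh by blast
  have v0: "v ~= 0" using unity_nonzero[OF n v(1)] .
  have m: "diag (u * v) \<in> ?\<Gamma>" "anti (u * v) \<in> ?\<Gamma>" "diag (u / v) \<in> ?\<Gamma>" "anti (u / v) \<in> ?\<Gamma>"
   using unity(2,3) u(1) v(1) by auto
  show ?thesis
   using u(2) v(2) fin[OF m(1)] fin[OF m(2)] fin[OF m(3)] fin[OF m(4)] mm_diag_anti v0
   by (elim disjE) (simp_all del: mm.simps smul.simps)
 qed
qed

lemma dihedral_example:
 assumes n: "1 \<le> n"
 shows "\<exists>\<omega>. galois_form (2 * n) \<omega> & n + 1 \<le> involutions \<omega>"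
proof -
 let ?\<Gamma> = "diag ` unity n \<union> anti ` unity n"
 have sub: "insert one_mob (anti ` unity n) \<subseteq> {g \<in> ?\<Gamma>. involutive g}"
  using unity(1)[of n] by (force simp: diag_def anti_def)
 have "card (insert one_mob (anti ` unity n)) = n + 1"
  using n by (subst card_insert_disjoint) (auto simp: finite_unity card_image inj_anti card_unity, auto simp: anti_def)
 moreover have "finite {g \<in> ?\<Gamma>. involutive g}" using n by (simp add: finite_unity)
 ultimately have "n + 1 \<le> card {g \<in> ?\<Gamma>. involutive g}" using card_mono[OF _ sub] by simp
 thus ?thesis using moebius_group_example[OF moebius_dihedral[OF n]] by metis
qed

subsection \<open>Tetrahedral and octahedral groups\<close>

text \<open>The transformation \<open>x \<mapsto> u (x + v) / (x - v)\<close>.\<close>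

definition rot :: "complex => complex => mob" where "rot u v = (u, u * v, 1, - v)"

lemma mm_rot:
 "mm (diag w) (rot u v) = smul 1 (rot (w * u) v)"
 "u ~= 0 ==> mm (anti w) (rot u v) = smul u (rot (w / u) (- v))"
 "w ~= 0 ==> mm (rot u v) (diag w) = smul w (rot u (v / w))"
 "v ~= 0 ==> mm (rot u v) (anti w) = smul (- v) (rot (- u) (w / v))"
 "t ~= 0 ==> mm (rot u v) (rot v t) = smul (2 * t * v) (diag (u / t))"
 "mm (rot u v) (rot (- v) t) = smul (- 2 * v) (anti (u * t))"
 by (simp_all add: diag_def anti_def rot_def algebra_simps)

lemma mm_rot_rot:
 assumes s: "s\<^sup>2 = - v\<^sup>2" and "s ~= v"
 shows "mm (rot u v) (rot s t) = smul (s - v) (rot (u * ((s + v) / (s - v))) (- t * ((s + v) / (s - v))))"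
proof -
 define k where "k = (s + v) / (s - v)"
 have "(s + v)\<^sup>2 = - ((s - v)\<^sup>2)" using s by (simp add: power2_eq_square algebra_simps)
 hence "k\<^sup>2 = - 1" using assms(2) by (simp add: k_def power_divide)
 hence k2: "k * k = - 1" by (simp add: power2_eq_square)
 have e: "s + v = k * (s - v)" using assms(2) by (simp add: k_def)
 have "u * s + u * v * 1 = (s - v) * (u * k)" "u * (s * t) + u * v * - t = (s - v) * (u * k * (- t * k))"
  "1 * (s * t) + - v * - t = (s - v) * - (- t * k)"
  using e k2 by algebra+
 thus ?thesis unfolding k_def[symmetric] rot_def by simp
qed

lemma quarter_cases:
 assumes "s ^ 4 = (1::complex)" "v ^ 4 = 1"
 shows "s = v \<or> s = - v \<or> s\<^sup>2 = - v\<^sup>2"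
proof -
 have "(s\<^sup>2)\<^sup>2 = (v\<^sup>2)\<^sup>2" using assms by (simp flip: power_mult)
 hence "s\<^sup>2 = v\<^sup>2 \<or> s\<^sup>2 = - v\<^sup>2" by (simp only: power2_eq_iff)
 thus ?thesis unfolding power2_eq_iff[of s v] by blast
qed

lemma power4: "x ^ 4 = (x\<^sup>2)\<^sup>2" for x :: complex
 by (simp flip: power_mult)

text \<open>
  The transformations permuting \<open>{0, \<infinity>, 1, i, -1, -i}\<close>, the vertices of an octahedron, form the
 case \<open>W = {1, -1}\<close>; the case \<open>W = {1}\<close> is the tetrahedral group, a subgroup of index 2.
\<close>

definition rotation_params :: "complex set => (complex \<times> complex) set" where
 "rotation_params W = {(u, v). u ^ 4 = 1 & v ^ 4 = 1 & - ((u * v)\<^sup>2) \<in> W}"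

definition axis_params :: "complex set => complex set" where
 "axis_params W = {u. u ^ 4 = 1 & u\<^sup>2 \<in> W}"

definition octahedral :: "complex set => mob set" where
 "octahedral W = diag ` axis_params W \<union> anti ` axis_params W \<union> (%(u, v). rot u v) ` rotation_params W"

lemma octahedral_cases:
 assumes "g \<in> octahedral W"
 obtains u where "g = diag u" "u ^ 4 = 1" "u\<^sup>2 \<in> W" | u where "g = anti u" "u ^ 4 = 1" "u\<^sup>2 \<in> W"
  | u v where "g = rot u v" "u ^ 4 = 1" "v ^ 4 = 1" "- ((u * v)\<^sup>2) \<in> W"
 using assms unfolding octahedral_def axis_params_def rotation_params_def by (elim UnE imageE) auto

lemma octahedral_I:
 "u ^ 4 = 1 ==> u\<^sup>2 \<in> W ==> diag u \<in> octahedral W" "u ^ 4 = 1 ==> u\<^sup>2 \<in> W ==> anti u \<in> octahedral W"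
 "u ^ 4 = 1 ==> v ^ 4 = 1 ==> - ((u * v)\<^sup>2) \<in> W ==> rot u v \<in> octahedral W"
 unfolding octahedral_def axis_params_def rotation_params_def by blast+

lemma quartic_nonzero: "u ^ 4 = (1::complex) ==> u ~= 0"
 by auto

lemma mult_witness: "mm g h = smul t k ==> k \<in> S ==> t ~= 0 ==> \<exists>k\<in>S. \<exists>t. t ~= 0 & mm g h = smul t k"
 by blast

lemma octahedral_mult:
 assumes W: "!!a b. a \<in> W ==> b \<in> W ==> a * b \<in> W"
  and gh: "g \<in> octahedral W" "h \<in> octahedral W"
 shows "\<exists>k\<in>octahedral W. \<exists>t. t ~= 0 & mm g h = smul t k"
proof -
 note pw = power_mult_distrib power_divide
 have inv2: "a / u\<^sup>2 = a * u\<^sup>2" if "u ^ 4 = 1" for a u :: complex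
 proof -
  have "u\<^sup>2 * u\<^sup>2 = 1" using that by (simp add: power4 power2_eq_square)
  thus ?thesis using quartic_nonzero[OF that] by (simp add: field_simps) 
 qed
 from gh(1) show ?thesis
 proof (cases rule: octahedral_cases)
  case g: (1 u)
  from gh(2) show ?thesis
  proof (cases rule: octahedral_cases)
   case (1 v)
   show ?thesis unfolding g(1) 1(1) by (rule mult_witness[OF mm_diag_anti(1) octahedral_I(1)]) (use g 1 W in \<open>auto simp: pw\<close>)
  next
   case (2 v)
   show ?thesis unfolding g(1) 2(1) by (rule mult_witness[OF mm_diag_anti(2) octahedral_I(2)]) (use g 2 W in \<open>auto simp: pw\<close>)
  next
   case (3 v w)
   have q: "- ((u * v * w)\<^sup>2) \<in> W" using W[OF g(3) 3(4)] by (simp add: pw mult_ac)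
   show ?thesis unfolding g(1) 3(1) by (rule mult_witness[OF mm_rot(1) octahedral_I(3)]) (use q g 3 in \<open>auto simp: pw\<close>)
  qed
 next
  case g: (2 u)
  from gh(2) show ?thesis
  proof (cases rule: octahedral_cases)
   case (1 v)
   have q: "(u / v)\<^sup>2 \<in> W" using W[OF g(3) 1(3)] 1(2) by (simp add: pw inv2)
   show ?thesis unfolding g(1) 1(1) by (rule mult_witness[OF mm_diag_anti(3)[OF quartic_nonzero[OF 1(2)]] octahedral_I(2)]) (use q g 1 quartic_nonzero in \<open>auto simp: pw\<close>)
  next
   case (2 v)
   have q: "(u / v)\<^sup>2 \<in> W" using W[OF g(3) 2(3)] 2(2) by (simp add: pw inv2)
   show ?thesis unfolding g(1) 2(1) by (rule mult_witness[OF mm_diag_anti(4)[OF quartic_nonzero[OF 2(2)]] octahedral_I(1)]) (use q g 2 quartic_nonzero in \<open>auto simp: pw\<close>)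
  next
   case (3 v w)
   have q: "- ((u / v * - w)\<^sup>2) \<in> W" using W[OF g(3) 3(4)] 3(2) inv2[of v "u\<^sup>2 * w\<^sup>2"] by (simp add: pw mult_ac)
   show ?thesis unfolding g(1) 3(1) by (rule mult_witness[OF mm_rot(2)[OF quartic_nonzero[OF 3(2)]] octahedral_I(3)]) (use q g 3 quartic_nonzero in \<open>auto simp: pw\<close>)
  qed
 next
  case g: (3 u v)
  from gh(2) show ?thesis
  proof (cases rule: octahedral_cases)
   case (1 w)
   have q: "- ((u * (v / w))\<^sup>2) \<in> W" using W[OF g(4) 1(3)] 1(2) inv2[of w "u\<^sup>2 * v\<^sup>2"] by (simp add: pw mult_ac)
   show ?thesis unfolding g(1) 1(1) by (rule mult_witness[OF mm_rot(3)[OF quartic_nonzero[OF 1(2)]] octahedral_I(3)]) (use q g 1 quartic_nonzero in \<open>auto simp: pw\<close>)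
  next
   case (2 w)
   have q: "- ((- u * (w / v))\<^sup>2) \<in> W" using W[OF g(4) 2(3)] g(3) inv2[of v "u\<^sup>2 * w\<^sup>2"] by (simp add: pw mult_ac)
   show ?thesis unfolding g(1) 2(1) by (rule mult_witness[OF mm_rot(4)[OF quartic_nonzero[OF g(3)]] octahedral_I(3)]) (use q g 2 quartic_nonzero in \<open>auto simp: pw\<close>)
  next
   case (3 s t)
   have w: "u\<^sup>2 * v\<^sup>2 * (s\<^sup>2 * t\<^sup>2) \<in> W" using W[OF g(4) 3(4)] by (simp add: pw mult_ac)
   have v4: "v\<^sup>2 * v\<^sup>2 = 1" using g(3) by (simp add: power4 power2_eq_square)
   consider "s = v" | "s = - v" | "s\<^sup>2 = - v\<^sup>2" "s ~= v" using quarter_cases[OF 3(2) g(3)] by blast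
   thus ?thesis
   proof cases
    case 1
    have e: "u\<^sup>2 * v\<^sup>2 * (s\<^sup>2 * t\<^sup>2) = u\<^sup>2 * t\<^sup>2" unfolding 1 using v4 by algebra
    have q: "(u / t)\<^sup>2 \<in> W" using w 3(3) unfolding e by (simp add: pw inv2)
    show ?thesis unfolding g(1) 3(1) 1 by (rule mult_witness[OF mm_rot(5)[OF quartic_nonzero[OF 3(3)]] octahedral_I(1)]) (use q g 3 quartic_nonzero in \<open>auto simp: pw\<close>)
   next
    case 2
    have e: "u\<^sup>2 * v\<^sup>2 * (s\<^sup>2 * t\<^sup>2) = u\<^sup>2 * t\<^sup>2" unfolding 2 power2_minus using v4 by algebra
    have q: "(u * t)\<^sup>2 \<in> W" using w unfolding e by (simp add: pw)
    show ?thesis unfolding g(1) 3(1) 2 by (rule mult_witness[OF mm_rot(6) octahedral_I(2)]) (use q g 3 quartic_nonzero in \<open>auto simp: pw\<close>)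
   next
    case c: 3
    let ?k = "(s + v) / (s - v)"
    have "(s + v)\<^sup>2 = - ((s - v)\<^sup>2)" using c(1) by (simp add: power2_eq_square algebra_simps)
    hence k2: "?k\<^sup>2 = - 1" using c(2) by (simp add: power_divide)
    hence k4: "?k ^ 4 = 1" by (simp add: power4)
    have e: "u\<^sup>2 * v\<^sup>2 * (s\<^sup>2 * t\<^sup>2) = - (u\<^sup>2 * t\<^sup>2)" unfolding c(1) using v4 by algebra
    have "- (u\<^sup>2 * t\<^sup>2) \<in> W" using w unfolding e .
    moreover have "(u * ?k * (- t * ?k))\<^sup>2 = u\<^sup>2 * t\<^sup>2 * (?k\<^sup>2 * ?k\<^sup>2)" by (simp only: power_mult_distrib power2_minus mult_ac)
    ultimately have q: "- ((u * ?k * (- t * ?k))\<^sup>2) \<in> W" unfolding k2 by simp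
    have q4: "(u * ?k) ^ 4 = 1" "(- t * ?k) ^ 4 = 1" using k4 g(2) 3(3) unfolding power_mult_distrib by simp_all
    show ?thesis unfolding g(1) 3(1) by (rule mult_witness[OF mm_rot_rot[OF c] octahedral_I(3)[OF q4 q]]) (use c(2) in simp)
   qed
  qed
 qed
qed

lemma moebius_octahedral:
 assumes W: "!!a b. a \<in> W ==> b \<in> W ==> a * b \<in> W" "1 \<in> W"
  and A: "card (axis_params W) = a" "0 < a" and R: "card (rotation_params W) = r" "0 < r"
 shows "moebius_group (octahedral W) (2 * a + r)"
proof
 have f: "finite (axis_params W)" "finite (rotation_params W)" using A R card_gt_0_iff by metis+
 have i: "inj_on (%(u, v). rot u v) S" for S by (auto simp: inj_on_def rot_def)
 have d1: "diag ` axis_params W \<inter> anti ` axis_params W = {}" using diag_neq_anti by blast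
 have r0: "(u, v) \<in> rotation_params W ==> u ~= 0 & v ~= 0" for u v by (auto simp: rotation_params_def)
 have d2: "(diag ` axis_params W \<union> anti ` axis_params W) \<inter> (%(u, v). rot u v) ` rotation_params W = {}"
 proof -
  have "diag w ~= rot u v & anti w ~= rot u v" if "(u, v) \<in> rotation_params W" for u v w
   using r0[OF that] by (simp add: diag_def anti_def rot_def)
  thus ?thesis by fastforce
 qed
 show "finite (octahedral W)" using f by (simp add: octahedral_def)
 show "card (octahedral W) = 2 * a + r"
  unfolding octahedral_def using f A R
  by (subst card_Un_disjoint[OF _ _ d2], simp, simp, subst card_Un_disjoint[OF _ _ d1])
   (simp_all add: card_image inj_diag inj_anti i)
 show "one_mob \<in> octahedral W" using octahedral_I(1)[of 1 W] W(2) by (simp add: diag_def)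
 show "disc g ~= 0" if "g \<in> octahedral W" for g
  using that by (cases rule: octahedral_cases) (auto simp: diag_def anti_def rot_def)
 show "g = h" if gh: "g \<in> octahedral W" "h \<in> octahedral W" "smul t g = h" for g h t
 proof (cases rule: octahedral_cases[OF gh(1)])
  case (1 u)
  thus ?thesis using gh(3)
   by (cases rule: octahedral_cases[OF gh(2)]) (auto simp: diag_def anti_def rot_def dest: quartic_nonzero)
 next
  case (2 u)
  thus ?thesis using gh(3)
   by (cases rule: octahedral_cases[OF gh(2)]) (auto simp: diag_def anti_def rot_def dest: quartic_nonzero)
 next
  case (3 u v)
  thus ?thesis using gh(3)
   by (cases rule: octahedral_cases[OF gh(2)]) (auto simp: diag_def anti_def rot_def dest: quartic_nonzero)
 qed
 show "\<exists>k\<in>octahedral W. \<exists>t. t ~= 0 & mm g h = smul t k" if "g \<in> octahedral W" "h \<in> octahedral W" for g h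
  by (rule octahedral_mult[OF W(1) that])
qed

lemma quartic_explicit: "u ^ 4 = 1 \<longleftrightarrow> u \<in> {1, - 1, \<i>, - \<i>}" for u :: complex
proof -
 have "u ^ 4 - 1 = (u - 1) * (u + 1) * (u - \<i>) * (u + \<i>)"
  by (simp add: algebra_simps power4 power2_eq_square)
 thus ?thesis by (auto simp: eq_neg_iff_add_eq_0)
qed

lemma octahedral_involutions:
 assumes W: "1 \<in> W" and A: "finite (axis_params W)" "finite (rotation_params W)"
 shows "3 \<le> card {g \<in> octahedral W. involutive g}"
  "card {g \<in> octahedral W. involutive g} \<le> 2 + card (axis_params W) + card {u. (u, u) \<in> rotation_params W}"
proof -
 let ?I = "{g \<in> octahedral W. involutive g}"
 have finO: "finite (octahedral W)" using A by (simp add: octahedral_def)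
 have fin: "finite ?I" using finO by simp
 have "{diag 1, anti 1, anti (- 1)} \<subseteq> ?I" using octahedral_I(1,2) W by (simp add: diag_def anti_def)
 from card_mono[OF fin this] show "3 \<le> card ?I" by (simp add: diag_def anti_def)
 have "?I \<subseteq> {diag 1, diag (- 1)} \<union> anti ` axis_params W \<union> (%u. rot u u) ` {u. (u, u) \<in> rotation_params W}"
 proof
  fix g assume g: "g \<in> ?I"
  hence "g \<in> octahedral W" by simp
  thus "g \<in> {diag 1, diag (- 1)} \<union> anti ` axis_params W \<union> (%u. rot u u) ` {u. (u, u) \<in> rotation_params W}"
   by (cases rule: octahedral_cases)
    (use g in \<open>auto simp: diag_def anti_def rot_def axis_params_def rotation_params_def eq_neg_iff_add_eq_0\<close>)
 qed
 moreover have fr: "finite {u. (u, u) \<in> rotation_params W}"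
  by (rule finite_subset[OF _ finite_imageI[OF A(2), of fst]]) force
 ultimately have "card ?I \<le> card ({diag 1, diag (- 1)} \<union> anti ` axis_params W \<union> (%u. rot u u) ` {u. (u, u) \<in> rotation_params W})"
  using A(1) by (intro card_mono) auto
 also have "\<dots> \<le> card {diag 1, diag (- 1)} + card (anti ` axis_params W) + card ((%u. rot u u) ` {u. (u, u) \<in> rotation_params W})"
  by (intro order_trans[OF card_Un_le] add_mono card_Un_le order_refl)
 also have "\<dots> \<le> 2 + card (axis_params W) + card {u. (u, u) \<in> rotation_params W}"
  using card_image_le[OF A(1), of anti] card_image_le[OF fr, of "%u. rot u u"] by (simp add: card_insert_if add_mono)
 finally show "card ?I \<le> 2 + card (axis_params W) + card {u. (u, u) \<in> rotation_params W}" .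
qed

lemma tetrahedral_example: "\<exists>\<omega>. galois_form 12 \<omega> & 3 \<le> involutions \<omega> & involutions \<omega> \<le> 6"
proof -
 have a: "axis_params {1} = {1, - 1}"
  unfolding axis_params_def quartic_explicit by (auto simp: power2_eq_1_iff)
 have "rotation_params {1} = {1, - 1} \<times> {\<i>, - \<i>} \<union> {\<i>, - \<i>} \<times> {1, - 1}"
  unfolding rotation_params_def quartic_explicit by (auto simp: power_mult_distrib)
 hence r: "card (rotation_params {1}) = 8" by (simp add: complex_eq_iff card_insert_if)
 have "{u. (u, u) \<in> rotation_params {1}} = {}"
  unfolding rotation_params_def quartic_explicit by (auto simp: power_mult_distrib)
 hence z: "card {u. (u, u) \<in> rotation_params {1}} = 0" by simp
 have fin: "finite (rotation_params {1})" using r card.infinite by fastforce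
 have "moebius_group (octahedral {1}) (2 * 2 + 8)"
  by (rule moebius_octahedral) (auto simp: a r)
 from moebius_group_example[OF this] octahedral_involutions[of "{1}"] fin a z show ?thesis by auto
qed

lemma octahedral_example: "\<exists>\<omega>. galois_form 24 \<omega> & 3 \<le> involutions \<omega> & involutions \<omega> \<le> 12"
proof -
 let ?Q = "{1, - 1, \<i>, - \<i>}"
 have a: "axis_params {1, - 1} = ?Q"
  unfolding axis_params_def quartic_explicit by auto
 have rr: "rotation_params {1, - 1} = ?Q \<times> ?Q"
  unfolding rotation_params_def quartic_explicit by (auto simp: power_mult_distrib)
 hence r: "card (rotation_params {1, - 1}) = 16" by (simp add: complex_eq_iff card_insert_if)
 have "{u. (u, u) \<in> rotation_params {1, - 1}} = ?Q" unfolding rr by auto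
 hence z: "card {u. (u, u) \<in> rotation_params {1, - 1}} \<le> 4" by (simp add: card_insert_if)
 have fin: "finite (rotation_params {1, - 1})" unfolding rr by simp
 have "moebius_group (octahedral {1, - 1}) (2 * 4 + 16)"
  by (rule moebius_octahedral) (auto simp: a r complex_eq_iff card_insert_if)
 moreover have "card (axis_params {1, - 1}) \<le> 4" by (simp add: a card_insert_if)
 ultimately show ?thesis
  using moebius_group_example[of "octahedral {1, - 1}" 24] octahedral_involutions[of "{1, - 1}"] fin a z by fastforce
qed

subsection \<open>The icosahedral group\<close>

text \<open>
  With this number, the transformation \<open>x \<mapsto> (1 - golden x) / (x + golden)\<close> of
 order 2 generates the icosahedral group together with the rotations by fifth roots of unity and
 \<open>x \<mapsto> -1/x\<close>. It is told apart from roots of unity by its absolute value.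
\<close>

definition golden :: complex where "golden = of_real ((1 + sqrt 5) / 2)"

lemma golden: "golden * golden = golden + 1"
proof -
 have "((1 + sqrt 5) / 2) * ((1 + sqrt 5) / 2) = (1 + sqrt 5) / 2 + 1"
  by (simp add: field_simps)
 thus ?thesis unfolding golden_def by (metis of_real_1 of_real_add of_real_mult)
qed

lemma golden_gt_1: "1 < norm golden"
 unfolding golden_def norm_of_real by (simp add: abs_of_pos add_pos_pos)

lemma norm_unity: "1 \<le> n ==> u \<in> unity n ==> norm u = 1"
proof -
 assume n: "1 \<le> n" and "u \<in> unity n"
 hence "norm u ^ n = 1" by (simp add: unity_def flip: norm_power)
 thus ?thesis using n power_eq_imp_eq_base[of "norm u" n 1] by simp
qed

lemma golden_neq: "golden ~= 0" "1 + golden * golden ~= 0"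
proof -
 show "golden ~= 0" using golden_gt_1 by auto
 show "1 + golden * golden ~= 0"
 proof
  assume z: "1 + golden * golden = 0"
  hence "golden = - 2" using golden by (simp add: algebra_simps eq_neg_iff_add_eq_0)
  have "1 + (- 2) * (- 2) = (0 :: complex)" using z unfolding \<open>golden = - 2\<close> .
  thus False by simp
 qed
qed

text \<open>The cyclotomic polynomial splits into two quadratic factors over the golden ratio.\<close>

lemma fifth_roots:
 assumes "s \<in> unity 5"
 shows "s = 1 \<or> s * s = (golden - 1) * s - 1 \<or> s * s = - golden * s - 1"
proof -
 have "(s - 1) * ((s * s - (golden - 1) * s + 1) * (s * s + golden * s + 1)) = s ^ 5 - 1"
  using golden by algebra
 hence "(s - 1) * ((s * s - (golden - 1) * s + 1) * (s * s + golden * s + 1)) = 0"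
  using assms by (simp add: unity_def)
 then consider "s - 1 = 0" | "s * s - (golden - 1) * s + 1 = 0" | "s * s + golden * s + 1 = 0" by auto
 thus ?thesis
 proof cases
  case 1 thus ?thesis by simp
 next
  case 2
  hence "s * s = (golden - 1) * s - 1" by algebra
  thus ?thesis by blast
 next
  case 3
  hence "s * s = - golden * s - 1" by algebra
  thus ?thesis by blast
 qed
qed

definition flip :: "complex => mob" where "flip u = (0, - u, 1, 0)"
definition ico :: "complex => complex => mob" where "ico u v = (- golden * u * v, u, v, golden)"
definition coi :: "complex => complex => mob" where "coi u v = (u, golden * u * v, golden, - v)"

definition icosahedral :: "mob set" where
 "icosahedral = (diag ` unity 5 \<union> flip ` unity 5) \<union>
   ((%(u, v). ico u v) ` (unity 5 \<times> unity 5) \<union> (%(u, v). coi u v) ` (unity 5 \<times> unity 5))"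

lemma icosahedral_cases:
 assumes "g \<in> icosahedral"
 obtains (diag) u where "g = diag u" "u \<in> unity 5" | (flip) u where "g = flip u" "u \<in> unity 5"
  | (ico) u v where "g = ico u v" "u \<in> unity 5" "v \<in> unity 5" | (coi) u v where "g = coi u v" "u \<in> unity 5" "v \<in> unity 5"
 using assms unfolding icosahedral_def by (elim UnE imageE) auto

lemma icosahedral_I:
 "u \<in> unity 5 ==> diag u \<in> icosahedral" "u \<in> unity 5 ==> flip u \<in> icosahedral"
 "u \<in> unity 5 ==> v \<in> unity 5 ==> ico u v \<in> icosahedral" "u \<in> unity 5 ==> v \<in> unity 5 ==> coi u v \<in> icosahedral"
 unfolding icosahedral_def by (auto intro: rev_image_eqI)

text \<open>The matrices that map the set to itself, up to scalars, when multiplied from the left.\<close>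

definition stabilizes :: "mob => bool" where
 "stabilizes g \<longleftrightarrow> (\<forall>h\<in>icosahedral. \<exists>k\<in>icosahedral. \<exists>t. t ~= 0 & mm g h = smul t k)"

lemma stabilizes_mm:
 assumes "stabilizes f" "stabilizes g"
 shows "stabilizes (mm f g)"
 unfolding stabilizes_def
proof
 fix h assume "h \<in> icosahedral"
 then obtain k t where k: "k \<in> icosahedral" "t ~= 0" "mm g h = smul t k" using assms(2) unfolding stabilizes_def by blast
 then obtain l s where l: "l \<in> icosahedral" "s ~= 0" "mm f k = smul s l" using assms(1) unfolding stabilizes_def by blast
 have "mm (mm f g) h = smul (t * s) l" by (simp only: mm_assoc k(3) mm_smul l(3) smul_smul)
 thus "\<exists>k\<in>icosahedral. \<exists>t. t ~= 0 & mm (mm f g) h = smul t k" using k(2) l(1,2) by (intro mult_witness[of _ _ "t * s" l]) auto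
qed

lemma mm_ico_diag:
 "mm (diag s) (flip u) = smul 1 (flip (s * u))"
 "mm (diag s) (ico u v) = smul 1 (ico (s * u) v)"
 "mm (diag s) (coi u v) = smul 1 (coi (s * u) v)"
 by (simp_all add: diag_def flip_def ico_def coi_def)

lemma mm_flip:
 "u ~= 0 ==> mm (flip 1) (diag u) = smul u (flip (1 / u))"
 "u ~= 0 ==> mm (flip 1) (flip u) = smul (- u) (diag (1 / u))"
 "u ~= 0 ==> v ~= 0 ==> mm (flip 1) (ico u v) = smul (- u * v) (coi (1 / u) (1 / v))"
 "u ~= 0 ==> v ~= 0 ==> mm (flip 1) (coi u v) = smul (u * v) (ico (1 / u) (1 / v))"
 by (simp_all add: diag_def flip_def ico_def coi_def)

lemma mm_ico:
 "mm (ico 1 1) (diag u) = smul 1 (ico 1 u)"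
 "mm (ico 1 1) (flip u) = smul 1 (coi 1 u)"
 "mm (ico 1 1) (ico 1 t) = smul (1 + golden * golden) (diag t)"
 by (simp_all add: diag_def flip_def ico_def coi_def algebra_simps)

lemma mm_ico_ico:
 assumes "s ~= 0" "s * s = (golden - 1) * s - 1"
 shows "mm (ico 1 1) (ico s t) = smul ((s + golden * golden) / golden) (ico (1 / s) (t / s))"
proof -
 define r l where "r = 1 / s" and "l = (s + golden * golden) / golden"
 have r: "r * s = 1" and l: "l * golden = s + golden * golden" using assms(1) golden_neq(1) l_def nonzero_eq_divide_eq by (simp add: r_def, metis)
 have lr: "l * r = golden * (1 - s)"
 proof -
  have "golden * (golden * (1 - s) - l * r) * s = 0" using r l assms(2) golden by algebra
  thus ?thesis using assms(1) golden_neq(1) by simp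
 qed
 have "- golden * 1 * 1 * (- golden * s * t) + 1 * t = l * (- golden * r * (r * t))" using lr r l assms(2) golden by algebra
 moreover have "- golden * 1 * 1 * s + 1 * golden = l * r" "1 * (- golden * s * t) + golden * t = l * (r * t)" using lr by algebra+
 moreover have "1 * s + golden * golden = l * golden" using l by simp
 ultimately have "mm (ico 1 1) (ico s t) = smul l (ico r (r * t))" by (simp add: ico_def)
 thus ?thesis by (simp add: r_def l_def)
qed

lemma mm_ico_coi:
 assumes "s ~= 0" "t ~= 0" "s * s = - golden * s - 1"
 shows "mm (ico 1 1) (ico s t) = smul (t * (1 - s)) (coi s (1 / (s * t)))"
proof -
 define r where "r = 1 / (s * t)"
 have r: "r * s * t = 1" using assms by (simp add: r_def)
 have "- golden * 1 * 1 * (- golden * s * t) + 1 * t = t * (1 - s) * s" using assms(3) golden by algebra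
 moreover have "- golden * 1 * 1 * s + 1 * golden = t * (1 - s) * (golden * s * r)" using r by algebra
 moreover have "1 * (- golden * s * t) + golden * t = t * (1 - s) * golden" by algebra
 moreover have "1 * s + golden * golden = t * (1 - s) * - r"
 proof -
  have "(s + golden * golden + t * (1 - s) * r) * s = 0" using r assms(3) golden by algebra
  hence "s + golden * golden + t * (1 - s) * r = 0" using assms(1) unfolding mult_eq_0_iff by blast
  thus ?thesis by algebra
 qed
 ultimately show ?thesis by (simp add: ico_def coi_def flip: r_def)
qed

lemma mm_to_coi: "mm (ico s t) (flip 1) = smul 1 (coi s t)" "mm (coi s t) (flip 1) = smul (- 1) (ico s t)"
 "mm (diag s) (flip 1) = smul 1 (flip s)"
 by (simp_all add: diag_def flip_def ico_def coi_def)

lemma unity5_nonzero: "u \<in> unity 5 ==> u ~= 0" by (rule unity_nonzero[of 5]) auto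

lemma inverse_unity: "u \<in> unity n ==> 1 / u \<in> unity n" using unity(1,3) by blast

lemma stabilizes_diag: "s \<in> unity 5 ==> stabilizes (diag s)"
 unfolding stabilizes_def
proof
 fix h assume s: "s \<in> unity 5" and "h \<in> icosahedral"
 from this(2) show "\<exists>k\<in>icosahedral. \<exists>t. t ~= 0 & mm (diag s) h = smul t k"
 proof (cases rule: icosahedral_cases)
  case (diag u) show ?thesis unfolding diag(1) by (rule mult_witness[OF mm_diag_anti(1) icosahedral_I(1)]) (use s diag unity(2) in auto)
 next
  case (flip u) show ?thesis unfolding flip(1) by (rule mult_witness[OF mm_ico_diag(1) icosahedral_I(2)]) (use s flip unity(2) in auto)
 next
  case (ico u v) show ?thesis unfolding ico(1) by (rule mult_witness[OF mm_ico_diag(2) icosahedral_I(3)]) (use s ico unity(2) in auto)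
 next
  case (coi u v) show ?thesis unfolding coi(1) by (rule mult_witness[OF mm_ico_diag(3) icosahedral_I(4)]) (use s coi unity(2) in auto)
 qed
qed

lemma stabilizes_flip: "stabilizes (flip 1)"
 unfolding stabilizes_def
proof
 fix h assume "h \<in> icosahedral"
 thus "\<exists>k\<in>icosahedral. \<exists>t. t ~= 0 & mm (flip 1) h = smul t k"
 proof (cases rule: icosahedral_cases)
  case (diag u) show ?thesis unfolding diag(1)
   by (rule mult_witness[OF mm_flip(1)[OF unity5_nonzero] icosahedral_I(2)]) (use diag inverse_unity unity5_nonzero in auto)
 next
  case (flip u) show ?thesis unfolding flip(1)
   by (rule mult_witness[OF mm_flip(2)[OF unity5_nonzero] icosahedral_I(1)]) (use flip inverse_unity unity5_nonzero in auto)
 next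
  case (ico u v) show ?thesis unfolding ico(1)
   by (rule mult_witness[OF mm_flip(3)[OF unity5_nonzero unity5_nonzero] icosahedral_I(4)]) (use ico inverse_unity unity5_nonzero in auto)
 next
  case (coi u v) show ?thesis unfolding coi(1)
   by (rule mult_witness[OF mm_flip(4)[OF unity5_nonzero unity5_nonzero] icosahedral_I(3)]) (use coi inverse_unity unity5_nonzero in auto)
 qed
qed

text \<open>
  The three cases are the factors of \<open>s\<^sup>5 - 1\<close>; each gives one of the normal
 forms of the elements.
\<close>

lemma ico_times_ico:
 assumes "s \<in> unity 5" "t \<in> unity 5"
 shows "(\<exists>u l. l ~= 0 & u \<in> unity 5 & mm (ico 1 1) (ico s t) = smul l (diag u)) \<or>
  (\<exists>u v l. l ~= 0 & u \<in> unity 5 & v \<in> unity 5 & (mm (ico 1 1) (ico s t) = smul l (ico u v) \<or> mm (ico 1 1) (ico s t) = smul l (coi u v)))"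
proof -
 note z = unity5_nonzero[OF assms(1)] unity5_nonzero[OF assms(2)]
 have m: "1 / s \<in> unity 5" "t / s \<in> unity 5" "1 / (s * t) \<in> unity 5" using assms unity inverse_unity by auto
 consider "s = 1" | "s * s = (golden - 1) * s - 1" | "s ~= 1" "s * s = - golden * s - 1" using fifth_roots[OF assms(1)] by blast
 thus ?thesis
 proof cases
  case 1
  thus ?thesis using mm_ico(3)[of t] golden_neq(2) assms(2) by blast
 next
  case 2
  have "s + golden * golden ~= 0"
  proof
   assume "s + golden * golden = 0"
   hence "norm s = norm golden * norm golden" by (metis norm_mult norm_minus_cancel add_eq_0_iff)
   thus False using norm_unity[of 5 s] assms(1) golden_gt_1 by (simp add: less_1_mult[THEN less_imp_neq, symmetric])
  qed
  thus ?thesis using mm_ico_ico[OF z(1) 2, of t] m golden_neq(1) by (metis divide_eq_0_iff)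
 next
  case 3
  thus ?thesis using mm_ico_coi[OF z 3(2)] m assms(1) z by (metis mult_eq_0_iff right_minus_eq)
 qed
qed

lemma stabilizes_ico: "stabilizes (ico 1 1)"
 unfolding stabilizes_def
proof
 fix h assume "h \<in> icosahedral"
 thus "\<exists>k\<in>icosahedral. \<exists>t. t ~= 0 & mm (ico 1 1) h = smul t k"
 proof (cases rule: icosahedral_cases)
  case (diag u) show ?thesis unfolding diag(1)
   by (rule mult_witness[OF mm_ico(1) icosahedral_I(3)]) (use diag unity in auto)
 next
  case (flip u) show ?thesis unfolding flip(1)
   by (rule mult_witness[OF mm_ico(2) icosahedral_I(4)]) (use flip unity in auto)
 next
  case (ico u v)
  from ico_times_ico[OF ico(2,3)] show ?thesis unfolding ico(1) using icosahedral_I by blast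
 next
  case (coi u v)
  have e: "mm (ico 1 1) h = mm (mm (ico 1 1) (ico u v)) (flip 1)"
   using mm_to_coi(1)[of u v] by (simp only: coi(1) smul_1 mm_assoc)
  from ico_times_ico[OF coi(2,3)] consider
    u' l where "l ~= 0" "u' \<in> unity 5" "mm (ico 1 1) (ico u v) = smul l (diag u')"
   | u' v' l where "l ~= 0" "u' \<in> unity 5" "v' \<in> unity 5" "mm (ico 1 1) (ico u v) = smul l (ico u' v')"
   | u' v' l where "l ~= 0" "u' \<in> unity 5" "v' \<in> unity 5" "mm (ico 1 1) (ico u v) = smul l (coi u' v')"
   by blast
  thus ?thesis
  proof cases
   case 1
   show ?thesis by (rule mult_witness[of _ _ "l * 1" "flip u'"]) (use 1 icosahedral_I(2) in \<open>simp_all only: e mm_smul mm_to_coi smul_smul, simp_all\<close>)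
  next
   case 2
   show ?thesis by (rule mult_witness[of _ _ "l * 1" "coi u' v'"]) (use 2 icosahedral_I(4) in \<open>simp_all only: e mm_smul mm_to_coi smul_smul, simp_all\<close>)
  next
   case 3
   show ?thesis by (rule mult_witness[of _ _ "l * - 1" "ico u' v'"]) (use 3 icosahedral_I(3) in \<open>simp_all only: e mm_smul mm_to_coi smul_smul, simp_all\<close>)
  qed
 qed
qed

lemma icosahedral_stabilizes:
 assumes "g \<in> icosahedral"
 shows "stabilizes g"
proof -
 have i: "stabilizes (ico u v)" if "u \<in> unity 5" "v \<in> unity 5" for u v
 proof -
  have "ico u v = mm (diag u) (mm (ico 1 1) (diag v))" by (simp add: ico_def diag_def)
  thus ?thesis using that stabilizes_mm stabilizes_diag stabilizes_ico by simp
 qed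
 from assms show ?thesis
 proof (cases rule: icosahedral_cases)
  case (diag u) thus ?thesis using stabilizes_diag by simp
 next
  case (flip u)
  have "flip u = mm (diag u) (flip 1)" by (simp add: flip_def diag_def)
  thus ?thesis using flip stabilizes_mm stabilizes_diag stabilizes_flip by simp
 next
  case (ico u v) thus ?thesis using i by simp
 next
  case (coi u v)
  have "coi u v = mm (ico u v) (flip 1)" by (simp add: flip_def coi_def ico_def)
  thus ?thesis using coi i stabilizes_mm stabilizes_flip by simp
 qed
qed

text \<open>The two classes with four nonzero entries are distinguished by the size of the entries.\<close>

lemma ico_neq_coi:
 assumes "u \<in> unity 5" "v \<in> unity 5" "s \<in> unity 5" "t \<in> unity 5"
 shows "smul l (ico u v) ~= coi s t" "smul l (coi u v) ~= ico s t"
proof -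
 have n: "norm w = 1" if "w \<in> unity 5" for w using norm_unity[of 5 w] that by simp
 have no: False if "norm l * 1 = norm golden" "norm l * norm golden = 1"
 proof -
  have "norm golden * norm golden = 1" using that by simp
  thus False using less_1_mult[OF golden_gt_1 golden_gt_1] by simp
 qed
 have no': False if "norm l = norm golden" "norm l * norm golden = 1" using no that by simp
 show "smul l (ico u v) ~= coi s t"
 proof
  assume "smul l (ico u v) = coi s t"
  hence "l * v = golden" "l * golden = - t" by (simp_all add: ico_def coi_def)
  hence "norm l * norm v = norm golden" "norm l * norm golden = norm t" by (metis norm_mult, metis norm_mult norm_minus_cancel)
  thus False using no n assms by simp
 qed
 show "smul l (coi u v) ~= ico s t"
 proof
  assume "smul l (coi u v) = ico s t"
  hence "l * - v = golden" "l * golden = t" by (simp_all add: ico_def coi_def)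
  hence "norm l * norm v = norm golden" "norm l * norm golden = norm t" by (metis norm_mult norm_minus_cancel, metis norm_mult)
  thus False using no n assms by simp
 qed
qed

lemma card_icosahedral: "card icosahedral = 60" and finite_icosahedral: "finite icosahedral"
proof -
 have c: "card (unity 5) = 5" and f: "finite (unity 5)" using card_unity[of 5] finite_unity[of 5] by auto
 have i: "inj_on (%(u, v). ico u v) S" "inj_on (%(u, v). coi u v) S" "inj_on flip S'" for S S'
  by (auto simp: inj_on_def ico_def coi_def flip_def)
 have d1: "diag ` unity 5 \<inter> flip ` unity 5 = {}"
 proof -
  have "diag u ~= flip v" for u v by (simp add: diag_def flip_def)
  thus ?thesis by blast
 qed
 have d2: "(%(u, v). ico u v) ` (unity 5 \<times> unity 5) \<inter> (%(u, v). coi u v) ` (unity 5 \<times> unity 5) = {}"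
  using ico_neq_coi(1)[where l = 1] by (fastforce simp: smul_1)
 have d3: "(diag ` unity 5 \<union> flip ` unity 5) \<inter>
   ((%(u, v). ico u v) ` (unity 5 \<times> unity 5) \<union> (%(u, v). coi u v) ` (unity 5 \<times> unity 5)) = {}"
 proof -
  have "diag w ~= ico u v & flip w ~= ico u v & diag w ~= coi u v & flip w ~= coi u v" if "u \<in> unity 5" "v \<in> unity 5" for u v w
   using unity5_nonzero[OF that(1)] unity5_nonzero[OF that(2)] golden_neq by (simp add: diag_def flip_def ico_def coi_def)
  thus ?thesis by fastforce
 qed
 show "finite icosahedral" unfolding icosahedral_def using f by simp
 show "card icosahedral = 60"
  unfolding icosahedral_def using f c
  by (simp add: card_Un_disjoint[OF _ _ d1] card_Un_disjoint[OF _ _ d2] card_Un_disjoint[OF _ _ d3]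
    card_image[OF i(1)] card_image[OF i(2)] card_image[OF i(3)] card_image[OF inj_diag])
qed

lemma moebius_icosahedral: "moebius_group icosahedral 60"
proof
 show "finite icosahedral" "card icosahedral = 60" by (rule finite_icosahedral card_icosahedral)+
 show "one_mob \<in> icosahedral" using icosahedral_I(1)[OF unity(1)] by (simp add: diag_def)
 show "disc g ~= 0" if "g \<in> icosahedral" for g
  using that
 proof (cases rule: icosahedral_cases)
  case (diag u) thus ?thesis using unity5_nonzero by (simp add: diag_def)
 next
  case (flip u) thus ?thesis using unity5_nonzero by (simp add: flip_def)
 next
  case (ico u v)
  have "disc g = - ((1 + golden * golden) * (u * v))" by (simp add: ico(1) ico_def algebra_simps)
  thus ?thesis using golden_neq(2) unity5_nonzero[OF ico(2)] unity5_nonzero[OF ico(3)] by simp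
 next
  case (coi u v)
  have "disc g = - ((1 + golden * golden) * (u * v))" by (simp add: coi(1) coi_def algebra_simps)
  thus ?thesis using golden_neq(2) unity5_nonzero[OF coi(2)] unity5_nonzero[OF coi(3)] by simp
 qed
 show "g = h" if gh: "g \<in> icosahedral" "h \<in> icosahedral" "smul t g = h" for g h t
 proof (cases rule: icosahedral_cases[OF gh(1), case_names diag flip ico coi])
  case (diag u)
  thus ?thesis using gh(3) golden_neq
   by (cases rule: icosahedral_cases[OF gh(2), case_names diag flip ico coi]) (auto simp: diag_def flip_def ico_def coi_def dest: unity5_nonzero)
 next
  case (flip u)
  thus ?thesis using gh(3) golden_neq
   by (cases rule: icosahedral_cases[OF gh(2), case_names diag flip ico coi]) (auto simp: diag_def flip_def ico_def coi_def dest: unity5_nonzero)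
 next
  case g: (ico u v)
  show ?thesis
  proof (cases rule: icosahedral_cases[OF gh(2), case_names diag flip ico coi])
   case (coi s r) thus ?thesis using ico_neq_coi(1)[OF g(2,3) coi(2,3), of t] gh(3) g(1) by simp
  qed (use gh(3) g golden_neq in \<open>auto simp: diag_def flip_def ico_def dest: unity5_nonzero\<close>)
 next
  case g: (coi u v)
  show ?thesis
  proof (cases rule: icosahedral_cases[OF gh(2), case_names diag flip ico coi])
   case (ico s r) thus ?thesis using ico_neq_coi(2)[OF g(2,3) ico(2,3), of t] gh(3) g(1) by simp
  qed (use gh(3) g golden_neq in \<open>auto simp: diag_def flip_def coi_def dest: unity5_nonzero\<close>)
 qed
 show "\<exists>k\<in>icosahedral. \<exists>t. t ~= 0 & mm g h = smul t k" if "g \<in> icosahedral" "h \<in> icosahedral" for g h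
  using icosahedral_stabilizes[OF that(1)] that(2) unfolding stabilizes_def by blast
qed

lemma icosahedral_example: "\<exists>\<omega>. galois_form 60 \<omega> & 3 \<le> involutions \<omega> & involutions \<omega> \<le> 30"
proof -
 let ?I = "{g \<in> icosahedral. involutive g}"
 have c: "card (unity 5) = 5" and f: "finite (unity 5)" using card_unity[of 5] finite_unity[of 5] by auto
 have fin: "finite ?I" using finite_icosahedral by simp
 have "diag 1 \<in> icosahedral" "flip 1 \<in> icosahedral" "ico 1 1 \<in> icosahedral"
  by (intro icosahedral_I unity(1))+
 hence "{diag 1, flip 1, ico 1 1} \<subseteq> ?I"
  by (simp add: diag_def flip_def ico_def)
 moreover have "card {diag 1, flip 1, ico 1 1} = 3" by (simp add: diag_def flip_def ico_def)
 ultimately have lower: "3 \<le> card ?I" using card_mono[OF fin, of "{diag 1, flip 1, ico 1 1}"] by linarith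
 let ?J = "({one_mob} \<union> flip ` unity 5) \<union> ((%u. ico u (1 / u)) ` unity 5 \<union> (%u. coi u u) ` unity 5)"
 have "?I \<subseteq> ?J"
 proof
  fix g assume g: "g \<in> ?I"
  hence "g \<in> icosahedral" by simp
  thus "g \<in> ?J"
  proof (cases rule: icosahedral_cases)
   case (diag u)
   have "u ~= - 1" using diag(2) by (auto simp: unity_def)
   thus ?thesis using g diag by (auto simp: diag_def eq_neg_iff_add_eq_0)
  next
   case (flip u) thus ?thesis by simp
  next
   case (ico u v)
   have "golden * (1 - u * v) = 0" using g unity5_nonzero[OF ico(2)] by (auto simp: ico(1) ico_def algebra_simps)
   hence "v = 1 / u" using golden_neq(1) unity5_nonzero[OF ico(2)] by (simp add: field_simps)
   thus ?thesis using ico by simp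
  next
   case (coi u v)
   have "u = v" using g golden_neq(1) by (auto simp: coi(1) coi_def)
   thus ?thesis using coi by simp
  qed
 qed
 hence "card ?I \<le> card ?J" using f by (intro card_mono) auto
 also have "\<dots> \<le> (card {one_mob} + card (flip ` unity 5)) + (card ((%u. ico u (1 / u)) ` unity 5) + card ((%u. coi u u) ` unity 5))"
  by (intro order_trans[OF card_Un_le] add_mono card_Un_le)
 also have "\<dots> \<le> 30"
  using card_image_le[OF f, of flip] card_image_le[OF f, of "%u. ico u (1 / u)"] card_image_le[OF f, of "%u. coi u u"] c by simp
 finally show ?thesis using moebius_group_example[OF moebius_icosahedral] lower by metis
qed

section \<open>Irreducible components separated by a locally constant function\<close>

lemma irreducible_singleton: "x \<in> topspace X ==> irreducible_in X {x}"
 by (auto simp: irreducible_in_def)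

lemma irreducible_Union_chain:
 assumes "\<C> ~= {}" and irr: "!!Z. Z \<in> \<C> ==> irreducible_in X Z"
  and chain: "!!Y Z. Y \<in> \<C> ==> Z \<in> \<C> ==> Y \<subseteq> Z \<or> Z \<subseteq> Y"
 shows "irreducible_in X (\<Union>\<C>)"
 unfolding irreducible_in_def
proof (intro conjI allI impI)
 show "\<Union>\<C> \<subseteq> topspace X" "\<Union>\<C> ~= {}" using assms(1) irr by (auto simp: irreducible_in_def)
 fix A B assume AB: "closedin X A" "closedin X B" "\<Union>\<C> \<subseteq> A \<union> B"
 show "\<Union>\<C> \<subseteq> A \<or> \<Union>\<C> \<subseteq> B"
 proof (rule ccontr)
  assume "\<not> (\<Union>\<C> \<subseteq> A \<or> \<Union>\<C> \<subseteq> B)"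
  then obtain Y Z where YZ: "Y \<in> \<C>" "\<not> Y \<subseteq> A" "Z \<in> \<C>" "\<not> Z \<subseteq> B" by blast
  have "\<exists>W\<in>\<C>. \<not> W \<subseteq> A & \<not> W \<subseteq> B" using chain[OF YZ(1,3)] YZ by blast
  thus False using irr AB by (meson Union_upper irreducible_in_def order_trans)
 qed
qed

text \<open>By Zorn's lemma.\<close>

lemma irreducible_component_exists:
 assumes "irreducible_in X Z"
 shows "\<exists>C\<in>irreducible_components X. Z \<subseteq> C"
proof -
 let ?A = "{Z'. irreducible_in X Z' & Z \<subseteq> Z'}"
 have "\<exists>M\<in>?A. \<forall>Y\<in>?A. M \<subseteq> Y --> Y = M"
 proof (rule subset_Zorn_nonempty)
  show "?A ~= {}" using assms by blast
  fix \<C> assume c: "\<C> ~= {}" "subset.chain ?A \<C>"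
  hence sub: "\<C> \<subseteq> ?A" and ch: "!!Y Z. Y \<in> \<C> ==> Z \<in> \<C> ==> Y \<subseteq> Z \<or> Z \<subseteq> Y"
   by (auto simp: subset_chain_def)
  have irr: "irreducible_in X Y" if "Y \<in> \<C>" for Y using sub that by blast
  have "irreducible_in X (\<Union>\<C>)" by (rule irreducible_Union_chain[OF c(1) irr ch])
  thus "\<Union>\<C> \<in> ?A" using c(1) sub by blast
 qed
 then obtain M where M: "irreducible_in X M" "Z \<subseteq> M"
  and max: "!!Y. irreducible_in X Y ==> Z \<subseteq> Y ==> M \<subseteq> Y ==> Y = M" by auto
 have "M \<in> irreducible_components X"
  unfolding irreducible_components_def using M(1) max[OF _ order_trans[OF M(2)]] by simp
 thus ?thesis using M(2) by blast
qed

lemma locally_constant_on_irreducible: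
 assumes f: "!!k. openin X {x \<in> topspace X. f x = (k :: nat)}" and Z: "irreducible_in X Z" "x \<in> Z" "y \<in> Z"
 shows "f x = f y"
proof (rule ccontr)
 assume ne: "f x ~= f y"
 have "openin X (\<Union>k\<in>{k. k ~= f x}. {z \<in> topspace X. f z = k})" using f by blast
 moreover have "(\<Union>k\<in>{k. k ~= f x}. {z \<in> topspace X. f z = k}) = {z \<in> topspace X. f z ~= f x}" by blast
 ultimately have "openin X {z \<in> topspace X. f z ~= f x}" by simp
 hence cl: "closedin X (topspace X - {z \<in> topspace X. f z = f x})" "closedin X (topspace X - {z \<in> topspace X. f z ~= f x})"
  using f[of "f x"] by (simp_all add: openin_closedin_eq)
 have "Z \<subseteq> topspace X" using Z(1) by (simp add: irreducible_in_def)
 hence "Z \<subseteq> (topspace X - {z \<in> topspace X. f z = f x}) \<union> (topspace X - {z \<in> topspace X. f z ~= f x})" by blast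
 hence "Z \<subseteq> topspace X - {z \<in> topspace X. f z = f x} \<or> Z \<subseteq> topspace X - {z \<in> topspace X. f z ~= f x}"
  using Z(1) cl unfolding irreducible_in_def by blast
 thus False using Z(2,3) ne by auto
qed

lemma separated_components:
 assumes f: "!!k. openin X {x \<in> topspace X. f x = (k :: nat)}" and S: "S \<subseteq> topspace X" "inj_on f S"
 shows "\<exists>C. C \<subseteq> irreducible_components X & card C = card S & pairwise disjnt C"
proof -
 have "\<forall>x\<in>S. \<exists>C. C \<in> irreducible_components X & x \<in> C"
 proof
  fix x assume "x \<in> S"
  hence "irreducible_in X {x}" using irreducible_singleton S(1) by (metis subsetD)
  from irreducible_component_exists[OF this] show "\<exists>C. C \<in> irreducible_components X & x \<in> C"
   by (metis insert_subset)
 qed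
 from bchoice[OF this] obtain c where c: "!!x. x \<in> S ==> c x \<in> irreducible_components X & x \<in> c x" by blast
 have const: "f z = f x" if "x \<in> S" "z \<in> c x" for x z
 proof -
  have "irreducible_in X (c x)" using c[OF that(1)] by (simp add: irreducible_components_def)
  from locally_constant_on_irreducible[OF f this that(2) c[OF that(1), THEN conjunct2]] show ?thesis .
 qed
 have inj: "inj_on c S"
  using c const S(2) by (metis inj_on_def)
 show ?thesis
 proof (intro exI[of _ "c ` S"] conjI)
  show "c ` S \<subseteq> irreducible_components X" using c by blast
  show "card (c ` S) = card S" by (rule card_image[OF inj])
  show "pairwise disjnt (c ` S)"
   unfolding pairwise_def disjnt_iff using const S(2) by (metis imageE inj_onD)
 qed
qed

section \<open>Components of the space of Galois foliations\<close>

text \<open>Any representative serves, as scaling a form does not change its Gauss map.\<close>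

definition foliation_involutions :: "form set => nat" where
 "foliation_involutions P = involutions (SOME \<omega>. \<omega> \<in> P)"

lemma foliation_involutions_class: "\<eta> \<in> proj_class \<omega> ==> foliation_involutions (proj_class \<omega>) = involutions \<eta>"
proof -
 assume "\<eta> \<in> proj_class \<omega>"
 moreover from this have "(SOME \<omega>'. \<omega>' \<in> proj_class \<omega>) \<in> proj_class \<omega>" by (rule someI)
 ultimately show ?thesis
  unfolding foliation_involutions_def by (auto simp: proj_class_eq involutions_scale)
qed

lemma galois_foliation_representative:
 assumes d: "1 \<le> d" and P: "P \<in> galois_foliations d" "\<omega> \<in> P"
 shows "galois_form d \<omega>"
proof -
 obtain \<omega>0 where w0: "P = proj_class \<omega>0" "\<omega>0 \<in> forms d" "no_common_factor \<omega>0"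
  using P(1) unfolding galois_foliations_def foliations_def by blast
 obtain c where "c ~= 0" "\<omega> = scale c \<omega>0" using P(2) unfolding w0(1) proj_class_eq by blast
 thus ?thesis
  using w0 P d unfolding galois_foliations_def
  by (intro galois_form.intro) (auto intro: scale_in_forms no_common_factor_scale)
qed

lemma galois_foliation_class:
 assumes "galois_form d \<omega>"
 shows "proj_class \<omega> \<in> galois_foliations d"
proof -
 interpret galois_form d \<omega> by fact
 have "\<not> no_common_factor 0" unfolding no_common_factor_def by (auto intro!: exI[of _ 0])
 hence "\<omega> ~= 0" using ncf by auto
 thus ?thesis
  unfolding galois_foliations_def foliations_def using w ncf gal
  by (auto simp: proj_class_eq gauss_subfield_scale)
qed

lemma topspace_galois_foliation_space: "topspace (galois_foliation_space d) = galois_foliations d"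
 unfolding galois_foliation_space_def foliation_space_def topspace_subtopology topspace_zariski
 by (auto simp: galois_foliations_def foliations_def proj_forms_def)

lemma openin_involutions:
 assumes d: "1 \<le> d"
 shows "openin (galois_foliation_space d) {P \<in> topspace (galois_foliation_space d). foliation_involutions P = k}"
 unfolding topspace_galois_foliation_space
proof (subst openin_subopen, intro ballI)
 fix P0 assume P0: "P0 \<in> {P \<in> galois_foliations d. foliation_involutions P = k}"
 have cls: "\<exists>\<omega>. P = proj_class \<omega>" if "P \<in> galois_foliations d" for P
  using that unfolding galois_foliations_def foliations_def by blast
 obtain \<omega>0 where w0: "P0 = proj_class \<omega>0" using cls P0 by blast
 hence in0: "\<omega>0 \<in> P0" using self_in_proj_class by simp
 have g0: "galois_form d \<omega>0" using galois_foliation_representative[OF d _ in0] P0 by blast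
 have k: "k = involutions \<omega>0" using foliation_involutions_class[of \<omega>0 \<omega>0] in0 P0 w0 by simp
 obtain D where D: "polyfun d D" "D \<omega>0 ~= 0" "!!\<omega>. galois_form d \<omega> ==> D \<omega> ~= 0 ==> involutions \<omega> = involutions \<omega>0"
  using involutions_locally_constant[OF g0] by blast
 let ?W = "{P \<in> proj_forms d. \<exists>\<omega>\<in>P. D \<omega> ~= 0}"
 let ?T = "?W \<inter> galois_foliations d"
 have "openin (galois_foliation_space d) ?T"
 proof -
  have e: "?T = ?W \<inter> foliations d \<inter> galois_foliations d" by (auto simp: galois_foliations_def)
  show ?thesis
   unfolding galois_foliation_space_def foliation_space_def e
   by (intro openin_subtopology_Int openin_nonvanishing[OF D(1)])
 qed
 moreover have "P0 \<in> ?T"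
 proof -
  have "galois_foliations d \<subseteq> proj_forms d"
   unfolding galois_foliations_def foliations_def proj_forms_def by blast
  thus ?thesis using P0 in0 D(2) by blast
 qed
 moreover have "?T \<subseteq> {P \<in> galois_foliations d. foliation_involutions P = k}"
 proof
  fix P assume "P \<in> ?T"
  then obtain \<omega> where P: "P \<in> galois_foliations d" "\<omega> \<in> P" "D \<omega> ~= 0" by blast
  obtain \<omega>1 where w1: "P = proj_class \<omega>1" using cls[OF P(1)] by blast
  have "foliation_involutions P = involutions \<omega>" using foliation_involutions_class P(2) unfolding w1 by blast
  also have "\<dots> = k" unfolding k by (rule D(3)[OF galois_foliation_representative[OF d P(1,2)] P(3)])
  finally show "P \<in> {P \<in> galois_foliations d. foliation_involutions P = k}" using P(1) by blast
 qed
 ultimately show "\<exists>T. openin (galois_foliation_space d) T & P0 \<in> T & T \<subseteq> {P \<in> galois_foliations d. foliation_involutions P = k}"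
  by blast
qed

lemma components_of_distinct_involutions:
 assumes w: "!!\<omega>. \<omega> \<in> S ==> galois_form d \<omega>" and inj: "inj_on involutions S" and d: "1 \<le> d"
 shows "\<exists>C. C \<subseteq> irreducible_components (galois_foliation_space d) & card C = card S & pairwise disjnt C"
proof -
 have e: "foliation_involutions (proj_class \<omega>) = involutions \<omega>" for \<omega>
  by (rule foliation_involutions_class[OF self_in_proj_class])
 have "inj_on (foliation_involutions \<circ> proj_class) S" using inj by (simp add: inj_on_def e)
 hence i: "inj_on proj_class S" "inj_on foliation_involutions (proj_class ` S)"
  by (auto dest: inj_on_imageI2 inj_on_imageI)
 have "proj_class ` S \<subseteq> topspace (galois_foliation_space d)"
  unfolding topspace_galois_foliation_space using galois_foliation_class[OF w] by blast
 from separated_components[OF openin_involutions[OF d] this i(2)] show ?thesis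
  by (simp add: card_image[OF i(1)])
qed

theorem corollary7p19:
  shows "(\<forall>n::nat. 2 \<le> n \<longrightarrow>
            (\<exists>C. C \<subseteq> irreducible_components (galois_foliation_space (2 * n)) \<and>
                 card C = 2 \<and> pairwise disjnt C)) \<and>
         (\<forall>d\<in>{12, 24, 60}.
            (\<exists>C. C \<subseteq> irreducible_components (galois_foliation_space d) \<and>
                 card C = 3 \<and> pairwise disjnt C))"
proof (intro conjI allI impI ballI)
 fix n :: nat assume n: "2 \<le> n"
 obtain \<omega>1 where c: "galois_form (2 * n) \<omega>1" "involutions \<omega>1 \<le> 2" using cyclic_example[of "2 * n"] n by auto
 obtain \<omega>2 where h: "galois_form (2 * n) \<omega>2" "n + 1 \<le> involutions \<omega>2" using dihedral_example[of n] n by auto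
 have ne: "involutions \<omega>1 ~= involutions \<omega>2" using c(2) h(2) n by simp
 hence card: "card {\<omega>1, \<omega>2} = 2" by (metis card_2_iff)
 have g: "galois_form (2 * n) \<omega>" if "\<omega> \<in> {\<omega>1, \<omega>2}" for \<omega> using that c(1) h(1) by blast
 have i: "inj_on involutions {\<omega>1, \<omega>2}" using ne by (intro inj_onI) (metis insertE singletonD)
 show "\<exists>C. C \<subseteq> irreducible_components (galois_foliation_space (2 * n)) & card C = 2 & pairwise disjnt C"
  using components_of_distinct_involutions[OF g i] n unfolding card by simp
next
 fix d :: nat assume d: "d \<in> {12, 24, 60}"
 define n where "n = d div 2"
 have n: "d = 2 * n" "6 \<le> n" using d by (auto simp: n_def)
 obtain \<omega>1 where c: "galois_form d \<omega>1" "involutions \<omega>1 \<le> 2" using cyclic_example[of d] n by auto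
 obtain \<omega>2 where h: "galois_form d \<omega>2" "n + 1 \<le> involutions \<omega>2" using dihedral_example[of n] n by auto
 have "\<exists>\<omega>3. galois_form d \<omega>3 & 3 \<le> involutions \<omega>3 & involutions \<omega>3 \<le> n"
  using d tetrahedral_example octahedral_example icosahedral_example by (auto simp: n_def)
 then obtain \<omega>3 where p: "galois_form d \<omega>3" "3 \<le> involutions \<omega>3" "involutions \<omega>3 \<le> n" by blast
 have ne: "involutions \<omega>1 ~= involutions \<omega>2" "involutions \<omega>1 ~= involutions \<omega>3" "involutions \<omega>2 ~= involutions \<omega>3"
  using c(2) h(2) p(2,3) n by auto
 hence card: "card {\<omega>1, \<omega>2, \<omega>3} = 3" by (metis card_3_iff)
 have g: "galois_form d \<omega>" if "\<omega> \<in> {\<omega>1, \<omega>2, \<omega>3}" for \<omega> using that c(1) h(1) p(1) by blast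
 have i: "inj_on involutions {\<omega>1, \<omega>2, \<omega>3}" using ne by (intro inj_onI) (metis insertE singletonD)
 show "\<exists>C. C \<subseteq> irreducible_components (galois_foliation_space d) & card C = 3 & pairwise disjnt C"
  using components_of_distinct_involutions[OF g i] n unfolding card by simp
qed

end
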